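(* Let $\alpha\in\mathbb{R}$, $0<\beta<3$ and suppose that $$\frac{3+\beta}{3}\le p<\frac{5+2\beta}{4}.$$ If $u=\phi+q\,\mathcal{G}_\lambda\in\mathrm{Dom}(\mathcal{H})$, with $(\phi,q,\lambda)\in T$, is a bound state with frequency $\omega\in\mathbb{R}$, i.e. $\mathcal{H}u+\omega u-(I_\beta*|u|^p)|u|^{p-2}u=0$ in $L^2$, then $$\frac12 Q(u)+\frac12\alpha|q|^2+\frac32\,\omega\,\|u\|_{L^2}^2=\frac{3+\beta}{2p}\,N(u).$$
   Context: All function spaces are over $\mathbb{R}^3$ and consist of complex-valued functions. The Riesz potential is $$I_\beta(x)=\frac{\Gamma\left(\frac{3-\beta}{2}\right)}{\Gamma(\beta/2)\,\pi^{3/2}\,2^\beta}\,\frac{1}{|x|^{3-\beta}},\qquad x\in\mathbb{R}^3\setminus\{0\}.$$ For $\lambda>0$, $\mathcal{G}_\lambda(x)=\frac{1}{4\pi|x|}e^{-\sqrt\lambda|x|}$ is the fundamental solution of $-\Delta+\lambda$. Let $$T=\Big\{(\phi,q,\lambda)\in H^2\times\mathbb{C}\times(0,\infty):\ \phi(0)=\Big(\alpha+\tfrac{\sqrt\lambda}{4\pi}\Big)q\Big\},\qquad \mathrm{Dom}(\mathcal{H})=\{\phi+q\,\mathcal{G}_\lambda:(\phi,q,\lambda)\in T\}\subset L^2,$$ and let $\mathcal{H}:\mathrm{Dom}(\mathcal{H})\to L^2$ be the self-adjoint operator (realizing $-\Delta+\alpha\delta_0$) given by $\mathcal{H}[\phi+q\,\mathcal{G}_\lambda]=-\Delta\phi-q\lambda\,\mathcal{G}_\lambda$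 for $(\phi,q,\lambda)\in T$. For $u$ in the domain the charge $q$ is uniquely determined by $u$, and for each $\lambda>0$ there is a unique $\phi$ with $u=\phi+q\,\mathcal{G}_\lambda$; the values of $\mathcal{H}u$ and $Q(u)$ do not depend on $\lambda$. The quadratic form is $$Q(u)=\|\nabla\phi\|_{L^2}^2+\lambda\big(\|\phi\|_{L^2}^2-\|u\|_{L^2}^2\big)+\Big(\alpha+\frac{\sqrt\lambda}{4\pi}\Big)|q|^2$$ for $u=\phi+q\,\mathcal{G}_\lambda$ with $\phi\in H^1$, $q\in\mathbb{C}$, $\lambda>0$, and $N(u)=\int_{\mathbb{R}^3}(I_\beta*|u|^p)|u|^p$. The bound state equation is an equality of elements of $L^2$ (so in particular the nonlinear term is in $L^2$). *)

theory Defs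
  imports "HOL-Analysis.Analysis"
begin

text \<open>
  Elements of \<open>L\<^sup>2\<close> and of the Sobolev spaces are represented by functions, and equality in
  \<open>L\<^sup>2\<close> is equality almost everywhere with respect to Lebesgue measure.
\<close>

type_synonym space = "real^3"

definition L2 :: "(space \<Rightarrow> complex) set" where
  "L2 = {f \<in> borel_measurable lebesgue. integrable lebesgue (\<lambda>x. (cmod (f x))\<^sup>2)}"

definition L2_norm :: "(space \<Rightarrow> 'a::real_normed_vector) \<Rightarrow> real" where
  "L2_norm f = sqrt (\<integral>x. (norm (f x))\<^sup>2 \<partial>lebesgue)"

definition partial_deriv :: "3 \<Rightarrow> (space \<Rightarrow> real) \<Rightarrow> space \<Rightarrow> real" where
  "partial_deriv i f x = frechet_derivative f (at x) (axis i 1)"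

primrec C_k :: "nat \<Rightarrow> (space \<Rightarrow> real) set" where
  "C_k 0 = {f. continuous_on UNIV f}"
| "C_k (Suc k) = {f. (\<forall>x. f differentiable at x) \<and> (\<forall>i. partial_deriv i f \<in> C_k k)}"

definition test_functions :: "(space \<Rightarrow> real) set" where
  "test_functions = {\<eta>. (\<forall>k. \<eta> \<in> C_k k) \<and> compact (closure {x. \<eta> x \<noteq> 0})}"

definition locally_integrable :: "(space \<Rightarrow> complex) \<Rightarrow> bool" where
  "locally_integrable f \<longleftrightarrow> (\<forall>K. compact K \<longrightarrow> f absolutely_integrable_on K)"

definition has_weak_partial :: "3 \<Rightarrow> (space \<Rightarrow> complex) \<Rightarrow> (space \<Rightarrow> complex) \<Rightarrow> bool" where
  "has_weak_partial i f g \<longleftrightarrow>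
     locally_integrable f \<and> locally_integrable g \<and>
     (\<forall>\<eta>\<in>test_functions.
        (\<integral>x. partial_deriv i \<eta> x *\<^sub>R f x \<partial>lebesgue) = - (\<integral>x. \<eta> x *\<^sub>R g x \<partial>lebesgue))"

text \<open>The weak derivative is unique up to null sets; \<open>weak_partial\<close> picks a representative.\<close>

definition weak_partial :: "3 \<Rightarrow> (space \<Rightarrow> complex) \<Rightarrow> space \<Rightarrow> complex" where
  "weak_partial i f = (SOME g. has_weak_partial i f g)"

definition weak_grad :: "(space \<Rightarrow> complex) \<Rightarrow> space \<Rightarrow> complex^3" where
  "weak_grad f x = (\<chi> i. weak_partial i f x)"

definition weak_laplacian :: "(space \<Rightarrow> complex) \<Rightarrow> space \<Rightarrow> complex" where
  "weak_laplacian f x = (\<Sum>i\<in>UNIV. weak_partial i (weak_partial i f) x)"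

text \<open>\<open>sobolev k\<close> is \<open>H\<^sup>k\<close>: all weak derivatives of order at most \<open>k\<close> exist and lie in \<open>L\<^sup>2\<close>.\<close>

primrec sobolev :: "nat \<Rightarrow> (space \<Rightarrow> complex) set" where
  "sobolev 0 = L2"
| "sobolev (Suc k) = {f \<in> L2. \<forall>i. \<exists>g \<in> sobolev k. has_weak_partial i f g}"

text \<open>
  The value at a point of an element of \<open>H\<^sup>2\<close> is that of its continuous representative, which
  exists by the Sobolev embedding and is unique.
\<close>

definition has_point_value :: "(space \<Rightarrow> complex) \<Rightarrow> space \<Rightarrow> complex \<Rightarrow> bool" where
  "has_point_value f x c \<longleftrightarrow>
     (\<exists>g. continuous_on UNIV g \<and> (AE y in lebesgue. f y = g y) \<and> g x = c)"

definition riesz_potential :: "real \<Rightarrow> space \<Rightarrow> real" where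
  "riesz_potential \<beta> x =
     Gamma ((3 - \<beta>) / 2) / (Gamma (\<beta> / 2) * pi powr (3 / 2) * 2 powr \<beta>) *
     (1 / norm x powr (3 - \<beta>))"

definition green :: "real \<Rightarrow> space \<Rightarrow> complex" where
  "green lam x = of_real (1 / (4 * pi * norm x) * exp (- sqrt lam * norm x))"

definition convolution :: "(space \<Rightarrow> real) \<Rightarrow> (space \<Rightarrow> real) \<Rightarrow> space \<Rightarrow> real" where
  "convolution f g x = (\<integral>y. f (x - y) * g y \<partial>lebesgue)"

definition decomposes :: "(space \<Rightarrow> complex) \<Rightarrow> (space \<Rightarrow> complex) \<Rightarrow> complex \<Rightarrow> real \<Rightarrow> bool" where
  "decomposes u \<phi> q lam \<longleftrightarrow> (AE x in lebesgue. u x = \<phi> x + q * green lam x)"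

definition admissible :: "real \<Rightarrow> ((space \<Rightarrow> complex) \<times> complex \<times> real) set" where
  "admissible \<alpha> =
     {(\<phi>, q, lam). \<phi> \<in> sobolev 2 \<and> lam > 0 \<and>
        has_point_value \<phi> 0 (of_real (\<alpha> + sqrt lam / (4 * pi)) * q)}"

definition hamiltonian_dom :: "real \<Rightarrow> (space \<Rightarrow> complex) set" where
  "hamiltonian_dom \<alpha> = {u \<in> L2. \<exists>(\<phi>, q, lam) \<in> admissible \<alpha>. decomposes u \<phi> q lam}"

text \<open>
  For \<open>u\<close> in the domain, all decompositions of \<open>u\<close> yield the same element of \<open>L\<^sup>2\<close>;
  \<open>hamiltonian \<alpha> u\<close> is a representative of it.
\<close>

definition hamiltonian :: "real \<Rightarrow> (space \<Rightarrow> complex) \<Rightarrow> space \<Rightarrow> complex" where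
  "hamiltonian \<alpha> u =
     (SOME v. \<exists>(\<phi>, q, lam) \<in> admissible \<alpha>. decomposes u \<phi> q lam \<and>
        v = (\<lambda>x. - weak_laplacian \<phi> x - q * of_real lam * green lam x))"

text \<open>The value below does not depend on the decomposition of \<open>u\<close>.\<close>

definition energy_form :: "real \<Rightarrow> (space \<Rightarrow> complex) \<Rightarrow> real" where
  "energy_form \<alpha> u =
     (THE r. \<exists>\<phi> q lam. \<phi> \<in> sobolev 1 \<and> lam > 0 \<and> decomposes u \<phi> q lam \<and>
        r = (L2_norm (weak_grad \<phi>))\<^sup>2 + lam * ((L2_norm \<phi>)\<^sup>2 - (L2_norm u)\<^sup>2)
              + (\<alpha> + sqrt lam / (4 * pi)) * (cmod q)\<^sup>2)"

definition hartree_potential :: "real \<Rightarrow> real \<Rightarrow> (space \<Rightarrow> complex) \<Rightarrow> space \<Rightarrow> real" where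
  "hartree_potential \<beta> p u = convolution (riesz_potential \<beta>) (\<lambda>y. cmod (u y) powr p)"

definition interaction :: "real \<Rightarrow> real \<Rightarrow> (space \<Rightarrow> complex) \<Rightarrow> real" where
  "interaction \<beta> p u = (\<integral>x. hartree_potential \<beta> p u x * cmod (u x) powr p \<partial>lebesgue)"

text \<open>
  For \<open>p < 2\<close> the expression \<open>|u|\<^bsup>p-2\<^esup> u\<close> is \<open>0\<close> where \<open>u\<close> vanishes, since \<open>0 powr a = 0\<close>.
\<close>

definition hartree_term :: "real \<Rightarrow> real \<Rightarrow> (space \<Rightarrow> complex) \<Rightarrow> space \<Rightarrow> complex" where
  "hartree_term \<beta> p u x =
     of_real (hartree_potential \<beta> p u x) * (of_real (cmod (u x) powr (p - 2)) * u x)"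

definition bound_state :: "real \<Rightarrow> real \<Rightarrow> real \<Rightarrow> real \<Rightarrow> (space \<Rightarrow> complex) \<Rightarrow> bool" where
  "bound_state \<alpha> \<beta> p \<omega> u \<longleftrightarrow>
     u \<in> hamiltonian_dom \<alpha> \<and> hartree_term \<beta> p u \<in> L2 \<and>
     (AE x in lebesgue. hamiltonian \<alpha> u x + of_real \<omega> * u x - hartree_term \<beta> p u x = 0)"

end

theory Submission
  imports Defs
begin

text \<open>
  The identity is the bound state equation paired with the dilation field \<open>x \<bullet> \<nabla>u\<close>. This field is not
  square integrable, and \<open>u\<close> is singular at the origin, so coordinate \<open>i\<close> is truncated to
  \<open>\<xi>(x\<^sub>i) = arctan (\<epsilon> x\<^sub>i) / \<epsilon>\<close>, and \<open>\<epsilon>\<close> tends to \<open>0\<close> after summing over \<open>i\<close>. For the nonlinear term no regularity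
  of \<open>|u|\<^bsup>p-2\<^esup>u\<close> is needed: along the flow of \<open>\<xi>(x\<^sub>i) \<partial>\<^sub>i\<close>, convexity of \<open>|u|\<^bsup>p\<^esup>\<close> and positive definiteness of
  the Riesz kernel bound the increments of the pairing by those of the interaction energy, which a change of
  variables computes to first order in time; as the time may have either sign, this determines the derivative.
  The Hamiltonian contributes \<open>-Q/2 - \<alpha>|q|\<^sup>2/2\<close>, since
  the pairing of \<open>\<Delta>\<phi>\<close> with \<open>x \<bullet> \<nabla>G\<close> reduces to the value \<open>\<phi>(0)\<close>, which is prescribed by the charge.
\<close>

text \<open>For q \<noteq> 0 the gradient of \<open>u\<close> is of order |x|^-2 at the origin and
  not in L^2. Only fields vanishing at 0 can be applied to \<open>u\<close>, hence the requirement
  |\<xi>(s)| \<le> |s|. Truncating each coordinate by itself makes every transport map a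
  one-dimensional shear. The map used is not the flow of an ODE but the inverse of x - t \<xi>(x_i)
  e_i, which agrees with it to first order and has an explicit inverse and Jacobian 1 - t
  \<xi>'(x_i).

  Derivatives in L^2 are encoded as increments along lines, so that Leibniz rules follow from
  translation invariance. All pairings are real: \<open>\<bullet>\<close> is the real part of the
  Hermitian product.

  Differences of Green functions are integrals of exp(-s|x|) over the rate s; this reaches singular
  pairings from functions with two derivatives in L^2.

  The factor (3 + \<beta>)/(2p): with kernel exponent s = 3 - \<beta>, the dilation changes the
  interaction energy at rate s from the kernel and -1 per coordinate from each of the two Jacobians,
  in total s - 6 = -(3 + \<beta>). Convexity contributes 1/p, and moving only one of the two
  densities 1/2.\<close>

abbreviation lborel_integral :: "('a::euclidean_space \<Rightarrow> 'b::{banach, second_countable_topology}) \<Rightarrow> 'b" (binder "LI " 10)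
  where "lborel_integral f \<equiv> integral\<^sup>L lborel f"

abbreviation lborel_nn_integral :: "('a::euclidean_space \<Rightarrow> ennreal) \<Rightarrow> ennreal" (binder "NI " 10)
  where "lborel_nn_integral f \<equiv> integral\<^sup>N lborel f"

abbreviation lborel2 :: "('a::euclidean_space \<times> 'b::euclidean_space) measure"
  where "lborel2 \<equiv> lborel \<Otimes>\<^sub>M lborel"

section \<open>Square-integrable functions and their derivatives\<close>

definition sq_integrable :: "(space \<Rightarrow> complex) \<Rightarrow> bool" where
  "sq_integrable f \<longleftrightarrow> f \<in> borel_measurable borel \<and> integrable lborel (\<lambda>x. (cmod (f x))\<^sup>2)"

definition unif01 :: "real measure" where
  "unif01 = density lborel (indicator {0..1})"

text \<open>The weak derivative, encoded as the fundamental theorem of calculus along lines. The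
  exceptional null set may depend on t, so the notion is stable under changes on null sets, and
  averaging over s in [0,1] treats both signs of t alike. In this form Leibniz rules and L^2 moduli
  of continuity come from translation invariance, with no mollification.\<close>

definition L2_partial :: "3 \<Rightarrow> (space \<Rightarrow> complex) \<Rightarrow> (space \<Rightarrow> complex) \<Rightarrow> bool" where
  "L2_partial i f g \<longleftrightarrow> sq_integrable f \<and> sq_integrable g \<and>
     (\<forall>t. AE x in lborel. f (x + t *\<^sub>R axis i 1) - f x = t *\<^sub>R (\<integral>s. g (x + (s * t) *\<^sub>R axis i 1) \<partial>unif01))"

lemma sets_unif01 [measurable_cong, simp]: "sets unif01 = sets borel"
  by (simp add: unif01_def)

lemma space_unif01 [simp]: "space unif01 = UNIV"
  by (simp add: unif01_def)

lemma emeasure_unif01_UNIV: "emeasure unif01 UNIV = 1"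
  by (simp add: unif01_def emeasure_density)

lemma sigma_finite_unif01: "sigma_finite_measure unif01" 
proof -
  interpret finite_measure unif01 by (rule finite_measureI) (simp add: emeasure_unif01_UNIV)
  show ?thesis by unfold_locales
qed

lemma finite_unif01: "finite_measure unif01" 
  by (rule finite_measureI) (simp add: emeasure_unif01_UNIV)

lemma AE_unif01: "(AE s in unif01. 0 \<le> s \<and> s \<le> 1)"
  unfolding unif01_def by (subst AE_density) (auto simp: indicator_def)

lemma pair_sigma_finite_unif01: "pair_sigma_finite (lborel :: space measure) unif01"
  by (simp add: pair_sigma_finite_def sigma_finite_unif01 sigma_finite_lborel)

lemma integral_unif01_const [simp]: "(\<integral>s. c \<partial>unif01) = (c :: 'b :: {banach, second_countable_topology})"
  by (simp add: measure_def emeasure_unif01_UNIV)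

lemma nn_integral_unif01_const [simp]: "(\<integral>\<^sup>+s. c \<partial>unif01) = c"
  by (simp add: emeasure_unif01_UNIV)

text \<open>The variance of \<open>cmod (g s)\<close> under a probability measure is nonnegative.
  All measurable \<open>g\<close> are covered: a non-integrable one has Bochner integral 0, and an
  infinite second moment makes the right side infinite.\<close>

lemma cauchy_unif01:
  fixes g :: "real \<Rightarrow> complex"
  assumes [measurable]: "g \<in> borel_measurable borel"
  shows "ennreal ((cmod (\<integral>s. g s \<partial>unif01))\<^sup>2) \<le> (\<integral>\<^sup>+s. ennreal ((cmod (g s))\<^sup>2) \<partial>unif01)"
proof (cases "integrable unif01 g \<and> (\<integral>\<^sup>+s. ennreal ((cmod (g s))\<^sup>2) \<partial>unif01) < \<infinity>")
  case True
  interpret finite_measure unif01 by (rule finite_unif01)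
  have i1: "integrable unif01 g" and i2: "integrable unif01 (\<lambda>s. (cmod (g s))\<^sup>2)"
    using True by (auto intro!: integrableI_bounded)
  let ?c = "\<integral>s. cmod (g s) \<partial>unif01"
  have i3: "integrable unif01 (\<lambda>s. cmod (g s))" using i1 by (rule integrable_norm)
  have "0 \<le> (\<integral>s. (cmod (g s) - ?c)\<^sup>2 \<partial>unif01)" by simp
  also have "\<dots> = (\<integral>s. (cmod (g s))\<^sup>2 - 2 * ?c * cmod (g s) + ?c\<^sup>2 \<partial>unif01)"
    by (intro Bochner_Integration.integral_cong) (auto simp: power2_eq_square algebra_simps)
  also have "\<dots> = (\<integral>s. (cmod (g s))\<^sup>2 \<partial>unif01) - 2 * ?c * ?c + ?c\<^sup>2"
  proof -
    have j: "integrable unif01 (\<lambda>s. 2 * ?c * cmod (g s))" using i3 by (rule integrable_mult_right)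
    show ?thesis
      by (subst Bochner_Integration.integral_add[OF Bochner_Integration.integrable_diff[OF i2 j] integrable_const],
          subst Bochner_Integration.integral_diff[OF i2 j])
         (simp only: integral_mult_right_zero integral_unif01_const)
  qed
  finally have "?c\<^sup>2 \<le> (\<integral>s. (cmod (g s))\<^sup>2 \<partial>unif01)" by (simp add: power2_eq_square)
  moreover have "(cmod (\<integral>s. g s \<partial>unif01))\<^sup>2 \<le> ?c\<^sup>2"
    by (intro power_mono integral_norm_bound) auto
  ultimately have "(cmod (\<integral>s. g s \<partial>unif01))\<^sup>2 \<le> (\<integral>s. (cmod (g s))\<^sup>2 \<partial>unif01)" by linarith
  then show ?thesis using i2 by (subst nn_integral_eq_integral) (auto intro: ennreal_leI)
next
  case False
  then have "\<not> integrable unif01 g \<or> (\<integral>\<^sup>+s. ennreal ((cmod (g s))\<^sup>2) \<partial>unif01) = \<infinity>"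
    by (simp add: less_top[symmetric])
  then show ?thesis by (elim disjE) (auto simp: not_integrable_integral_eq)
qed

lemma sq_integrable_measurable [measurable_dest]: "sq_integrable f \<Longrightarrow> f \<in> borel_measurable borel"
  by (simp add: sq_integrable_def)

lemma sq_integrable_integrable: "sq_integrable f \<Longrightarrow> integrable lborel (\<lambda>x. (cmod (f x))\<^sup>2)"
  by (simp add: sq_integrable_def)

lemma sq_integrableI_nn:
  assumes "f \<in> borel_measurable borel" "(NI x. ennreal ((cmod (f x))\<^sup>2)) < \<infinity>"
  shows "sq_integrable f"
  using assms unfolding sq_integrable_def by (auto intro!: integrableI_bounded)

lemma nn_sq_integrable:
  "sq_integrable f \<Longrightarrow> (NI x. ennreal ((cmod (f x))\<^sup>2)) = ennreal (LI x. (cmod (f x))\<^sup>2)"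
  by (intro nn_integral_eq_integral) (auto simp: sq_integrable_def)

lemma sq_integrable_bound:
  assumes "sq_integrable g" "f \<in> borel_measurable borel" "\<And>x. cmod (f x) \<le> C * cmod (g x)"
  shows "sq_integrable f"
  unfolding sq_integrable_def
proof (intro conjI)
  show "integrable lborel (\<lambda>x. (cmod (f x))\<^sup>2)"
  proof (rule Bochner_Integration.integrable_bound[of _ "\<lambda>x. C\<^sup>2 * (cmod (g x))\<^sup>2"])
    show "integrable lborel (\<lambda>x. C\<^sup>2 * (cmod (g x))\<^sup>2)" using assms by (auto simp: sq_integrable_def)
    show "AE x in lborel. norm ((cmod (f x))\<^sup>2) \<le> norm (C\<^sup>2 * (cmod (g x))\<^sup>2)"
      using assms(3) by (auto simp flip: power_mult_distrib intro!: power_mono)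
  qed (use assms in measurable)
qed (use assms in auto)

lemma sq_integrable_AE_bound:
  assumes "sq_integrable g" "f \<in> borel_measurable borel" "AE x in lborel. cmod (f x) \<le> C * cmod (g x)"
  shows "sq_integrable f"
  unfolding sq_integrable_def
proof (intro conjI)
  show "integrable lborel (\<lambda>x. (cmod (f x))\<^sup>2)"
  proof (rule Bochner_Integration.integrable_bound[of _ "\<lambda>x. C\<^sup>2 * (cmod (g x))\<^sup>2"])
    show "integrable lborel (\<lambda>x. C\<^sup>2 * (cmod (g x))\<^sup>2)" using assms by (auto simp: sq_integrable_def)
    show "AE x in lborel. norm ((cmod (f x))\<^sup>2) \<le> norm (C\<^sup>2 * (cmod (g x))\<^sup>2)"
      using assms(3) by (auto simp flip: power_mult_distrib intro!: power_mono elim!: eventually_mono)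
  qed (use assms in measurable)
qed (use assms in auto)

lemma norm_add_sq_le: "(cmod (a + b))\<^sup>2 \<le> 2 * (cmod a)\<^sup>2 + 2 * (cmod b)\<^sup>2"
proof -
  have "(cmod (a + b))\<^sup>2 \<le> (cmod a + cmod b)\<^sup>2" by (intro power_mono norm_triangle_ineq) auto
  also have "\<dots> \<le> 2 * (cmod a)\<^sup>2 + 2 * (cmod b)\<^sup>2"
    using zero_le_power2[of "cmod a - cmod b"] by (simp add: power2_eq_square algebra_simps)
  finally show ?thesis .
qed

lemma sq_integrable_add:
  assumes [measurable]: "sq_integrable f" "sq_integrable g"
  shows "sq_integrable (\<lambda>x. f x + g x)"
  unfolding sq_integrable_def
proof (intro conjI)
  show "integrable lborel (\<lambda>x. (cmod (f x + g x))\<^sup>2)"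
  proof (rule Bochner_Integration.integrable_bound[of _ "\<lambda>x. 2 * (cmod (f x))\<^sup>2 + 2 * (cmod (g x))\<^sup>2"])
    show "integrable lborel (\<lambda>x. 2 * (cmod (f x))\<^sup>2 + 2 * (cmod (g x))\<^sup>2)"
      using assms by (auto simp: sq_integrable_def)
    show "AE x in lborel. norm ((cmod (f x + g x))\<^sup>2) \<le> norm (2 * (cmod (f x))\<^sup>2 + 2 * (cmod (g x))\<^sup>2)"
      using norm_add_sq_le by (auto intro!: AE_I2 order_trans[OF _ abs_ge_self])
  qed measurable
qed measurable

lemma sq_integrable_cmult: "sq_integrable f \<Longrightarrow> sq_integrable (\<lambda>x. c * f x)"
  by (rule sq_integrable_bound[of f _ "cmod c"]) (auto simp: norm_mult)

lemma sq_integrable_scaleR: "sq_integrable f \<Longrightarrow> sq_integrable (\<lambda>x. c *\<^sub>R f x)"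
  by (rule sq_integrable_bound[of f _ "\<bar>c\<bar>"]) auto

lemma sq_integrable_diff: "sq_integrable f \<Longrightarrow> sq_integrable g \<Longrightarrow> sq_integrable (\<lambda>x. f x - g x)"
  using sq_integrable_add[of f "\<lambda>x. (-1) *\<^sub>R g x"] sq_integrable_scaleR[of g "-1"] by simp

lemma sq_integrable_zero: "sq_integrable (\<lambda>x. 0)" by (simp add: sq_integrable_def)

lemma sq_integrable_sum: "(\<And>i. i \<in> I \<Longrightarrow> sq_integrable (f i)) \<Longrightarrow> sq_integrable (\<lambda>x. \<Sum>i\<in>I. f i x)"
  by (induction I rule: infinite_finite_induct) (auto simp: sq_integrable_zero intro!: sq_integrable_add)

text \<open>The free parameter replaces Cauchy-Schwarz with square roots: with \<open>c\<close>
  proportional to a power of the shift length, a fixed norm and a small increment contribute terms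
  of the same order.\<close>

lemma inner_amgm:
  fixes a b :: "'a::real_inner"
  assumes "0 < c" shows "\<bar>a \<bullet> b\<bar> \<le> (c * (norm a)\<^sup>2 + (norm b)\<^sup>2 / c) / 2"
proof -
  have "\<bar>a \<bullet> b\<bar> \<le> norm a * norm b" by (rule Cauchy_Schwarz_ineq2)
  moreover have "0 \<le> (c * norm a - norm b)\<^sup>2 / c" using assms by simp
  then have "2 * (norm a * norm b) \<le> c * (norm a)\<^sup>2 + (norm b)\<^sup>2 / c"
    using assms by (simp add: power2_eq_square field_simps)
  ultimately show ?thesis by argo
qed

lemma integrable_inner_sq:
  assumes [measurable]: "sq_integrable f" "sq_integrable g"
  shows "integrable lborel (\<lambda>x. f x \<bullet> g x)"
proof (rule Bochner_Integration.integrable_bound[of _ "\<lambda>x. (cmod (f x))\<^sup>2 + (cmod (g x))\<^sup>2"])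
  show "integrable lborel (\<lambda>x. (cmod (f x))\<^sup>2 + (cmod (g x))\<^sup>2)"
    using assms by (auto simp: sq_integrable_def)
  show "AE x in lborel. norm (f x \<bullet> g x) \<le> norm ((cmod (f x))\<^sup>2 + (cmod (g x))\<^sup>2)"
  proof (intro AE_I2)
    fix x
    show "norm (f x \<bullet> g x) \<le> norm ((cmod (f x))\<^sup>2 + (cmod (g x))\<^sup>2)"
      using inner_amgm[of 1 "f x" "g x"] by simp
  qed
qed measurable

lemma integral_inner_amgm:
  assumes "sq_integrable f" "sq_integrable g" "0 < c"
  shows "\<bar>(LI x. f x \<bullet> g x)\<bar> \<le>
    (c * (LI x. (cmod (f x))\<^sup>2) + (LI x. (cmod (g x))\<^sup>2) / c) / 2"
proof -
  have "\<bar>(LI x. f x \<bullet> g x)\<bar> \<le> (LI x. \<bar>f x \<bullet> g x\<bar>)" by (rule integral_abs_bound)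
  also have "\<dots> \<le> (LI x. (c * (cmod (f x))\<^sup>2 + (cmod (g x))\<^sup>2 / c) / 2)"
    using assms by (intro integral_mono inner_amgm) (auto simp: sq_integrable_def intro!: integrable_inner_sq[unfolded sq_integrable_def])
  also have "\<dots> = (c * (LI x. (cmod (f x))\<^sup>2) + (LI x. (cmod (g x))\<^sup>2) / c) / 2"
    using assms by (simp add: sq_integrable_def)
  finally show ?thesis .
qed

section \<open>Translation invariance and averages over segments\<close>

lemma nn_integral_shift:
  fixes f :: "'a::euclidean_space \<Rightarrow> ennreal"
  assumes [measurable]: "f \<in> borel_measurable borel"
  shows "(NI x. f (x + a)) = (NI x. f x)"
proof -
  have "(\<integral>\<^sup>+x. f x \<partial>distr lborel borel ((+) a)) = (NI x. f (a + x))"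
    by (rule nn_integral_distr) measurable
  then show ?thesis by (simp only: lborel_distr_plus add.commute)
qed

lemma integral_shift:
  fixes f :: "'a::euclidean_space \<Rightarrow> 'b::{banach,second_countable_topology}"
  assumes [measurable]: "f \<in> borel_measurable borel"
  shows "(LI x. f (x + a)) = (LI x. f x)"
proof -
  have "(\<integral>x. f x \<partial>distr lborel borel ((+) a)) = (LI x. f (a + x))"
    by (rule integral_distr) measurable
  then show ?thesis by (simp only: lborel_distr_plus add.commute)
qed

lemma integrable_shift:
  fixes f :: "'a::euclidean_space \<Rightarrow> 'b::{banach,second_countable_topology}"
  assumes "integrable lborel f"
  shows "integrable lborel (\<lambda>x. f (x + a))"
proof -
  have [measurable]: "f \<in> borel_measurable borel" using borel_measurable_integrable[OF assms] by simp
  have "integrable (distr lborel borel ((+) a)) f \<longleftrightarrow> integrable lborel (\<lambda>x. f (a + x))"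
    by (rule integrable_distr_eq) measurable
  then show ?thesis using assms by (simp only: lborel_distr_plus add.commute)
qed

lemma AE_shift:
  fixes P :: "'a::euclidean_space \<Rightarrow> bool"
  assumes "AE x in lborel. P x"
  shows "AE x in lborel. P (x + a)"
proof -
  have "AE x in distr lborel borel ((+) a). P x" using assms by (simp only: lborel_distr_plus)
  then have "AE x in lborel. P (a + x)" by (rule AE_distrD[rotated]) simp
  then show ?thesis by (simp add: add.commute)
qed

lemma sq_integrable_shift: "sq_integrable f \<Longrightarrow> sq_integrable (\<lambda>x. f (x + a))"
  unfolding sq_integrable_def using integrable_shift[of "\<lambda>x. (cmod (f x))\<^sup>2" a] by auto

lemma L2_partial_sq: "L2_partial i f g \<Longrightarrow> sq_integrable f" "L2_partial i f g \<Longrightarrow> sq_integrable g"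
  by (auto simp: L2_partial_def)

lemma L2_partialD:
  "L2_partial i f g \<Longrightarrow> AE x in lborel. f (x + t *\<^sub>R axis i 1) - f x = t *\<^sub>R (\<integral>s. g (x + (s * t) *\<^sub>R axis i 1) \<partial>unif01)"
  by (auto simp: L2_partial_def)

text \<open>Tonelli: for each s the translation by \<open>c s\<close> preserves the integral, and
  averaging over s has total mass 1.\<close>

lemma nn_integral_line_average:
  assumes [measurable]: "k \<in> borel_measurable borel" "c \<in> borel_measurable borel"
  shows "(NI x. (\<integral>\<^sup>+s. k (x + c s *\<^sub>R axis i 1 :: space) \<partial>unif01)) = (NI x. k x)"
proof -
  interpret pair_sigma_finite "lborel :: space measure" unif01 by (rule pair_sigma_finite_unif01)
  have "(NI x. (\<integral>\<^sup>+s. k (x + c s *\<^sub>R axis i 1) \<partial>unif01)) =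
        (\<integral>\<^sup>+s. (NI x. k (x + c s *\<^sub>R axis i 1)) \<partial>unif01)"
    by (rule Fubini'[symmetric]) measurable
  also have "\<dots> = (\<integral>\<^sup>+s. (NI x. k x) \<partial>unif01)"
    by (intro nn_integral_cong nn_integral_shift) measurable
  finally show ?thesis by (simp only: nn_integral_unif01_const)
qed

text \<open>The increment is t times an average of translates of \<open>g\<close>, whose L^2 norm is
  at most that of \<open>g\<close> by Jensen. This Lipschitz modulus under translations measures the
  error terms of the weak calculus.\<close>

lemma L2_partial_shift_bound:
  assumes LP: "L2_partial i f g"
  shows "(LI x. (cmod (f (x + t *\<^sub>R axis i 1) - f x))\<^sup>2) \<le> t\<^sup>2 * (LI x. (cmod (g x))\<^sup>2)"
proof -
  note [measurable] = L2_partial_sq[OF LP, THEN sq_integrable_measurable]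
  have s: "sq_integrable (\<lambda>x. f (x + t *\<^sub>R axis i 1) - f x)"
    by (intro sq_integrable_diff sq_integrable_shift L2_partial_sq[OF LP])
  have "ennreal (LI x. (cmod (f (x + t *\<^sub>R axis i 1) - f x))\<^sup>2) =
     (NI x. ennreal ((cmod (f (x + t *\<^sub>R axis i 1) - f x))\<^sup>2))"
    using nn_sq_integrable[OF s] by simp
  also have "\<dots> = (NI x. ennreal (t\<^sup>2) * ennreal ((cmod (\<integral>s. g (x + (s * t) *\<^sub>R axis i 1) \<partial>unif01))\<^sup>2))"
    using L2_partialD[OF LP, of t]
    by (intro nn_integral_cong_AE) (auto simp: power_mult_distrib ennreal_mult elim!: eventually_mono)
  also have "\<dots> \<le> (NI x. ennreal (t\<^sup>2) * (\<integral>\<^sup>+s. ennreal ((cmod (g (x + (s * t) *\<^sub>R axis i 1)))\<^sup>2) \<partial>unif01))"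
    by (intro nn_integral_mono mult_left_mono cauchy_unif01) auto
  also have "\<dots> = ennreal (t\<^sup>2) * (NI x. (\<integral>\<^sup>+s. ennreal ((cmod (g (x + (s * t) *\<^sub>R axis i 1)))\<^sup>2) \<partial>unif01))"
    by (intro nn_integral_cmult) (use sigma_finite_unif01 in \<open>auto intro!: sigma_finite_measure.borel_measurable_nn_integral\<close>)
  also have "\<dots> = ennreal (t\<^sup>2) * (NI x. ennreal ((cmod (g x))\<^sup>2))"
    by (subst nn_integral_line_average[of "\<lambda>x. ennreal ((cmod (g x))\<^sup>2)" "\<lambda>s. s * t" i]) auto
  also have "\<dots> = ennreal (t\<^sup>2 * (LI x. (cmod (g x))\<^sup>2))"
    using nn_sq_integrable[OF L2_partial_sq(2)[OF LP]] by (simp add: ennreal_mult)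
  finally show ?thesis by (subst (asm) ennreal_le_iff) auto
qed

text \<open>Linearity of the line average needs integrability on the line, since the Bochner
  integral is 0 where it fails. On almost every line \<open>g\<close> is square integrable over the
  segment, and the measure is finite.\<close>

lemma AE_integrable_line:
  assumes sg: "sq_integrable g"
  shows "AE x in lborel. integrable unif01 (\<lambda>s. g (x + (s * t) *\<^sub>R axis i 1))"
proof -
  note [measurable] = sg[THEN sq_integrable_measurable]
  interpret pair_sigma_finite "lborel :: space measure" unif01 by (rule pair_sigma_finite_unif01)
  interpret finite_measure unif01 by (rule finite_unif01)
  let ?e = "axis i 1 :: space"
  have "AE x in lborel. integrable unif01 (\<lambda>s. (cmod (g (x + (s * t) *\<^sub>R ?e)))\<^sup>2)"
  proof -
    have "(NI x. (\<integral>\<^sup>+s. ennreal ((cmod (g (x + (s * t) *\<^sub>R ?e)))\<^sup>2) \<partial>unif01)) \<noteq> \<infinity>"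
      by (subst nn_integral_line_average[of "\<lambda>x. ennreal ((cmod (g x))\<^sup>2)" "\<lambda>s. s * t" i])
         (auto simp: nn_sq_integrable[OF sg])
    then have "AE x in lborel. (\<integral>\<^sup>+s. ennreal ((cmod (g (x + (s * t) *\<^sub>R ?e)))\<^sup>2) \<partial>unif01) \<noteq> \<infinity>"
      by (intro nn_integral_PInf_AE) (auto intro!: borel_measurable_nn_integral)
    then show ?thesis by eventually_elim (auto intro!: integrableI_bounded simp: top.not_eq_extremum)
  qed
  then show ?thesis
  proof eventually_elim
    case (elim x)
    show ?case
    proof (rule Bochner_Integration.integrable_bound)
      show "integrable unif01 (\<lambda>s. 1 + (cmod (g (x + (s * t) *\<^sub>R ?e)))\<^sup>2)" using elim by auto
      show "AE s in unif01. norm (g (x + (s * t) *\<^sub>R ?e)) \<le> norm (1 + (cmod (g (x + (s * t) *\<^sub>R ?e)))\<^sup>2)"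
      proof (intro AE_I2)
        fix s
        have "2 * cmod (g (x + (s * t) *\<^sub>R ?e)) \<le> 1 + (cmod (g (x + (s * t) *\<^sub>R ?e)))\<^sup>2"
          using zero_le_power2[of "cmod (g (x + (s * t) *\<^sub>R ?e)) - 1"] by (simp add: power2_eq_square algebra_simps)
        then show "norm (g (x + (s * t) *\<^sub>R ?e)) \<le> norm (1 + (cmod (g (x + (s * t) *\<^sub>R ?e)))\<^sup>2)"
          using norm_ge_zero[of "g (x + (s * t) *\<^sub>R ?e)"] unfolding real_norm_def by linarith
      qed
    qed measurable
  qed
qed

text \<open>Fubini moves the average from one factor to the other, where translation invariance
  reverses the shift. Regularity of \<open>w\<close> can then stand in for regularity that
  \<open>g\<close> lacks.\<close>

lemma line_average_pairing:
  assumes sg: "sq_integrable g" and w: "sq_integrable w"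
  shows "(LI x. (\<integral>s. g (x + (s * t) *\<^sub>R axis i 1) \<partial>unif01) \<bullet> w x) =
     (\<integral>s. (LI x. g x \<bullet> w (x + (-s * t) *\<^sub>R axis i 1)) \<partial>unif01)"
proof -
  note [measurable] = sg[THEN sq_integrable_measurable] w[THEN sq_integrable_measurable]
  interpret pair_sigma_finite "lborel :: space measure" unif01 by (rule pair_sigma_finite_unif01)
  interpret finite_measure unif01 by (rule finite_unif01)
  let ?A = "LI x. (cmod (g x))\<^sup>2"
  let ?e = "axis i 1 :: space"
  have int2: "integrable (lborel \<Otimes>\<^sub>M unif01) (\<lambda>(x, s). g (x + (s * t) *\<^sub>R ?e) \<bullet> w x)"
  proof (rule Bochner_Integration.integrable_bound)
    have "(\<integral>\<^sup>+p. ennreal (cmod (g (fst p + (snd p * t) *\<^sub>R ?e)))^2 \<partial>(lborel \<Otimes>\<^sub>M unif01)) < \<infinity>"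
    proof -
      have "(\<integral>\<^sup>+p. ennreal (cmod (g (fst p + (snd p * t) *\<^sub>R ?e)))^2 \<partial>(lborel \<Otimes>\<^sub>M unif01)) =
        (NI x. (\<integral>\<^sup>+s. ennreal ((cmod (g (x + (s * t) *\<^sub>R ?e)))\<^sup>2) \<partial>unif01))"
        by (subst M2.nn_integral_fst[symmetric]) (auto simp: ennreal_power)
      also have "\<dots> = ennreal ?A"
        by (subst nn_integral_line_average[of "\<lambda>x. ennreal ((cmod (g x))\<^sup>2)" "\<lambda>s. s * t" i])
           (auto simp: nn_sq_integrable[OF sg])
      finally show ?thesis by simp
    qed
    then have i1: "integrable (lborel \<Otimes>\<^sub>M unif01) (\<lambda>p. (cmod (g (fst p + (snd p * t) *\<^sub>R ?e)))^2)"
      by (intro integrableI_bounded) (auto simp: ennreal_power)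
    have "(\<integral>\<^sup>+p. ennreal (cmod (w (fst p)))^2 \<partial>(lborel \<Otimes>\<^sub>M unif01)) =
        (NI x. (\<integral>\<^sup>+s. ennreal ((cmod (w x))\<^sup>2) \<partial>unif01))"
      by (subst M2.nn_integral_fst[symmetric]) (auto simp: ennreal_power)
    also have "\<dots> < \<infinity>" by (simp only: nn_integral_unif01_const nn_sq_integrable[OF w]) simp
    finally have i2: "integrable (lborel \<Otimes>\<^sub>M unif01) (\<lambda>p. (cmod (w (fst p)))^2)"
      by (intro integrableI_bounded) (auto simp: ennreal_power)
    show "integrable (lborel \<Otimes>\<^sub>M unif01) (\<lambda>p. (cmod (g (fst p + (snd p * t) *\<^sub>R ?e)))^2 + (cmod (w (fst p)))^2)"
      using i1 i2 by auto
    show "AE p in lborel \<Otimes>\<^sub>M unif01. norm (case p of (x, s) \<Rightarrow> g (x + (s * t) *\<^sub>R ?e) \<bullet> w x)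
       \<le> norm ((cmod (g (fst p + (snd p * t) *\<^sub>R ?e)))^2 + (cmod (w (fst p)))^2)"
    proof (intro AE_I2, clarsimp)
      fix x s
      show "\<bar>g (x + (s * t) *\<^sub>R ?e) \<bullet> w x\<bar> \<le> (cmod (g (x + (s * t) *\<^sub>R ?e)))^2 + (cmod (w x))^2"
        using inner_amgm[of 1 "g (x + (s * t) *\<^sub>R ?e)" "w x"] zero_le_power2[of "cmod (w x)"] 
          zero_le_power2[of "cmod (g (x + (s * t) *\<^sub>R ?e))"] by auto
    qed
  qed measurable
  have aei: "AE x in lborel. integrable unif01 (\<lambda>s. g (x + (s * t) *\<^sub>R ?e))"
    by (rule AE_integrable_line[OF sg])
  have [measurable]: "(\<lambda>x. \<integral>s. g (x + (s * t) *\<^sub>R ?e) \<partial>unif01) \<in> borel_measurable borel"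
    "(\<lambda>x. \<integral>s. g (x + (s * t) *\<^sub>R ?e) \<bullet> w x \<partial>unif01) \<in> borel_measurable borel"
    by measurable
  have "(LI x. (\<integral>s. g (x + (s * t) *\<^sub>R ?e) \<partial>unif01) \<bullet> w x) = (LI x. (\<integral>s. g (x + (s * t) *\<^sub>R ?e) \<bullet> w x \<partial>unif01))"
  proof (rule integral_cong_AE)
    show "AE x in lborel. (\<integral>s. g (x + (s * t) *\<^sub>R ?e) \<partial>unif01) \<bullet> w x = (\<integral>s. g (x + (s * t) *\<^sub>R ?e) \<bullet> w x \<partial>unif01)"
      using aei by eventually_elim simp
  qed measurable
  also have "\<dots> = (\<integral>s. (LI x. g (x + (s * t) *\<^sub>R ?e) \<bullet> w x) \<partial>unif01)"
    by (rule Fubini_integral[OF int2, symmetric])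
  also have "\<dots> = (\<integral>s. (LI x. g x \<bullet> w (x + (-s * t) *\<^sub>R ?e)) \<partial>unif01)"
  proof (rule Bochner_Integration.integral_cong[OF refl])
    fix s :: real
    have c: "x + (s * t) *\<^sub>R ?e + (-s * t) *\<^sub>R ?e = x" for x by simp
    show "(LI x. g (x + (s * t) *\<^sub>R ?e) \<bullet> w x) = (LI x. g x \<bullet> w (x + (-s * t) *\<^sub>R ?e))"
      using integral_shift[of "\<lambda>x. g x \<bullet> w (x + (-s * t) *\<^sub>R ?e)" "(s * t) *\<^sub>R ?e"] unfolding c by measurable
  qed
  finally show ?thesis .
qed

lemma sq_integrable_line_average:
  assumes sg: "sq_integrable g"
  shows "sq_integrable (\<lambda>x. \<integral>s. g (x + (s * t) *\<^sub>R axis i 1) \<partial>unif01)"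
proof (rule sq_integrableI_nn)
  note [measurable] = sg[THEN sq_integrable_measurable]
  interpret finite_measure unif01 by (rule finite_unif01)
  show "(\<lambda>x. \<integral>s. g (x + (s * t) *\<^sub>R axis i 1) \<partial>unif01) \<in> borel_measurable borel" by measurable
  have "(NI x. ennreal ((cmod (\<integral>s. g (x + (s * t) *\<^sub>R axis i 1) \<partial>unif01))\<^sup>2)) \<le>
      (NI x. (\<integral>\<^sup>+s. ennreal ((cmod (g (x + (s * t) *\<^sub>R axis i 1)))\<^sup>2) \<partial>unif01))"
    by (intro nn_integral_mono cauchy_unif01) measurable
  also have "\<dots> = (NI x. ennreal ((cmod (g x))\<^sup>2))"
    by (rule nn_integral_line_average[of "\<lambda>x. ennreal ((cmod (g x))\<^sup>2)" "\<lambda>s. s * t" i]) measurable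
  also have "\<dots> < \<infinity>" by (simp add: nn_sq_integrable[OF sg])
  finally show "(NI x. ennreal ((cmod (\<integral>s. g (x + (s * t) *\<^sub>R axis i 1) \<partial>unif01))\<^sup>2)) < \<infinity>" .
qed

text \<open>First-order expansion of a pairing without a second derivative of \<open>f\<close>: the
  line average is moved onto \<open>w\<close>, and \<open>g\<close> is then paired with an increment
  of \<open>w\<close>, which is Lipschitz in the shift by assumption.\<close>

lemma pairing_difference:
  assumes LP: "L2_partial i f g" and w: "sq_integrable w"
    and mod: "\<And>r. (LI x. (cmod (w (x + r *\<^sub>R axis i 1) - w x))\<^sup>2) \<le> r\<^sup>2 * C"
  shows "\<bar>(LI x. (f (x + t *\<^sub>R axis i 1) - f x) \<bullet> w x) - t * (LI x. g x \<bullet> w x)\<bar>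
    \<le> t\<^sup>2 * (((LI x. (cmod (g x))\<^sup>2) + C) / 2)"
proof -
  note [measurable] = L2_partial_sq[OF LP, THEN sq_integrable_measurable] w[THEN sq_integrable_measurable]
  interpret pair_sigma_finite "lborel :: space measure" unif01 by (rule pair_sigma_finite_unif01)
  interpret finite_measure unif01 by (rule finite_unif01)
  let ?A = "LI x. (cmod (g x))\<^sup>2"
  let ?e = "axis i 1 :: space"
  have A0: "0 \<le> ?A" by simp
  have C0: "0 \<le> C" using order_trans[OF _ mod[of 1]] by simp
  have sg: "sq_integrable g" by (rule L2_partial_sq[OF LP])
  have "(LI x. (f (x + t *\<^sub>R ?e) - f x) \<bullet> w x) = (LI x. t * ((\<integral>s. g (x + (s * t) *\<^sub>R ?e) \<partial>unif01) \<bullet> w x))"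
  proof (rule integral_cong_AE)
    show "AE x in lborel. (f (x + t *\<^sub>R ?e) - f x) \<bullet> w x = t * ((\<integral>s. g (x + (s * t) *\<^sub>R ?e) \<partial>unif01) \<bullet> w x)"
      using L2_partialD[OF LP, of t] by eventually_elim simp
  qed measurable
  also have "\<dots> = t * (\<integral>s. (LI x. g x \<bullet> w (x + (-s * t) *\<^sub>R ?e)) \<partial>unif01)"
    by (simp only: integral_mult_right_zero line_average_pairing[OF sg w])
  finally have eq: "(LI x. (f (x + t *\<^sub>R ?e) - f x) \<bullet> w x) = t * (\<integral>s. (LI x. g x \<bullet> w (x + (-s * t) *\<^sub>R ?e)) \<partial>unif01)" .
  define H where "H s = (LI x. g x \<bullet> w (x + (-s * t) *\<^sub>R ?e))" for s
  define h where "h = (LI x. g x \<bullet> w x)"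
  have [measurable]: "H \<in> borel_measurable borel" unfolding H_def by measurable
  have bd: "\<bar>H s - h\<bar> \<le> \<bar>t\<bar> * ((?A + C) / 2)" if s: "0 \<le> s \<and> s \<le> 1" for s
  proof (cases "s * t = 0")
    case True
    then have "H s = h" by (auto simp: H_def h_def)
    then show ?thesis using A0 C0 by simp
  next
    case False
    have ws: "sq_integrable (\<lambda>x. w (x + (-s * t) *\<^sub>R ?e))" by (rule sq_integrable_shift[OF w])
    have "H s - h = (LI x. g x \<bullet> (w (x + (-s * t) *\<^sub>R ?e) - w x))"
        unfolding H_def h_def inner_diff_right
      by (rule Bochner_Integration.integral_diff[symmetric]; rule integrable_inner_sq; rule sg w ws)
    \<comment> \<open>The parameter |s t| balances the fixed norm of \<open>g\<close> against a
      squared increment of order (s t)^2; both terms become linear in t.\<close>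
    also have "\<bar>\<dots>\<bar> \<le> (\<bar>s * t\<bar> * ?A + (LI x. (cmod (w (x + (-s * t) *\<^sub>R ?e) - w x))\<^sup>2) / \<bar>s * t\<bar>) / 2"
      using False by (intro integral_inner_amgm sg sq_integrable_diff ws w) auto
    also have "\<dots> \<le> (\<bar>s * t\<bar> * ?A + ((-s * t)\<^sup>2 * C) / \<bar>s * t\<bar>) / 2"
      by (intro divide_right_mono add_left_mono mod) auto
    also have "((-s * t)\<^sup>2 * C) / \<bar>s * t\<bar> = \<bar>s * t\<bar> * C" using False
      by (simp add: power2_eq_square field_simps abs_mult)
    also have "(\<bar>s * t\<bar> * ?A + \<bar>s * t\<bar> * C) / 2 = \<bar>s\<bar> * (\<bar>t\<bar> * ((?A + C) / 2))" by (simp add: field_simps abs_mult)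
    also have "\<dots> \<le> 1 * (\<bar>t\<bar> * ((?A + C) / 2))" using s A0 C0 by (intro mult_right_mono) auto
    finally show ?thesis by simp
  qed
  have AEb: "AE s in unif01. \<bar>H s - h\<bar> \<le> \<bar>t\<bar> * ((?A + C) / 2)"
    using AE_unif01 by eventually_elim (rule bd)
  have iH: "integrable unif01 (\<lambda>s. H s - h)"
    by (rule integrable_const_bound[of _ "\<bar>t\<bar> * ((?A + C) / 2)"]) (use AEb in auto)
  have "(\<integral>s. H s \<partial>unif01) - h = (\<integral>s. H s - h \<partial>unif01)"
  proof -
    have iH': "integrable unif01 H"
      using Bochner_Integration.integrable_add[OF iH integrable_const[of h]] by simp
    show ?thesis by (subst Bochner_Integration.integral_diff[OF iH' integrable_const]) (simp only: integral_unif01_const)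
  qed
  also have "\<bar>\<dots>\<bar> \<le> (\<integral>s. \<bar>H s - h\<bar> \<partial>unif01)" by (rule integral_abs_bound)
  also have "\<dots> \<le> (\<integral>s. \<bar>t\<bar> * ((?A + C) / 2) \<partial>unif01)"
    by (rule integral_mono_AE[OF integrable_abs[OF iH] integrable_const AEb])
  finally have "\<bar>(\<integral>s. H s \<partial>unif01) - h\<bar> \<le> \<bar>t\<bar> * ((?A + C) / 2)"
    by (simp only: integral_unif01_const)
  then have "\<bar>t\<bar> * \<bar>(\<integral>s. H s \<partial>unif01) - h\<bar> \<le> \<bar>t\<bar> * (\<bar>t\<bar> * ((?A + C) / 2))"
    by (rule mult_left_mono) simp
  then have "\<bar>t * (\<integral>s. H s \<partial>unif01) - t * h\<bar> \<le> t\<^sup>2 * ((?A + C) / 2)"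
    by (simp only: right_diff_distrib[symmetric] abs_mult power2_eq_square mult.assoc[symmetric] abs_mult_self_eq)
  then show ?thesis unfolding eq H_def h_def .
qed

section \<open>Integration by parts\<close>

text \<open>Identities between pairings are obtained by expanding one increment in two ways: their
  defect is linear in t and yet bounded by a multiple of t^2.\<close>

lemma zero_of_quadratic_bound:
  fixes Z K :: real
  assumes "\<And>t. 0 < t \<Longrightarrow> \<bar>t * Z\<bar> \<le> t\<^sup>2 * K"
  shows "Z = 0"
proof (rule ccontr)
  assume "Z \<noteq> 0"
  then have Z: "\<bar>Z\<bar> > 0" by simp
  have le: "\<bar>Z\<bar> \<le> t * K" if "0 < t" for t
    using assms[OF that] that by (simp add: power2_eq_square abs_mult)
  from le[of 1] Z have K: "K > 0" by simp
  have "\<bar>Z\<bar> \<le> \<bar>Z\<bar> / (2 * K) * K" by (rule le) (use Z K in simp)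
  then show False using Z K by simp
qed

lemma measurable_vec_nth [measurable]: "(\<lambda>x :: space. x $ i) \<in> borel_measurable borel"
  by (intro borel_measurable_continuous_onI continuous_intros)

lemma axis_nth_same [simp]: "(axis i 1 :: space) $ i = 1" by (simp add: axis_def)

lemma axis_nth_other: "j \<noteq> i \<Longrightarrow> (axis j 1 :: space) $ i = 0" by (simp add: axis_def)

text \<open>\<open>M\<close> bounds the weight, 1 bounds its slope and \<open>L\<close> its
  second-order Taylor remainder. Differentiability is stated as a uniform remainder bound because
  that is what difference quotients consume.\<close>

definition weight :: "(real \<Rightarrow> real) \<Rightarrow> (real \<Rightarrow> real) \<Rightarrow> real \<Rightarrow> real \<Rightarrow> bool" where
  "weight \<xi> \<xi>' M L \<longleftrightarrow> \<xi> \<in> borel_measurable borel \<and> \<xi>' \<in> borel_measurable borel \<and>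
     (\<forall>s. \<bar>\<xi> s\<bar> \<le> M \<and> \<bar>\<xi>' s\<bar> \<le> 1) \<and>
     (\<forall>s t. \<bar>\<xi> (s + t) - \<xi> s\<bar> \<le> \<bar>t\<bar> \<and> \<bar>\<xi> (s + t) - \<xi> s - t * \<xi>' s\<bar> \<le> L * t\<^sup>2)"

lemma weight_const: "weight (\<lambda>_. 1) (\<lambda>_. 0) 1 0"
  by (simp add: weight_def)

lemma weight_measurable [measurable_dest]:
  "weight \<xi> \<xi>' M L \<Longrightarrow> \<xi> \<in> borel_measurable borel" "weight \<xi> \<xi>' M L \<Longrightarrow> \<xi>' \<in> borel_measurable borel"
  by (auto simp: weight_def)

lemma sq_integrable_weight:
  assumes "weight \<xi> \<xi>' M L" and h: "sq_integrable h"
  shows "sq_integrable (\<lambda>x. \<xi> (x $ i) *\<^sub>R h x)" "sq_integrable (\<lambda>x. \<xi>' (x $ i) *\<^sub>R h x)"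
proof -
  note [measurable] = assms(1)[THEN weight_measurable(1)] assms(1)[THEN weight_measurable(2)] sq_integrable_measurable[OF h]
  show "sq_integrable (\<lambda>x. \<xi> (x $ i) *\<^sub>R h x)"
    using assms(1) by (intro sq_integrable_bound[OF h, of _ M]) (auto simp: weight_def intro!: mult_right_mono)
  show "sq_integrable (\<lambda>x. \<xi>' (x $ i) *\<^sub>R h x)"
    using assms(1) by (intro sq_integrable_bound[OF h, of _ 1]) (auto simp: weight_def intro!: mult_left_le_one_le)
qed

text \<open>Provides the Lipschitz modulus that \<open>pairing_difference\<close> asks of its second
  factor, for a weighted function: one term from the increment of \<open>h\<close>, one from that of
  the weight.\<close>

lemma weighted_shift_bound:
  assumes w: "weight \<xi> \<xi>' M L" and LP: "L2_partial i h h'"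
  shows "(LI x. (cmod (\<xi> ((x + r *\<^sub>R axis i 1) $ i) *\<^sub>R h (x + r *\<^sub>R axis i 1) - \<xi> (x $ i) *\<^sub>R h x))\<^sup>2)
     \<le> r\<^sup>2 * (2 * M\<^sup>2 * (LI x. (cmod (h' x))\<^sup>2) + 2 * (LI x. (cmod (h x))\<^sup>2))"
proof -
  have h: "sq_integrable h" and h': "sq_integrable h'" using L2_partial_sq[OF LP] by auto
  let ?e = "axis i 1 :: space"
  have hr: "sq_integrable (\<lambda>x. h (x + r *\<^sub>R ?e))" by (rule sq_integrable_shift[OF h])
  have d: "sq_integrable (\<lambda>x. h (x + r *\<^sub>R ?e) - h x)" by (rule sq_integrable_diff[OF hr h])
  have wh: "sq_integrable (\<lambda>x. \<xi> (x $ i) *\<^sub>R h x)" by (rule sq_integrable_weight[OF w h])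
  have wd: "sq_integrable (\<lambda>x. \<xi> ((x + r *\<^sub>R ?e) $ i) *\<^sub>R h (x + r *\<^sub>R ?e) - \<xi> (x $ i) *\<^sub>R h x)"
    by (rule sq_integrable_diff[OF sq_integrable_shift[OF wh] wh])
  have pt: "(cmod (\<xi> ((x + r *\<^sub>R ?e) $ i) *\<^sub>R h (x + r *\<^sub>R ?e) - \<xi> (x $ i) *\<^sub>R h x))\<^sup>2
      \<le> 2 * M\<^sup>2 * (cmod (h (x + r *\<^sub>R ?e) - h x))\<^sup>2 + 2 * r\<^sup>2 * (cmod (h x))\<^sup>2" for x
  proof -
    have "\<xi> ((x + r *\<^sub>R ?e) $ i) *\<^sub>R h (x + r *\<^sub>R ?e) - \<xi> (x $ i) *\<^sub>R h x =
      \<xi> (x $ i + r) *\<^sub>R (h (x + r *\<^sub>R ?e) - h x) + (\<xi> (x $ i + r) - \<xi> (x $ i)) *\<^sub>R h x"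
      by (simp add: scaleR_diff_left scaleR_diff_right)
    also have "(cmod \<dots>)\<^sup>2 \<le> 2 * (cmod (\<xi> (x $ i + r) *\<^sub>R (h (x + r *\<^sub>R ?e) - h x)))\<^sup>2
        + 2 * (cmod ((\<xi> (x $ i + r) - \<xi> (x $ i)) *\<^sub>R h x))\<^sup>2" by (rule norm_add_sq_le)
    also have "\<dots> = 2 * (\<bar>\<xi> (x $ i + r)\<bar>\<^sup>2 * (cmod (h (x + r *\<^sub>R ?e) - h x))\<^sup>2)
        + 2 * (\<bar>\<xi> (x $ i + r) - \<xi> (x $ i)\<bar>\<^sup>2 * (cmod (h x))\<^sup>2)" by (simp add: power_mult_distrib)
    also have "\<dots> \<le> 2 * (M\<^sup>2 * (cmod (h (x + r *\<^sub>R ?e) - h x))\<^sup>2) + 2 * (\<bar>r\<bar>\<^sup>2 * (cmod (h x))\<^sup>2)"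
      using w unfolding weight_def by (intro add_mono mult_left_mono mult_right_mono power_mono) auto
    finally show ?thesis by (simp add: algebra_simps)
  qed
  have "(LI x. (cmod (\<xi> ((x + r *\<^sub>R ?e) $ i) *\<^sub>R h (x + r *\<^sub>R ?e) - \<xi> (x $ i) *\<^sub>R h x))\<^sup>2)
      \<le> (LI x. 2 * M\<^sup>2 * (cmod (h (x + r *\<^sub>R ?e) - h x))\<^sup>2 + 2 * r\<^sup>2 * (cmod (h x))\<^sup>2)"
    by (intro integral_mono pt sq_integrable_integrable[OF wd] Bochner_Integration.integrable_add integrable_mult_right
        sq_integrable_integrable[OF d] sq_integrable_integrable[OF h])
  also have "\<dots> = 2 * M\<^sup>2 * (LI x. (cmod (h (x + r *\<^sub>R ?e) - h x))\<^sup>2) + 2 * r\<^sup>2 * (LI x. (cmod (h x))\<^sup>2)"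
    by (subst Bochner_Integration.integral_add) (simp_all add: sq_integrable_integrable[OF d] sq_integrable_integrable[OF h])
  also have "\<dots> \<le> 2 * M\<^sup>2 * (r\<^sup>2 * (LI x. (cmod (h' x))\<^sup>2)) + 2 * r\<^sup>2 * (LI x. (cmod (h x))\<^sup>2)"
    by (intro add_right_mono mult_left_mono L2_partial_shift_bound[OF LP]) auto
  finally show ?thesis by (simp add: algebra_simps)
qed

text \<open>The Leibniz rule from translation invariance: the increment of the weighted product is
  evaluated once by expanding both factors and once by translating it back, which leaves a shift on
  the weight alone.\<close>

lemma weighted_integration_by_parts:
  assumes w: "weight \<xi> \<xi>' M L" and f: "L2_partial i f f'" and g: "L2_partial i g g'"
  shows "(LI x. f' x \<bullet> (\<xi> (x $ i) *\<^sub>R g x)) + (LI x. g' x \<bullet> (\<xi> (x $ i) *\<^sub>R f x))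
      = - (LI x. f x \<bullet> (\<xi>' (x $ i) *\<^sub>R g x))"
proof -
  let ?e = "axis i 1 :: space"
  note sf = L2_partial_sq[OF f] and sg = L2_partial_sq[OF g]
  note [measurable] = sf[THEN sq_integrable_measurable] sg[THEN sq_integrable_measurable]
    w[THEN weight_measurable(1)] w[THEN weight_measurable(2)]
  note wf = sq_integrable_weight[OF w sf(1), of i] and wg = sq_integrable_weight[OF w sg(1), of i]
  define a where "a = (LI x. f' x \<bullet> (\<xi> (x $ i) *\<^sub>R g x))"
  define b where "b = (LI x. g' x \<bullet> (\<xi> (x $ i) *\<^sub>R f x))"
  define c where "c = (LI x. f x \<bullet> (\<xi>' (x $ i) *\<^sub>R g x))"
  define F where "F = (LI x. (cmod (f' x))\<^sup>2)"
  define G where "G = (LI x. (cmod (g' x))\<^sup>2)"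
  obtain C1 where C1: "\<And>t. \<bar>(LI x. (f (x + t *\<^sub>R ?e) - f x) \<bullet> (\<xi> (x $ i) *\<^sub>R g x)) - t * a\<bar> \<le> t\<^sup>2 * C1"
    unfolding a_def using pairing_difference[OF f wg(1) weighted_shift_bound[OF w g]] by blast
  obtain C2 where C2: "\<And>t. \<bar>(LI x. (g (x + t *\<^sub>R ?e) - g x) \<bullet> (\<xi> (x $ i) *\<^sub>R f x)) - t * b\<bar> \<le> t\<^sup>2 * C2"
    unfolding b_def using pairing_difference[OF g wf(1) weighted_shift_bound[OF w f]] by blast
  define C3 where "C3 = (M\<^sup>2 * F + G) / 2"
  define C4 where "C4 = L * (LI x. \<bar>f x \<bullet> g x\<bar>)"
  have "a + b + c = 0"
  proof (rule zero_of_quadratic_bound)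
    fix t :: real
    note sft = sq_integrable_shift[OF sf(1), of "t *\<^sub>R ?e"] and sgt = sq_integrable_shift[OF sg(1), of "t *\<^sub>R ?e"]
    note df = sq_integrable_diff[OF sft sf(1)] and dg = sq_integrable_diff[OF sgt sg(1)]
    note wfg = sq_integrable_weight(1)[OF w df, of i]
    \<comment> \<open>Increment of the product with the weight frozen at x. Expansion gives t (a +
      b) plus the product \<open>P\<close> of two increments, hence up to O(t^2); translating back
      gives - t c up to O(t^2).\<close>
    define D where "D = (LI x. (f (x + t *\<^sub>R ?e)) \<bullet> (\<xi> (x $ i) *\<^sub>R g (x + t *\<^sub>R ?e))) - (LI x. f x \<bullet> (\<xi> (x $ i) *\<^sub>R g x))"
    define P where "P = (LI x. (\<xi> (x $ i) *\<^sub>R (f (x + t *\<^sub>R ?e) - f x)) \<bullet> (g (x + t *\<^sub>R ?e) - g x))"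
    note wgt = sq_integrable_weight(1)[OF w sgt, of i]
    have D1: "D = (LI x. (f (x + t *\<^sub>R ?e) - f x) \<bullet> (\<xi> (x $ i) *\<^sub>R g x))
        + (LI x. (g (x + t *\<^sub>R ?e) - g x) \<bullet> (\<xi> (x $ i) *\<^sub>R f x)) + P"
      unfolding D_def P_def
      by (subst Bochner_Integration.integral_diff[OF integrable_inner_sq[OF sft wgt] integrable_inner_sq[OF sf(1) wg(1)], symmetric],
          subst Bochner_Integration.integral_add[OF integrable_inner_sq[OF df wg(1)] integrable_inner_sq[OF dg wf(1)], symmetric],
          subst Bochner_Integration.integral_add[OF Bochner_Integration.integrable_add[OF integrable_inner_sq[OF df wg(1)] integrable_inner_sq[OF dg wf(1)]] integrable_inner_sq[OF wfg dg], symmetric],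
          rule Bochner_Integration.integral_cong[OF refl])
         (simp add: inner_diff_left inner_diff_right algebra_simps inner_commute)
    have "(LI x. (f (x + t *\<^sub>R ?e)) \<bullet> (\<xi> ((x + t *\<^sub>R ?e) $ i - t) *\<^sub>R g (x + t *\<^sub>R ?e))) = (LI x. f x \<bullet> (\<xi> (x $ i - t) *\<^sub>R g x))"
      by (rule integral_shift) measurable
    then have s: "(LI x. (f (x + t *\<^sub>R ?e)) \<bullet> (\<xi> (x $ i) *\<^sub>R g (x + t *\<^sub>R ?e))) = (LI x. f x \<bullet> (\<xi> (x $ i - t) *\<^sub>R g x))"
      by simp
    have wgs: "sq_integrable (\<lambda>x. \<xi> (x $ i - t) *\<^sub>R g x)"
      by (rule sq_integrable_bound[OF sg(1), of _ M]) (use w in \<open>auto simp: weight_def intro!: mult_right_mono\<close>)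
    have "D + t * c = (LI x. f x \<bullet> (\<xi> (x $ i - t) *\<^sub>R g x) - f x \<bullet> (\<xi> (x $ i) *\<^sub>R g x) + t * (f x \<bullet> (\<xi>' (x $ i) *\<^sub>R g x)))"
      unfolding D_def s c_def
      using integrable_inner_sq[OF sf(1) wgs] integrable_inner_sq[OF sf(1) wg(1)] integrable_inner_sq[OF sf(1) wg(2)]
      by simp
    also have "\<dots> = (LI x. (\<xi> (x $ i - t) - \<xi> (x $ i) + t * \<xi>' (x $ i)) * (f x \<bullet> g x))"
      by (intro Bochner_Integration.integral_cong) (auto simp: algebra_simps)
    also have "\<bar>\<dots>\<bar> \<le> (LI x. \<bar>(\<xi> (x $ i - t) - \<xi> (x $ i) + t * \<xi>' (x $ i)) * (f x \<bullet> g x)\<bar>)"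
      by (rule integral_abs_bound)
    also have "\<dots> \<le> (LI x. (L * t\<^sup>2) * \<bar>f x \<bullet> g x\<bar>)"
    proof (rule integral_mono_AE)
      have b: "\<bar>\<xi> (s - t) - \<xi> s + t * \<xi>' s\<bar> \<le> L * t\<^sup>2" for s
      proof -
        have "\<forall>s t. \<bar>\<xi> (s + t) - \<xi> s - t * \<xi>' s\<bar> \<le> L * t\<^sup>2" using w by (simp add: weight_def)
        from this[rule_format, of s "-t"] show ?thesis by simp
      qed
      then have b': "\<bar>(\<xi> (x $ i - t) - \<xi> (x $ i) + t * \<xi>' (x $ i)) * (f x \<bullet> g x)\<bar> \<le> (L * t\<^sup>2) * \<bar>f x \<bullet> g x\<bar>" for x
        unfolding abs_mult by (intro mult_right_mono) auto
      show i: "integrable lborel (\<lambda>x. (L * t\<^sup>2) * \<bar>f x \<bullet> g x\<bar>)"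
        using integrable_inner_sq[OF sf(1) sg(1)] by auto
      show "integrable lborel (\<lambda>x. \<bar>(\<xi> (x $ i - t) - \<xi> (x $ i) + t * \<xi>' (x $ i)) * (f x \<bullet> g x)\<bar>)"
        by (rule Bochner_Integration.integrable_bound[OF i]) (measurable, use b' in \<open>auto intro!: AE_I2 order_trans[OF _ abs_ge_self]\<close>)
      show "AE x in lborel. \<bar>(\<xi> (x $ i - t) - \<xi> (x $ i) + t * \<xi>' (x $ i)) * (f x \<bullet> g x)\<bar> \<le> (L * t\<^sup>2) * \<bar>f x \<bullet> g x\<bar>"
        using b' by simp
    qed
    finally have D2: "\<bar>D + t * c\<bar> \<le> t\<^sup>2 * C4" by (simp add: C4_def mult_ac)
    have "\<bar>P\<bar> \<le> (1 * (LI x. (cmod (\<xi> (x $ i) *\<^sub>R (f (x + t *\<^sub>R ?e) - f x)))\<^sup>2) + (LI x. (cmod (g (x + t *\<^sub>R ?e) - g x))\<^sup>2) / 1) / 2"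
      unfolding P_def by (rule integral_inner_amgm[OF wfg dg]) simp
    also have "\<dots> \<le> (1 * (M\<^sup>2 * (t\<^sup>2 * F)) + (t\<^sup>2 * G) / 1) / 2"
    proof (intro divide_right_mono add_mono mult_left_mono)
      have "(LI x. (cmod (\<xi> (x $ i) *\<^sub>R (f (x + t *\<^sub>R ?e) - f x)))\<^sup>2) \<le> (LI x. M\<^sup>2 * (cmod (f (x + t *\<^sub>R ?e) - f x))\<^sup>2)"
      proof (rule integral_mono[OF sq_integrable_integrable[OF wfg] integrable_mult_right[OF sq_integrable_integrable[OF df]]])
        fix x
        show "(cmod (\<xi> (x $ i) *\<^sub>R (f (x + t *\<^sub>R ?e) - f x)))\<^sup>2 \<le> M\<^sup>2 * (cmod (f (x + t *\<^sub>R ?e) - f x))\<^sup>2"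
          unfolding norm_scaleR power_mult_distrib using w by (intro mult_right_mono power_mono) (auto simp: weight_def)
      qed
      also have "\<dots> = M\<^sup>2 * (LI x. (cmod (f (x + t *\<^sub>R ?e) - f x))\<^sup>2)" by simp
      also have "\<dots> \<le> M\<^sup>2 * (t\<^sup>2 * F)"
        unfolding F_def by (intro mult_left_mono L2_partial_shift_bound[OF f]) auto
      finally show "(LI x. (cmod (\<xi> (x $ i) *\<^sub>R (f (x + t *\<^sub>R ?e) - f x)))\<^sup>2) \<le> M\<^sup>2 * (t\<^sup>2 * F)" .
      show "(LI x. (cmod (g (x + t *\<^sub>R ?e) - g x))\<^sup>2) \<le> t\<^sup>2 * G"
        unfolding G_def by (rule L2_partial_shift_bound[OF g])
    qed auto
    finally have P: "\<bar>P\<bar> \<le> t\<^sup>2 * C3" by (simp add: C3_def field_simps)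
    have "t * (a + b + c) = (t * c + D) - P - ((LI x. (f (x + t *\<^sub>R ?e) - f x) \<bullet> (\<xi> (x $ i) *\<^sub>R g x)) - t * a)
        - ((LI x. (g (x + t *\<^sub>R ?e) - g x) \<bullet> (\<xi> (x $ i) *\<^sub>R f x)) - t * b)"
      unfolding D1 by (simp add: algebra_simps)
    then have "\<bar>t * (a + b + c)\<bar> \<le> t\<^sup>2 * C4 + t\<^sup>2 * C3 + t\<^sup>2 * C1 + t\<^sup>2 * C2"
      using D2 P C1[of t] C2[of t] by linarith
    then show "\<bar>t * (a + b + c)\<bar> \<le> t\<^sup>2 * (C4 + C3 + C1 + C2)" by (simp add: distrib_left)
  qed
  then show ?thesis unfolding a_def b_def c_def by linarith
qed

lemma integration_by_parts:
  assumes f: "L2_partial i f f'" and g: "L2_partial i g g'"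
  shows "(LI x. f' x \<bullet> g x) = - (LI x. f x \<bullet> g' x)"
  using weighted_integration_by_parts[OF weight_const f g] by (simp add: inner_commute)

section \<open>Rules for L^2 derivatives\<close>

lemma L2_partial_shift:
  assumes "L2_partial j f g" shows "L2_partial j (\<lambda>x. f (x + a)) (\<lambda>x. g (x + a))"
  unfolding L2_partial_def
proof (intro conjI allI)
  show "sq_integrable (\<lambda>x. f (x + a))" "sq_integrable (\<lambda>x. g (x + a))"
    using L2_partial_sq[OF assms] by (auto intro: sq_integrable_shift)
  fix t
  show "AE x in lborel. f (x + t *\<^sub>R axis j 1 + a) - f (x + a) = t *\<^sub>R (\<integral>s. g (x + (s * t) *\<^sub>R axis j 1 + a) \<partial>unif01)"
    using AE_shift[OF L2_partialD[OF assms, of t], of a] by (simp add: add_ac)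
qed

lemma L2_partial_add:
  assumes f: "L2_partial j f f'" and g: "L2_partial j g g'"
  shows "L2_partial j (\<lambda>x. f x + g x) (\<lambda>x. f' x + g' x)"
  unfolding L2_partial_def
proof (intro conjI allI)
  note sf = L2_partial_sq[OF f] and sg = L2_partial_sq[OF g]
  show "sq_integrable (\<lambda>x. f x + g x)" "sq_integrable (\<lambda>x. f' x + g' x)"
    by (intro sq_integrable_add sf sg)+
  fix t
  show "AE x in lborel. f (x + t *\<^sub>R axis j 1) + g (x + t *\<^sub>R axis j 1) - (f x + g x) =
      t *\<^sub>R (\<integral>s. f' (x + (s * t) *\<^sub>R axis j 1) + g' (x + (s * t) *\<^sub>R axis j 1) \<partial>unif01)"
    using L2_partialD[OF f, of t] L2_partialD[OF g, of t] AE_integrable_line[OF sf(2), of t j] AE_integrable_line[OF sg(2), of t j]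
    by eventually_elim (simp add: scaleR_add_right algebra_simps)
qed

lemma L2_partial_cmult:
  assumes f: "L2_partial j f f'"
  shows "L2_partial j (\<lambda>x. c * f x) (\<lambda>x. c * f' x)"
  unfolding L2_partial_def
proof (intro conjI allI)
  note sf = L2_partial_sq[OF f]
  show "sq_integrable (\<lambda>x. c * f x)" "sq_integrable (\<lambda>x. c * f' x)"
    by (intro sq_integrable_cmult sf)+
  fix t
  show "AE x in lborel. c * f (x + t *\<^sub>R axis j 1) - c * f x = t *\<^sub>R (\<integral>s. c * f' (x + (s * t) *\<^sub>R axis j 1) \<partial>unif01)"
    using L2_partialD[OF f, of t]
    by eventually_elim (simp flip: right_diff_distrib)
qed

lemma L2_partial_diff:
  assumes f: "L2_partial j f f'" and g: "L2_partial j g g'"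
  shows "L2_partial j (\<lambda>x. f x - g x) (\<lambda>x. f' x - g' x)"
  using L2_partial_add[OF f L2_partial_cmult[OF g, of "-1"]] by simp

lemma L2_partial_weight_other:
  assumes w: "weight \<xi> \<xi>' M L" and f: "L2_partial j f f'" and ij: "j \<noteq> i"
  shows "L2_partial j (\<lambda>x. \<xi> (x $ i) *\<^sub>R f x) (\<lambda>x. \<xi> (x $ i) *\<^sub>R f' x)"
  unfolding L2_partial_def
proof (intro conjI allI)
  show "sq_integrable (\<lambda>x. \<xi> (x $ i) *\<^sub>R f x)" "sq_integrable (\<lambda>x. \<xi> (x $ i) *\<^sub>R f' x)"
    by (intro sq_integrable_weight(1)[OF w] L2_partial_sq[OF f])+
  fix t
  show "AE x in lborel. \<xi> ((x + t *\<^sub>R axis j 1) $ i) *\<^sub>R f (x + t *\<^sub>R axis j 1) - \<xi> (x $ i) *\<^sub>R f x =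
      t *\<^sub>R (\<integral>s. \<xi> ((x + (s * t) *\<^sub>R axis j 1) $ i) *\<^sub>R f' (x + (s * t) *\<^sub>R axis j 1) \<partial>unif01)"
    using L2_partialD[OF f, of t]
    by eventually_elim (simp add: axis_nth_other[OF ij] flip: scaleR_diff_right)
qed

text \<open>The remainder is t times the average of \<open>g (x + s t e) - g x\<close>, and each of
  these increments has L^2 norm at most |t| times that of \<open>k\<close>.\<close>

lemma L2_partial_second_order:
  assumes f: "L2_partial i f g" and g: "L2_partial i g k"
  shows "(LI x. (cmod (f (x + t *\<^sub>R axis i 1) - f x - t *\<^sub>R g x))\<^sup>2) \<le> t^4 * (LI x. (cmod (k x))\<^sup>2)"
proof -
  let ?e = "axis i 1 :: space"
  note sf = L2_partial_sq[OF f] and sk = L2_partial_sq(2)[OF g]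
  note [measurable] = sf[THEN sq_integrable_measurable] sk[THEN sq_integrable_measurable]
  interpret pair_sigma_finite "lborel :: space measure" unif01 by (rule pair_sigma_finite_unif01)
  interpret finite_measure unif01 by (rule finite_unif01)
  have s: "sq_integrable (\<lambda>x. f (x + t *\<^sub>R ?e) - f x - t *\<^sub>R g x)"
    by (rule sq_integrable_diff[OF sq_integrable_diff[OF sq_integrable_shift[OF sf(1)] sf(1)] sq_integrable_scaleR[OF sf(2)]])
  have "ennreal (LI x. (cmod (f (x + t *\<^sub>R ?e) - f x - t *\<^sub>R g x))\<^sup>2) =
     (NI x. ennreal ((cmod (f (x + t *\<^sub>R ?e) - f x - t *\<^sub>R g x))\<^sup>2))"
    using nn_sq_integrable[OF s] by simp
  also have "\<dots> = (NI x. ennreal (t\<^sup>2) * ennreal ((cmod (\<integral>s. g (x + (s * t) *\<^sub>R ?e) - g x \<partial>unif01))\<^sup>2))"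
  proof (rule nn_integral_cong_AE)
    show "AE x in lborel. ennreal ((cmod (f (x + t *\<^sub>R ?e) - f x - t *\<^sub>R g x))\<^sup>2) =
       ennreal (t\<^sup>2) * ennreal ((cmod (\<integral>s. g (x + (s * t) *\<^sub>R ?e) - g x \<partial>unif01))\<^sup>2)"
      using L2_partialD[OF f, of t] AE_integrable_line[OF sf(2), of t i]
    proof eventually_elim
      case (elim x)
      have "(\<integral>s. g (x + (s * t) *\<^sub>R ?e) - g x \<partial>unif01) = (\<integral>s. g (x + (s * t) *\<^sub>R ?e) \<partial>unif01) - g x"
        by (subst Bochner_Integration.integral_diff[OF elim(2) integrable_const]) (simp only: integral_unif01_const)
      then have "f (x + t *\<^sub>R ?e) - f x - t *\<^sub>R g x = t *\<^sub>R (\<integral>s. g (x + (s * t) *\<^sub>R ?e) - g x \<partial>unif01)"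
        using elim(1) by (simp add: scaleR_diff_right)
      then show ?case by (simp add: power_mult_distrib ennreal_mult)
    qed
  qed
  also have "\<dots> \<le> (NI x. ennreal (t\<^sup>2) * (\<integral>\<^sup>+s. ennreal ((cmod (g (x + (s * t) *\<^sub>R ?e) - g x))\<^sup>2) \<partial>unif01))"
    by (intro nn_integral_mono mult_left_mono cauchy_unif01) auto
  also have "\<dots> = ennreal (t\<^sup>2) * (NI x. (\<integral>\<^sup>+s. ennreal ((cmod (g (x + (s * t) *\<^sub>R ?e) - g x))\<^sup>2) \<partial>unif01))"
    by (intro nn_integral_cmult) measurable
  also have "(NI x. (\<integral>\<^sup>+s. ennreal ((cmod (g (x + (s * t) *\<^sub>R ?e) - g x))\<^sup>2) \<partial>unif01)) =
      (\<integral>\<^sup>+s. (NI x. ennreal ((cmod (g (x + (s * t) *\<^sub>R ?e) - g x))\<^sup>2)) \<partial>unif01)"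
    by (rule Fubini'[symmetric]) measurable
  also have "ennreal (t\<^sup>2) * \<dots> \<le> ennreal (t\<^sup>2) * (\<integral>\<^sup>+s. ennreal (t\<^sup>2 * (LI x. (cmod (k x))\<^sup>2)) \<partial>unif01)"
  proof (intro mult_left_mono nn_integral_mono_AE)
    show "AE s in unif01. (NI x. ennreal ((cmod (g (x + (s * t) *\<^sub>R ?e) - g x))\<^sup>2)) \<le> ennreal (t\<^sup>2 * (LI x. (cmod (k x))\<^sup>2))"
      using AE_unif01
    proof eventually_elim
      case (elim s)
      have "(NI x. ennreal ((cmod (g (x + (s * t) *\<^sub>R ?e) - g x))\<^sup>2)) = ennreal (LI x. (cmod (g (x + (s * t) *\<^sub>R ?e) - g x))\<^sup>2)"
        by (rule nn_sq_integrable[OF sq_integrable_diff[OF sq_integrable_shift[OF sf(2)] sf(2)]])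
      also have "\<dots> \<le> ennreal ((s * t)\<^sup>2 * (LI x. (cmod (k x))\<^sup>2))"
        by (intro ennreal_leI L2_partial_shift_bound[OF g])
      also have "\<dots> \<le> ennreal (t\<^sup>2 * (LI x. (cmod (k x))\<^sup>2))"
        using elim by (intro ennreal_leI mult_right_mono) (auto simp: power_mult_distrib intro!: mult_left_le_one_le power_le_one)
      finally show ?case .
    qed
  qed simp
  also have "\<dots> = ennreal (t^4 * (LI x. (cmod (k x))\<^sup>2))"
    by (simp only: nn_integral_unif01_const) (simp flip: ennreal_mult add: mult.assoc[symmetric] power_add[symmetric])
  finally show ?thesis by (subst (asm) ennreal_le_iff) auto
qed

text \<open>Approximating \<open>\<partial>\<^sub>i\<phi>\<close> by difference quotients avoids the symmetry of mixed second derivatives.\<close>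

lemma second_derivative_pairing_other:
  assumes w: "weight \<xi> \<xi>' M L" and ij: "j \<noteq> i"
    and fi: "L2_partial i \<phi> fi" and fii: "L2_partial i fi fii"
    and fj: "L2_partial j \<phi> fj" and fjj: "L2_partial j fj fjj" and fji: "L2_partial i fj fji"
  shows "(LI x. fjj x \<bullet> (\<xi> (x $ i) *\<^sub>R fi x)) = 1 / 2 * (LI x. \<xi>' (x $ i) * (cmod (fj x))\<^sup>2)"
proof -
  let ?e = "axis i 1 :: space"
  note s\<phi> = L2_partial_sq(1)[OF fi] and si = L2_partial_sq[OF fii] and sj = L2_partial_sq[OF fjj] and sji = L2_partial_sq(2)[OF fji]
  note wj = sq_integrable_weight[OF w sj(1), of i] 
  define a where "a = (LI x. fjj x \<bullet> (\<xi> (x $ i) *\<^sub>R fi x))"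
  define b where "b = (LI x. fji x \<bullet> (\<xi> (x $ i) *\<^sub>R fj x))"
  obtain C1 where C1: "\<And>t. \<bar>(LI x. (fj (x + t *\<^sub>R ?e) - fj x) \<bullet> (\<xi> (x $ i) *\<^sub>R fj x)) - t * b\<bar> \<le> t\<^sup>2 * C1"
    unfolding b_def using pairing_difference[OF fji wj(1) weighted_shift_bound[OF w fji]] by blast
  define C2 where "C2 = ((LI x. (cmod (\<xi> (x $ i) *\<^sub>R fjj x))\<^sup>2) + (LI x. (cmod (fii x))\<^sup>2)) / 2"
  have "a + b = 0"
  proof (rule zero_of_quadratic_bound)
    fix t :: real assume t: "0 < t"
    let ?D = "\<lambda>x. \<phi> (x + t *\<^sub>R ?e) - \<phi> x"
    have sD: "sq_integrable ?D" by (rule sq_integrable_diff[OF sq_integrable_shift[OF s\<phi>] s\<phi>])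
    have sR: "sq_integrable (\<lambda>x. ?D x - t *\<^sub>R fi x)" by (rule sq_integrable_diff[OF sD sq_integrable_scaleR[OF si(1)]])
    have wjj: "sq_integrable (\<lambda>x. \<xi> (x $ i) *\<^sub>R fjj x)" by (rule sq_integrable_weight(1)[OF w sj(2)])
    \<comment> \<open>For j \<noteq> i the weight is constant in direction j, so this integration by
      parts produces no derivative of the weight. The increment \<open>?D\<close> has a j-derivative
      in L^2 because \<phi> has one; \<partial>_j of \<open>fi\<close> is never formed.\<close>
    have "(LI x. fjj x \<bullet> (\<xi> (x $ i) *\<^sub>R ?D x)) = - (LI x. fj x \<bullet> (\<xi> (x $ i) *\<^sub>R (fj (x + t *\<^sub>R ?e) - fj x)))"
      by (rule integration_by_parts[OF fjj L2_partial_weight_other[OF w L2_partial_diff[OF L2_partial_shift[OF fj] fj] ij]])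
    also have "\<dots> = - (LI x. (fj (x + t *\<^sub>R ?e) - fj x) \<bullet> (\<xi> (x $ i) *\<^sub>R fj x))"
      by (simp add: inner_commute)
    finally have e1: "(LI x. fjj x \<bullet> (\<xi> (x $ i) *\<^sub>R ?D x)) = - (LI x. (fj (x + t *\<^sub>R ?e) - fj x) \<bullet> (\<xi> (x $ i) *\<^sub>R fj x))" .
    have e2: "(LI x. (\<xi> (x $ i) *\<^sub>R fjj x) \<bullet> (?D x - t *\<^sub>R fi x)) = (LI x. fjj x \<bullet> (\<xi> (x $ i) *\<^sub>R ?D x)) - t * a"
    proof -
      have "(LI x. (\<xi> (x $ i) *\<^sub>R fjj x) \<bullet> (?D x - t *\<^sub>R fi x)) =
         (LI x. fjj x \<bullet> (\<xi> (x $ i) *\<^sub>R ?D x) - t * (fjj x \<bullet> (\<xi> (x $ i) *\<^sub>R fi x)))"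
        by (intro Bochner_Integration.integral_cong refl) (simp add: inner_diff_right algebra_simps)
      also have "\<dots> = (LI x. fjj x \<bullet> (\<xi> (x $ i) *\<^sub>R ?D x)) - (LI x. t * (fjj x \<bullet> (\<xi> (x $ i) *\<^sub>R fi x)))"
        by (intro Bochner_Integration.integral_diff integrable_mult_right integrable_inner_sq sj sq_integrable_weight(1)[OF w] sD si)
      finally show ?thesis by (simp add: a_def)
    qed
    \<comment> \<open>The squared norm of the remainder is O(t^4), so the parameter t^2 leaves
      O(t^2) on both sides.\<close>
    have "\<bar>(LI x. (\<xi> (x $ i) *\<^sub>R fjj x) \<bullet> (?D x - t *\<^sub>R fi x))\<bar>
        \<le> (t\<^sup>2 * (LI x. (cmod (\<xi> (x $ i) *\<^sub>R fjj x))\<^sup>2) + (LI x. (cmod (?D x - t *\<^sub>R fi x))\<^sup>2) / t\<^sup>2) / 2"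
      using t by (intro integral_inner_amgm wjj sR) auto
    also have "\<dots> \<le> (t\<^sup>2 * (LI x. (cmod (\<xi> (x $ i) *\<^sub>R fjj x))\<^sup>2) + (t^4 * (LI x. (cmod (fii x))\<^sup>2)) / t\<^sup>2) / 2"
      by (intro divide_right_mono add_left_mono L2_partial_second_order[OF fi fii]) auto
    also have "\<dots> = t\<^sup>2 * C2" using t by (simp add: C2_def field_simps power2_eq_square power4_eq_xxxx)
    finally have e3: "\<bar>(LI x. fjj x \<bullet> (\<xi> (x $ i) *\<^sub>R ?D x)) - t * a\<bar> \<le> t\<^sup>2 * C2" unfolding e2 .
    have "\<bar>t * (a + b)\<bar> \<le> t\<^sup>2 * C1 + t\<^sup>2 * C2"
      using e3 C1[of t] unfolding e1 distrib_left by linarith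
    then show "\<bar>t * (a + b)\<bar> \<le> t\<^sup>2 * (C1 + C2)" by (simp add: distrib_left)
  qed
  moreover have "b + b = - (LI x. \<xi>' (x $ i) * (cmod (fj x))\<^sup>2)"
    unfolding b_def using weighted_integration_by_parts[OF w fji fji] by (simp add: power2_norm_eq_inner)
  ultimately show ?thesis unfolding a_def by linarith
qed

lemma second_derivative_pairing_same:
  assumes w: "weight \<xi> \<xi>' M L" and fii: "L2_partial i fi fii"
  shows "(LI x. fii x \<bullet> (\<xi> (x $ i) *\<^sub>R fi x)) = - (1 / 2) * (LI x. \<xi>' (x $ i) * (cmod (fi x))\<^sup>2)"
  using weighted_integration_by_parts[OF w fii fii] by (simp add: power2_norm_eq_inner)

section \<open>Test functions\<close>

text \<open>The classical flat function exp(-1/s), multiplied by powers of 1/s. With the powers the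
  family is closed under differentiation up to linear combinations, which reduces smoothness to a
  structural induction.\<close>

definition flat :: "nat \<Rightarrow> real \<Rightarrow> real" where
  "flat n s = (if s \<le> 0 then 0 else exp (- inverse s) * inverse s ^ n)"

lemma flat_at_right_0: "(flat n \<longlongrightarrow> 0) (at_right 0)"
proof -
  have "((\<lambda>x. x ^ n / exp x) \<longlongrightarrow> (0::real)) at_top" by (rule tendsto_power_div_exp_0)
  then have "((\<lambda>s. (inverse s) ^ n / exp (inverse s)) \<longlongrightarrow> (0::real)) (at_right 0)"
    by (rule filterlim_compose[OF _ filterlim_inverse_at_top_right])
  moreover have "\<forall>\<^sub>F s in at_right 0. (inverse s) ^ n / exp (inverse s) = flat n s"
    unfolding eventually_at_right_field
    by (intro exI[of _ 1]) (auto simp: flat_def exp_minus divide_inverse mult.commute)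
  ultimately show ?thesis by (rule Lim_transform_eventually)
qed

lemma DERIV_flat: "(flat n has_real_derivative (flat (n + 2) s - n * flat (n + 1) s)) (at s)"
proof -
  consider "s < 0" | "s = 0" | "0 < s" by linarith
  then show ?thesis
  proof cases
    case 1
    have "((\<lambda>_. 0) has_real_derivative 0) (at s)" by simp
    then have "(flat n has_real_derivative 0) (at s)"
      by (rule DERIV_cong_ev[THEN iffD1, rotated -1, OF _ refl])
         (use 1 in \<open>auto simp: eventually_nhds flat_def intro!: exI[of _ "{..<0}"]\<close>)
    then show ?thesis using 1 by (simp add: flat_def)
  next
    case 2
    have l: "((\<lambda>h. flat n h / h) \<longlongrightarrow> 0) (at_left 0)"
      by (rule Lim_transform_eventually[of "\<lambda>_. 0"])
         (auto simp: eventually_at_left_field flat_def intro!: exI[of _ "-1"])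
    \<comment> \<open>For h > 0 the quotient \<open>flat n h / h\<close> is
      \<open>flat (n + 1) h\<close>, so the difference quotient at 0 is covered by the limit of the
      next function of the family.\<close>
    have r: "((\<lambda>h. flat n h / h) \<longlongrightarrow> 0) (at_right 0)"
      by (rule Lim_transform_eventually[OF flat_at_right_0[of "n + 1"]])
         (auto simp: eventually_at_right_field flat_def divide_inverse mult_ac intro!: exI[of _ "1"])
    have "((\<lambda>h. flat n h / h) \<longlongrightarrow> 0) (at 0)" using l r by (rule filterlim_split_at)
    then show ?thesis using 2 by (simp add: DERIV_def flat_def)
  next
      case 3
    define y where "y = inverse s"
    define E where "E = exp (- y)"
    have "((\<lambda>s. exp (- inverse s) * inverse s ^ n) has_real_derivative
        E * (y * y) * y ^ n + E * (real n * y ^ (n - 1) * - (y * y))) (at s)"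
      using 3 unfolding E_def y_def by (auto intro!: derivative_eq_intros)
    also have "E * (y * y) * y ^ n + E * (real n * y ^ (n - 1) * - (y * y)) = E * y ^ (n + 2) - n * (E * y ^ (n + 1))"
      by (cases n) simp_all
    also have "\<dots> = flat (n + 2) s - n * flat (n + 1) s"
      using 3 by (simp add: flat_def E_def y_def)
    finally have "((\<lambda>s. exp (- inverse s) * inverse s ^ n) has_real_derivative (flat (n + 2) s - n * flat (n + 1) s)) (at s)" .
    then show ?thesis
      by (rule DERIV_cong_ev[THEN iffD1, rotated -1, OF _ refl])
         (use 3 in \<open>auto simp: eventually_nhds flat_def intro!: exI[of _ "{0<..}"]\<close>)
  qed
qed

section \<open>An algebra of smooth functions\<close>

inductive_set smooth_alg :: "(space \<Rightarrow> real) set" where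
  const: "(\<lambda>_. c) \<in> smooth_alg"
| coord: "(\<lambda>x. x $ i) \<in> smooth_alg"
| add: "f \<in> smooth_alg \<Longrightarrow> g \<in> smooth_alg \<Longrightarrow> (\<lambda>x. f x + g x) \<in> smooth_alg"
| mult: "f \<in> smooth_alg \<Longrightarrow> g \<in> smooth_alg \<Longrightarrow> (\<lambda>x. f x * g x) \<in> smooth_alg"
| flat: "f \<in> smooth_alg \<Longrightarrow> (\<lambda>x. flat n (f x)) \<in> smooth_alg"

lemma smooth_alg_cmult: "f \<in> smooth_alg \<Longrightarrow> (\<lambda>x. c * f x) \<in> smooth_alg"
  by (intro smooth_alg.intros)

lemma smooth_alg_diff: "f \<in> smooth_alg \<Longrightarrow> g \<in> smooth_alg \<Longrightarrow> (\<lambda>x. f x - g x) \<in> smooth_alg"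
  using smooth_alg.add[OF _ smooth_alg_cmult[of g "-1"]] by simp

lemma smooth_alg_prod: "(\<And>i. i \<in> I \<Longrightarrow> f i \<in> smooth_alg) \<Longrightarrow> (\<lambda>x. \<Prod>i\<in>I. f i x) \<in> smooth_alg"
  by (induction I rule: infinite_finite_induct) (auto intro: smooth_alg.intros)

lemma smooth_alg_shift: "f \<in> smooth_alg \<Longrightarrow> (\<lambda>x. f (x + a)) \<in> smooth_alg"
  by (induction rule: smooth_alg.induct) (auto intro: smooth_alg.intros)

text \<open>Closure under partial derivatives is the purpose of the algebra: membership then gives
  derivatives of every order by a plain induction on k.\<close>

lemma smooth_alg_has_derivative:
  assumes "f \<in> smooth_alg"
  shows "\<exists>p. (\<forall>i. p i \<in> smooth_alg) \<and> (\<forall>x. (f has_derivative (\<lambda>h. \<Sum>i\<in>UNIV. p i x * h $ i)) (at x))"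
  using assms
proof induction
  case (const c)
  show ?case by (intro exI[of _ "\<lambda>_ _. 0"]) (auto intro: smooth_alg.const)
next
  case (coord j)
  have "((\<lambda>x. x $ j) has_derivative (\<lambda>h. \<Sum>i\<in>UNIV. (if i = j then 1 else 0) * h $ i)) (at x)" for x :: space
    by (simp add: if_distrib[where f = "\<lambda>c. c * _"] cong: if_cong)
       (intro bounded_linear.has_derivative[OF bounded_linear_vec_nth] has_derivative_ident)
  then show ?case by (intro exI[of _ "\<lambda>i _. if i = j then 1 else 0"]) (auto intro: smooth_alg.const)
next
  case (add f g)
  then obtain p q where p: "\<And>i. p i \<in> smooth_alg" "\<And>x. (f has_derivative (\<lambda>h. \<Sum>i\<in>UNIV. p i x * h $ i)) (at x)"
    and q: "\<And>i. q i \<in> smooth_alg" "\<And>x. (g has_derivative (\<lambda>h. \<Sum>i\<in>UNIV. q i x * h $ i)) (at x)" by blast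
  show ?case
    by (intro exI[of _ "\<lambda>i x. p i x + q i x"] conjI allI smooth_alg.add p q has_derivative_eq_rhs[OF has_derivative_add[OF p(2) q(2)]])
       (simp add: sum.distrib distrib_right)
next
  case (mult f g)
  then obtain p q where p: "\<And>i. p i \<in> smooth_alg" "\<And>x. (f has_derivative (\<lambda>h. \<Sum>i\<in>UNIV. p i x * h $ i)) (at x)"
    and q: "\<And>i. q i \<in> smooth_alg" "\<And>x. (g has_derivative (\<lambda>h. \<Sum>i\<in>UNIV. q i x * h $ i)) (at x)" by blast
  show ?case
    by (intro exI[of _ "\<lambda>i x. f x * q i x + p i x * g x"] conjI allI smooth_alg.add smooth_alg.mult mult.hyps p q has_derivative_eq_rhs[OF has_derivative_mult[OF p(2) q(2)]])
       (simp add: sum.distrib distrib_right sum_distrib_left sum_distrib_right algebra_simps)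
next
  case (flat f n)
  then obtain p where p: "\<And>i. p i \<in> smooth_alg" "\<And>x. (f has_derivative (\<lambda>h. \<Sum>i\<in>UNIV. p i x * h $ i)) (at x)" by blast
  have s: "(\<lambda>x. flat (n + 2) (f x) - n * flat (n + 1) (f x)) \<in> smooth_alg"
    by (intro smooth_alg_diff smooth_alg_cmult smooth_alg.flat flat.hyps)
  show ?case
    by (intro exI[of _ "\<lambda>i x. (flat (n + 2) (f x) - n * flat (n + 1) (f x)) * p i x"] conjI allI smooth_alg.mult s p
          has_derivative_eq_rhs[OF DERIV_compose_FDERIV[OF DERIV_flat p(2)]])
       (simp add: sum_distrib_left algebra_simps sum_subtractf)
qed

lemma smooth_alg_deriv:
  assumes "f \<in> smooth_alg"
  shows "f differentiable at x" "partial_deriv i f \<in> smooth_alg"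
    "((\<lambda>s. f (x + s *\<^sub>R axis i 1)) has_real_derivative partial_deriv i f (x + s *\<^sub>R axis i 1)) (at s)"
proof -
  obtain p where p: "\<And>i. p i \<in> smooth_alg" "\<And>x. (f has_derivative (\<lambda>h. \<Sum>i\<in>UNIV. p i x * h $ i)) (at x)"
    using smooth_alg_has_derivative[OF assms] by blast
  show d: "f differentiable at x" for x using p(2) by (auto simp: differentiable_def)
  have pd: "partial_deriv i f = p i"
  proof
    fix x
    have "frechet_derivative f (at x) = (\<lambda>h. \<Sum>i\<in>UNIV. p i x * h $ i)"
      by (rule frechet_derivative_at[OF p(2), symmetric])
    then show "partial_deriv i f x = p i x"
      by (simp add: partial_deriv_def axis_def if_distrib cong: if_cong)
  qed
  show "partial_deriv i f \<in> smooth_alg" using p(1) pd by simp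
  have h: "(\<Sum>j\<in>UNIV. p j y * (s *\<^sub>R axis i 1 :: space) $ j) = s * p i y" for y s
    by (simp add: axis_def if_distrib mult_ac cong: if_cong)
  have "((\<lambda>s. f (x + s *\<^sub>R axis i 1)) has_derivative (\<lambda>h. \<Sum>j\<in>UNIV. p j (x + s *\<^sub>R axis i 1) * (h *\<^sub>R axis i 1 :: space) $ j)) (at s)"
    by (rule has_derivative_compose[OF _ p(2)]) (auto intro!: derivative_eq_intros)
  then show "((\<lambda>s. f (x + s *\<^sub>R axis i 1)) has_real_derivative partial_deriv i f (x + s *\<^sub>R axis i 1)) (at s)"
    unfolding h pd by (simp add: has_field_derivative_def mult.commute[of _ "p i _"])
qed

lemma smooth_alg_continuous: "f \<in> smooth_alg \<Longrightarrow> continuous_on S f"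
  by (meson smooth_alg_deriv(1) differentiable_imp_continuous_within continuous_at_imp_continuous_on)

lemma smooth_alg_C_k: "f \<in> smooth_alg \<Longrightarrow> f \<in> C_k k"
  by (induction k arbitrary: f) (auto simp: smooth_alg_continuous smooth_alg_deriv)

text \<open>Test functions of an explicit form, closed under translations and partial derivatives.
  They are dense enough to determine a locally integrable function, so that weak derivatives need to
  be tested on them only.\<close>

definition bumps :: "(space \<Rightarrow> real) set" where
  "bumps = {\<eta> \<in> smooth_alg. \<exists>R. \<forall>x. norm x > R \<longrightarrow> \<eta> x = 0}"

lemma bumps_test: "\<eta> \<in> bumps \<Longrightarrow> \<eta> \<in> test_functions"
proof -
  assume "\<eta> \<in> bumps"
  then obtain R where s: "\<eta> \<in> smooth_alg" and R: "\<And>x. norm x > R \<Longrightarrow> \<eta> x = 0" by (auto simp: bumps_def)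
  have "bounded {x. \<eta> x \<noteq> 0}" unfolding bounded_iff using R by (intro exI[of _ R]) force
  then show ?thesis using smooth_alg_C_k[OF s] by (simp add: test_functions_def compact_closure)
qed

lemma bumps_shift: "\<eta> \<in> bumps \<Longrightarrow> (\<lambda>x. \<eta> (x + a)) \<in> bumps"
proof -
  assume "\<eta> \<in> bumps"
  then obtain R where s: "\<eta> \<in> smooth_alg" and R: "\<And>x. norm x > R \<Longrightarrow> \<eta> x = 0" by (auto simp: bumps_def)
  have "\<eta> (x + a) = 0" if "norm x > R + norm a" for x
    using norm_diff_ineq[of x a] that by (intro R) linarith
  then show ?thesis using smooth_alg_shift[OF s] by (auto simp: bumps_def)
qed

lemma bumps_partial: "\<eta> \<in> bumps \<Longrightarrow> partial_deriv i \<eta> \<in> bumps"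
proof -
  assume "\<eta> \<in> bumps"
  then obtain R where s: "\<eta> \<in> smooth_alg" and R: "\<And>x. norm x > R \<Longrightarrow> \<eta> x = 0" by (auto simp: bumps_def)
  have "partial_deriv i \<eta> x = 0" if "norm x > R" for x
  proof -
    have o: "open {x :: space. norm x > R}" by (intro open_Collect_less continuous_intros)
    have "((\<lambda>_. 0) has_derivative (\<lambda>_. 0 :: real)) (at x)" by simp
    then have "(\<eta> has_derivative (\<lambda>_. 0)) (at x)"
      by (rule has_derivative_transform_within_open[OF _ o]) (use that R in auto)
    from frechet_derivative_at[OF this] show ?thesis by (simp add: partial_deriv_def fun_eq_iff)
  qed
  then show ?thesis using smooth_alg_deriv(2)[OF s] by (auto simp: bumps_def)
qed

lemma bumps_bound:
  assumes "\<eta> \<in> bumps" obtains C R where "\<And>x. \<bar>\<eta> x\<bar> \<le> C * indicator (cball 0 R) x" "0 \<le> C"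
proof -
  obtain R where s: "\<eta> \<in> smooth_alg" and R: "\<And>x. norm x > R \<Longrightarrow> \<eta> x = 0" using assms by (auto simp: bumps_def)
  have cp: "compact (\<eta> ` cball 0 R)" by (intro compact_continuous_image smooth_alg_continuous s) auto
  obtain C where "\<forall>y\<in>\<eta> ` cball 0 R. norm y \<le> C"
    using compact_imp_bounded[OF cp] unfolding bounded_iff by (elim exE)
  then have C: "\<And>x. x \<in> cball 0 R \<Longrightarrow> \<bar>\<eta> x\<bar> \<le> C" by simp
  show ?thesis
  proof (rule that[of "max C 0" R])
    fix x show "\<bar>\<eta> x\<bar> \<le> max C 0 * indicator (cball 0 R) x"
      using C[of x] R[of x] by (cases "norm x \<le> R") (auto simp: indicator_def)
  qed simp
qed

lemma bumps_measurable [measurable_dest]: "\<eta> \<in> bumps \<Longrightarrow> \<eta> \<in> borel_measurable borel"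
  by (auto simp: bumps_def intro!: borel_measurable_continuous_onI smooth_alg_continuous)

lemma bumps_sq_integrable:
  assumes "\<eta> \<in> bumps" shows "sq_integrable (\<lambda>x. \<eta> x *\<^sub>R c)"
proof -
  obtain C R where C: "\<And>x. \<bar>\<eta> x\<bar> \<le> C * indicator (cball 0 R) x" "0 \<le> C" using bumps_bound[OF assms] by blast
  note [measurable] = bumps_measurable[OF assms]
  have "sq_integrable (\<lambda>x. indicator (cball 0 R) x)"
    unfolding sq_integrable_def
  proof (intro conjI)
    have "integrable lborel (indicator (cball 0 R) :: space \<Rightarrow> real)"
      by (rule integrable_real_indicator) (use emeasure_bounded_finite[OF bounded_cball] in auto)
    moreover have "(\<lambda>x::space. (cmod (indicator (cball 0 R) x))\<^sup>2) = indicator (cball 0 R)" by (auto simp: indicator_def)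
    ultimately show "integrable lborel (\<lambda>x::space. (cmod (indicator (cball 0 R) x))\<^sup>2)" by simp
  qed (rule borel_measurable_indicator, simp)
  then show ?thesis
  proof (rule sq_integrable_bound[where C = "C * cmod c"])
    fix x
    have "cmod (\<eta> x *\<^sub>R c) \<le> C * indicator (cball 0 R) x * cmod c"
      by (simp only: norm_scaleR) (rule mult_right_mono[OF C(1) norm_ge_zero])
    then show "cmod (\<eta> x *\<^sub>R c) \<le> C * cmod c * cmod (indicator (cball 0 R) x)" by (auto simp: indicator_def)
  qed measurable
qed

text \<open>\<open>flat 0 (n s)\<close> tends to the indicator of \<open>s > 0\<close>, so products of these exhaust open boxes.\<close>

definition box_bump :: "space \<Rightarrow> space \<Rightarrow> nat \<Rightarrow> space \<Rightarrow> real" where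
  "box_bump a b n x = (\<Prod>i\<in>UNIV. flat 0 (real n * ((x $ i - a $ i) * (b $ i - x $ i))))"

lemma flat0_bounds: "0 \<le> flat 0 s" "flat 0 s \<le> 1"
  by (auto simp: flat_def)

lemma box_bump_tendsto:
  assumes ab: "\<And>i. a $ i < b $ i"
  shows "(\<lambda>n. box_bump a b n x) \<longlonglongrightarrow> indicator (box a b) x"
proof (cases "x \<in> box a b")
  case True
  have "(\<lambda>n. flat 0 (real n * ((x $ i - a $ i) * (b $ i - x $ i)))) \<longlonglongrightarrow> 1" for i
  proof -
    define r where "r = (x $ i - a $ i) * (b $ i - x $ i)"
    have r: "0 < r" using True by (auto simp: r_def mem_box_cart)
    have "(\<lambda>n. exp (- (1 / r) / real n)) \<longlonglongrightarrow> exp 0"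
      by (intro tendsto_exp lim_const_over_n)
    moreover have "\<forall>\<^sub>F n in sequentially. exp (- (1 / r) / real n) = flat 0 (real n * r)"
      using eventually_gt_at_top[of 0] by eventually_elim (use r in \<open>auto simp: flat_def field_simps mult_le_0_iff\<close>)
    ultimately show ?thesis unfolding r_def by (auto intro: Lim_transform_eventually)
  qed
  then have "(\<lambda>n. box_bump a b n x) \<longlonglongrightarrow> (\<Prod>i\<in>(UNIV::3 set). 1)"
    unfolding box_bump_def by (intro tendsto_prod)
  then show ?thesis using True by simp
next
  case False
  then obtain i where i: "\<not> (a $ i < x $ i \<and> x $ i < b $ i)" by (auto simp: mem_box_cart)
  \<comment> \<open>Both factors can be negative only if b_i < x_i < a_i, which a_i < b_i excludes;
    so outside the box the argument of \<open>flat 0\<close> is nonpositive in some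
    coordinate.\<close>
  have "(x $ i - a $ i) * (b $ i - x $ i) \<le> 0" using i ab[of i] by (auto simp: mult_le_0_iff)
  then have "flat 0 (real n * ((x $ i - a $ i) * (b $ i - x $ i))) = 0" for n
    by (auto simp: flat_def mult_le_0_iff not_le zero_less_mult_iff)
  then have "box_bump a b n x = 0" for n unfolding box_bump_def by (intro prod_zero) auto
  then show ?thesis using False by simp
qed

lemma box_bump_outside:
  assumes ab: "\<And>i. a $ i < b $ i" and "x \<notin> box a b"
  shows "box_bump a b n x = 0"
proof -
  obtain i where i: "\<not> (a $ i < x $ i \<and> x $ i < b $ i)" using assms(2) by (auto simp: mem_box_cart)
  have "(x $ i - a $ i) * (b $ i - x $ i) \<le> 0" using i ab[of i] by (auto simp: mult_le_0_iff)
  then have "flat 0 (real n * ((x $ i - a $ i) * (b $ i - x $ i))) = 0"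
    by (auto simp: flat_def mult_le_0_iff not_le zero_less_mult_iff)
  then show ?thesis unfolding box_bump_def by (intro prod_zero) auto
qed

lemma box_bump_bound:
  assumes "\<And>i. a $ i < b $ i" shows "\<bar>box_bump a b n x\<bar> \<le> indicator (box a b) x"
proof (cases "x \<in> box a b")
  case True
  have "0 \<le> box_bump a b n x" "box_bump a b n x \<le> 1" unfolding box_bump_def
    by (auto intro!: prod_nonneg prod_le_1 flat0_bounds)
  then show ?thesis using True by simp
qed (use box_bump_outside[OF assms] in auto)

lemma box_bump_bumps:
  assumes "\<And>i. a $ i < b $ i" shows "box_bump a b n \<in> bumps"
proof -
  have "box_bump a b n \<in> smooth_alg"
    unfolding box_bump_def[abs_def]
    by (intro smooth_alg_prod smooth_alg.flat smooth_alg_cmult smooth_alg.mult smooth_alg_diff smooth_alg.coord smooth_alg.const)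
  moreover obtain R where R: "\<And>x. x \<in> box a b \<Longrightarrow> norm x \<le> R"
    using bounded_box[of a b] by (auto simp: bounded_iff)
  then have "\<forall>x. norm x > R \<longrightarrow> box_bump a b n x = 0"
    using box_bump_outside[OF assms] by (meson leD)
  ultimately show ?thesis unfolding bumps_def by blast
qed

text \<open>The positive and the negative part of \<open>D\<close>, taken as densities, agree on
  boxes, a generating family stable under intersection, and hence everywhere. Uniqueness of
  densities gives \<open>ennreal (D x) = ennreal (- D x)\<close> almost everywhere; one of the two
  is always 0, so \<open>D x\<close> is 0.\<close>

lemma AE_zero_of_box_integrals:
  fixes D :: "space \<Rightarrow> real"
  assumes D: "\<And>a b. integrable lborel (\<lambda>x. indicator (box a b) x * D x)"
    and [measurable]: "D \<in> borel_measurable borel"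
    and z: "\<And>a b. (LI x. indicator (box a b) x * D x) = 0"
  shows "AE x in lborel. D x = 0"
proof -
  define P where "P = density lborel (\<lambda>x. ennreal (D x))"
  define N where "N = density lborel (\<lambda>x. ennreal (- D x))"
  have boxes: "emeasure P (box a b) = emeasure N (box a b) \<and> emeasure P (box a b) \<noteq> \<infinity>" for a b
  proof -
    let ?f = "\<lambda>x. indicator (box a b) x * D x"
    have e: "(NI x. ennreal (D x) * indicator (box a b) x) = (NI x. ennreal (max 0 (?f x)))"
       "(NI x. ennreal (- D x) * indicator (box a b) x) = (NI x. ennreal (max 0 (- ?f x)))"
      by (auto intro!: nn_integral_cong simp: indicator_def max_def ennreal_neg)
    have i: "integrable lborel (\<lambda>x. max 0 (?f x))" "integrable lborel (\<lambda>x. max 0 (- ?f x))"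
      using D[of a b] by (auto intro!: integrable_max)
    have "(LI x. max 0 (?f x) - max 0 (- ?f x)) = (LI x. ?f x)"
      by (intro Bochner_Integration.integral_cong refl) (auto simp: max_def)
    then have "(LI x. max 0 (?f x)) = (LI x. max 0 (- ?f x))"
      using i z[of a b] by simp
    then show ?thesis
      unfolding P_def N_def by (simp add: emeasure_density e nn_integral_eq_integral[OF i(1)] nn_integral_eq_integral[OF i(2)])
  qed
  have "P = N"
  proof (rule measure_eqI_generator_eq[where E = "range (\<lambda>(a, b). box a b)" and \<Omega> = UNIV and A = "\<lambda>n::nat. box (- (real n *\<^sub>R One)) (real n *\<^sub>R One)"])
    show "Int_stable (range (\<lambda>(a, b). box a b :: space set))"
      by (force simp: Int_stable_def box_Int_box)
    show "sets P = sigma_sets UNIV (range (\<lambda>(a, b). box a b))" "sets N = sigma_sets UNIV (range (\<lambda>(a, b). box a b))"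
      by (simp_all add: P_def N_def borel_eq_box)
    show "(\<Union>n::nat. box (- (real n *\<^sub>R One)) (real n *\<^sub>R One)) = (UNIV :: space set)"
      by (rule UN_box_eq_UNIV)
    show "emeasure P (box (- (real n *\<^sub>R One)) (real n *\<^sub>R One)) \<noteq> \<infinity>" for n
      using boxes by blast
  qed (use boxes in auto)
  then have "AE x in lborel. ennreal (D x) = ennreal (- D x)"
    unfolding P_def N_def by (subst (asm) sigma_finite_measure.density_unique_iff[OF sigma_finite_lborel]) auto
  then show ?thesis
  proof eventually_elim
    case (elim x)
    then show ?case by (cases "0 \<le> D x") (auto simp: ennreal_neg ennreal_eq_0_iff dest!: sym[of "0::ennreal"])
  qed
qed

lemma fundamental_lemma:
  fixes D :: "space \<Rightarrow> complex"
  assumes D: "\<And>a b. integrable lborel (\<lambda>x. indicator (box a b) x *\<^sub>R D x)"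
    and [measurable]: "D \<in> borel_measurable borel"
    and z: "\<And>\<eta>. \<eta> \<in> bumps \<Longrightarrow> (LI x. \<eta> x *\<^sub>R D x) = 0"
  shows "AE x in lborel. D x = 0"
proof -
  have box: "(LI x. indicator (box a b) x *\<^sub>R D x) = 0" for a b
  proof (cases "\<forall>i. a $ i < b $ i")
    case True
    then have ab: "\<And>i. a $ i < b $ i" by simp
    have [measurable]: "box_bump a b n \<in> borel_measurable borel" for n
      by (rule bumps_measurable[OF box_bump_bumps[OF ab]])
    have "(\<lambda>n. LI x. box_bump a b n x *\<^sub>R D x) \<longlonglongrightarrow> (LI x. indicator (box a b) x *\<^sub>R D x)"
    proof (rule integral_dominated_convergence[where w = "\<lambda>x. norm (indicator (box a b) x *\<^sub>R D x)"])
      show "AE x in lborel. (\<lambda>n. box_bump a b n x *\<^sub>R D x) \<longlonglongrightarrow> indicator (box a b) x *\<^sub>R D x"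
        by (intro AE_I2 tendsto_intros box_bump_tendsto ab)
      show "AE x in lborel. norm (box_bump a b n x *\<^sub>R D x) \<le> norm (indicator (box a b) x *\<^sub>R D x)" for n
        using box_bump_bound[OF ab, of n] by (auto intro!: AE_I2 mult_right_mono)
      show "integrable lborel (\<lambda>x. norm (indicator (box a b) x *\<^sub>R D x))" by (intro integrable_norm D)
    qed measurable
    moreover have "(LI x. box_bump a b n x *\<^sub>R D x) = 0" for n by (rule z[OF box_bump_bumps[OF ab]])
    ultimately show ?thesis by (simp add: LIMSEQ_const_iff)
  next
    case False
    then obtain i where i: "\<not> a $ i < b $ i" by blast
    have "x \<notin> box a b" for x
    proof
      assume "x \<in> box a b"
      then have "a $ i < x $ i" "x $ i < b $ i" by (auto simp: mem_box_cart)
      then show False using i by linarith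
    qed
    then have "box a b = {}" by blast
    then show ?thesis by simp
  qed
  have "AE x in lborel. Re (D x) = 0"
  proof (rule AE_zero_of_box_integrals)
    show "integrable lborel (\<lambda>x. indicator (box a b) x * Re (D x))" for a b using integrable_Re[OF D[of a b]] by simp
    show "(LI x. indicator (box a b) x * Re (D x)) = 0" for a b using integral_Re[OF D[of a b]] box[of a b] by simp
  qed measurable
  moreover have "AE x in lborel. Im (D x) = 0"
  proof (rule AE_zero_of_box_integrals)
    show "integrable lborel (\<lambda>x. indicator (box a b) x * Im (D x))" for a b using integrable_Im[OF D[of a b]] by simp
    show "(LI x. indicator (box a b) x * Im (D x)) = 0" for a b using integral_Im[OF D[of a b]] box[of a b] by simp
  qed measurable
  ultimately show ?thesis by eventually_elim (simp add: complex_eq_iff)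
qed

section \<open>Weak derivatives\<close>

lemma complex_borel_representative:
  fixes f :: "space \<Rightarrow> complex"
  assumes "f \<in> borel_measurable lebesgue"
  obtains g where "g \<in> borel_measurable borel" "AE x in lborel. f x = g x"
proof -
  have m: "(\<lambda>x. Re (f x)) \<in> borel_measurable lebesgue" "(\<lambda>x. Im (f x)) \<in> borel_measurable lebesgue"
    using assms by (auto intro: borel_measurable_Re borel_measurable_Im)
  obtain a where a: "a \<in> borel_measurable lborel" "AE x in lborel. Re (f x) = a x"
    using completion_ex_borel_measurable_real[OF m(1)] by blast
  obtain b where b: "b \<in> borel_measurable lborel" "AE x in lborel. Im (f x) = b x"
    using completion_ex_borel_measurable_real[OF m(2)] by blast
  show ?thesis
  proof
    show "(\<lambda>x. complex_of_real (a x) + \<i> * complex_of_real (b x)) \<in> borel_measurable borel"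
      using a(1) b(1) by simp
    show "AE x in lborel. f x = complex_of_real (a x) + \<i> * complex_of_real (b x)"
      using a(2) b(2) by eventually_elim (simp add: complex_eq_iff)
  qed
qed

lemma AE_lebesgue_iff: "(AE x in lebesgue. P x) \<longleftrightarrow> (AE x in lborel. P x)"
  by (rule AE_completion_iff)

lemma borel_imp_lebesgue:
  fixes f :: "'a::euclidean_space \<Rightarrow> 'b::topological_space"
  shows "f \<in> borel_measurable borel \<Longrightarrow> f \<in> borel_measurable lebesgue"
  by (rule measurable_completion) simp

lemma integral_lebesgue_eq:
  fixes f :: "'a::euclidean_space \<Rightarrow> 'b::{banach,second_countable_topology}"
  assumes "f \<in> borel_measurable lebesgue" and g: "g \<in> borel_measurable borel" and "AE x in lborel. f x = g x"
  shows "(\<integral>x. f x \<partial>lebesgue) = (LI x. g x)"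
proof -
  have "(\<integral>x. f x \<partial>lebesgue) = (\<integral>x. g x \<partial>lebesgue)"
    by (rule integral_cong_AE[OF assms(1) borel_imp_lebesgue[OF g]]) (simp add: AE_completion_iff assms(3))
  also have "\<dots> = (LI x. g x)" using g by (intro integral_completion) simp
  finally show ?thesis .
qed

lemma integrable_lebesgue_iff:
  fixes f :: "'a::euclidean_space \<Rightarrow> 'b::{banach,second_countable_topology}"
  assumes "f \<in> borel_measurable lebesgue" and g: "g \<in> borel_measurable borel" and "AE x in lborel. f x = g x"
  shows "integrable lebesgue f \<longleftrightarrow> integrable lborel g"
proof -
  have "integrable lebesgue f \<longleftrightarrow> integrable lebesgue g"
    by (rule integrable_cong_AE[OF assms(1) borel_imp_lebesgue[OF g]]) (simp add: AE_completion_iff assms(3))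
  also have "\<dots> \<longleftrightarrow> integrable lborel g" using g by (intro integrable_completion) simp
  finally show ?thesis .
qed

lemma L2_representative:
  assumes "f \<in> L2" "g \<in> borel_measurable borel" "AE x in lborel. f x = g x"
  shows "sq_integrable g"
proof -
  have "integrable lebesgue (\<lambda>x. (cmod (f x))\<^sup>2) \<longleftrightarrow> integrable lborel (\<lambda>x. (cmod (g x))\<^sup>2)"
    using assms by (intro integrable_lebesgue_iff) (auto simp: L2_def elim!: eventually_mono)
  then show ?thesis using assms by (auto simp: L2_def sq_integrable_def)
qed

lemma L2_norm_eq:
  assumes "f \<in> borel_measurable lebesgue" "g \<in> borel_measurable borel" "AE x in lborel. f x = g x"
  shows "(L2_norm f)\<^sup>2 = (LI x. (cmod (g x))\<^sup>2)"
proof -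
  have "(\<integral>x. (cmod (f x))\<^sup>2 \<partial>lebesgue) = (LI x. (cmod (g x))\<^sup>2)"
    using assms by (intro integral_lebesgue_eq) (auto elim!: eventually_mono)
  then show ?thesis by (simp add: L2_norm_def)
qed

lemma integral_unif01_FTC:
  fixes F :: "real \<Rightarrow> 'a::euclidean_space"
  assumes d: "\<And>s. 0 \<le> s \<Longrightarrow> s \<le> 1 \<Longrightarrow> (F has_vector_derivative F' s) (at s)"
    and c: "continuous_on {0..1} F'" and [measurable]: "F' \<in> borel_measurable borel"
  shows "(\<integral>s. F' s \<partial>unif01) = F 1 - F 0"
proof -
  have e: "unif01 = density lborel (\<lambda>s. ennreal (indicator {0..1} s))"
    unfolding unif01_def by (simp add: ennreal_indicator)
  have "(\<integral>s. F' s \<partial>unif01) = (LI s. indicator {0..1} s *\<^sub>R F' s)"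
    unfolding e by (rule integral_density) (simp_all add: assms(3))
  also have "\<dots> = F 1 - F 0"
    by (rule integral_FTC_Icc[OF zero_le_one has_vector_derivative_at_within[OF d] c])
  finally show ?thesis .
qed

section \<open>Weak derivatives as increments along lines\<close>

lemma bump_difference:
  assumes \<eta>: "\<eta> \<in> bumps"
  shows "\<eta> (x + t *\<^sub>R axis i 1) - \<eta> x = t * (\<integral>s. partial_deriv i \<eta> (x + (s * t) *\<^sub>R axis i 1) \<partial>unif01)"
proof -
  have s: "\<eta> \<in> smooth_alg" and p: "partial_deriv i \<eta> \<in> smooth_alg"
    using \<eta> smooth_alg_deriv(2) by (auto simp: bumps_def)
  have d: "((\<lambda>s. \<eta> (x + (s * t) *\<^sub>R axis i 1)) has_real_derivative (partial_deriv i \<eta> (x + (s * t) *\<^sub>R axis i 1) * t)) (at s)" for s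
    by (rule DERIV_chain2[OF smooth_alg_deriv(3)[OF s]]) (auto intro!: derivative_eq_intros)
  have c: "continuous_on S (\<lambda>s. partial_deriv i \<eta> (x + (s * t) *\<^sub>R axis i 1) * t)" for S
    by (intro continuous_intros continuous_on_compose2[OF smooth_alg_continuous[OF p, of UNIV]]) auto
  have "(\<integral>s. partial_deriv i \<eta> (x + (s * t) *\<^sub>R axis i 1) * t \<partial>unif01) = \<eta> (x + (1 * t) *\<^sub>R axis i 1) - \<eta> (x + (0 * t) *\<^sub>R axis i 1)"
    by (rule integral_unif01_FTC) (use d c in \<open>auto simp: has_real_derivative_iff_has_vector_derivative[symmetric] intro: borel_measurable_continuous_onI\<close>)
  then show ?thesis by (simp add: mult.commute)
qed

lemma bumps_L2_partial:
  assumes \<eta>: "\<eta> \<in> bumps"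
  shows "L2_partial i (\<lambda>x. \<eta> x *\<^sub>R c) (\<lambda>x. partial_deriv i \<eta> x *\<^sub>R c)"
  unfolding L2_partial_def
proof (intro conjI allI AE_I2)
  show "sq_integrable (\<lambda>x. \<eta> x *\<^sub>R c)" "sq_integrable (\<lambda>x. partial_deriv i \<eta> x *\<^sub>R c)"
    by (intro bumps_sq_integrable \<eta> bumps_partial)+
  fix t x
  show "\<eta> (x + t *\<^sub>R axis i 1) *\<^sub>R c - \<eta> x *\<^sub>R c = t *\<^sub>R (\<integral>s. partial_deriv i \<eta> (x + (s * t) *\<^sub>R axis i 1) *\<^sub>R c \<partial>unif01)"
  proof -
    interpret finite_measure unif01 by (rule finite_unif01)
    obtain C R where C: "\<And>x. \<bar>partial_deriv i \<eta> x\<bar> \<le> C * indicator (cball 0 R) x" "0 \<le> C"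
      using bumps_bound[OF bumps_partial[OF \<eta>]] by blast
    have C': "\<bar>partial_deriv i \<eta> x\<bar> \<le> C" for x
      using C(1)[of x] C(2) by (cases "x \<in> cball 0 R") auto
    note [measurable] = bumps_measurable[OF bumps_partial[OF \<eta>]]
    have "integrable unif01 (\<lambda>s. partial_deriv i \<eta> (x + (s * t) *\<^sub>R axis i 1))"
      by (rule integrable_const_bound[of _ C]) (use C' in auto)
    then show ?thesis
      using bump_difference[OF \<eta>, of x t i] by (simp flip: scaleR_diff_left)
  qed
qed

lemma partial_deriv_shift:
  assumes \<eta>: "\<eta> \<in> bumps"
  shows "partial_deriv i (\<lambda>x. \<eta> (x + a)) x = partial_deriv i \<eta> (x + a)"
proof -
  have s: "\<eta> \<in> smooth_alg" "(\<lambda>x. \<eta> (x + a)) \<in> smooth_alg" using \<eta> smooth_alg_shift by (auto simp: bumps_def)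
  have "((\<lambda>s. \<eta> (x + s *\<^sub>R axis i 1 + a)) has_real_derivative partial_deriv i (\<lambda>x. \<eta> (x + a)) (x + 0 *\<^sub>R axis i 1)) (at 0)"
    by (rule smooth_alg_deriv(3)[OF s(2)])
  moreover have "((\<lambda>s. \<eta> (x + a + s *\<^sub>R axis i 1)) has_real_derivative partial_deriv i \<eta> (x + a + 0 *\<^sub>R axis i 1)) (at 0)"
    by (rule smooth_alg_deriv(3)[OF s(1)])
  ultimately show ?thesis by (auto simp: add_ac dest: DERIV_unique)
qed

lemma sq_integrable_times_bump:
  assumes f: "sq_integrable f" and \<eta>: "\<eta> \<in> bumps"
  shows "integrable lborel (\<lambda>x. \<eta> x *\<^sub>R f x)"
proof (rule Bochner_Integration.integrable_bound[of _ "\<lambda>x. (cmod (\<eta> x *\<^sub>R 1))\<^sup>2 + (cmod (f x))\<^sup>2"])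
  note [measurable] = sq_integrable_measurable[OF f] bumps_measurable[OF \<eta>]
  show "integrable lborel (\<lambda>x. (cmod (\<eta> x *\<^sub>R 1))\<^sup>2 + (cmod (f x))\<^sup>2)"
    by (intro Bochner_Integration.integrable_add sq_integrable_integrable f bumps_sq_integrable \<eta>)
  show "(\<lambda>x. \<eta> x *\<^sub>R f x) \<in> borel_measurable lborel" by measurable
  show "AE x in lborel. norm (\<eta> x *\<^sub>R f x) \<le> norm ((cmod (\<eta> x *\<^sub>R 1))\<^sup>2 + (cmod (f x))\<^sup>2)"
  proof (intro AE_I2)
    fix x
    have "2 * (\<bar>\<eta> x\<bar> * cmod (f x)) \<le> \<bar>\<eta> x\<bar>\<^sup>2 + (cmod (f x))\<^sup>2"
      using zero_le_power2[of "\<bar>\<eta> x\<bar> - cmod (f x)"] by (simp add: power2_eq_square algebra_simps)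
    moreover have "0 \<le> \<bar>\<eta> x\<bar> * cmod (f x)" by simp
    ultimately have "\<bar>\<eta> x\<bar> * cmod (f x) \<le> \<bar>\<eta> x\<bar>\<^sup>2 + (cmod (f x))\<^sup>2" by linarith
    then show "norm (\<eta> x *\<^sub>R f x) \<le> norm ((cmod (\<eta> x *\<^sub>R 1))\<^sup>2 + (cmod (f x))\<^sup>2)" by simp
  qed
qed

lemma sq_integrable_box:
  assumes f: "sq_integrable f"
  shows "integrable lborel (\<lambda>x. indicator (box a b) x *\<^sub>R f x)"
proof (rule Bochner_Integration.integrable_bound[of _ "\<lambda>x. indicator (box a b) x + (cmod (f x))\<^sup>2"])
  note [measurable] = sq_integrable_measurable[OF f]
  have "integrable lborel (indicator (box a b) :: space \<Rightarrow> real)"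
    by (rule integrable_real_indicator) (use emeasure_bounded_finite[OF bounded_box] in auto)
  then show "integrable lborel (\<lambda>x. indicator (box a b) x + (cmod (f x))\<^sup>2)"
    by (intro Bochner_Integration.integrable_add sq_integrable_integrable f)
  show "(\<lambda>x. indicator (box a b) x *\<^sub>R f x) \<in> borel_measurable lborel" by measurable
  show "AE x in lborel. norm (indicator (box a b) x *\<^sub>R f x) \<le> norm (indicator (box a b) x + (cmod (f x))\<^sup>2)"
  proof (intro AE_I2)
    fix x
    have "2 * cmod (f x) \<le> 1 + (cmod (f x))\<^sup>2"
      using zero_le_power2[of "1 - cmod (f x)"] by (simp add: power2_eq_square algebra_simps)
    moreover have "0 \<le> cmod (f x)" by simp
    ultimately have "cmod (f x) \<le> 1 + (cmod (f x))\<^sup>2" by linarith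
    then show "norm (indicator (box a b) x *\<^sub>R f x) \<le> norm (indicator (box a b) x + (cmod (f x))\<^sup>2)"
      by (simp add: indicator_def)
  qed
qed

lemma complex_zero_inner: "(\<And>c. z \<bullet> c = 0) \<Longrightarrow> z = (0 :: complex)"
  using inner_eq_zero_iff by blast

text \<open>Tested against a bump, the translate and the line average can both be moved onto the
  bump, where the increment formula is the classical fundamental theorem. The fundamental lemma then
  removes the bump, for each t separately.\<close>

lemma weak_imp_L2_partial:
  assumes f: "sq_integrable f" and g: "sq_integrable g"
    and weak: "\<And>\<eta>. \<eta> \<in> bumps \<Longrightarrow> (LI x. partial_deriv i \<eta> x *\<^sub>R f x) = - (LI x. \<eta> x *\<^sub>R g x)"
  shows "L2_partial i f g"
  unfolding L2_partial_def
proof (intro conjI allI f g)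
  fix t :: real
  let ?e = "axis i 1 :: space"
  note [measurable] = f[THEN sq_integrable_measurable] g[THEN sq_integrable_measurable]
  let ?T = "\<lambda>x. \<integral>s. g (x + (s * t) *\<^sub>R ?e) \<partial>unif01"
  let ?D = "\<lambda>x. f (x + t *\<^sub>R ?e) - f x - t *\<^sub>R ?T x"
  have sT: "sq_integrable ?T" by (rule sq_integrable_line_average[OF g])
  note sft = sq_integrable_shift[OF f, of "t *\<^sub>R ?e"]
  have sD: "sq_integrable ?D"
    by (rule sq_integrable_diff[OF sq_integrable_diff[OF sft f] sq_integrable_scaleR[OF sT]])
  have "AE x in lborel. ?D x = 0"
  proof (rule fundamental_lemma)
    show "integrable lborel (\<lambda>x. indicator (box a b) x *\<^sub>R ?D x)" for a b by (rule sq_integrable_box[OF sD])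
    show "?D \<in> borel_measurable borel" by (rule sq_integrable_measurable[OF sD])
    fix \<eta> assume \<eta>: "\<eta> \<in> bumps"
    show "(LI x. \<eta> x *\<^sub>R ?D x) = 0"
    proof (rule complex_zero_inner)
      fix c :: complex
      let ?w = "\<lambda>x. \<eta> x *\<^sub>R c" and ?w' = "\<lambda>x. partial_deriv i \<eta> x *\<^sub>R c"
      have LP: "L2_partial i ?w ?w'" by (rule bumps_L2_partial[OF \<eta>])
      note w = L2_partial_sq[OF LP]
      note [measurable] = w[THEN sq_integrable_measurable]
      \<comment> \<open>The weak identity is applied to every translate of the bump, as needed along
        the whole segment of the line average. Pairing with a constant \<open>c\<close> turns
        complex identities into real ones.\<close>
      have weak_c: "(LI x. ?w' (x + a) \<bullet> f x) = - (LI x. g x \<bullet> ?w (x + a))" for a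
      proof -
        note \<eta>a = bumps_shift[OF \<eta>, of a]
        have "(LI x. ?w' (x + a) \<bullet> f x) = (LI x. (partial_deriv i (\<lambda>x. \<eta> (x + a)) x *\<^sub>R f x) \<bullet> c)"
          by (simp add: partial_deriv_shift[OF \<eta>] inner_commute)
        also have "\<dots> = (LI x. partial_deriv i (\<lambda>x. \<eta> (x + a)) x *\<^sub>R f x) \<bullet> c"
          by (rule integral_inner_left) (rule sq_integrable_times_bump[OF f bumps_partial[OF \<eta>a]])
        also have "\<dots> = - ((LI x. \<eta> (x + a) *\<^sub>R g x) \<bullet> c)" by (simp add: weak[OF \<eta>a])
        also have "(LI x. \<eta> (x + a) *\<^sub>R g x) \<bullet> c = (LI x. (\<eta> (x + a) *\<^sub>R g x) \<bullet> c)"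
          by (rule integral_inner_left[symmetric]) (rule sq_integrable_times_bump[OF g \<eta>a])
        finally show ?thesis by simp
      qed
      have "(LI x. \<eta> x *\<^sub>R ?D x) \<bullet> c = (LI x. (\<eta> x *\<^sub>R ?D x) \<bullet> c)"
        by (rule integral_inner_left[symmetric]) (rule sq_integrable_times_bump[OF sD \<eta>])
      also have "\<dots> = (LI x. f (x + t *\<^sub>R ?e) \<bullet> ?w x - f x \<bullet> ?w x - t * (?T x \<bullet> ?w x))"
        by (intro Bochner_Integration.integral_cong refl) (simp add: inner_diff_left algebra_simps)
      also have "\<dots> = (LI x. f (x + t *\<^sub>R ?e) \<bullet> ?w x) - (LI x. f x \<bullet> ?w x) - t * (LI x. ?T x \<bullet> ?w x)"
        using integrable_inner_sq[OF sft w(1)] integrable_inner_sq[OF f w(1)] integrable_inner_sq[OF sT w(1)] by simp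
      also have "(LI x. f (x + t *\<^sub>R ?e) \<bullet> ?w x) = (LI x. f x \<bullet> ?w (x + (-t) *\<^sub>R ?e))"
      proof -
        have c: "x + t *\<^sub>R ?e + (-t) *\<^sub>R ?e = x" for x by simp
        show ?thesis using integral_shift[of "\<lambda>x. f x \<bullet> ?w (x + (-t) *\<^sub>R ?e)" "t *\<^sub>R ?e"] unfolding c by measurable
      qed
      also have "(LI x. f x \<bullet> ?w (x + (-t) *\<^sub>R ?e)) - (LI x. f x \<bullet> ?w x) = (LI x. f x \<bullet> (?w (x + (-t) *\<^sub>R ?e) - ?w x))"
        unfolding inner_diff_right
        by (rule Bochner_Integration.integral_diff[symmetric]; rule integrable_inner_sq; rule f w sq_integrable_shift[OF w(1)])
      also have "\<dots> = (LI x. (- t) * ((\<integral>s. ?w' (x + (s * (-t)) *\<^sub>R ?e) \<partial>unif01) \<bullet> f x))"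
      proof (intro integral_cong_AE)
        show "AE x in lborel. f x \<bullet> (?w (x + (-t) *\<^sub>R ?e) - ?w x) = (- t) * ((\<integral>s. ?w' (x + (s * (-t)) *\<^sub>R ?e) \<partial>unif01) \<bullet> f x)"
          using L2_partialD[OF LP, of "-t"] by eventually_elim (simp add: inner_commute)
        have [measurable]: "(\<lambda>x. \<integral>s. ?w' (x + (s * (-t)) *\<^sub>R ?e) \<partial>unif01) \<in> borel_measurable borel"
          by (rule sq_integrable_measurable[OF sq_integrable_line_average[OF w(2)]])
        show "(\<lambda>x. - t * ((\<integral>s. ?w' (x + (s * (-t)) *\<^sub>R ?e) \<partial>unif01) \<bullet> f x)) \<in> borel_measurable lborel" by measurable
      qed measurable
      also have "\<dots> = (- t) * (\<integral>s. (LI x. ?w' x \<bullet> f (x + (-s * -t) *\<^sub>R ?e)) \<partial>unif01)"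
        by (simp only: integral_mult_right_zero line_average_pairing[OF w(2) f])
      also have "(\<integral>s. (LI x. ?w' x \<bullet> f (x + (-s * -t) *\<^sub>R ?e)) \<partial>unif01) = (\<integral>s. - (LI x. g x \<bullet> ?w (x + (-s * t) *\<^sub>R ?e)) \<partial>unif01)"
      proof (rule Bochner_Integration.integral_cong[OF refl])
        fix s :: real
        have c: "x + (-s * -t) *\<^sub>R ?e + (-s * t) *\<^sub>R ?e = x" for x by simp
        have "(LI x. ?w' x \<bullet> f (x + (-s * -t) *\<^sub>R ?e)) = (LI x. ?w' (x + (-s * t) *\<^sub>R ?e) \<bullet> f x)"
          using integral_shift[of "\<lambda>x. ?w' (x + (-s * t) *\<^sub>R ?e) \<bullet> f x" "(-s * -t) *\<^sub>R ?e"] unfolding c by measurable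
        then show "(LI x. ?w' x \<bullet> f (x + (-s * -t) *\<^sub>R ?e)) = - (LI x. g x \<bullet> ?w (x + (-s * t) *\<^sub>R ?e))"
          using weak_c[of "(-s * t) *\<^sub>R ?e"] by simp
      qed
      also have "\<dots> = - (LI x. ?T x \<bullet> ?w x)"
        by (simp only: Bochner_Integration.integral_minus line_average_pairing[OF g w(1)])
      finally show "(LI x. \<eta> x *\<^sub>R ?D x) \<bullet> c = 0" by simp
    qed
  qed
  then show "AE x in lborel. f (x + t *\<^sub>R ?e) - f x = t *\<^sub>R ?T x"
    by eventually_elim simp
qed

section \<open>Uniqueness of weak derivatives; Sobolev functions\<close>

lemma locally_integrable_measurable:
  assumes "locally_integrable f" shows "f \<in> borel_measurable lebesgue"
proof (rule borel_measurable_LIMSEQ_metric)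
  show "(\<lambda>x. indicator (cball 0 (real n)) x *\<^sub>R f x) \<in> borel_measurable lebesgue" for n
    using assms unfolding locally_integrable_def set_integrable_def by (auto intro!: borel_measurable_integrable)
  fix x :: space
  have "\<forall>\<^sub>F n in sequentially. norm x \<le> real n"
    using eventually_ge_at_top[of "nat \<lceil>norm x\<rceil>"] by eventually_elim linarith
  then show "(\<lambda>n. indicator (cball 0 (real n)) x *\<^sub>R f x) \<longlonglongrightarrow> f x"
    by (intro tendsto_eventually) (auto elim!: eventually_mono)
qed

lemma locally_integrable_times_bump:
  assumes f: "locally_integrable f" and \<eta>: "\<eta> \<in> bumps"
  shows "integrable lebesgue (\<lambda>x. \<eta> x *\<^sub>R f x)"
proof -
  obtain C R where C: "\<And>x. \<bar>\<eta> x\<bar> \<le> C * indicator (cball 0 R) x" "0 \<le> C" using bumps_bound[OF \<eta>] by blast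
  have i: "integrable lebesgue (\<lambda>x. indicator (cball 0 R) x *\<^sub>R f x)"
    using f unfolding locally_integrable_def set_integrable_def by auto
  show ?thesis
  proof (rule Bochner_Integration.integrable_bound[of _ "\<lambda>x. C *\<^sub>R (indicator (cball 0 R) x *\<^sub>R f x)"])
    show "integrable lebesgue (\<lambda>x. C *\<^sub>R (indicator (cball 0 R) x *\<^sub>R f x))" using i by (rule integrable_scaleR_right)
    show "(\<lambda>x. \<eta> x *\<^sub>R f x) \<in> borel_measurable lebesgue"
      by (intro borel_measurable_scaleR borel_imp_lebesgue bumps_measurable \<eta> locally_integrable_measurable f)
    show "AE x in lebesgue. norm (\<eta> x *\<^sub>R f x) \<le> norm (C *\<^sub>R (indicator (cball 0 R) x *\<^sub>R f x))"
    proof (intro AE_I2)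
      fix x
      have "\<bar>\<eta> x\<bar> * cmod (f x) \<le> (C * indicator (cball 0 R) x) * cmod (f x)" by (intro mult_right_mono C) auto
      then show "norm (\<eta> x *\<^sub>R f x) \<le> norm (C *\<^sub>R (indicator (cball 0 R) x *\<^sub>R f x))"
        using C(2) by (simp add: mult.assoc)
    qed
  qed
qed

text \<open>Identifies the representative chosen by \<open>weak_partial\<close> with any known weak
  derivative up to a null set. The difference is only locally integrable, so the fundamental lemma
  is used in its form with box integrals.\<close>

lemma has_weak_partial_unique:
  assumes g: "has_weak_partial i f g" and h: "has_weak_partial i f h"
  shows "AE x in lborel. g x = h x"
proof -
  have lg: "locally_integrable g" and lh: "locally_integrable h" using g h by (auto simp: has_weak_partial_def)
  have m: "(\<lambda>x. g x - h x) \<in> borel_measurable lebesgue"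
    by (intro borel_measurable_diff locally_integrable_measurable lg lh)
  obtain D where D: "D \<in> borel_measurable borel" "AE x in lborel. g x - h x = D x"
    using complex_borel_representative[OF m] by blast
  note [measurable] = D(1)
  have "AE x in lborel. D x = 0"
  proof (rule fundamental_lemma)
    show "integrable lborel (\<lambda>x. indicator (box a b) x *\<^sub>R D x)" for a b :: space
    proof -
      have "set_integrable lebesgue (cbox a b) g" "set_integrable lebesgue (cbox a b) h"
        using lg lh compact_cbox unfolding locally_integrable_def by blast+
      then have "set_integrable lebesgue (cbox a b) (\<lambda>x. g x - h x)" by (rule set_integral_diff)
      then have "set_integrable lebesgue (box a b) (\<lambda>x. g x - h x)"
        by (rule set_integrable_subset) (simp_all add: box_subset_cbox)
      then have "integrable lebesgue (\<lambda>x. indicator (box a b) x *\<^sub>R (g x - h x))" by (simp add: set_integrable_def)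
      moreover have "integrable lebesgue (\<lambda>x. indicator (box a b) x *\<^sub>R (g x - h x)) \<longleftrightarrow> integrable lborel (\<lambda>x. indicator (box a b) x *\<^sub>R D x)"
      proof (rule integrable_lebesgue_iff)
        show "(\<lambda>x. indicator (box a b) x *\<^sub>R (g x - h x)) \<in> borel_measurable lebesgue"
          by (rule borel_measurable_integrable) fact
        show "AE x in lborel. indicator (box a b) x *\<^sub>R (g x - h x) = indicator (box a b) x *\<^sub>R D x"
          using D(2) by eventually_elim simp
      qed measurable
      ultimately show ?thesis by simp
    qed
    fix \<eta> assume \<eta>: "\<eta> \<in> bumps"
    note [measurable] = bumps_measurable[OF \<eta>]
    have "(\<integral>x. \<eta> x *\<^sub>R g x \<partial>lebesgue) = (\<integral>x. \<eta> x *\<^sub>R h x \<partial>lebesgue)"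
    proof -
      have "(\<integral>x. partial_deriv i \<eta> x *\<^sub>R f x \<partial>lebesgue) = - (\<integral>x. \<eta> x *\<^sub>R g x \<partial>lebesgue)"
        "(\<integral>x. partial_deriv i \<eta> x *\<^sub>R f x \<partial>lebesgue) = - (\<integral>x. \<eta> x *\<^sub>R h x \<partial>lebesgue)"
        using g h bumps_test[OF \<eta>] by (simp_all add: has_weak_partial_def)
      then show ?thesis by simp
    qed
    then have "(\<integral>x. \<eta> x *\<^sub>R (g x - h x) \<partial>lebesgue) = 0"
      using locally_integrable_times_bump[OF lg \<eta>] locally_integrable_times_bump[OF lh \<eta>]
      by (simp add: scaleR_diff_right)
    moreover have "(\<integral>x. \<eta> x *\<^sub>R (g x - h x) \<partial>lebesgue) = (LI x. \<eta> x *\<^sub>R D x)"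
    proof (rule integral_lebesgue_eq)
      show "(\<lambda>x. \<eta> x *\<^sub>R (g x - h x)) \<in> borel_measurable lebesgue"
        by (intro borel_measurable_scaleR borel_imp_lebesgue bumps_measurable \<eta> m)
      show "AE x in lborel. \<eta> x *\<^sub>R (g x - h x) = \<eta> x *\<^sub>R D x" using D(2) by eventually_elim simp
    qed measurable
    ultimately show "(LI x. \<eta> x *\<^sub>R D x) = 0" by simp
  qed measurable
  then show ?thesis using D(2) by eventually_elim simp
qed

text \<open>Needed because \<open>weak_laplacian\<close> iterates \<open>weak_partial\<close> on a
  chosen representative, while membership in \<open>sobolev 2\<close> provides derivatives of some
  other witness.\<close>

lemma has_weak_partial_AE_cong:
  assumes g: "has_weak_partial i f g" and h: "locally_integrable h" and ae: "AE x in lborel. f x = h x"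
  shows "has_weak_partial i h g"
proof -
  have "(\<integral>x. partial_deriv i \<eta> x *\<^sub>R h x \<partial>lebesgue) = (\<integral>x. partial_deriv i \<eta> x *\<^sub>R f x \<partial>lebesgue)" if "\<eta> \<in> test_functions" for \<eta>
  proof (rule integral_cong_AE)
    have "partial_deriv i \<eta> \<in> C_k 0" using that by (auto simp: test_functions_def dest: spec[of _ "Suc 0"])
    then have [measurable]: "partial_deriv i \<eta> \<in> borel_measurable lebesgue"
      by (intro borel_imp_lebesgue borel_measurable_continuous_onI) simp
    have [measurable]: "h \<in> borel_measurable lebesgue" "f \<in> borel_measurable lebesgue"
      using h g by (auto simp: has_weak_partial_def intro: locally_integrable_measurable)
    show "(\<lambda>x. partial_deriv i \<eta> x *\<^sub>R h x) \<in> borel_measurable lebesgue" "(\<lambda>x. partial_deriv i \<eta> x *\<^sub>R f x) \<in> borel_measurable lebesgue"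
      by measurable
    show "AE x in lebesgue. partial_deriv i \<eta> x *\<^sub>R h x = partial_deriv i \<eta> x *\<^sub>R f x"
      unfolding AE_lebesgue_iff using ae by eventually_elim simp
  qed
  then show ?thesis using g h by (simp add: has_weak_partial_def)
qed

lemma has_weak_partial_L2_partial:
  assumes weak: "has_weak_partial i f g" and f: "f \<in> L2" and g: "g \<in> L2"
    and f0: "f0 \<in> borel_measurable borel" "AE x in lborel. f x = f0 x"
    and g0: "g0 \<in> borel_measurable borel" "AE x in lborel. g x = g0 x"
  shows "L2_partial i f0 g0"
proof (rule weak_imp_L2_partial)
  show "sq_integrable f0" "sq_integrable g0" by (rule L2_representative[OF f f0] L2_representative[OF g g0])+
  fix \<eta> assume \<eta>: "\<eta> \<in> bumps"
  note [measurable] = bumps_measurable[OF \<eta>] bumps_measurable[OF bumps_partial[OF \<eta>]] f0(1) g0(1)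
  have mf: "f \<in> borel_measurable lebesgue" "g \<in> borel_measurable lebesgue" using f g by (auto simp: L2_def)
  have "(\<integral>x. partial_deriv i \<eta> x *\<^sub>R f x \<partial>lebesgue) = (LI x. partial_deriv i \<eta> x *\<^sub>R f0 x)"
  proof (rule integral_lebesgue_eq)
    show "(\<lambda>x. partial_deriv i \<eta> x *\<^sub>R f x) \<in> borel_measurable lebesgue"
      by (intro borel_measurable_scaleR borel_imp_lebesgue bumps_measurable bumps_partial \<eta> mf)
    show "AE x in lborel. partial_deriv i \<eta> x *\<^sub>R f x = partial_deriv i \<eta> x *\<^sub>R f0 x"
      using f0(2) by eventually_elim simp
  qed measurable
  moreover have "(\<integral>x. \<eta> x *\<^sub>R g x \<partial>lebesgue) = (LI x. \<eta> x *\<^sub>R g0 x)"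
  proof (rule integral_lebesgue_eq)
    show "(\<lambda>x. \<eta> x *\<^sub>R g x) \<in> borel_measurable lebesgue"
      by (intro borel_measurable_scaleR borel_imp_lebesgue bumps_measurable \<eta> mf)
    show "AE x in lborel. \<eta> x *\<^sub>R g x = \<eta> x *\<^sub>R g0 x"
      using g0(2) by eventually_elim simp
  qed measurable
  ultimately show "(LI x. partial_deriv i \<eta> x *\<^sub>R f0 x) = - (LI x. \<eta> x *\<^sub>R g0 x)"
    using weak bumps_test[OF \<eta>] by (simp add: has_weak_partial_def)
qed

lemma weak_partial_AE:
  assumes "has_weak_partial i f g"
  shows "has_weak_partial i f (weak_partial i f)" "AE x in lborel. weak_partial i f x = g x"
proof -
  show "has_weak_partial i f (weak_partial i f)" unfolding weak_partial_def by (rule someI[of "has_weak_partial i f", OF assms])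
  then show "AE x in lborel. weak_partial i f x = g x" using assms by (rule has_weak_partial_unique)
qed

lemma sobolev_subset_L2: "f \<in> sobolev k \<Longrightarrow> f \<in> L2"
  by (cases k) auto

lemma sobolev_1_L2_partial:
  assumes f: "f \<in> sobolev 1" and f0: "f0 \<in> borel_measurable borel" "AE x in lborel. f x = f0 x"
  shows "\<exists>g. \<forall>i. L2_partial i f0 (g i) \<and> (AE x in lborel. weak_partial i f x = g i x)"
proof -
  have "\<exists>g. L2_partial i f0 g \<and> (AE x in lborel. weak_partial i f x = g x)" for i
  proof -
    obtain h where h: "h \<in> L2" "has_weak_partial i f h" using f by auto
    obtain g where g: "g \<in> borel_measurable borel" "AE x in lborel. h x = g x"
      using complex_borel_representative[of h] h(1) by (auto simp: L2_def)
    have "L2_partial i f0 g"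
      by (rule has_weak_partial_L2_partial[OF h(2) sobolev_subset_L2[OF f] h(1) f0 g])
    moreover have "AE x in lborel. weak_partial i f x = g x"
      using weak_partial_AE(2)[OF h(2)] g(2) by eventually_elim simp
    ultimately show ?thesis by blast
  qed
  then show ?thesis by metis
qed

text \<open>Joins the chosen representatives to increments along lines. \<open>G i j\<close> is the
  j-derivative of \<open>g i\<close>; nothing is claimed about its symmetry, and only the diagonal
  is tied to the weak Laplacian.\<close>

lemma sobolev_2_L2_partial:
  assumes f: "f \<in> sobolev 2" and f0: "f0 \<in> borel_measurable borel" "AE x in lborel. f x = f0 x"
  shows "\<exists>g G. \<forall>i. L2_partial i f0 (g i) \<and> (AE x in lborel. weak_partial i f x = g i x) \<and>
     (\<forall>j. L2_partial j (g i) (G i j)) \<and> (AE x in lborel. weak_partial i (weak_partial i f) x = G i i x)"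
proof -
  have "\<exists>g G. L2_partial i f0 g \<and> (AE x in lborel. weak_partial i f x = g x) \<and>
     (\<forall>j. L2_partial j g (G j)) \<and> (AE x in lborel. weak_partial i (weak_partial i f) x = G i x)" for i
  proof -
    have "\<forall>i. \<exists>h \<in> sobolev 1. has_weak_partial i f h" using f by (simp add: numeral_2_eq_2)
    then obtain h where h: "h \<in> sobolev 1" "has_weak_partial i f h" by blast
    obtain g where g: "g \<in> borel_measurable borel" "AE x in lborel. h x = g x"
      using complex_borel_representative[of h] sobolev_subset_L2[OF h(1)] by (auto simp: L2_def)
    have LP: "L2_partial i f0 g"
      by (rule has_weak_partial_L2_partial[OF h(2) sobolev_subset_L2[OF f] sobolev_subset_L2[OF h(1)] f0 g])
    have ae: "AE x in lborel. weak_partial i f x = g x"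
      using weak_partial_AE(2)[OF h(2)] g(2) by eventually_elim simp
    obtain G where G: "\<And>j. L2_partial j g (G j)" "\<And>j. AE x in lborel. weak_partial j h x = G j x"
      using sobolev_1_L2_partial[OF h(1) g] by blast
    obtain k where k: "has_weak_partial i h k" using h(1) by auto
    have "locally_integrable (weak_partial i f)" using weak_partial_AE(1)[OF h(2)] by (simp add: has_weak_partial_def)
    moreover have "AE x in lborel. h x = weak_partial i f x"
      using weak_partial_AE(2)[OF h(2)] by eventually_elim simp
    ultimately have "has_weak_partial i (weak_partial i f) (weak_partial i h)"
      using has_weak_partial_AE_cong[OF weak_partial_AE(1)[OF k]] by blast
    from weak_partial_AE(2)[OF this]
    have "AE x in lborel. weak_partial i (weak_partial i f) x = G i x" using G(2)[of i] by eventually_elim simp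
    then show ?thesis using LP ae G(1) by blast
  qed
  then have "\<forall>i. \<exists>g G. L2_partial i f0 g \<and> (AE x in lborel. weak_partial i f x = g x) \<and>
     (\<forall>j. L2_partial j g (G j)) \<and> (AE x in lborel. weak_partial i (weak_partial i f) x = G i x)" by blast
  from choice[OF this] show ?thesis by (elim exE, intro exI choice)
qed

section \<open>Yukawa potentials\<close>

text \<open>Polar coordinates for radial integrands: the density is the derivative of the ball
  volume 4/3 pi a^3, and half-lines form a generating family stable under intersection.\<close>

lemma distr_norm_lborel:
  "distr lborel borel (norm :: space \<Rightarrow> real) = density lborel (\<lambda>r. ennreal (4 * pi * r\<^sup>2) * indicator {0..} r)"
proof (rule measure_eqI_generator_eq[where E = "range (\<lambda>a::real. {..a})" and \<Omega> = UNIV and A = "\<lambda>n::nat. {..real n}"])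
  show "Int_stable (range (\<lambda>a::real. {..a}))"
    by (auto simp: Int_stable_def)
  show "sets (distr lborel borel (norm :: space \<Rightarrow> real)) = sigma_sets UNIV (range (\<lambda>a::real. {..a}))"
    "sets (density lborel (\<lambda>r::real. ennreal (4 * pi * r\<^sup>2) * indicator {0..} r)) = sigma_sets UNIV (range (\<lambda>a::real. {..a}))"
    by (simp_all add: borel_eq_atMost)
  show "(\<Union>n::nat. {..real n}) = UNIV"
    using real_arch_simple by auto
  show "range (\<lambda>a::real. {..a}) \<subseteq> Pow UNIV" "range (\<lambda>n::nat. {..real n}) \<subseteq> range (\<lambda>a::real. {..a})"
    by auto
  have e: "emeasure (distr lborel borel (norm :: space \<Rightarrow> real)) {..a} = emeasure lborel (cball (0::space) a)" for a
    by (subst emeasure_distr) (auto simp: vimage_def cball_def intro!: arg_cong[where f = "emeasure lborel"])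
  show "emeasure (distr lborel borel (norm :: space \<Rightarrow> real)) {..real n} \<noteq> \<infinity>" for n
    unfolding e using emeasure_bounded_finite[OF bounded_cball, of "0::space" "real n"] by auto
  fix X assume "X \<in> range (\<lambda>a::real. {..a})"
  then obtain a where X: "X = {..a}" by auto
  show "emeasure (distr lborel borel (norm :: space \<Rightarrow> real)) X = emeasure (density lborel (\<lambda>r. ennreal (4 * pi * r\<^sup>2) * indicator {0..} r)) X"
  proof (cases "0 \<le> a")
    case True
    have "(NI r. ennreal (4 * pi * r\<^sup>2) * indicator {0..a} r) = ennreal (4 / 3 * pi * a ^ 3 - 4 / 3 * pi * 0 ^ 3)"
      by (rule nn_integral_FTC_Icc) (use True in \<open>auto intro!: derivative_eq_intros simp: power2_eq_square\<close>)
    moreover have "(\<lambda>r::real. ennreal (4 * pi * r\<^sup>2) * indicator {0..} r * indicator {..a} r) = (\<lambda>r. ennreal (4 * pi * r\<^sup>2) * indicator {0..a} r)"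
      by (auto simp: fun_eq_iff indicator_def)
    ultimately have "emeasure (density lborel (\<lambda>r. ennreal (4 * pi * r\<^sup>2) * indicator {0..} r)) X = ennreal (4 / 3 * pi * a ^ 3)"
      unfolding X by (subst emeasure_density) simp_all
    then show ?thesis unfolding X e using True by (simp add: emeasure_cball unit_ball_vol_3)
  next
    case False
    then have "(\<lambda>r::real. ennreal (4 * pi * r\<^sup>2) * indicator {0..} r * indicator {..a} r) = (\<lambda>r. 0)"
      by (auto simp: fun_eq_iff indicator_def)
    then have "emeasure (density lborel (\<lambda>r. ennreal (4 * pi * r\<^sup>2) * indicator {0..} r)) X = 0"
      unfolding X by (subst emeasure_density) simp_all
    then show ?thesis unfolding X e using False by simp
  qed
qed

lemma nn_integral_radial:
  assumes [measurable]: "f \<in> borel_measurable borel"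
  shows "(NI x. f (norm (x :: space))) = (NI r. ennreal (4 * pi * r\<^sup>2) * f r * indicator {0..} r)"
proof -
  have "(NI x. f (norm (x :: space))) = (\<integral>\<^sup>+r. f r \<partial>distr lborel borel (norm :: space \<Rightarrow> real))"
    by (subst nn_integral_distr) auto
  also have "\<dots> = (NI r. (ennreal (4 * pi * r\<^sup>2) * indicator {0..} r) * f r)"
    unfolding distr_norm_lborel by (rule nn_integral_density) measurable
  finally show ?thesis by (simp add: mult_ac)
qed

lemma AE_nonzero: "AE x::space in lborel. x \<noteq> 0"
  by (rule AE_I[of _ _ "{0}"]) auto

lemma exp_linear_limits:
  fixes c :: real assumes c: "0 < c"
  shows "((\<lambda>r. exp (- c * r)) \<longlongrightarrow> 0) at_top" "((\<lambda>r. r * exp (- c * r)) \<longlongrightarrow> 0) at_top"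
proof -
  have t: "filterlim (\<lambda>r. c * r) at_top at_top"
    by (intro filterlim_tendsto_pos_mult_at_top[OF tendsto_const c filterlim_ident])
  have "((\<lambda>r. (c * r) ^ 0 / exp (c * r)) \<longlongrightarrow> 0) at_top"
    by (rule filterlim_compose[OF tendsto_power_div_exp_0 t])
  then show "((\<lambda>r. exp (- c * r)) \<longlongrightarrow> 0) at_top" by (simp add: exp_minus inverse_eq_divide)
  have "((\<lambda>r. (c * r) ^ 1 / exp (c * r)) \<longlongrightarrow> 0) at_top"
    by (rule filterlim_compose[OF tendsto_power_div_exp_0 t])
  then have "((\<lambda>r. (1 / c) * ((c * r) ^ 1 / exp (c * r))) \<longlongrightarrow> (1 / c) * 0) at_top" by (intro tendsto_intros)
  then show "((\<lambda>r. r * exp (- c * r)) \<longlongrightarrow> 0) at_top" using c by (simp add: exp_minus field_simps)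
qed

lemma nn_integral_exp_over_square:
  assumes c: "0 < c"
  shows "(NI x. ennreal (exp (- c * norm (x::space)) / (norm x)\<^sup>2)) = ennreal (4 * pi / c)"
proof -
  have "(NI x. ennreal (exp (- c * norm (x::space)) / (norm x)\<^sup>2)) =
      (NI r. ennreal (4 * pi * r\<^sup>2) * ennreal (exp (- c * r) / r\<^sup>2) * indicator {0..} r)"
    by (rule nn_integral_radial[of "\<lambda>r. ennreal (exp (- c * r) / r\<^sup>2)"]) measurable
  also have "\<dots> = (NI r. ennreal (4 * pi * exp (- c * r)) * indicator {0..} r)"
  proof (rule nn_integral_cong_AE)
    have "AE r::real in lborel. r \<noteq> 0" by (rule AE_I[of _ _ "{0}"]) auto
    then show "AE r in lborel. ennreal (4 * pi * r\<^sup>2) * ennreal (exp (- c * r) / r\<^sup>2) * indicator {0..} r = ennreal (4 * pi * exp (- c * r)) * indicator {0..} r"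
      by eventually_elim (simp add: ennreal_mult[symmetric] mult.assoc)
  qed
  also have "\<dots> = ennreal (0 - (- (4 * pi / c) * exp (- c * 0)))"
  proof (rule nn_integral_FTC_atLeast)
    show "((\<lambda>r. - (4 * pi / c) * exp (- c * r)) has_real_derivative 4 * pi * exp (- c * r)) (at r)" for r
      using c by (auto intro!: derivative_eq_intros)
    show "((\<lambda>r. - (4 * pi / c) * exp (- c * r)) \<longlongrightarrow> 0) at_top"
      using tendsto_mult[OF tendsto_const exp_linear_limits(1)[OF c], of "- (4 * pi / c)"] by simp
  qed auto
  finally show ?thesis by simp
qed

text \<open>The Green function written with the decay rate c = sqrt lam in place of the spectral
  parameter: integrals over the rate are then elementary.\<close>

definition yukawa :: "real \<Rightarrow> space \<Rightarrow> real" where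
  "yukawa c x = exp (- c * norm x) / (4 * pi * norm x)"

lemma yukawa_measurable [measurable]: "yukawa c \<in> borel_measurable borel"
  unfolding yukawa_def[abs_def] by measurable

lemma yukawa_nonneg: "0 \<le> yukawa c x"
  by (simp add: yukawa_def)

lemma green_eq_yukawa: "green lam x = of_real (yukawa (sqrt lam) x)"
  by (simp add: green_def yukawa_def)

lemma nn_integral_yukawa:
  assumes c: "0 < c"
  shows "(NI x. ennreal (yukawa c x)) = ennreal (1 / c\<^sup>2)"
proof -
  have "(NI x. ennreal (yukawa c x)) =
      (NI r. ennreal (4 * pi * r\<^sup>2) * ennreal (exp (- c * r) / (4 * pi * r)) * indicator {0..} r)"
    unfolding yukawa_def by (rule nn_integral_radial[of "\<lambda>r. ennreal (exp (- c * r) / (4 * pi * r))"]) measurable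
  also have "\<dots> = (NI r. ennreal (r * exp (- c * r)) * indicator {0..} r)"
  proof (rule nn_integral_cong_AE)
    have "AE r::real in lborel. r \<noteq> 0" by (rule AE_I[of _ _ "{0}"]) auto
    then show "AE r in lborel. ennreal (4 * pi * r\<^sup>2) * ennreal (exp (- c * r) / (4 * pi * r)) * indicator {0..} r = ennreal (r * exp (- c * r)) * indicator {0..} r"
    proof eventually_elim
      case (elim r)
      show ?case
      proof (cases "0 < r")
        case True
        then have "ennreal (4 * pi * r\<^sup>2) * ennreal (exp (- c * r) / (4 * pi * r)) = ennreal (4 * pi * r\<^sup>2 * (exp (- c * r) / (4 * pi * r)))"
          by (intro ennreal_mult[symmetric]) auto
        also have "4 * pi * r\<^sup>2 * (exp (- c * r) / (4 * pi * r)) = r * exp (- c * r)" using True by (simp add: power2_eq_square)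
        finally show ?thesis by simp
      qed (use elim in \<open>auto simp: indicator_def\<close>)
    qed
  qed
  also have "\<dots> = ennreal (0 - (- ((c * 0 + 1) / c\<^sup>2) * exp (- c * 0)))"
  proof (rule nn_integral_FTC_atLeast)
    show "((\<lambda>r. - ((c * r + 1) / c\<^sup>2) * exp (- c * r)) has_real_derivative r * exp (- c * r)) (at r)" for r
      using c by (auto intro!: derivative_eq_intros simp: field_simps power2_eq_square)
    have "((\<lambda>r. - (1 / c) * (r * exp (- c * r)) + - (1 / c\<^sup>2) * exp (- c * r)) \<longlongrightarrow> - (1 / c) * 0 + - (1 / c\<^sup>2) * 0) at_top"
      by (intro tendsto_intros exp_linear_limits c)
    moreover have "(\<lambda>r. - (1 / c) * (r * exp (- c * r)) + - (1 / c\<^sup>2) * exp (- c * r)) = (\<lambda>r. - ((c * r + 1) / c\<^sup>2) * exp (- c * r))"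
      using c by (auto simp: fun_eq_iff field_simps power2_eq_square)
    ultimately show "((\<lambda>r. - ((c * r + 1) / c\<^sup>2) * exp (- c * r)) \<longlongrightarrow> 0) at_top" by simp
  qed auto
  finally show ?thesis by simp
qed

lemma yukawa_integrable: "0 < c \<Longrightarrow> integrable lborel (yukawa c)"
  by (rule integrableI_bounded) (auto simp: nn_integral_yukawa yukawa_nonneg)

lemma yukawa_integral: "0 < c \<Longrightarrow> (LI x. yukawa c x) = 1 / c\<^sup>2"
  by (rule integral_eq_nn_integral[THEN trans]) (auto simp: nn_integral_yukawa yukawa_nonneg)

text \<open>In polar coordinates the factor |x|^-2 cancels the surface measure and a plain
  exponential remains. This value is the source of every explicit multiple of |q|^2 in the quadratic
  form.\<close>

lemma yukawa_product:
  assumes "0 < a" "0 < b"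
  shows "integrable lborel (\<lambda>x. yukawa a x * yukawa b x)"
    "(LI x. yukawa a x * yukawa b x) = 1 / (4 * pi * (a + b))"
proof -
  have p: "yukawa a x * yukawa b x = (1 / (16 * pi\<^sup>2)) * (exp (- (a + b) * norm x) / (norm x)\<^sup>2)" for x
    by (simp add: yukawa_def power2_eq_square exp_add[symmetric] algebra_simps)
  have i: "integrable lborel (\<lambda>x::space. exp (- (a + b) * norm x) / (norm x)\<^sup>2)"
    by (rule integrableI_bounded) (use nn_integral_exp_over_square[of "a + b"] assms in auto)
  have v: "(LI x. exp (- (a + b) * norm (x::space)) / (norm x)\<^sup>2) = 4 * pi / (a + b)"
    by (rule integral_eq_nn_integral[THEN trans]) (use nn_integral_exp_over_square[of "a + b"] assms in auto)
  show "integrable lborel (\<lambda>x. yukawa a x * yukawa b x)" unfolding p using i by (rule integrable_mult_right)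
  show "(LI x. yukawa a x * yukawa b x) = 1 / (4 * pi * (a + b))"
    unfolding p integral_mult_right_zero v using assms by (simp add: power2_eq_square)
qed

section \<open>Square integrability from exponential decay\<close>

lemma yukawa_sq_integrable: "0 < c \<Longrightarrow> sq_integrable (\<lambda>x. yukawa c x *\<^sub>R q)"
proof -
  assume c: "0 < c"
  have "integrable lborel (\<lambda>x. (cmod q)\<^sup>2 * (yukawa c x * yukawa c x))" by (intro integrable_mult_right yukawa_product c)
  then show ?thesis unfolding sq_integrable_def
    by (auto simp: power_mult_distrib power2_eq_square[of "yukawa _ _"] mult_ac)
qed

lemma times_exp_le: "0 < c \<Longrightarrow> 0 \<le> r \<Longrightarrow> r * exp (- c * r) \<le> 1 / (c :: real)"
proof -
  assume c: "0 < c" and r: "0 \<le> r"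
  have "c * r \<le> exp (c * r)" using exp_ge_add_one_self[of "c * r"] by linarith
  then show ?thesis using c by (simp add: exp_minus field_simps)
qed

text \<open>Half of the decay rate absorbs the growing factor |x| + 1; what remains is a Yukawa
  potential of rate c/2, whose singularity 1/|x| is square integrable in three dimensions.\<close>

lemma exp_decay_bound:
  assumes c: "0 < c" and x: "x \<noteq> 0"
  shows "exp (- c * norm x) * (1 + 1 / norm x) \<le> 4 * pi * (2 / c + 1) * yukawa (c / 2) (x :: space)"
proof -
  let ?r = "norm x"
  have r: "0 < ?r" using x by simp
  have "?r * exp (- (c / 2) * ?r) \<le> 2 / c" using times_exp_le[of "c / 2" ?r] c r by simp
  moreover have "exp (- (c / 2) * ?r) \<le> 1" using c r by simp
  ultimately have "(?r + 1) * exp (- (c / 2) * ?r) \<le> 2 / c + 1" unfolding distrib_right mult_1 by linarith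
  then have "(?r + 1) * exp (- (c / 2) * ?r) * (exp (- (c / 2) * ?r) / ?r) \<le> (2 / c + 1) * (exp (- (c / 2) * ?r) / ?r)"
    by (rule mult_right_mono) (use r in auto)
  moreover have "exp (- c * ?r) = exp (- (c / 2) * ?r) * exp (- (c / 2) * ?r)" by (simp flip: exp_add)
  moreover have "(?r + 1) * exp (- (c / 2) * ?r) * (exp (- (c / 2) * ?r) / ?r) = exp (- (c / 2) * ?r) * exp (- (c / 2) * ?r) * (1 + 1 / ?r)"
    using r by (simp add: field_simps)
  ultimately show ?thesis by (simp add: yukawa_def)
qed

lemma exp_decay_sq_integrable:
  fixes f :: "space \<Rightarrow> complex"
  assumes c: "0 < c" and [measurable]: "f \<in> borel_measurable borel" and C: "0 \<le> C"
    and b: "\<And>x. x \<noteq> 0 \<Longrightarrow> cmod (f x) \<le> C * (exp (- c * norm x) * (1 + 1 / norm x))"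
  shows "sq_integrable f"
proof (rule sq_integrable_AE_bound)
  show "sq_integrable (\<lambda>x. yukawa (c / 2) x *\<^sub>R 1)" by (rule yukawa_sq_integrable) (use c in simp)
  show "AE x in lborel. cmod (f x) \<le> (C * (4 * pi * (2 / c + 1))) * cmod (yukawa (c / 2) x *\<^sub>R 1)"
    using AE_nonzero
  proof eventually_elim
    case (elim x)
    have "cmod (f x) \<le> C * (exp (- c * norm x) * (1 + 1 / norm x))" by (rule b[OF elim])
    also have "\<dots> \<le> C * (4 * pi * (2 / c + 1) * yukawa (c / 2) x)" by (intro mult_left_mono exp_decay_bound c elim C)
    finally show ?case by (simp add: yukawa_nonneg mult.assoc)
  qed
qed measurable

lemma exp_decay_sq_integrable_real:
  fixes k :: "space \<Rightarrow> real"
  assumes c: "0 < c" and [measurable]: "k \<in> borel_measurable borel" and C: "0 \<le> C"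
    and b: "\<And>x. x \<noteq> 0 \<Longrightarrow> \<bar>k x\<bar> \<le> C * (exp (- c * norm x) * (1 + 1 / norm x))"
  shows "sq_integrable (\<lambda>x. k x *\<^sub>R q)"
proof (rule exp_decay_sq_integrable[OF c, of _ "C * cmod q"])
  fix x :: space assume x: "x \<noteq> 0"
  have "\<bar>k x\<bar> * cmod q \<le> C * (exp (- c * norm x) * (1 + 1 / norm x)) * cmod q"
    by (intro mult_right_mono b x) simp
  then show "cmod (k x *\<^sub>R q) \<le> C * cmod q * (exp (- c * norm x) * (1 + 1 / norm x))"
    by (simp only: norm_scaleR mult_ac)
qed (use C in auto)

lemma norm_has_partial:
  assumes "x \<noteq> (0 :: space)"
  shows "((\<lambda>s. norm (x + s *\<^sub>R axis i 1)) has_real_derivative (x $ i / norm x)) (at 0)"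
proof -
  have "(norm has_derivative (\<lambda>h. h \<bullet> sgn x)) (at x)"
    using has_derivative_norm[OF assms] by (simp add: inner_commute)
  then have "((\<lambda>s. norm (x + s *\<^sub>R axis i 1)) has_derivative (\<lambda>s. (s *\<^sub>R axis i 1) \<bullet> sgn x)) (at 0)"
    by (intro has_derivative_compose[where g = norm and f = "\<lambda>s. x + s *\<^sub>R axis i 1"]) (auto intro!: derivative_eq_intros)
  moreover have "(\<lambda>s. (s *\<^sub>R axis i 1) \<bullet> sgn x) = (*) (x $ i / norm x)"
    by (auto simp: fun_eq_iff inner_axis' sgn_div_norm divide_inverse)
  ultimately show ?thesis by (simp add: has_field_derivative_def)
qed

text \<open>Functions smooth away from the origin: almost no line parallel to an axis meets the origin.\<close>

lemma L2_partial_classical: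
  assumes K: "sq_integrable K" and K': "sq_integrable K'"
    and d: "\<And>x. x \<noteq> 0 \<Longrightarrow> ((\<lambda>s. K (x + s *\<^sub>R axis i 1)) has_vector_derivative K' x) (at 0)"
    and c: "continuous_on (- {0}) K'"
  shows "L2_partial i K K'"
  unfolding L2_partial_def
proof (intro conjI allI K K')
  fix t :: real
  note [measurable] = sq_integrable_measurable[OF K] sq_integrable_measurable[OF K']
  \<comment> \<open>A line in direction i through the origin lies in the plane x_j = 0 for every j
    \<noteq> i. Excluding a single such plane, a null set, keeps all remaining lines away from the
    singularity.\<close>
  obtain j where j: "j \<noteq> i" using that[of "if i = 1 then 2 else 1"] by (auto split: if_splits)
  have "{x :: space. x $ j = 0} \<in> null_sets lebesgue"
    using negligible_standard_hyperplane_cart[of j] by (simp add: negligible_iff_null_sets)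
  then have "AE x in lebesgue. x \<notin> {x :: space. x $ j = 0}" by (rule AE_not_in)
  then have "AE x :: space in lborel. x $ j \<noteq> 0" by (simp add: AE_completion_iff)
  then show "AE x in lborel. K (x + t *\<^sub>R axis i 1) - K x = t *\<^sub>R (\<integral>s. K' (x + (s * t) *\<^sub>R axis i 1) \<partial>unif01)"
  proof eventually_elim
    case (elim x)
    have nz: "x + s *\<^sub>R axis i 1 \<noteq> 0" for s
    proof
      assume "x + s *\<^sub>R axis i 1 = 0"
      then have "(x + s *\<^sub>R axis i 1) $ j = 0" by simp
      then show False using elim j by (simp add: axis_nth_other)
    qed
    have d': "((\<lambda>s. K (x + s *\<^sub>R axis i 1)) has_vector_derivative K' (x + s *\<^sub>R axis i 1)) (at s)" for s
    proof -
      have "((\<lambda>r. K (x + s *\<^sub>R axis i 1 + r *\<^sub>R axis i 1)) has_vector_derivative K' (x + s *\<^sub>R axis i 1)) (at 0)"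
        by (rule d[OF nz])
      moreover have "((\<lambda>r. r - s) has_vector_derivative 1) (at s)" by (auto intro!: derivative_eq_intros)
      ultimately have "((\<lambda>r. K (x + s *\<^sub>R axis i 1 + r *\<^sub>R axis i 1)) \<circ> (\<lambda>r. r - s) has_vector_derivative 1 *\<^sub>R K' (x + s *\<^sub>R axis i 1)) (at s)"
        by (intro vector_diff_chain_at) simp_all
      moreover have "x + s *\<^sub>R axis i 1 + (r - s) *\<^sub>R axis i 1 = x + r *\<^sub>R axis i 1" for r
        by (simp add: scaleR_diff_left)
      ultimately show ?thesis by (simp add: o_def)
    qed
    have d2: "((\<lambda>s. K (x + (s * t) *\<^sub>R axis i 1)) has_vector_derivative t *\<^sub>R K' (x + (s * t) *\<^sub>R axis i 1)) (at s)" for s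
    proof -
      have "((\<lambda>s. s * t) has_vector_derivative t) (at s)" by (auto intro!: derivative_eq_intros)
      from vector_diff_chain_at[of "\<lambda>s. s * t", OF this d'[of "s * t"]] show ?thesis by (simp add: o_def)
    qed
    have c': "continuous_on {0..1} (\<lambda>s. t *\<^sub>R K' (x + (s * t) *\<^sub>R axis i 1))"
      by (intro continuous_intros continuous_on_compose2[OF c]) (use nz in auto)
    have "(\<integral>s. t *\<^sub>R K' (x + (s * t) *\<^sub>R axis i 1) \<partial>unif01) = K (x + (1 * t) *\<^sub>R axis i 1) - K (x + (0 * t) *\<^sub>R axis i 1)"
      by (rule integral_unif01_FTC[OF d2 c']) measurable
    then show ?case by simp
  qed
qed

section \<open>The exponential exp(-c|x|) and its derivatives\<close>

definition expo :: "real \<Rightarrow> space \<Rightarrow> real" where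
  "expo c x = exp (- c * norm x)"

definition expo_partial :: "real \<Rightarrow> 3 \<Rightarrow> space \<Rightarrow> real" where
  "expo_partial c i x = - c * (x $ i / norm x) * exp (- c * norm x)"

definition expo_partial2 :: "real \<Rightarrow> 3 \<Rightarrow> space \<Rightarrow> real" where
  "expo_partial2 c i x = exp (- c * norm x) * (c\<^sup>2 * (x $ i)\<^sup>2 / (norm x)\<^sup>2 - c / norm x + c * (x $ i)\<^sup>2 / (norm x)^3)"

lemma expo_measurable [measurable]: "expo c \<in> borel_measurable borel" "expo_partial c i \<in> borel_measurable borel"
    "expo_partial2 c i \<in> borel_measurable borel"
  unfolding expo_def[abs_def] expo_partial_def[abs_def] expo_partial2_def[abs_def] by measurable

lemma abs_nth_over_norm: "\<bar>x $ i / norm x\<bar> \<le> 1" for x :: space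
  using component_le_norm_cart[of x i] by (auto simp: divide_le_eq)

lemma expo_sq_integrable:
  assumes c: "0 < c"
  shows "sq_integrable (\<lambda>x. expo c x *\<^sub>R q)" "sq_integrable (\<lambda>x. expo_partial c i x *\<^sub>R q)" "sq_integrable (\<lambda>x. expo_partial2 c i x *\<^sub>R q)"
proof -
  have e1: "exp (- c * norm x) \<le> exp (- c * norm x) * (1 + 1 / norm x)" for x :: space
    by (simp add: distrib_left)
  show "sq_integrable (\<lambda>x. expo c x *\<^sub>R q)"
    by (rule exp_decay_sq_integrable_real[OF c, of _ 1]) (use e1 in \<open>auto simp: expo_def\<close>)
  show "sq_integrable (\<lambda>x. expo_partial c i x *\<^sub>R q)"
  proof (rule exp_decay_sq_integrable_real[OF c, of _ c])
    fix x :: space assume "x \<noteq> 0"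
    have "\<bar>expo_partial c i x\<bar> = c * \<bar>x $ i / norm x\<bar> * exp (- c * norm x)"
      using c by (simp add: expo_partial_def abs_mult)
    also have "\<dots> \<le> c * 1 * exp (- c * norm x)" using abs_nth_over_norm[of x i] c by (intro mult_right_mono mult_left_mono) auto
    also have "\<dots> \<le> c * 1 * (exp (- c * norm x) * (1 + 1 / norm x))" using c e1 by (intro mult_left_mono) auto
    finally show "\<bar>expo_partial c i x\<bar> \<le> c * (exp (- c * norm x) * (1 + 1 / norm x))" by simp
  qed (use c in auto)
  show "sq_integrable (\<lambda>x. expo_partial2 c i x *\<^sub>R q)"
  proof (rule exp_decay_sq_integrable_real[OF c, of _ "c\<^sup>2 + 2 * c"])
    fix x :: space assume x: "x \<noteq> 0"
    define u where "u = (x $ i / norm x)\<^sup>2"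
    have u: "0 \<le> u" "u \<le> 1" unfolding u_def using abs_nth_over_norm[of x i] by (simp_all only: abs_square_le_1 zero_le_power2)
    have "expo_partial2 c i x = exp (- c * norm x) * (c\<^sup>2 * u - c * (1 / norm x) + c * u * (1 / norm x))"
      using x by (simp add: expo_partial2_def u_def power_divide power2_eq_square power3_eq_cube)
    moreover have "\<bar>c\<^sup>2 * u - c * (1 / norm x) + c * u * (1 / norm x)\<bar> \<le> c\<^sup>2 * 1 + c * (1 / norm x) + c * 1 * (1 / norm x)"
    proof -
      have "c\<^sup>2 * u \<le> c\<^sup>2 * 1" "c * u * (1 / norm x) \<le> c * 1 * (1 / norm x)" "0 \<le> c\<^sup>2 * u" "0 \<le> c * u * (1 / norm x)" "0 \<le> c * (1 / norm x)"
        using u c by (auto intro!: mult_left_mono mult_right_mono mult_nonneg_nonneg divide_right_mono)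
      then show ?thesis by linarith
    qed
    moreover have "c\<^sup>2 * 1 + c * (1 / norm x) + c * 1 * (1 / norm x) \<le> (c\<^sup>2 + 2 * c) * (1 + 1 / norm x)"
    proof -
      have "0 \<le> c\<^sup>2 * (1 / norm x)" "0 \<le> c" using c by auto
      then show ?thesis unfolding distrib_left distrib_right by linarith
    qed
    ultimately have "\<bar>expo_partial2 c i x\<bar> \<le> exp (- c * norm x) * ((c\<^sup>2 + 2 * c) * (1 + 1 / norm x))"
      by (simp only: abs_mult abs_exp_cancel) (intro mult_left_mono, auto)
    then show "\<bar>expo_partial2 c i x\<bar> \<le> (c\<^sup>2 + 2 * c) * (exp (- c * norm x) * (1 + 1 / norm x))"
      by (simp only: mult_ac)
  qed (use c in auto)
qed

lemma expo_has_partial: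
  assumes "x \<noteq> (0 :: space)"
  shows "((\<lambda>s. expo c (x + s *\<^sub>R axis i 1)) has_real_derivative expo_partial c i x) (at 0)"
  unfolding expo_def expo_partial_def
  by (auto intro!: derivative_eq_intros norm_has_partial assms)

lemma expo_partial_has_partial:
  assumes x: "x \<noteq> (0 :: space)"
  shows "((\<lambda>s. expo_partial c i (x + s *\<^sub>R axis i 1)) has_real_derivative expo_partial2 c i x) (at 0)"
proof -
  define r where "r = norm x"
  define v where "v = x $ i"
  have r: "r \<noteq> 0" using x by (simp add: r_def)
  have 1: "((\<lambda>s. (x + s *\<^sub>R axis i 1) $ i) has_real_derivative 1) (at 0)"
    by (auto intro!: derivative_eq_intros)
  have "((\<lambda>s. - c * ((x + s *\<^sub>R axis i 1) $ i / norm (x + s *\<^sub>R axis i 1)) * exp (- c * norm (x + s *\<^sub>R axis i 1)))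
     has_real_derivative (- c * ((1 * norm (x + 0 *\<^sub>R axis i 1) - (x + 0 *\<^sub>R axis i 1) $ i * (x $ i / norm x)) / (norm (x + 0 *\<^sub>R axis i 1) * norm (x + 0 *\<^sub>R axis i 1)))) * exp (- c * norm (x + 0 *\<^sub>R axis i 1))
       + (exp (- c * norm (x + 0 *\<^sub>R axis i 1)) * (- c * (x $ i / norm x))) * (- c * ((x + 0 *\<^sub>R axis i 1) $ i / norm (x + 0 *\<^sub>R axis i 1)))) (at 0)"
    by (intro DERIV_mult DERIV_cmult DERIV_divide 1 norm_has_partial x DERIV_fun_exp) (use x in auto)
  moreover have "(- c * ((1 * r - v * (v / r)) / (r * r))) * exp (- c * r)
       + (exp (- c * r) * (- c * (v / r))) * (- c * (v / r)) = exp (- c * r) * (c\<^sup>2 * v\<^sup>2 / r\<^sup>2 - c / r + c * v\<^sup>2 / r^3)"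
    using r by (simp add: field_simps power2_eq_square power3_eq_cube)
  ultimately show ?thesis
    by (simp add: expo_partial_def[abs_def] expo_partial2_def r_def v_def)
qed

text \<open>The reason for working with exp(-c|x|): its second derivatives blow up only like 1/|x|
  and stay in L^2, whereas already the first derivatives of the Yukawa potential do not. Integration
  by parts is legitimate here, and integrating over c transfers the result to Yukawa
  potentials.\<close>

lemma expo_L2_partial:
  assumes c: "0 < c"
  shows "L2_partial i (\<lambda>x. expo c x *\<^sub>R q) (\<lambda>x. expo_partial c i x *\<^sub>R q)"
    "L2_partial i (\<lambda>x. expo_partial c i x *\<^sub>R q) (\<lambda>x. expo_partial2 c i x *\<^sub>R q)"
proof -
  have vd: "((\<lambda>s. f s *\<^sub>R q) has_vector_derivative f' *\<^sub>R q) (at 0)" if "(f has_real_derivative f') (at 0)" for f f'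
    using has_vector_derivative_scaleR[OF that has_vector_derivative_const, of q] by simp
  show "L2_partial i (\<lambda>x. expo c x *\<^sub>R q) (\<lambda>x. expo_partial c i x *\<^sub>R q)"
  proof (rule L2_partial_classical[OF expo_sq_integrable(1)[OF c] expo_sq_integrable(2)[OF c] vd[OF expo_has_partial]])
    show "continuous_on (- {0}) (\<lambda>x. expo_partial c i x *\<^sub>R q)"
      unfolding expo_partial_def by (intro continuous_intros) auto
  qed
  show "L2_partial i (\<lambda>x. expo_partial c i x *\<^sub>R q) (\<lambda>x. expo_partial2 c i x *\<^sub>R q)"
  proof (rule L2_partial_classical[OF expo_sq_integrable(2)[OF c] expo_sq_integrable(3)[OF c] vd[OF expo_partial_has_partial]])
    show "continuous_on (- {0}) (\<lambda>x. expo_partial2 c i x *\<^sub>R q)"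
      unfolding expo_partial2_def by (intro continuous_intros) auto
  qed
qed

lemma sum_expo_partial2:
  assumes x: "x \<noteq> (0::space)"
  shows "(\<Sum>i\<in>UNIV. expo_partial2 c i x) = (c\<^sup>2 - 2 * c / norm x) * expo c x"
proof -
  have n: "(norm x)\<^sup>2 = (\<Sum>i\<in>UNIV. (x $ i)\<^sup>2)" by (simp add: norm_vec_def L2_set_def sum_nonneg)
  have "(\<Sum>i\<in>UNIV. expo_partial2 c i x) = exp (- c * norm x) * (c\<^sup>2 * (\<Sum>i\<in>UNIV. (x $ i)\<^sup>2) / (norm x)\<^sup>2 - 3 * (c / norm x) + c * (\<Sum>i\<in>UNIV. (x $ i)\<^sup>2) / (norm x)^3)"
    unfolding expo_partial2_def
    by (simp add: sum_distrib_left[symmetric] sum.distrib sum_subtractf sum_divide_distrib[symmetric])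
  also have "\<dots> = exp (- c * norm x) * (c\<^sup>2 - 3 * (c / norm x) + c / norm x)"
    unfolding n[symmetric] using x by (simp add: power2_eq_square power3_eq_cube)
  finally show ?thesis by (simp add: expo_def algebra_simps)
qed

section \<open>The Laplacian paired with Yukawa potentials\<close>

text \<open>The pointwise derivative away from the origin. It is of order |x|^-2 there and not
  square integrable; it enters pairings only through differences of two rates, where the
  singularities cancel, or multiplied by a factor bounded by |x_i|.\<close>

definition yukawa_partial :: "real \<Rightarrow> 3 \<Rightarrow> space \<Rightarrow> real" where
  "yukawa_partial c i x = - (c * norm x + 1) * exp (- c * norm x) / (4 * pi * (norm x)^3) * x $ i"

lemma yukawa_partial_measurable [measurable]: "yukawa_partial c i \<in> borel_measurable borel"
  unfolding yukawa_partial_def[abs_def] by measurable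

text \<open>A majorant uniform in the rate gives integrability on the product, hence Fubini. No
  bound is asked at x = 0, where the kernels may be singular.\<close>

lemma integral_over_parameter:
  fixes k :: "real \<Rightarrow> space \<Rightarrow> real"
  assumes h: "sq_integrable h" and B: "sq_integrable (\<lambda>x. B x *\<^sub>R q)" 
    and [measurable]: "(\<lambda>(x, s). k s x) \<in> borel_measurable (borel \<Otimes>\<^sub>M borel)"
    and b: "\<And>s x. a \<le> s \<Longrightarrow> s \<le> b \<Longrightarrow> x \<noteq> 0 \<Longrightarrow> \<bar>k s x\<bar> \<le> B x"
  shows "(LI s. indicator {a..b} s * (LI x. h x \<bullet> (k s x *\<^sub>R q))) =
    (LI x. h x \<bullet> ((LI s. indicator {a..b} s * k s x) *\<^sub>R q))"
proof -
  note [measurable] = sq_integrable_measurable[OF h] 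
  let ?g = "\<lambda>(x, s). indicator {a..b} s * (k s x * (h x \<bullet> q)) :: real"
  have int: "integrable lborel2 ?g"
  proof (rule integrableI_bounded)
    show "?g \<in> borel_measurable lborel2" by measurable
    have iB: "integrable lborel (\<lambda>x. h x \<bullet> (B x *\<^sub>R q))" by (rule integrable_inner_sq[OF h B])
    have mB[measurable]: "(\<lambda>x. h x \<bullet> (B x *\<^sub>R q)) \<in> borel_measurable borel" using iB by (auto dest: borel_measurable_integrable)
    have "(\<integral>\<^sup>+p. ennreal (norm (?g p)) \<partial>lborel2) = (NI x. NI s. ennreal (norm (?g (x, s))))"
      by (rule lborel.nn_integral_fst[symmetric]) measurable
    also have "\<dots> \<le> (NI x. NI s. ennreal \<bar>h x \<bullet> (B x *\<^sub>R q)\<bar> * indicator {a..b} s)"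
    proof (rule nn_integral_mono_AE)
      show "AE x in lborel. (NI s. ennreal (norm (?g (x, s)))) \<le> (NI s. ennreal \<bar>h x \<bullet> (B x *\<^sub>R q)\<bar> * indicator {a..b} s)"
        using AE_nonzero
      proof eventually_elim
        case (elim x)
        show ?case
        proof (rule nn_integral_mono)
          fix s :: real
          show "ennreal (norm (?g (x, s))) \<le> ennreal \<bar>h x \<bullet> (B x *\<^sub>R q)\<bar> * indicator {a..b} s"
          proof (cases "s \<in> {a..b}")
            case True
            then have "\<bar>k s x\<bar> \<le> B x" by (intro b elim) auto
            then have "\<bar>k s x * (h x \<bullet> q)\<bar> \<le> \<bar>h x \<bullet> (B x *\<^sub>R q)\<bar>"
              by (simp add: abs_mult mult_right_mono)
            then show ?thesis using True by (simp add: ennreal_leI)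
          qed simp
        qed
      qed
    qed
    also have "\<dots> = (NI x. ennreal \<bar>h x \<bullet> (B x *\<^sub>R q)\<bar> * ennreal (max 0 (b - a)))"
      by (intro nn_integral_cong) (simp add: nn_integral_cmult_indicator max_def ennreal_neg)
    also have "\<dots> = (NI x. ennreal \<bar>h x \<bullet> (B x *\<^sub>R q)\<bar>) * ennreal (max 0 (b - a))"
      by (rule nn_integral_multc) measurable
    also have "\<dots> < \<infinity>"
    proof -
      have "(NI x. ennreal \<bar>h x \<bullet> (B x *\<^sub>R q)\<bar>) < \<infinity>" using iB by (simp only: integrable_iff_bounded real_norm_def)
      then show ?thesis by (simp add: ennreal_mult_less_top)
    qed
    finally show "(\<integral>\<^sup>+p. ennreal (norm (?g p)) \<partial>lborel2) < \<infinity>" .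
  qed
  have "(LI s. indicator {a..b} s * (LI x. h x \<bullet> (k s x *\<^sub>R q))) = (LI s. (LI x. indicator {a..b} s * (k s x * (h x \<bullet> q))))"
    by simp
  also have "\<dots> = (LI x. (LI s. indicator {a..b} s * (k s x * (h x \<bullet> q))))"
    by (rule lborel_pair.Fubini_integral[OF int])
  also have "\<dots> = (LI x. h x \<bullet> ((LI s. indicator {a..b} s * k s x) *\<^sub>R q))"
    by (simp add: mult.assoc[symmetric])
  finally show ?thesis .
qed

section \<open>Integration over the decay rate\<close>

lemma integral_Icc_FTC_real:
  fixes F f :: "real \<Rightarrow> real"
  assumes "a \<le> b" "\<And>s. (F has_real_derivative f s) (at s)" "continuous_on {a..b} f"
  shows "(LI s. indicator {a..b} s * f s) = F b - F a"
  using integral_FTC_Icc[of a b F f] assms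
  by (auto simp: has_real_derivative_iff_has_vector_derivative has_vector_derivative_at_within)

text \<open>The antiderivatives in s are elementary: for instance - s^2 exp(-s r)/r has derivative
  (s^2 - 2 s/r) exp(-s r), the Laplacian of exp(-s|x|). Up to the factor 4 pi the second equation
  thus says that the Laplacian of G_a - G_b is a^2 G_a - b^2 G_b.\<close>

lemma expo_parameter_integrals:
  assumes ab: "a \<le> b" and x: "x \<noteq> (0 :: space)"
  shows "(LI s. indicator {a..b} s * expo s x) = 4 * pi * (yukawa a x - yukawa b x)"
    "(LI s. indicator {a..b} s * ((s\<^sup>2 - 2 * s / norm x) * expo s x)) = 4 * pi * (a\<^sup>2 * yukawa a x - b\<^sup>2 * yukawa b x)"
    "(LI s. indicator {a..b} s * expo_partial s i x) = 4 * pi * (yukawa_partial a i x - yukawa_partial b i x)"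
proof -
  define r where "r = norm x"
  have r: "r \<noteq> 0" using x by (simp add: r_def)
  have 1: "(LI s. indicator {a..b} s * exp (- s * r)) = - exp (- b * r) / r - (- exp (- a * r) / r)"
    by (rule integral_Icc_FTC_real[OF ab]) (use r in \<open>auto intro!: derivative_eq_intros continuous_intros\<close>)
  show "(LI s. indicator {a..b} s * expo s x) = 4 * pi * (yukawa a x - yukawa b x)"
    unfolding expo_def yukawa_def r_def[symmetric] 1 using r by (simp add: field_simps)
  have 2: "(LI s. indicator {a..b} s * ((s\<^sup>2 - 2 * s / r) * exp (- s * r))) = - b\<^sup>2 * exp (- b * r) / r - (- a\<^sup>2 * exp (- a * r) / r)"
    by (rule integral_Icc_FTC_real[OF ab])
       (use r in \<open>auto intro!: derivative_eq_intros continuous_intros simp: field_simps power2_eq_square\<close>)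
  show "(LI s. indicator {a..b} s * ((s\<^sup>2 - 2 * s / norm x) * expo s x)) = 4 * pi * (a\<^sup>2 * yukawa a x - b\<^sup>2 * yukawa b x)"
    unfolding expo_def yukawa_def r_def[symmetric] 2 using r by (simp add: field_simps)
  have 3: "(LI s. indicator {a..b} s * (- s * (x $ i / r) * exp (- s * r))) =
     (b * r + 1) * exp (- b * r) / r^3 * x $ i - ((a * r + 1) * exp (- a * r) / r^3 * x $ i)"
    by (rule integral_Icc_FTC_real[OF ab])
       (use r in \<open>auto intro!: derivative_eq_intros continuous_intros simp: field_simps power2_eq_square power3_eq_cube\<close>)
  show "(LI s. indicator {a..b} s * expo_partial s i x) = 4 * pi * (yukawa_partial a i x - yukawa_partial b i x)"
    unfolding expo_partial_def yukawa_partial_def r_def[symmetric] 3 using r by (simp add: field_simps)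
qed

lemma expo_first_order:
  assumes f: "\<And>j. L2_partial j \<phi> (f j)" and s: "0 < s"
  shows "(\<Sum>j\<in>UNIV. LI x. f j x \<bullet> (expo_partial s j x *\<^sub>R q)) =
     - (LI x. \<phi> x \<bullet> (((s\<^sup>2 - 2 * s / norm x) * expo s x) *\<^sub>R q))"
proof -
  note s\<phi> = L2_partial_sq(1)[OF f]
  note [measurable] = sq_integrable_measurable[OF s\<phi>]
  have "(\<Sum>j\<in>UNIV. LI x. f j x \<bullet> (expo_partial s j x *\<^sub>R q)) = (\<Sum>j\<in>UNIV. - (LI x. \<phi> x \<bullet> (expo_partial2 s j x *\<^sub>R q)))"
    by (intro sum.cong refl integration_by_parts[OF f expo_L2_partial(2)[OF s]])
  also have "\<dots> = - (LI x. (\<Sum>j\<in>UNIV. \<phi> x \<bullet> (expo_partial2 s j x *\<^sub>R q)))"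
    unfolding sum_negf
    by (subst Bochner_Integration.integral_sum[OF integrable_inner_sq[OF s\<phi> expo_sq_integrable(3)[OF s]]]) simp
  also have "(LI x. (\<Sum>j\<in>UNIV. \<phi> x \<bullet> (expo_partial2 s j x *\<^sub>R q))) = (LI x. \<phi> x \<bullet> (((s\<^sup>2 - 2 * s / norm x) * expo s x) *\<^sub>R q))"
  proof (rule integral_cong_AE)
    show "AE x in lborel. (\<Sum>j\<in>UNIV. \<phi> x \<bullet> (expo_partial2 s j x *\<^sub>R q)) = \<phi> x \<bullet> (((s\<^sup>2 - 2 * s / norm x) * expo s x) *\<^sub>R q)"
      using AE_nonzero by eventually_elim (simp flip: sum_expo_partial2 add: sum_distrib_right)
  qed measurable
  finally show ?thesis .
qed

lemma expo_second_order:
  assumes f: "\<And>j. L2_partial j \<phi> (f j)" and F: "\<And>j. L2_partial j (f j) (F j)" and s: "0 < s"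
  shows "(LI x. (\<Sum>j\<in>UNIV. F j x) \<bullet> (expo s x *\<^sub>R q)) =
     (LI x. \<phi> x \<bullet> (((s\<^sup>2 - 2 * s / norm x) * expo s x) *\<^sub>R q))"
proof -
  have "(LI x. (\<Sum>j\<in>UNIV. F j x) \<bullet> (expo s x *\<^sub>R q)) = (\<Sum>j\<in>UNIV. LI x. F j x \<bullet> (expo s x *\<^sub>R q))"
    unfolding inner_sum_left
    by (rule Bochner_Integration.integral_sum[OF integrable_inner_sq[OF L2_partial_sq(2)[OF F] expo_sq_integrable(1)[OF s]]])
  also have "\<dots> = (\<Sum>j\<in>UNIV. - (LI x. f j x \<bullet> (expo_partial s j x *\<^sub>R q)))"
    by (intro sum.cong refl integration_by_parts[OF F expo_L2_partial(1)[OF s]])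
  finally show ?thesis unfolding sum_negf expo_first_order[OF f s] by simp
qed

lemma expo_antimono: "a \<le> s \<Longrightarrow> expo s x \<le> exp (- a * norm x)"
  by (simp add: expo_def mult_right_mono)

lemma exp_decay_dominant:
  assumes "0 < a" "0 \<le> C" shows "sq_integrable (\<lambda>x. (C * (exp (- a * norm x) * (1 + 1 / norm x))) *\<^sub>R q)"
  by (rule exp_decay_sq_integrable_real[OF assms(1), of _ C])
     (use assms in \<open>auto simp: abs_mult intro!: add_nonneg_nonneg\<close>)

lemma expo_parameter_bounds:
  assumes a: "0 < a" and s: "a \<le> s" "s \<le> b" and x: "x \<noteq> (0 :: space)"
  shows "\<bar>expo s x\<bar> \<le> 1 * (exp (- a * norm x) * (1 + 1 / norm x))"
    "\<bar>(s\<^sup>2 - 2 * s / norm x) * expo s x\<bar> \<le> (b\<^sup>2 + 2 * b) * (exp (- a * norm x) * (1 + 1 / norm x))"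
    "\<bar>expo_partial s i x\<bar> \<le> b * exp (- a * norm x)"
proof -
  define u where "u = 1 / norm x"
  have u: "0 \<le> u" by (simp add: u_def)
  have e: "0 \<le> expo s x" "expo s x \<le> exp (- a * norm x)" using expo_antimono[OF s(1)] by (auto simp: expo_def)
  have "exp (- a * norm x) * 1 \<le> exp (- a * norm x) * (1 + u)" using u by (intro mult_left_mono) auto
  moreover have "\<bar>expo s x\<bar> = expo s x" using e by simp
  ultimately show "\<bar>expo s x\<bar> \<le> 1 * (exp (- a * norm x) * (1 + 1 / norm x))" unfolding u_def[symmetric] using e by linarith
  have s2: "s\<^sup>2 \<le> b\<^sup>2" using a s by (intro power_mono) auto
  have su: "s * u \<le> b * u" "0 \<le> s * u" using a s u by (auto intro: mult_right_mono)
  have "0 \<le> b\<^sup>2 * u" "0 \<le> b" "0 \<le> s\<^sup>2" using u a s by auto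
  then have "\<bar>s\<^sup>2 - 2 * (s * u)\<bar> \<le> (b\<^sup>2 + 2 * b) * (1 + u)"
    unfolding distrib_left distrib_right mult_1_right using s2 su by linarith
  then have "\<bar>s\<^sup>2 - 2 * (s * u)\<bar> * expo s x \<le> ((b\<^sup>2 + 2 * b) * (1 + u)) * exp (- a * norm x)"
    by (intro mult_mono e) (use u a s in auto)
  then show "\<bar>(s\<^sup>2 - 2 * s / norm x) * expo s x\<bar> \<le> (b\<^sup>2 + 2 * b) * (exp (- a * norm x) * (1 + 1 / norm x))"
    using e(1) by (simp add: abs_mult u_def mult_ac)
  have "\<bar>expo_partial s i x\<bar> = s * \<bar>x $ i / norm x\<bar> * expo s x"
    using a s by (simp add: expo_partial_def abs_mult expo_def)
  also have "\<dots> \<le> b * 1 * exp (- a * norm x)"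
    by (intro mult_mono e abs_nth_over_norm s) (use a s in auto)
  finally show "\<bar>expo_partial s i x\<bar> \<le> b * exp (- a * norm x)" by simp
qed

text \<open>The Dirac masses of the two Green functions cancel in the difference, so no value of
  \<phi> at the origin appears. The identity is \<open>expo_second_order\<close> integrated over the
  rates between a and b.\<close>

lemma yukawa_difference_second_order:
  assumes f: "\<And>j. L2_partial j \<phi> (f j)" and F: "\<And>j. L2_partial j (f j) (F j)" and a: "0 < a" and ab: "a \<le> b"
  shows "(LI x. (\<Sum>j\<in>UNIV. F j x) \<bullet> ((yukawa a x - yukawa b x) *\<^sub>R q)) =
     (LI x. \<phi> x \<bullet> ((a\<^sup>2 * yukawa a x - b\<^sup>2 * yukawa b x) *\<^sub>R q))"
proof -
  have C: "0 \<le> b\<^sup>2 + 2 * b" using a ab by simp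
  note s\<phi> = L2_partial_sq(1)[OF f]
  have sF: "sq_integrable (\<lambda>x. \<Sum>j\<in>UNIV. F j x)" by (intro sq_integrable_sum L2_partial_sq(2)[OF F])
  note [measurable] = sq_integrable_measurable[OF s\<phi>] sq_integrable_measurable[OF sF]
  have "(LI s. indicator {a..b} s * (LI x. (\<Sum>j\<in>UNIV. F j x) \<bullet> (expo s x *\<^sub>R q))) =
    (LI s. indicator {a..b} s * (LI x. \<phi> x \<bullet> (((s\<^sup>2 - 2 * s / norm x) * expo s x) *\<^sub>R q)))"
  proof (rule Bochner_Integration.integral_cong[OF refl])
    fix s :: real
    show "indicator {a..b} s * (LI x. (\<Sum>j\<in>UNIV. F j x) \<bullet> (expo s x *\<^sub>R q)) =
      indicator {a..b} s * (LI x. \<phi> x \<bullet> (((s\<^sup>2 - 2 * s / norm x) * expo s x) *\<^sub>R q))"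
    proof (cases "s \<in> {a..b}")
      case True
      then have "0 < s" using a by auto
      from expo_second_order[OF f F this] show ?thesis by simp
    qed simp
  qed
  moreover have "(LI s. indicator {a..b} s * (LI x. (\<Sum>j\<in>UNIV. F j x) \<bullet> (expo s x *\<^sub>R q))) =
     (LI x. (\<Sum>j\<in>UNIV. F j x) \<bullet> ((LI s. indicator {a..b} s * expo s x) *\<^sub>R q))"
  proof (rule integral_over_parameter[OF sF exp_decay_dominant[OF a zero_le_one]])
    show "(\<lambda>(x, s). expo s x) \<in> borel_measurable (borel \<Otimes>\<^sub>M borel)" unfolding expo_def by measurable
  qed (rule expo_parameter_bounds(1)[OF a])
  moreover have "(LI s. indicator {a..b} s * (LI x. \<phi> x \<bullet> (((s\<^sup>2 - 2 * s / norm x) * expo s x) *\<^sub>R q))) =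
     (LI x. \<phi> x \<bullet> ((LI s. indicator {a..b} s * ((s\<^sup>2 - 2 * s / norm x) * expo s x)) *\<^sub>R q))"
  proof (rule integral_over_parameter[OF s\<phi> exp_decay_dominant[OF a C]])
    show "(\<lambda>(x, s). (s\<^sup>2 - 2 * s / norm x) * expo s x) \<in> borel_measurable (borel \<Otimes>\<^sub>M borel)" unfolding expo_def by measurable
  qed (rule expo_parameter_bounds(2)[OF a])
  moreover have "(LI x. (\<Sum>j\<in>UNIV. F j x) \<bullet> ((LI s. indicator {a..b} s * expo s x) *\<^sub>R q)) =
     (LI x. 4 * pi * ((\<Sum>j\<in>UNIV. F j x) \<bullet> ((yukawa a x - yukawa b x) *\<^sub>R q)))"
  proof (rule integral_cong_AE)
    show "(\<lambda>x. (\<Sum>j\<in>UNIV. F j x) \<bullet> ((LI s. indicator {a..b} s * expo s x) *\<^sub>R q)) \<in> borel_measurable lborel"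
      unfolding expo_def by measurable
    show "AE x in lborel. (\<Sum>j\<in>UNIV. F j x) \<bullet> ((LI s. indicator {a..b} s * expo s x) *\<^sub>R q) = 4 * pi * ((\<Sum>j\<in>UNIV. F j x) \<bullet> ((yukawa a x - yukawa b x) *\<^sub>R q))"
      using AE_nonzero proof eventually_elim
        case (elim x)
        show ?case unfolding expo_parameter_integrals(1)[OF ab elim] by simp
      qed
  qed measurable
  moreover have "(LI x. \<phi> x \<bullet> ((LI s. indicator {a..b} s * ((s\<^sup>2 - 2 * s / norm x) * expo s x)) *\<^sub>R q)) =
     (LI x. 4 * pi * (\<phi> x \<bullet> ((a\<^sup>2 * yukawa a x - b\<^sup>2 * yukawa b x) *\<^sub>R q)))"
  proof (rule integral_cong_AE)
    show "(\<lambda>x. \<phi> x \<bullet> ((LI s. indicator {a..b} s * ((s\<^sup>2 - 2 * s / norm x) * expo s x)) *\<^sub>R q)) \<in> borel_measurable lborel"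
      unfolding expo_def by measurable
    show "AE x in lborel. \<phi> x \<bullet> ((LI s. indicator {a..b} s * ((s\<^sup>2 - 2 * s / norm x) * expo s x)) *\<^sub>R q) = 4 * pi * (\<phi> x \<bullet> ((a\<^sup>2 * yukawa a x - b\<^sup>2 * yukawa b x) *\<^sub>R q))"
      using AE_nonzero proof eventually_elim
        case (elim x)
        show ?case unfolding expo_parameter_integrals(2)[OF ab elim] by simp
      qed
  qed measurable
  ultimately show ?thesis by simp
qed

text \<open>The same computation with only one integration by parts, so that \<phi> needs first
  derivatives only: this version applies on the form domain H^1.\<close>

lemma yukawa_difference_first_order:
  assumes f: "\<And>j. L2_partial j \<phi> (f j)" and a: "0 < a" and ab: "a \<le> b"
  shows "(\<Sum>j\<in>UNIV. LI x. f j x \<bullet> ((yukawa_partial a j x - yukawa_partial b j x) *\<^sub>R q)) =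
     - (LI x. \<phi> x \<bullet> ((a\<^sup>2 * yukawa a x - b\<^sup>2 * yukawa b x) *\<^sub>R q))"
proof -
  have C: "0 \<le> b\<^sup>2 + 2 * b" using a ab by simp
  note s\<phi> = L2_partial_sq(1)[OF f] and sf = L2_partial_sq(2)[OF f]
  note [measurable] = sq_integrable_measurable[OF s\<phi>] sq_integrable_measurable[OF sf]
  have exd: "sq_integrable (\<lambda>x. (b * exp (- a * norm x)) *\<^sub>R q)"
    using sq_integrable_scaleR[OF expo_sq_integrable(1)[OF a, of q], of b] by (simp add: expo_def)
  have ij: "integrable lborel (\<lambda>s. indicator {a..b} s * (LI x. f j x \<bullet> (expo_partial s j x *\<^sub>R q)))" for j
  proof -
    have m: "(\<lambda>s. indicator {a..b} s * (LI x. f j x \<bullet> (expo_partial s j x *\<^sub>R q))) \<in> borel_measurable borel"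
      unfolding expo_partial_def by measurable
    define K where "K = (LI x. \<bar>f j x \<bullet> ((b * exp (- a * norm x)) *\<^sub>R q)\<bar>)"
    have K: "\<bar>(LI x. f j x \<bullet> (expo_partial s j x *\<^sub>R q))\<bar> \<le> K" if s: "s \<in> {a..b}" for s
    proof -
      have s0: "0 < s" using s a by auto
      have "\<bar>(LI x. f j x \<bullet> (expo_partial s j x *\<^sub>R q))\<bar> \<le> (LI x. \<bar>f j x \<bullet> (expo_partial s j x *\<^sub>R q)\<bar>)"
        by (rule integral_abs_bound)
      also have "\<dots> \<le> K" unfolding K_def
      proof (rule integral_mono_AE)
        show "integrable lborel (\<lambda>x. \<bar>f j x \<bullet> (expo_partial s j x *\<^sub>R q)\<bar>)"
          by (intro integrable_abs integrable_inner_sq sf expo_sq_integrable s0)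
        show "integrable lborel (\<lambda>x. \<bar>f j x \<bullet> ((b * exp (- a * norm x)) *\<^sub>R q)\<bar>)"
          by (intro integrable_abs integrable_inner_sq sf exd)
        show "AE x in lborel. \<bar>f j x \<bullet> (expo_partial s j x *\<^sub>R q)\<bar> \<le> \<bar>f j x \<bullet> ((b * exp (- a * norm x)) *\<^sub>R q)\<bar>"
          using AE_nonzero
        proof eventually_elim
          case (elim x)
          have "\<bar>expo_partial s j x\<bar> * \<bar>f j x \<bullet> q\<bar> \<le> (b * exp (- a * norm x)) * \<bar>f j x \<bullet> q\<bar>"
            by (intro mult_right_mono expo_parameter_bounds(3)[OF a _ _ elim]) (use s in auto)
          then show ?case using a ab by (simp add: abs_mult)
        qed
      qed
      finally show ?thesis .
    qed
    have "integrable lborel (\<lambda>s. K * indicator {a..b} s)" by (intro integrable_mult_right integrable_real_indicator) (auto simp: emeasure_lborel_Icc_eq)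
    then show ?thesis
    proof (rule Bochner_Integration.integrable_bound)
      show "AE s in lborel. norm (indicator {a..b} s * (LI x. f j x \<bullet> (expo_partial s j x *\<^sub>R q))) \<le> norm (K * indicator {a..b} s)"
        using K by (intro AE_I2) (auto simp: indicator_def intro: order_trans[OF _ abs_ge_self])
    qed (use m in simp)
  qed
  have "(LI s. (\<Sum>j\<in>UNIV. indicator {a..b} s * (LI x. f j x \<bullet> (expo_partial s j x *\<^sub>R q)))) =
    (LI s. - (indicator {a..b} s * (LI x. \<phi> x \<bullet> (((s\<^sup>2 - 2 * s / norm x) * expo s x) *\<^sub>R q))))"
  proof (rule Bochner_Integration.integral_cong[OF refl])
    fix s :: real
    show "(\<Sum>j\<in>UNIV. indicator {a..b} s * (LI x. f j x \<bullet> (expo_partial s j x *\<^sub>R q))) =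
      - (indicator {a..b} s * (LI x. \<phi> x \<bullet> (((s\<^sup>2 - 2 * s / norm x) * expo s x) *\<^sub>R q)))"
    proof (cases "s \<in> {a..b}")
      case True
      then have "0 < s" using a by auto
      from expo_first_order[OF f this, of q] True show ?thesis by simp
    qed simp
  qed
  moreover have "(LI s. (\<Sum>j\<in>UNIV. indicator {a..b} s * (LI x. f j x \<bullet> (expo_partial s j x *\<^sub>R q)))) =
     (\<Sum>j\<in>UNIV. LI s. indicator {a..b} s * (LI x. f j x \<bullet> (expo_partial s j x *\<^sub>R q)))"
    by (rule Bochner_Integration.integral_sum) (rule ij)
  moreover have "(LI s. indicator {a..b} s * (LI x. f j x \<bullet> (expo_partial s j x *\<^sub>R q))) =
     4 * pi * (LI x. f j x \<bullet> ((yukawa_partial a j x - yukawa_partial b j x) *\<^sub>R q))" for j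
  proof -
    have "(LI s. indicator {a..b} s * (LI x. f j x \<bullet> (expo_partial s j x *\<^sub>R q))) =
       (LI x. f j x \<bullet> ((LI s. indicator {a..b} s * expo_partial s j x) *\<^sub>R q))"
    proof (rule integral_over_parameter[OF sf exd])
      show "(\<lambda>(x, s). expo_partial s j x) \<in> borel_measurable (borel \<Otimes>\<^sub>M borel)" unfolding expo_partial_def by measurable
    qed (rule expo_parameter_bounds(3)[OF a])
    also have "\<dots> = (LI x. 4 * pi * (f j x \<bullet> ((yukawa_partial a j x - yukawa_partial b j x) *\<^sub>R q)))"
    proof (rule integral_cong_AE)
      show "(\<lambda>x. f j x \<bullet> ((LI s. indicator {a..b} s * expo_partial s j x) *\<^sub>R q)) \<in> borel_measurable lborel"
        unfolding expo_partial_def by measurable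
      show "AE x in lborel. f j x \<bullet> ((LI s. indicator {a..b} s * expo_partial s j x) *\<^sub>R q) = 4 * pi * (f j x \<bullet> ((yukawa_partial a j x - yukawa_partial b j x) *\<^sub>R q))"
        using AE_nonzero proof eventually_elim
        case (elim x)
        show ?case unfolding expo_parameter_integrals(3)[OF ab elim] by simp
      qed
    qed measurable
    finally show ?thesis by simp
  qed
  moreover have "(LI s. indicator {a..b} s * (LI x. \<phi> x \<bullet> (((s\<^sup>2 - 2 * s / norm x) * expo s x) *\<^sub>R q))) =
     (LI x. \<phi> x \<bullet> ((LI s. indicator {a..b} s * ((s\<^sup>2 - 2 * s / norm x) * expo s x)) *\<^sub>R q))"
  proof (rule integral_over_parameter[OF s\<phi> exp_decay_dominant[OF a C]])
    show "(\<lambda>(x, s). (s\<^sup>2 - 2 * s / norm x) * expo s x) \<in> borel_measurable (borel \<Otimes>\<^sub>M borel)" unfolding expo_def by measurable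
  qed (rule expo_parameter_bounds(2)[OF a])
  moreover have "(LI x. \<phi> x \<bullet> ((LI s. indicator {a..b} s * ((s\<^sup>2 - 2 * s / norm x) * expo s x)) *\<^sub>R q)) =
     (LI x. 4 * pi * (\<phi> x \<bullet> ((a\<^sup>2 * yukawa a x - b\<^sup>2 * yukawa b x) *\<^sub>R q)))"
  proof (rule integral_cong_AE)
    show "(\<lambda>x. \<phi> x \<bullet> ((LI s. indicator {a..b} s * ((s\<^sup>2 - 2 * s / norm x) * expo s x)) *\<^sub>R q)) \<in> borel_measurable lborel"
      unfolding expo_def by measurable
    show "AE x in lborel. \<phi> x \<bullet> ((LI s. indicator {a..b} s * ((s\<^sup>2 - 2 * s / norm x) * expo s x)) *\<^sub>R q) = 4 * pi * (\<phi> x \<bullet> ((a\<^sup>2 * yukawa a x - b\<^sup>2 * yukawa b x) *\<^sub>R q))"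
      using AE_nonzero proof eventually_elim
        case (elim x)
        show ?case unfolding expo_parameter_integrals(2)[OF ab elim] by simp
      qed
  qed measurable
  ultimately have "4 * pi * (\<Sum>j\<in>UNIV. LI x. f j x \<bullet> ((yukawa_partial a j x - yukawa_partial b j x) *\<^sub>R q)) =
     4 * pi * (- (LI x. \<phi> x \<bullet> ((a\<^sup>2 * yukawa a x - b\<^sup>2 * yukawa b x) *\<^sub>R q)))"
    by (simp add: sum_distrib_left[symmetric])
  then show ?thesis by (rule mult_left_cancel[THEN iffD1, rotated]) simp
qed

section \<open>Differences of Green functions and the Dirac mass\<close>

lemma scaleR_has_vector_derivative_const:
  "(f has_real_derivative f') (at t) \<Longrightarrow> ((\<lambda>s. f s *\<^sub>R q) has_vector_derivative f' *\<^sub>R q) (at t)"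
  using has_vector_derivative_scaleR[OF _ has_vector_derivative_const, of f f' t UNIV q] by simp

lemma yukawa_has_partial:
  assumes x: "x \<noteq> (0 :: space)"
  shows "((\<lambda>s. yukawa c (x + s *\<^sub>R axis i 1)) has_real_derivative yukawa_partial c i x) (at 0)"
proof -
  define r where "r = norm x"
  define v where "v = x $ i"
  have r: "r \<noteq> 0" using x by (simp add: r_def)
  have "((\<lambda>s. exp (- c * norm (x + s *\<^sub>R axis i 1)) / (4 * pi * norm (x + s *\<^sub>R axis i 1))) has_real_derivative
     ((exp (- c * norm (x + 0 *\<^sub>R axis i 1)) * (- c * (x $ i / norm x))) * (4 * pi * norm (x + 0 *\<^sub>R axis i 1)) -
       exp (- c * norm (x + 0 *\<^sub>R axis i 1)) * (4 * pi * (x $ i / norm x))) /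
     ((4 * pi * norm (x + 0 *\<^sub>R axis i 1)) * (4 * pi * norm (x + 0 *\<^sub>R axis i 1)))) (at 0)"
    by (intro DERIV_divide DERIV_cmult norm_has_partial x DERIV_fun_exp) (use x in auto)
  moreover have "((exp (- c * r) * (- c * (v / r))) * (4 * pi * r) - exp (- c * r) * (4 * pi * (v / r))) / ((4 * pi * r) * (4 * pi * r))
     = - (c * r + 1) * exp (- c * r) / (4 * pi * r^3) * v"
    using r by (simp add: field_simps power3_eq_cube)
  ultimately show ?thesis by (simp add: yukawa_def[abs_def] yukawa_partial_def r_def v_def)
qed

lemma yukawa_partial_continuous: "continuous_on (- {0}) (yukawa_partial c i)"
  unfolding yukawa_partial_def[abs_def] by (intro continuous_intros) auto

text \<open>As an integral over the rate of the bounded functions \<open>expo_partial s i\<close>,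
  the difference stays bounded although each term has a singularity |x|^-2.\<close>

lemma yukawa_difference_bounds:
  assumes a: "0 < a" and ab: "a \<le> b" and x: "x \<noteq> (0 :: space)"
  shows "\<bar>yukawa_partial a i x - yukawa_partial b i x\<bar> \<le> b * (b - a) * exp (- a * norm x)"
proof -
  have "4 * pi * \<bar>yukawa_partial a i x - yukawa_partial b i x\<bar> = \<bar>4 * pi * (yukawa_partial a i x - yukawa_partial b i x)\<bar>"
    by (simp add: abs_mult)
  also have "\<dots> = \<bar>(LI s. indicator {a..b} s * expo_partial s i x)\<bar>"
    by (simp only: expo_parameter_integrals(3)[OF ab x])
  also have "\<dots> \<le> (LI s. \<bar>indicator {a..b} s * expo_partial s i x\<bar>)" by (rule integral_abs_bound)
  also have "\<dots> \<le> (LI s. (b * exp (- a * norm x)) * indicator {a..b} s)"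
  proof (rule integral_mono)
    have i: "integrable lborel (\<lambda>s. (b * exp (- a * norm x)) * indicator {a..b} s)"
      by (intro integrable_mult_right integrable_real_indicator) (auto simp: emeasure_lborel_Icc_eq)
    then show "integrable lborel (\<lambda>s. (b * exp (- a * norm x)) * indicator {a..b} s)" .
    have bd: "\<bar>indicator {a..b} s * expo_partial s i x\<bar> \<le> (b * exp (- a * norm x)) * indicator {a..b} s" for s
      using expo_parameter_bounds(3)[OF a _ _ x, of s b i] by (auto simp: indicator_def)
    then show "\<And>s. \<bar>indicator {a..b} s * expo_partial s i x\<bar> \<le> (b * exp (- a * norm x)) * indicator {a..b} s" .
    show "integrable lborel (\<lambda>s. \<bar>indicator {a..b} s * expo_partial s i x\<bar>)"
      by (rule Bochner_Integration.integrable_bound[OF i]) (unfold expo_partial_def, measurable, use bd in \<open>auto simp: expo_partial_def intro: order_trans[OF _ abs_ge_self]\<close>)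
  qed
  also have "\<dots> = b * (b - a) * exp (- a * norm x)" using ab by simp
  finally have "4 * pi * \<bar>yukawa_partial a i x - yukawa_partial b i x\<bar> \<le> b * (b - a) * exp (- a * norm x)" .
  moreover have "1 * \<bar>yukawa_partial a i x - yukawa_partial b i x\<bar> \<le> 4 * pi * \<bar>yukawa_partial a i x - yukawa_partial b i x\<bar>"
    using pi_gt3 by (intro mult_right_mono) auto
  ultimately show ?thesis by simp
qed

lemma yukawa_difference_L2_partial:
  assumes a: "0 < a" and ab: "a \<le> b"
  shows "L2_partial i (\<lambda>x. (yukawa a x - yukawa b x) *\<^sub>R q) (\<lambda>x. (yukawa_partial a i x - yukawa_partial b i x) *\<^sub>R q)"
proof (rule L2_partial_classical)
  show "sq_integrable (\<lambda>x. (yukawa a x - yukawa b x) *\<^sub>R q)"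
    using sq_integrable_diff[OF yukawa_sq_integrable[OF a] yukawa_sq_integrable, of b q q] a ab
    by (simp add: scaleR_diff_left)
  show "sq_integrable (\<lambda>x. (yukawa_partial a i x - yukawa_partial b i x) *\<^sub>R q)"
  proof (rule exp_decay_sq_integrable_real[OF a, of _ "b * (b - a)"])
    fix x :: space assume x: "x \<noteq> 0"
    have "b * (b - a) * exp (- a * norm x) \<le> b * (b - a) * (exp (- a * norm x) * (1 + 1 / norm x))"
      using a ab by (intro mult_left_mono) (auto simp: distrib_left)
    then show "\<bar>yukawa_partial a i x - yukawa_partial b i x\<bar> \<le> b * (b - a) * (exp (- a * norm x) * (1 + 1 / norm x))"
      using yukawa_difference_bounds[OF a ab x, of i] by linarith
  qed (use a ab in auto)
  show "continuous_on (- {0}) (\<lambda>x. (yukawa_partial a i x - yukawa_partial b i x) *\<^sub>R q)"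
    by (intro continuous_intros yukawa_partial_continuous)
  fix x :: space assume "x \<noteq> 0"
  then show "((\<lambda>s. (yukawa a (x + s *\<^sub>R axis i 1) - yukawa b (x + s *\<^sub>R axis i 1)) *\<^sub>R q) has_vector_derivative
      (yukawa_partial a i x - yukawa_partial b i x) *\<^sub>R q) (at 0)"
    by (intro scaleR_has_vector_derivative_const DERIV_diff yukawa_has_partial)
qed

text \<open>\<open>n\<^sup>2 yukawa n\<close> is an approximate identity at the origin.\<close>

lemma yukawa_approximate_identity:
  assumes \<phi>: "sq_integrable \<phi>" and cont: "isCont \<phi> 0"
  shows "(\<lambda>n. LI x. \<phi> x \<bullet> (((real n)\<^sup>2 * yukawa (real n) x) *\<^sub>R q)) \<longlonglongrightarrow> \<phi> 0 \<bullet> q"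
proof -
  note [measurable] = sq_integrable_measurable[OF \<phi>]
  define h where "h x = (\<phi> x - \<phi> 0) \<bullet> q" for x
  have [measurable]: "h \<in> borel_measurable borel" unfolding h_def by measurable
  have iq: "integrable lborel (\<lambda>x. \<phi> x \<bullet> (yukawa 1 x *\<^sub>R q))" by (rule integrable_inner_sq[OF \<phi> yukawa_sq_integrable]) simp
  have "integrable lborel (\<lambda>x. \<phi> x \<bullet> (yukawa 1 x *\<^sub>R q) - (\<phi> 0 \<bullet> q) * yukawa 1 x)"
    by (intro Bochner_Integration.integrable_diff iq integrable_mult_right yukawa_integrable) simp
  then have i1: "integrable lborel (\<lambda>x. yukawa 1 x * h x)"
    by (simp add: h_def algebra_simps)
  define A where "A = (LI x. yukawa 1 x * \<bar>h x\<bar>)"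
  have i1': "integrable lborel (\<lambda>x. yukawa 1 x * \<bar>h x\<bar>)"
    using integrable_abs[OF i1] by (simp add: abs_mult yukawa_nonneg)
  have split: "(LI x. \<phi> x \<bullet> ((n\<^sup>2 * yukawa n x) *\<^sub>R q)) - \<phi> 0 \<bullet> q = (LI x. n\<^sup>2 * yukawa n x * h x)"
    and int: "integrable lborel (\<lambda>x. n\<^sup>2 * yukawa n x * h x)"
    if n: "0 < n" for n :: real
  proof -
    have j: "integrable lborel (\<lambda>x. \<phi> x \<bullet> ((n\<^sup>2 * yukawa n x) *\<^sub>R q))"
      using integrable_mult_right[OF integrable_inner_sq[OF \<phi> yukawa_sq_integrable[OF n, of q]], of "n\<^sup>2"] by (simp add: mult.assoc)
    have k: "integrable lborel (\<lambda>x. (\<phi> 0 \<bullet> q) * (n\<^sup>2 * yukawa n x))"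
      by (intro integrable_mult_right yukawa_integrable n)
    have e: "n\<^sup>2 * yukawa n x * h x = \<phi> x \<bullet> ((n\<^sup>2 * yukawa n x) *\<^sub>R q) - (\<phi> 0 \<bullet> q) * (n\<^sup>2 * yukawa n x)" for x
      by (simp add: h_def inner_diff_left algebra_simps)
    show "integrable lborel (\<lambda>x. n\<^sup>2 * yukawa n x * h x)" unfolding e by (rule Bochner_Integration.integrable_diff[OF j k])
    show "(LI x. \<phi> x \<bullet> ((n\<^sup>2 * yukawa n x) *\<^sub>R q)) - \<phi> 0 \<bullet> q = (LI x. n\<^sup>2 * yukawa n x * h x)"
      unfolding e Bochner_Integration.integral_diff[OF j k] using n by (simp add: yukawa_integral)
  qed
  have "(\<lambda>n. (LI x. \<phi> x \<bullet> (((real n)\<^sup>2 * yukawa (real n) x) *\<^sub>R q)) - \<phi> 0 \<bullet> q) \<longlonglongrightarrow> 0"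
  proof (rule LIMSEQ_I)
    fix r :: real assume r: "0 < r"
    have "isCont h 0" unfolding h_def by (intro continuous_intros cont)
    moreover have "h 0 = 0" by (simp add: h_def)
    ultimately obtain d where d: "0 < d" "\<And>x. norm x < d \<Longrightarrow> \<bar>h x\<bar> < r / 2"
      using r unfolding continuous_at_eps_delta by (metis dist_0_norm dist_norm diff_zero half_gt_zero real_norm_def dist_commute)
    have lim: "(\<lambda>n. (exp d * A) * ((real n)\<^sup>2 * exp (- (d * real n)))) \<longlonglongrightarrow> (exp d * A) * 0"
    proof (intro tendsto_mult tendsto_const)
      have t: "filterlim (\<lambda>n. d * real n) at_top sequentially"
        by (intro filterlim_tendsto_pos_mult_at_top[OF tendsto_const d(1) filterlim_real_sequentially])
      have "(\<lambda>n. (1 / d\<^sup>2) * ((d * real n)^2 / exp (d * real n))) \<longlonglongrightarrow> (1 / d\<^sup>2) * 0"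
        by (intro tendsto_mult tendsto_const filterlim_compose[OF tendsto_power_div_exp_0 t])
      then show "(\<lambda>n. (real n)\<^sup>2 * exp (- (d * real n))) \<longlonglongrightarrow> 0"
        using d(1) by (simp add: exp_minus power_mult_distrib divide_inverse mult.assoc)
    qed
    then have "\<forall>\<^sub>F n in sequentially. (exp d * A) * ((real n)\<^sup>2 * exp (- (d * real n))) < r / 2"
      using r by (intro order_tendstoD) auto
    then have "\<forall>\<^sub>F n in sequentially. norm ((LI x. \<phi> x \<bullet> (((real n)\<^sup>2 * yukawa (real n) x) *\<^sub>R q)) - \<phi> 0 \<bullet> q - 0) < r"
      using eventually_ge_at_top[of 1]
    proof eventually_elim
      case (elim n)
      let ?n = "real n"
      have n: "1 \<le> ?n" "0 < ?n" using elim by auto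
      \<comment> \<open>Within distance d of the origin, continuity gives r/2 times an integrand of
        total mass 1. Outside, exp(-n|x|) is at most exp(-(n - 1) d) exp(-|x|), and the exponential
        gain beats the factor n^2.\<close>
      have pt: "\<bar>?n\<^sup>2 * yukawa ?n x * h x\<bar> \<le> (r / 2) * (?n\<^sup>2 * yukawa ?n x) + (?n\<^sup>2 * exp (- (?n - 1) * d)) * (yukawa 1 x * \<bar>h x\<bar>)" for x
      proof (cases "norm x < d")
        case True
        have "\<bar>?n\<^sup>2 * yukawa ?n x * h x\<bar> = (?n\<^sup>2 * yukawa ?n x) * \<bar>h x\<bar>" by (simp add: abs_mult yukawa_nonneg)
        also have "\<dots> \<le> (?n\<^sup>2 * yukawa ?n x) * (r / 2)" using d(2)[OF True] by (intro mult_left_mono) (auto simp: yukawa_nonneg)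
        finally have "\<bar>?n\<^sup>2 * yukawa ?n x * h x\<bar> \<le> (r / 2) * (?n\<^sup>2 * yukawa ?n x)" by (simp only: mult.commute)
        moreover have "0 \<le> (?n\<^sup>2 * exp (- (?n - 1) * d)) * (yukawa 1 x * \<bar>h x\<bar>)" by (simp add: yukawa_nonneg)
        ultimately show ?thesis by linarith
      next
        case False
        have "(?n - 1) * d \<le> (?n - 1) * norm x" using False n by (intro mult_left_mono) auto
        then have "exp (- ?n * norm x) \<le> exp (- (?n - 1) * d) * exp (- 1 * norm x)"
          by (simp flip: exp_add add: algebra_simps)
        then have "yukawa ?n x \<le> exp (- (?n - 1) * d) * yukawa 1 x"
          unfolding yukawa_def by (simp add: divide_right_mono)
        then have "?n\<^sup>2 * yukawa ?n x * \<bar>h x\<bar> \<le> ?n\<^sup>2 * (exp (- (?n - 1) * d) * yukawa 1 x) * \<bar>h x\<bar>"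
          by (intro mult_right_mono mult_left_mono) auto
        moreover have "\<bar>?n\<^sup>2 * yukawa ?n x * h x\<bar> = ?n\<^sup>2 * yukawa ?n x * \<bar>h x\<bar>" by (simp add: abs_mult yukawa_nonneg)
        moreover have "0 \<le> (r / 2) * (?n\<^sup>2 * yukawa ?n x)" using r by (simp add: yukawa_nonneg)
        ultimately show ?thesis by (simp add: mult.assoc)
      qed
      have "\<bar>(LI x. ?n\<^sup>2 * yukawa ?n x * h x)\<bar> \<le> (LI x. \<bar>?n\<^sup>2 * yukawa ?n x * h x\<bar>)" by (rule integral_abs_bound)
      also have "\<dots> \<le> (LI x. (r / 2) * (?n\<^sup>2 * yukawa ?n x) + (?n\<^sup>2 * exp (- (?n - 1) * d)) * (yukawa 1 x * \<bar>h x\<bar>))"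
        by (intro integral_mono integrable_abs int n pt Bochner_Integration.integrable_add integrable_mult_right i1' yukawa_integrable)
      also have "\<dots> = r / 2 + (?n\<^sup>2 * exp (- (?n - 1) * d)) * A"
        using n i1' by (simp add: yukawa_integral yukawa_integrable A_def)
      also have "(?n\<^sup>2 * exp (- (?n - 1) * d)) * A = (exp d * A) * (?n\<^sup>2 * exp (- (d * ?n)))"
        by (simp add: exp_add[symmetric] algebra_simps)
      finally show ?case using elim(1) unfolding split[OF n(2)] by simp
    qed
    then show "\<exists>no. \<forall>n\<ge>no. norm ((LI x. \<phi> x \<bullet> (((real n)\<^sup>2 * yukawa (real n) x) *\<^sub>R q)) - \<phi> 0 \<bullet> q - 0) < r"
      unfolding eventually_sequentially .
  qed
  then show ?thesis by (simp add: LIM_zero_iff)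
qed

text \<open>The Green function property: in the identity for G_a - G_b the rate b tends to infinity;
  G_b tends to 0 under a fixed majorant, and b^2 G_b becomes the Dirac mass at the origin.
  Continuity of \<phi> at 0 enters only here.\<close>

lemma yukawa_second_order:
  assumes f: "\<And>j. L2_partial j \<phi> (f j)" and F: "\<And>j. L2_partial j (f j) (F j)" and cont: "isCont \<phi> 0" and a: "0 < a"
  shows "(LI x. (\<Sum>j\<in>UNIV. F j x) \<bullet> (yukawa a x *\<^sub>R q)) =
     a\<^sup>2 * (LI x. \<phi> x \<bullet> (yukawa a x *\<^sub>R q)) - \<phi> 0 \<bullet> q"
proof -
  define L where "L x = (\<Sum>j\<in>UNIV. F j x)" for x
  note s\<phi> = L2_partial_sq(1)[OF f]
  have sL: "sq_integrable L" unfolding L_def by (intro sq_integrable_sum L2_partial_sq(2)[OF F])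
  note [measurable] = sq_integrable_measurable[OF s\<phi>] sq_integrable_measurable[OF sL]
  have e: "(LI x. L x \<bullet> (yukawa a x *\<^sub>R q)) - (LI x. L x \<bullet> (yukawa b x *\<^sub>R q)) =
     a\<^sup>2 * (LI x. \<phi> x \<bullet> (yukawa a x *\<^sub>R q)) - (LI x. \<phi> x \<bullet> ((b\<^sup>2 * yukawa b x) *\<^sub>R q))"
    if ab: "a \<le> b" for b
  proof -
    have b: "0 < b" using a ab by simp
    have i: "integrable lborel (\<lambda>x. h x \<bullet> ((k * yukawa c x) *\<^sub>R q))" if "0 < c" "sq_integrable h" for c h k
      using integrable_mult_right[OF integrable_inner_sq[OF that(2) yukawa_sq_integrable[OF that(1), of q]], of k] by (simp add: mult.assoc)
    have "(LI x. L x \<bullet> ((yukawa a x - yukawa b x) *\<^sub>R q)) = (LI x. L x \<bullet> (yukawa a x *\<^sub>R q)) - (LI x. L x \<bullet> (yukawa b x *\<^sub>R q))"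
      using Bochner_Integration.integral_diff[OF i[OF a sL, of 1] i[OF b sL, of 1]] by (simp add: left_diff_distrib)
    moreover have "(LI x. \<phi> x \<bullet> ((a\<^sup>2 * yukawa a x - b\<^sup>2 * yukawa b x) *\<^sub>R q)) = (LI x. \<phi> x \<bullet> ((a\<^sup>2 * yukawa a x) *\<^sub>R q)) - (LI x. \<phi> x \<bullet> ((b\<^sup>2 * yukawa b x) *\<^sub>R q))"
      using Bochner_Integration.integral_diff[OF i[OF a s\<phi>, of "a\<^sup>2"] i[OF b s\<phi>, of "b\<^sup>2"]] by (simp add: left_diff_distrib)
    moreover have "(LI x. \<phi> x \<bullet> ((a\<^sup>2 * yukawa a x) *\<^sub>R q)) = a\<^sup>2 * (LI x. \<phi> x \<bullet> (yukawa a x *\<^sub>R q))"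
      by (simp add: mult.assoc)
    ultimately show ?thesis using yukawa_difference_second_order[OF f F a ab, of q] unfolding L_def by simp
  qed
  have l0: "(\<lambda>n. LI x. L x \<bullet> (yukawa (real n) x *\<^sub>R q)) \<longlonglongrightarrow> (\<integral>x. 0 \<partial>(lborel :: space measure))"
  \<comment> \<open>The index is shifted by one since the rate 0 has no decay; from rate 1 on,
    \<open>yukawa 1\<close> is a majorant.\<close>
  proof (rule LIMSEQ_offset[where k = 1], rule integral_dominated_convergence)
    show "integrable lborel (\<lambda>x. \<bar>L x \<bullet> (yukawa 1 x *\<^sub>R q)\<bar>)"
      by (intro integrable_abs integrable_inner_sq sL yukawa_sq_integrable) simp
    show "AE x in lborel. (\<lambda>n. L x \<bullet> (yukawa (real (n + 1)) x *\<^sub>R q)) \<longlonglongrightarrow> 0"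
      using AE_nonzero
    proof eventually_elim
      case (elim x)
      have t: "filterlim (\<lambda>n. norm x * real (n + 1)) at_top sequentially"
        by (intro filterlim_tendsto_pos_mult_at_top[OF tendsto_const] filterlim_compose[OF filterlim_real_sequentially filterlim_add_const_nat_at_top]) (use elim in auto)
      have "(\<lambda>n. (norm x * real (n + 1)) ^ 0 / exp (norm x * real (n + 1))) \<longlonglongrightarrow> 0"
        by (rule filterlim_compose[OF tendsto_power_div_exp_0 t])
      moreover have "(norm x * real (n + 1)) ^ 0 / exp (norm x * real (n + 1)) = exp (- (real (n + 1)) * norm x)" for n
        by (metis exp_minus inverse_eq_divide mult.commute mult_minus_left power_0)
      ultimately have "(\<lambda>n. exp (- (real (n + 1)) * norm x)) \<longlonglongrightarrow> 0" by simp
      then have "(\<lambda>n. (exp (- (real (n + 1)) * norm x) / (4 * pi * norm x)) * (L x \<bullet> q)) \<longlonglongrightarrow> (0 / (4 * pi * norm x)) * (L x \<bullet> q)"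
        by (intro tendsto_intros) (use elim in auto)
      then show ?case by (simp add: yukawa_def)
    qed
    show "AE x in lborel. norm (L x \<bullet> (yukawa (real (n + 1)) x *\<^sub>R q)) \<le> \<bar>L x \<bullet> (yukawa 1 x *\<^sub>R q)\<bar>" for n
    proof (intro AE_I2)
      fix x :: space
      have "1 * norm x \<le> real (n + 1) * norm x" by (rule mult_right_mono) auto
      then have "exp (- (real (n + 1)) * norm x) \<le> exp (- 1 * norm x)"
        by (simp only: exp_le_cancel_iff mult_minus_left neg_le_iff_le)
      then have "yukawa (real (n + 1)) x \<le> yukawa 1 x" unfolding yukawa_def by (rule divide_right_mono) simp
      then show "norm (L x \<bullet> (yukawa (real (n + 1)) x *\<^sub>R q)) \<le> \<bar>L x \<bullet> (yukawa 1 x *\<^sub>R q)\<bar>"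
        by (simp add: abs_mult yukawa_nonneg mult_right_mono)
    qed
  qed measurable
  have l1: "(\<lambda>n. (LI x. L x \<bullet> (yukawa a x *\<^sub>R q)) - (LI x. L x \<bullet> (yukawa (real n) x *\<^sub>R q))) \<longlonglongrightarrow> (LI x. L x \<bullet> (yukawa a x *\<^sub>R q)) - (\<integral>x. 0 \<partial>(lborel :: space measure))"
    by (intro tendsto_diff tendsto_const l0)
  have l2: "(\<lambda>n. a\<^sup>2 * (LI x. \<phi> x \<bullet> (yukawa a x *\<^sub>R q)) - (LI x. \<phi> x \<bullet> (((real n)\<^sup>2 * yukawa (real n) x) *\<^sub>R q))) \<longlonglongrightarrow>
      a\<^sup>2 * (LI x. \<phi> x \<bullet> (yukawa a x *\<^sub>R q)) - \<phi> 0 \<bullet> q"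
    by (intro tendsto_diff tendsto_const yukawa_approximate_identity s\<phi> cont)
  have ev: "\<forall>\<^sub>F n in sequentially. a\<^sup>2 * (LI x. \<phi> x \<bullet> (yukawa a x *\<^sub>R q)) - (LI x. \<phi> x \<bullet> (((real n)\<^sup>2 * yukawa (real n) x) *\<^sub>R q)) =
     (LI x. L x \<bullet> (yukawa a x *\<^sub>R q)) - (LI x. L x \<bullet> (yukawa (real n) x *\<^sub>R q))"
    using eventually_ge_at_top[of "nat \<lceil>a\<rceil>"] by eventually_elim (rule e[symmetric], linarith)
  have "(LI x. L x \<bullet> (yukawa a x *\<^sub>R q)) - (\<integral>x. 0 \<partial>(lborel :: space measure)) = a\<^sup>2 * (LI x. \<phi> x \<bullet> (yukawa a x *\<^sub>R q)) - \<phi> 0 \<bullet> q"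
    by (rule LIMSEQ_unique[OF l1 Lim_transform_eventually[OF l2 ev]])
  then show ?thesis by (simp add: L_def)
qed

text \<open>The factor x_i cancels one power of 1/|x|, which brings both the Green function and its
  derivative back within the reach of integration by parts.\<close>

lemma coord_yukawa_L2_partial:
  assumes a: "0 < a"
  shows "L2_partial i (\<lambda>x. (x $ i * yukawa a x) *\<^sub>R q) (\<lambda>x. (yukawa a x + x $ i * yukawa_partial a i x) *\<^sub>R q)"
    "sq_integrable (\<lambda>x. (x $ i * yukawa_partial a i x) *\<^sub>R q)"
proof -
  have b1: "\<bar>x $ i * yukawa a x\<bar> \<le> 1 * (exp (- a * norm x) * (1 + 1 / norm x))" if x: "x \<noteq> 0" for x
  proof -
    have "\<bar>x $ i * yukawa a x\<bar> = \<bar>x $ i / norm x\<bar> * (exp (- a * norm x) / (4 * pi))"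
      by (simp add: yukawa_def abs_mult)
    also have "\<dots> \<le> 1 * (exp (- a * norm x) / 1)"
      using pi_gt3 by (intro mult_mono abs_nth_over_norm divide_left_mono) auto
    also have "\<dots> \<le> 1 * (exp (- a * norm x) * (1 + 1 / norm x))" by (simp add: distrib_left)
    finally show ?thesis .
  qed
  have b2: "\<bar>x $ i * yukawa_partial a i x\<bar> \<le> (a + 1) * (exp (- a * norm x) * (1 + 1 / norm x))" if x: "x \<noteq> 0" for x
  proof -
    have r: "norm x > 0" using x by simp
    have "x $ i * yukawa_partial a i x = - (x $ i / norm x * (x $ i / norm x) * (exp (- a * norm x) * (a + 1 / norm x) / (4 * pi)))"
      using r a by (simp add: yukawa_partial_def power3_eq_cube field_simps)
    then have "\<bar>x $ i * yukawa_partial a i x\<bar> = \<bar>x $ i / norm x\<bar> * \<bar>x $ i / norm x\<bar> * (exp (- a * norm x) * (a + 1 / norm x) / (4 * pi))"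
      using r a by (simp only: abs_minus_cancel abs_mult) simp
    also have "\<dots> \<le> 1 * 1 * (exp (- a * norm x) * (a + 1 / norm x) / 1)"
      using pi_gt3 a by (intro mult_mono abs_nth_over_norm divide_left_mono) auto
    also have "a + 1 / norm x \<le> (a + 1) * (1 + 1 / norm x)" using a r by (simp add: field_simps)
    finally show ?thesis by (simp add: mult_left_mono mult_ac)
  qed
  have s1: "sq_integrable (\<lambda>x. (x $ i * yukawa a x) *\<^sub>R q)"
    by (rule exp_decay_sq_integrable_real[OF a _ _ b1]) auto
  show s2: "sq_integrable (\<lambda>x. (x $ i * yukawa_partial a i x) *\<^sub>R q)"
    by (rule exp_decay_sq_integrable_real[OF a _ _ b2]) (use a in auto)
  show "L2_partial i (\<lambda>x. (x $ i * yukawa a x) *\<^sub>R q) (\<lambda>x. (yukawa a x + x $ i * yukawa_partial a i x) *\<^sub>R q)"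
  proof (rule L2_partial_classical[OF s1])
    show "sq_integrable (\<lambda>x. (yukawa a x + x $ i * yukawa_partial a i x) *\<^sub>R q)"
      using sq_integrable_add[OF yukawa_sq_integrable[OF a] s2] by (simp add: scaleR_add_left)
    show "continuous_on (- {0}) (\<lambda>x. (yukawa a x + x $ i * yukawa_partial a i x) *\<^sub>R q)"
      unfolding yukawa_def[abs_def] by (intro continuous_intros yukawa_partial_continuous) auto
    fix x :: space assume x: "x \<noteq> 0"
    have 1: "((\<lambda>s. (x + s *\<^sub>R axis i 1) $ i) has_real_derivative 1) (at 0)"
      by (auto intro!: derivative_eq_intros)
    have "((\<lambda>s. (x + s *\<^sub>R axis i 1) $ i * yukawa a (x + s *\<^sub>R axis i 1)) has_real_derivative
       (1 * yukawa a (x + 0 *\<^sub>R axis i 1) + yukawa_partial a i x * (x + 0 *\<^sub>R axis i 1) $ i)) (at 0)"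
      by (rule DERIV_mult[OF 1 yukawa_has_partial[OF x]])
    then have "((\<lambda>s. (x + s *\<^sub>R axis i 1) $ i * yukawa a (x + s *\<^sub>R axis i 1)) has_real_derivative
       (yukawa a x + x $ i * yukawa_partial a i x)) (at 0)" by (simp add: mult.commute)
    then show "((\<lambda>s. ((x + s *\<^sub>R axis i 1) $ i * yukawa a (x + s *\<^sub>R axis i 1)) *\<^sub>R q) has_vector_derivative
      (yukawa a x + x $ i * yukawa_partial a i x) *\<^sub>R q) (at 0)"
      by (rule scaleR_has_vector_derivative_const)
  qed
qed

lemma sum_coord_yukawa_partial:
  assumes x: "x \<noteq> (0::space)"
  shows "(\<Sum>i\<in>UNIV. x $ i * yukawa_partial a i x) = - yukawa a x - a / (4 * pi) * expo a x"
proof -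
  define r where "r = norm x"
  have r: "r \<noteq> 0" using x by (simp add: r_def)
  have n: "(\<Sum>i\<in>UNIV. (x $ i)\<^sup>2) = r\<^sup>2" by (simp add: r_def norm_vec_def L2_set_def sum_nonneg)
  have "(\<Sum>i\<in>UNIV. x $ i * yukawa_partial a i x) = (- (a * r + 1) * exp (- a * r) / (4 * pi * r^3)) * (\<Sum>i\<in>UNIV. (x $ i)\<^sup>2)"
    unfolding yukawa_partial_def r_def sum_distrib_left by (intro sum.cong refl) (simp add: power2_eq_square)
  also have "\<dots> = - (exp (- a * r) / (4 * pi * r)) - a / (4 * pi) * exp (- a * r)"
    unfolding n using r by (simp add: field_simps power2_eq_square power3_eq_cube)
  finally show ?thesis by (simp add: yukawa_def expo_def r_def)
qed

text \<open>The field \<open>x\<close> applied to the Green function gives \<open>- G - (a / 4\<pi>) exp (-a r)\<close>, whose pairing with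
  \<open>\<Delta>\<phi>\<close> is explicit.\<close>

lemma virial_cross_term:
  assumes f: "\<And>j. L2_partial j \<phi> (f j)" and F: "\<And>j. L2_partial j (f j) (F j)" and cont: "isCont \<phi> 0" and a: "0 < a"
  shows "(\<Sum>i\<in>UNIV. - (LI x. (\<Sum>j\<in>UNIV. F j x) \<bullet> ((x $ i * yukawa_partial a i x) *\<^sub>R q))
      - a\<^sup>2 * (LI x. f i x \<bullet> ((x $ i * yukawa a x) *\<^sub>R q))) =
     a\<^sup>2 * (LI x. \<phi> x \<bullet> (yukawa a x *\<^sub>R q)) - \<phi> 0 \<bullet> q"
proof -
  define L where "L x = (\<Sum>j\<in>UNIV. F j x)" for x
  define PG where "PG = (LI x. \<phi> x \<bullet> (yukawa a x *\<^sub>R q))"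
  define PE where "PE = (LI x. \<phi> x \<bullet> (expo a x *\<^sub>R q))"
  note s\<phi> = L2_partial_sq(1)[OF f]
  have sL: "sq_integrable L" unfolding L_def by (intro sq_integrable_sum L2_partial_sq(2)[OF F])
  note [measurable] = sq_integrable_measurable[OF s\<phi>] sq_integrable_measurable[OF sL]
  note sY = yukawa_sq_integrable[OF a, of q] and sE = expo_sq_integrable(1)[OF a, of q] and sX = coord_yukawa_L2_partial(2)[OF a]
  \<comment> \<open>Stated for general \<open>h\<close> because it is used twice: with the Laplacian
    of \<phi> and, after an integration by parts, with \<phi> itself.\<close>
  have split: "(\<Sum>i\<in>UNIV. LI x. h x \<bullet> ((x $ i * yukawa_partial a i x) *\<^sub>R q)) =
     - (LI x. h x \<bullet> (yukawa a x *\<^sub>R q)) - a / (4 * pi) * (LI x. h x \<bullet> (expo a x *\<^sub>R q))"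
    if h: "sq_integrable h" for h
  proof -
    note [measurable] = sq_integrable_measurable[OF h]
    have "(\<Sum>i\<in>UNIV. LI x. h x \<bullet> ((x $ i * yukawa_partial a i x) *\<^sub>R q)) = (LI x. (\<Sum>i\<in>UNIV. h x \<bullet> ((x $ i * yukawa_partial a i x) *\<^sub>R q)))"
      by (rule Bochner_Integration.integral_sum[symmetric]) (rule integrable_inner_sq[OF h sX])
    also have "\<dots> = (LI x. - (h x \<bullet> (yukawa a x *\<^sub>R q)) - a / (4 * pi) * (h x \<bullet> (expo a x *\<^sub>R q)))"
    proof (rule integral_cong_AE)
      show "AE x in lborel. (\<Sum>i\<in>UNIV. h x \<bullet> ((x $ i * yukawa_partial a i x) *\<^sub>R q)) = - (h x \<bullet> (yukawa a x *\<^sub>R q)) - a / (4 * pi) * (h x \<bullet> (expo a x *\<^sub>R q))"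
        using AE_nonzero
      proof eventually_elim
        case (elim x)
        have "(\<Sum>i\<in>UNIV. h x \<bullet> ((x $ i * yukawa_partial a i x) *\<^sub>R q)) = (\<Sum>i\<in>UNIV. x $ i * yukawa_partial a i x) * (h x \<bullet> q)"
          by (simp add: sum_distrib_right)
        then show ?case unfolding sum_coord_yukawa_partial[OF elim] by (simp add: left_diff_distrib mult.assoc)
      qed
    qed measurable
    also have "\<dots> = (LI x. - (h x \<bullet> (yukawa a x *\<^sub>R q))) - (LI x. a / (4 * pi) * (h x \<bullet> (expo a x *\<^sub>R q)))"
      by (intro Bochner_Integration.integral_diff integrable_minus integrable_mult_right integrable_inner_sq h sY sE)
    finally show ?thesis by simp
  qed
  have E: "(LI x. L x \<bullet> (expo a x *\<^sub>R q)) = a\<^sup>2 * PE - 8 * pi * a * PG"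
  proof -
    have "(LI x. L x \<bullet> (expo a x *\<^sub>R q)) = (LI x. \<phi> x \<bullet> (((a\<^sup>2 - 2 * a / norm x) * expo a x) *\<^sub>R q))"
      unfolding L_def by (rule expo_second_order[OF f F a])
    also have "\<dots> = (LI x. a\<^sup>2 * (\<phi> x \<bullet> (expo a x *\<^sub>R q)) - (8 * pi * a) * (\<phi> x \<bullet> (yukawa a x *\<^sub>R q)))"
    proof (rule integral_cong_AE)
      show "AE x in lborel. \<phi> x \<bullet> (((a\<^sup>2 - 2 * a / norm x) * expo a x) *\<^sub>R q) = a\<^sup>2 * (\<phi> x \<bullet> (expo a x *\<^sub>R q)) - (8 * pi * a) * (\<phi> x \<bullet> (yukawa a x *\<^sub>R q))"
        by (intro AE_I2) (simp add: expo_def yukawa_def algebra_simps)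
    qed measurable
    also have "\<dots> = (LI x. a\<^sup>2 * (\<phi> x \<bullet> (expo a x *\<^sub>R q))) - (LI x. (8 * pi * a) * (\<phi> x \<bullet> (yukawa a x *\<^sub>R q)))"
      by (intro Bochner_Integration.integral_diff integrable_mult_right integrable_inner_sq s\<phi> sY sE)
    finally show ?thesis by (simp add: PE_def PG_def)
  qed
  have Y: "(LI x. L x \<bullet> (yukawa a x *\<^sub>R q)) = a\<^sup>2 * PG - \<phi> 0 \<bullet> q"
    unfolding L_def PG_def by (rule yukawa_second_order[OF f F cont a])
  have "(\<Sum>i\<in>UNIV. LI x. f i x \<bullet> ((x $ i * yukawa a x) *\<^sub>R q)) =
     (\<Sum>i\<in>UNIV. - (LI x. \<phi> x \<bullet> ((yukawa a x + x $ i * yukawa_partial a i x) *\<^sub>R q)))"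
    by (intro sum.cong refl integration_by_parts[OF f coord_yukawa_L2_partial(1)[OF a]])
  also have "\<dots> = (\<Sum>i\<in>(UNIV::3 set). - (PG + (LI x. \<phi> x \<bullet> ((x $ i * yukawa_partial a i x) *\<^sub>R q))))"
  proof (intro sum.cong refl)
    fix i :: 3
    show "- (LI x. \<phi> x \<bullet> ((yukawa a x + x $ i * yukawa_partial a i x) *\<^sub>R q)) = - (PG + (LI x. \<phi> x \<bullet> ((x $ i * yukawa_partial a i x) *\<^sub>R q)))"
      using Bochner_Integration.integral_add[OF integrable_inner_sq[OF s\<phi> sY] integrable_inner_sq[OF s\<phi> sX[of i]]]
      by (simp add: PG_def distrib_right)
  qed
  also have "\<dots> = - 3 * PG + PG + a / (4 * pi) * PE"
    unfolding sum_negf sum.distrib split[OF s\<phi>] by (simp add: PG_def PE_def)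
  finally have S: "(\<Sum>i\<in>UNIV. LI x. f i x \<bullet> ((x $ i * yukawa a x) *\<^sub>R q)) = - 2 * PG + a / (4 * pi) * PE" by simp
  \<comment> \<open>The pairings with exp(-a|x|) cancel: a/(4 pi) times \<open>E\<close> contributes
    a^3/(4 pi) PE, and - a^2 times \<open>S\<close> contributes the opposite. The coefficients of PG
    add up to a^2 - 2 a^2 + 2 a^2.\<close>
  have "(\<Sum>i\<in>UNIV. - (LI x. L x \<bullet> ((x $ i * yukawa_partial a i x) *\<^sub>R q))
      - a\<^sup>2 * (LI x. f i x \<bullet> ((x $ i * yukawa a x) *\<^sub>R q))) = a\<^sup>2 * PG - \<phi> 0 \<bullet> q"
    unfolding sum_subtractf sum_negf sum_distrib_left[symmetric] S split[OF sL] E Y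
    by (simp add: field_simps power2_eq_square)
  then show ?thesis by (simp add: L_def PG_def)
qed

section \<open>The charge and the quadratic form\<close>

lemma L2_partial_AE_cong:
  assumes f: "L2_partial i f g" and ae: "AE x in lborel. f x = h x" and h: "h \<in> borel_measurable borel"
  shows "L2_partial i h g"
  unfolding L2_partial_def
proof (intro conjI allI)
  show "sq_integrable h"
    by (rule sq_integrable_AE_bound[OF L2_partial_sq(1)[OF f] h, of 1]) (use ae in \<open>auto elim!: eventually_mono\<close>)
  show "sq_integrable g" by (rule L2_partial_sq[OF f])
  fix t
  show "AE x in lborel. h (x + t *\<^sub>R axis i 1) - h x = t *\<^sub>R (\<integral>s. g (x + (s * t) *\<^sub>R axis i 1) \<partial>unif01)"
    using L2_partialD[OF f, of t] ae AE_shift[OF ae, of "t *\<^sub>R axis i 1"] by eventually_elim simp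
qed

lemma L2_partial_unique:
  assumes g: "L2_partial i f g" and h: "L2_partial i f h"
  shows "AE x in lborel. g x = h x"
proof -
  note sg = L2_partial_sq(2)[OF g] and sh = L2_partial_sq(2)[OF h]
  have sd: "sq_integrable (\<lambda>x. g x - h x)" by (rule sq_integrable_diff[OF sg sh])
  have "AE x in lborel. g x - h x = 0"
  proof (rule fundamental_lemma)
    show "integrable lborel (\<lambda>x. indicator (box a b) x *\<^sub>R (g x - h x))" for a b by (rule sq_integrable_box[OF sd])
    show "(\<lambda>x. g x - h x) \<in> borel_measurable borel" by (rule sq_integrable_measurable[OF sd])
    fix \<eta> assume \<eta>: "\<eta> \<in> bumps"
    show "(LI x. \<eta> x *\<^sub>R (g x - h x)) = 0"
    proof (rule complex_zero_inner)
      fix c :: complex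
      note w = bumps_L2_partial[OF \<eta>, of i c]
      have "(LI x. \<eta> x *\<^sub>R (g x - h x)) \<bullet> c = (LI x. (\<eta> x *\<^sub>R (g x - h x)) \<bullet> c)"
        by (rule integral_inner_left[symmetric]) (rule sq_integrable_times_bump[OF sd \<eta>])
      also have "\<dots> = (LI x. g x \<bullet> (\<eta> x *\<^sub>R c) - h x \<bullet> (\<eta> x *\<^sub>R c))"
        by (intro Bochner_Integration.integral_cong refl) (simp add: inner_diff_left algebra_simps)
      also have "\<dots> = (LI x. g x \<bullet> (\<eta> x *\<^sub>R c)) - (LI x. h x \<bullet> (\<eta> x *\<^sub>R c))"
        by (rule Bochner_Integration.integral_diff; rule integrable_inner_sq; rule sg sh L2_partial_sq(1)[OF w])
      also have "\<dots> = 0" unfolding integration_by_parts[OF g w] integration_by_parts[OF h w] by simp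
      finally show "(LI x. \<eta> x *\<^sub>R (g x - h x)) \<bullet> c = 0" .
    qed
  qed
  then show ?thesis by eventually_elim simp
qed

text \<open>From 1 - c r \<le> exp(-c r) \<le> 1: Green functions of all rates have the same Coulomb
  singularity up to a bounded error, so the charge can be read off at the origin.\<close>

lemma yukawa_near_coulomb:
  assumes c: "0 < c" and x: "x \<noteq> (0 :: space)"
  shows "\<bar>yukawa c x - 1 / (4 * pi * norm x)\<bar> \<le> c"
proof -
  define r where "r = norm x"
  have r: "0 < r" using x by (simp add: r_def)
  have "1 - c * r \<le> exp (- c * r)" using exp_ge_add_one_self[of "- c * r"] by simp
  moreover have "exp (- c * r) \<le> 1" using c r by simp
  ultimately have "\<bar>exp (- c * r) - 1\<bar> \<le> c * r" by linarith
  then have "\<bar>exp (- c * r) - 1\<bar> / (4 * pi * r) \<le> (c * r) / (4 * pi * r)" using r by (intro divide_right_mono) auto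
  also have "\<dots> = c / (4 * pi)" using r by simp
  also have "\<dots> \<le> c / 1" by (rule divide_left_mono) (use c pi_gt3 in auto)
  finally have "\<bar>exp (- c * r) - 1\<bar> / (4 * pi * r) \<le> c" by simp
  moreover have "\<bar>yukawa c x - 1 / (4 * pi * norm x)\<bar> = \<bar>exp (- c * r) - 1\<bar> / (4 * pi * r)"
    using r by (simp add: yukawa_def r_def[symmetric] diff_divide_distrib[symmetric] abs_divide)
  ultimately show ?thesis by simp
qed

text \<open>A difference of Green functions with different charges is too singular: its increments over a
  shift by \<open>t\<close> have \<open>L\<^sup>2\<close> norm of order \<open>t\<^bsup>1/2\<^esup>\<close>, whereas those of an \<open>H\<^sup>1\<close> function are of order \<open>t\<close>.\<close>

lemma charge_unique:
  assumes f1: "L2_partial i \<phi>1 f1" and f2: "L2_partial i \<phi>2 f2" and a: "0 < a" and b: "0 < b"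
    and ae: "AE x in lborel. \<phi>1 x + yukawa a x *\<^sub>R q1 = \<phi>2 x + yukawa b x *\<^sub>R q2"
  shows "q1 = q2"
proof (rule ccontr)
  assume "q1 \<noteq> q2"
  define k where "k = cmod (q2 - q1) / (4 * pi)"
  have k: "0 < k" using \<open>q1 \<noteq> q2\<close> by (simp add: k_def)
  define D where "D x = \<phi>1 x - \<phi>2 x" for x
  define H where "H = (LI x. (cmod (f1 x - f2 x))\<^sup>2)"
  have LP: "L2_partial i D (\<lambda>x. f1 x - f2 x)" unfolding D_def by (rule L2_partial_diff[OF f1 f2])
  define E where "E x = yukawa b x *\<^sub>R q2 - yukawa a x *\<^sub>R q1" for x
  have DE: "AE x in lborel. D x = E x" using ae by eventually_elim (simp add: D_def E_def algebra_simps)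
  define C where "C = b * cmod q2 + a * cmod q1"
  have C0: "0 \<le> C" using a b by (simp add: C_def)
  have R: "cmod (E x - (1 / (4 * pi * norm x)) *\<^sub>R (q2 - q1)) \<le> C" if "x \<noteq> 0" for x
  proof -
    have "E x - (1 / (4 * pi * norm x)) *\<^sub>R (q2 - q1) = (yukawa b x - 1 / (4 * pi * norm x)) *\<^sub>R q2 - (yukawa a x - 1 / (4 * pi * norm x)) *\<^sub>R q1"
      by (simp add: E_def algebra_simps)
    also have "cmod \<dots> \<le> \<bar>yukawa b x - 1 / (4 * pi * norm x)\<bar> * cmod q2 + \<bar>yukawa a x - 1 / (4 * pi * norm x)\<bar> * cmod q1"
      by (rule order_trans[OF norm_triangle_ineq4]) simp
    also have "\<dots> \<le> C" unfolding C_def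
      by (intro add_mono mult_right_mono yukawa_near_coulomb a b that) auto
    finally show ?thesis .
  qed
  \<comment> \<open>For |x| \<le> t/4 the shifted point y has norm at least 3t/4, so 1/|x| - 1/|y|
    is at least 4/t - 4/(3t) = 8/(3t). Of the resulting 8/3 (k/t), the bounded error 2 C costs at
    most k/t.\<close>
  have low: "k / t \<le> cmod (E (x + t *\<^sub>R axis i 1) - E x)"
    if t: "0 < t" "2 * C * t \<le> k" and x: "x \<noteq> 0" "norm x \<le> t / 4" for t x
  proof -
    let ?y = "x + t *\<^sub>R axis i 1"
    have "t = norm (t *\<^sub>R axis i 1 :: space)" using t by simp
    also have "\<dots> \<le> norm ?y + norm x" using norm_triangle_ineq4[of ?y x] by simp
    finally have y: "3 / 4 * t \<le> norm ?y" using x by linarith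
    then have y0: "?y \<noteq> 0" using t by auto
    define u where "u = 1 / (4 * pi * norm x) - 1 / (4 * pi * norm ?y)"
    have "0 < norm ?y" using y0 by (rule zero_less_norm_iff[THEN iffD2])
    then have "1 / norm ?y \<le> 1 / (3 / 4 * t)" using y t by (intro divide_left_mono mult_pos_pos) auto
    moreover have "1 / (t / 4) \<le> 1 / norm x" using x t by (intro divide_left_mono mult_pos_pos) auto
    ultimately have "8 / (3 * t) \<le> 1 / norm x - 1 / norm ?y" by (simp add: field_simps)
    then have "8 / (3 * t) / (4 * pi) \<le> (1 / norm x - 1 / norm ?y) / (4 * pi)" by (rule divide_right_mono) simp
    then have u: "8 / (3 * t) / (4 * pi) \<le> u" by (simp add: u_def diff_divide_distrib mult.commute)
    have "u *\<^sub>R (q2 - q1) = (E x - (1 / (4 * pi * norm ?y)) *\<^sub>R (q2 - q1)) - (E x - (1 / (4 * pi * norm x)) *\<^sub>R (q2 - q1))"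
      by (simp add: u_def algebra_simps)
    also have "\<dots> = (E ?y - (1 / (4 * pi * norm ?y)) *\<^sub>R (q2 - q1)) - (E x - (1 / (4 * pi * norm x)) *\<^sub>R (q2 - q1)) - (E ?y - E x)"
      by simp
    also have "cmod \<dots> \<le> cmod (E ?y - (1 / (4 * pi * norm ?y)) *\<^sub>R (q2 - q1)) + cmod (E x - (1 / (4 * pi * norm x)) *\<^sub>R (q2 - q1)) + cmod (E ?y - E x)"
      by (rule order_trans[OF norm_triangle_ineq4 add_right_mono[OF norm_triangle_ineq4]])
    also have "\<dots> \<le> C + C + cmod (E ?y - E x)" by (intro add_mono R y0 x) simp
    finally have "\<bar>u\<bar> * cmod (q2 - q1) \<le> 2 * C + cmod (E ?y - E x)" by simp
    moreover have "8 / (3 * t) / (4 * pi) * cmod (q2 - q1) \<le> \<bar>u\<bar> * cmod (q2 - q1)" using u by (intro mult_right_mono) auto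
    moreover have "8 / (3 * t) / (4 * pi) * cmod (q2 - q1) = 8 / 3 * (k / t)" by (simp add: k_def)
    moreover have "2 * C \<le> k / t" using t by (simp add: field_simps)
    moreover have "0 \<le> k / t" using k t by simp
    ultimately show ?thesis by linarith
  qed
  have main: "pi / 48 * k\<^sup>2 \<le> t * H" if t: "0 < t" "2 * C * t \<le> k" for t
  proof -
    let ?B = "cball (0::space) (t / 4)"
    note [measurable] = sq_integrable_measurable[OF L2_partial_sq(1)[OF LP]]
    have sD: "sq_integrable (\<lambda>x. D (x + t *\<^sub>R axis i 1) - D x)"
      by (rule sq_integrable_diff[OF sq_integrable_shift[OF L2_partial_sq(1)[OF LP]] L2_partial_sq(1)[OF LP]])
    have fin: "emeasure lborel ?B < \<infinity>" using emeasure_bounded_finite[OF bounded_cball] by auto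
    \<comment> \<open>The ball has volume pi t^3/48, so the increments have squared norm at least
      (k/t)^2 pi t^3/48, which is linear in t; the L^2 derivative allows only t^2 H.\<close>
    have "measure lborel ?B = 4 / 3 * pi * (t / 4) ^ 3"
      using t by (simp add: measure_def emeasure_cball unit_ball_vol_3)
    then have "(k / t)\<^sup>2 * (4 / 3 * pi * (t / 4) ^ 3) = (LI x. (k / t)\<^sup>2 * indicator ?B x)"
      using fin by simp
    also have "\<dots> \<le> (LI x. (cmod (D (x + t *\<^sub>R axis i 1) - D x))\<^sup>2)"
    proof (rule integral_mono_AE)
      show "integrable lborel (\<lambda>x. (k / t)\<^sup>2 * indicator ?B x)"
        by (intro integrable_mult_right integrable_real_indicator fin) simp
      show "integrable lborel (\<lambda>x. (cmod (D (x + t *\<^sub>R axis i 1) - D x))\<^sup>2)" by (rule sq_integrable_integrable[OF sD])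
      show "AE x in lborel. (k / t)\<^sup>2 * indicator ?B x \<le> (cmod (D (x + t *\<^sub>R axis i 1) - D x))\<^sup>2"
        using AE_nonzero DE AE_shift[OF DE, of "t *\<^sub>R axis i 1"]
      proof eventually_elim
        case (elim x)
        show ?case
        proof (cases "x \<in> ?B")
          case True
          then have "k / t \<le> cmod (D (x + t *\<^sub>R axis i 1) - D x)" unfolding elim by (intro low t elim) simp
          then show ?thesis using True k t by (simp add: power_mono)
        qed simp
      qed
    qed
    also have "\<dots> \<le> t\<^sup>2 * H" unfolding H_def by (rule L2_partial_shift_bound[OF LP])
    also have "(k / t)\<^sup>2 * (4 / 3 * pi * (t / 4) ^ 3) = t * (pi / 48 * k\<^sup>2)"
      using t by (simp add: field_simps power2_eq_square power3_eq_cube)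
    finally have "t * (pi / 48 * k\<^sup>2) \<le> t * (t * H)" by (simp add: power2_eq_square mult.assoc)
    then show ?thesis using t by simp
  qed
  have H0: "0 \<le> H" by (simp add: H_def)
  \<comment> \<open>The first entry makes t admissible for \<open>main\<close>; the second makes t H
    at most half of the lower bound pi/48 k^2.\<close>
  define t where "t = min (k / (2 * C + 1)) ((pi / 96 * k\<^sup>2) / (H + 1))"
  have t: "0 < t" using k C0 H0 by (simp add: t_def)
  have "2 * C * t \<le> (2 * C + 1) * t" using t by (intro mult_right_mono) auto
  also have "\<dots> \<le> (2 * C + 1) * (k / (2 * C + 1))" using C0 by (intro mult_left_mono) (auto simp: t_def)
  also have "\<dots> = k" using C0 by simp
  finally have tC: "2 * C * t \<le> k" .
  have "t * H \<le> (pi / 96 * k\<^sup>2) / (H + 1) * (H + 1)" using H0 t by (intro mult_mono) (auto simp: t_def)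
  also have "\<dots> = pi / 96 * k\<^sup>2"
  proof -
    have cancel: "z / (H + 1) * (H + 1) = z" for z using H0 by (simp add: field_simps)
    show ?thesis by (rule cancel)
  qed
  finally have "pi / 48 * k\<^sup>2 \<le> pi / 96 * k\<^sup>2" using main[OF t tC] by linarith
  moreover have "0 < pi * k\<^sup>2" using k by simp
  ultimately show False by simp
qed

section \<open>Independence of the quadratic form from the decomposition\<close>

definition form_value :: "real \<Rightarrow> real \<Rightarrow> complex \<Rightarrow> (space \<Rightarrow> complex) \<Rightarrow> (3 \<Rightarrow> space \<Rightarrow> complex) \<Rightarrow> real" where
  "form_value \<alpha> a q \<phi> f = (\<Sum>j\<in>UNIV. LI x. (cmod (f j x))\<^sup>2)
     + a\<^sup>2 * ((LI x. (cmod (\<phi> x))\<^sup>2) - (LI x. (cmod (\<phi> x + yukawa a x *\<^sub>R q))\<^sup>2))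
     + (\<alpha> + a / (4 * pi)) * (cmod q)\<^sup>2"

lemma integral_norm_add_sq:
  assumes f: "sq_integrable f" and g: "sq_integrable g"
  shows "(LI x. (cmod (f x + g x))\<^sup>2) = (LI x. (cmod (f x))\<^sup>2) + 2 * (LI x. f x \<bullet> g x) + (LI x. (cmod (g x))\<^sup>2)"
proof -
  have "(cmod (f x + g x))\<^sup>2 = (cmod (f x))\<^sup>2 + 2 * (f x \<bullet> g x) + (cmod (g x))\<^sup>2" for x
    by (simp add: power2_norm_eq_inner inner_add_left inner_add_right inner_commute)
  then show ?thesis
    using sq_integrable_integrable[OF f] sq_integrable_integrable[OF g] integrable_inner_sq[OF f g] by simp
qed

text \<open>Everything is expanded in \<phi>1 and d = (G_a - G_b) q. The first-order identity turns
  the gradient terms into pairings without derivatives, and all terms containing \<phi>1 cancel.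
  There remains (b^2 - a^2) times the pairing of G_a q with G_b q, which by
  \<open>yukawa_product\<close> is (b - a)/(4 pi) |q|^2, exactly the change in the charge term. The
  order a \<le> b serves the integration over rates.\<close>

lemma form_value_invariant_le:
  assumes f1: "\<And>j. L2_partial j \<phi>1 (f1 j)" and f2: "\<And>j. L2_partial j \<phi>2 (f2 j)" and a: "0 < a" and ab: "a \<le> b"
    and ae: "AE x in lborel. \<phi>1 x + yukawa a x *\<^sub>R q = \<phi>2 x + yukawa b x *\<^sub>R q"
  shows "form_value \<alpha> b q \<phi>2 f2 = form_value \<alpha> a q \<phi>1 f1"
proof -
  have b: "0 < b" using a ab by simp
  note s1 = L2_partial_sq(1)[OF f1] and s2 = L2_partial_sq(1)[OF f2]
  note sf1 = L2_partial_sq(2)[OF f1] and sf2 = L2_partial_sq(2)[OF f2]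
  note [measurable] = sq_integrable_measurable[OF s1] sq_integrable_measurable[OF s2]
  define d where "d x = (yukawa a x - yukawa b x) *\<^sub>R q" for x
  define d' where "d' j x = (yukawa_partial a j x - yukawa_partial b j x) *\<^sub>R q" for j x
  have dL: "L2_partial j d (d' j)" for j unfolding d_def[abs_def] d'_def[abs_def] by (rule yukawa_difference_L2_partial[OF a ab])
  note sd = L2_partial_sq(1)[OF dL] and sd' = L2_partial_sq(2)[OF dL]
  note [measurable] = sq_integrable_measurable[OF sd]
  have \<phi>2: "AE x in lborel. \<phi>2 x = \<phi>1 x + d x" using ae by eventually_elim (simp add: d_def algebra_simps)
  have f2_eq: "AE x in lborel. f2 j x = f1 j x + d' j x" for j
  proof (rule L2_partial_unique[OF L2_partial_AE_cong[OF f2 \<phi>2] L2_partial_add[OF f1 dL]])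
  qed measurable
  define P where "P = (LI x. \<phi>1 x \<bullet> (yukawa a x *\<^sub>R q))"
  define R where "R = (LI x. \<phi>1 x \<bullet> (yukawa b x *\<^sub>R q))"
  define N where "N = (LI x. (cmod (\<phi>1 x))\<^sup>2)"
  define S where "S = (\<Sum>j\<in>UNIV. LI x. (cmod (f1 j x))\<^sup>2)"
  define Y where "Y s t = (LI x. (yukawa s x *\<^sub>R q) \<bullet> (yukawa t x *\<^sub>R q))" for s t
  have Y: "Y s t = (cmod q)\<^sup>2 / (4 * pi * (s + t))" if "0 < s" "0 < t" for s t
  proof -
    have "Y s t = (LI x. (cmod q)\<^sup>2 * (yukawa s x * yukawa t x))"
      unfolding Y_def by (simp add: power2_norm_eq_inner mult_ac)
    then show ?thesis using yukawa_product[OF that] by simp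
  qed
  note ya = yukawa_sq_integrable[OF a, of q] and yb = yukawa_sq_integrable[OF b, of q]
  have lin: "(LI x. h x \<bullet> ((s * yukawa a x - t * yukawa b x) *\<^sub>R q)) =
      s * (LI x. h x \<bullet> (yukawa a x *\<^sub>R q)) - t * (LI x. h x \<bullet> (yukawa b x *\<^sub>R q))" if h: "sq_integrable h" for h s t
  proof -
    have "(LI x. h x \<bullet> ((s * yukawa a x - t * yukawa b x) *\<^sub>R q)) =
      (LI x. s * (h x \<bullet> (yukawa a x *\<^sub>R q)) - t * (h x \<bullet> (yukawa b x *\<^sub>R q)))"
      by (intro Bochner_Integration.integral_cong refl) (simp add: left_diff_distrib mult.assoc)
    also have "\<dots> = (LI x. s * (h x \<bullet> (yukawa a x *\<^sub>R q))) - (LI x. t * (h x \<bullet> (yukawa b x *\<^sub>R q)))"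
      by (intro Bochner_Integration.integral_diff integrable_mult_right integrable_inner_sq h ya yb)
    finally show ?thesis by simp
  qed
  have dd: "(LI x. d x \<bullet> h x) = (LI x. (yukawa a x *\<^sub>R q) \<bullet> h x) - (LI x. (yukawa b x *\<^sub>R q) \<bullet> h x)"
    if h: "sq_integrable h" for h
    using lin[OF h, of 1 1] by (simp add: d_def inner_commute)
  have S2: "(\<Sum>j\<in>UNIV. LI x. (cmod (f2 j x))\<^sup>2) =
     S + 2 * (\<Sum>j\<in>UNIV. LI x. f1 j x \<bullet> d' j x) + (\<Sum>j\<in>UNIV. LI x. d' j x \<bullet> d' j x)"
  proof -
    have "(LI x. (cmod (f2 j x))\<^sup>2) = (LI x. (cmod (f1 j x))\<^sup>2) + 2 * (LI x. f1 j x \<bullet> d' j x) + (LI x. d' j x \<bullet> d' j x)" for j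
    proof -
      note [measurable] = sq_integrable_measurable[OF sf1] sq_integrable_measurable[OF sf2] sq_integrable_measurable[OF sd']
      have "(LI x. (cmod (f2 j x))\<^sup>2) = (LI x. (cmod (f1 j x + d' j x))\<^sup>2)"
        by (rule integral_cong_AE) (measurable, use f2_eq[of j] in \<open>auto elim!: eventually_mono\<close>)
      then show ?thesis unfolding integral_norm_add_sq[OF sf1 sd'] by (simp add: power2_norm_eq_inner)
    qed
    then show ?thesis by (simp add: S_def sum.distrib sum_distrib_left)
  qed
  have e1: "(\<Sum>j\<in>UNIV. LI x. f1 j x \<bullet> d' j x) = - (a\<^sup>2 * P - b\<^sup>2 * R)"
    unfolding d'_def yukawa_difference_first_order[OF f1 a ab] lin[OF s1] P_def R_def ..
  have e2: "(\<Sum>j\<in>UNIV. LI x. d' j x \<bullet> d' j x) = - (a\<^sup>2 * (Y a a - Y b a) - b\<^sup>2 * (Y a b - Y b b))"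
    using yukawa_difference_first_order[OF dL a ab, of q]
    unfolding d'_def[symmetric] lin[OF sd] dd[OF ya] dd[OF yb] Y_def by simp
  have \<phi>2n: "(LI x. (cmod (\<phi>2 x))\<^sup>2) = N + 2 * (P - R) + (Y a a - Y b a - (Y a b - Y b b))"
  proof -
    have "(LI x. (cmod (\<phi>2 x))\<^sup>2) = (LI x. (cmod (\<phi>1 x + d x))\<^sup>2)"
      by (rule integral_cong_AE) (measurable, use \<phi>2 in \<open>auto elim!: eventually_mono\<close>)
    also have "\<dots> = N + 2 * (LI x. \<phi>1 x \<bullet> d x) + (LI x. d x \<bullet> d x)"
      unfolding integral_norm_add_sq[OF s1 sd] N_def by (simp add: power2_norm_eq_inner)
    also have "(LI x. \<phi>1 x \<bullet> d x) = P - R"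
      using lin[OF s1, of 1 1] by (simp add: d_def P_def R_def)
    also have "(LI x. d x \<bullet> d x) = (Y a a - Y b a - (Y a b - Y b b))"
      using lin[OF sd, of 1 1] dd[OF ya] dd[OF yb] by (simp add: d_def[symmetric] Y_def)
    finally show ?thesis .
  qed
  have un: "(LI x. (cmod (\<phi>1 x + yukawa a x *\<^sub>R q))\<^sup>2) = N + 2 * P + Y a a"
    unfolding integral_norm_add_sq[OF s1 ya] N_def P_def Y_def by (simp only: power2_norm_eq_inner)
  have un2: "(LI x. (cmod (\<phi>2 x + yukawa b x *\<^sub>R q))\<^sup>2) = N + 2 * P + Y a a"
    unfolding un[symmetric]
    by (rule integral_cong_AE) (measurable, use ae in \<open>auto elim!: eventually_mono\<close>)
  have yab: "Y b a = Y a b" by (simp add: Y_def inner_commute)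
  have "(b\<^sup>2 - a\<^sup>2) * Y a b = (b - a) / (4 * pi) * (cmod q)\<^sup>2"
  proof -
    have "b\<^sup>2 - a\<^sup>2 = (b - a) * (a + b)" by (simp add: power2_eq_square algebra_simps)
    moreover have "a + b \<noteq> 0" using a b by simp
    ultimately show ?thesis unfolding Y[OF a b] by simp
  qed
  then show ?thesis
    unfolding form_value_def S2 e1 e2 \<phi>2n un un2 S_def[symmetric] N_def[symmetric] yab
    by (simp add: algebra_simps diff_divide_distrib)
qed

lemma form_value_invariant:
  assumes f1: "\<And>j. L2_partial j \<phi>1 (f1 j)" and f2: "\<And>j. L2_partial j \<phi>2 (f2 j)" and a: "0 < a" and b: "0 < b"
    and ae: "AE x in lborel. \<phi>1 x + yukawa a x *\<^sub>R q = \<phi>2 x + yukawa b x *\<^sub>R q"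
  shows "form_value \<alpha> b q \<phi>2 f2 = form_value \<alpha> a q \<phi>1 f1"
proof (cases "a \<le> b")
  case True
  show ?thesis by (rule form_value_invariant_le[OF f1 f2 a True ae])
next
  case False
  have ae': "AE x in lborel. \<phi>2 x + yukawa b x *\<^sub>R q = \<phi>1 x + yukawa a x *\<^sub>R q" using ae by eventually_elim simp
  show ?thesis by (rule form_value_invariant_le[OF f2 f1 b _ ae', symmetric]) (use False in simp)
qed

lemma sobolev_1_form_value:
  assumes \<phi>: "\<phi> \<in> sobolev 1" and u: "u \<in> L2" and lam: "0 < lam" and dec: "decomposes u \<phi> q lam"
  shows "\<exists>\<phi>0 f. \<phi>0 \<in> borel_measurable borel \<and> (AE x in lborel. \<phi> x = \<phi>0 x) \<and> (\<forall>j. L2_partial j \<phi>0 (f j)) \<and>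
     (AE x in lborel. u x = \<phi>0 x + yukawa (sqrt lam) x *\<^sub>R q) \<and>
     (L2_norm (weak_grad \<phi>))\<^sup>2 + lam * ((L2_norm \<phi>)\<^sup>2 - (L2_norm u)\<^sup>2) + (\<alpha> + sqrt lam / (4 * pi)) * (cmod q)\<^sup>2
       = form_value \<alpha> (sqrt lam) q \<phi>0 f"
proof -
  have m\<phi>: "\<phi> \<in> borel_measurable lebesgue" using sobolev_subset_L2[OF \<phi>] by (simp add: L2_def)
  obtain \<phi>0 where \<phi>0: "\<phi>0 \<in> borel_measurable borel" "AE x in lborel. \<phi> x = \<phi>0 x"
    using complex_borel_representative[OF m\<phi>] by blast
  obtain f where f: "\<And>j. L2_partial j \<phi>0 (f j)" "\<And>j. AE x in lborel. weak_partial j \<phi> x = f j x"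
    using sobolev_1_L2_partial[OF \<phi> \<phi>0] by blast
  note [measurable] = \<phi>0(1) sq_integrable_measurable[OF L2_partial_sq(2)[OF f(1)]]
  have u0: "AE x in lborel. u x = \<phi>0 x + yukawa (sqrt lam) x *\<^sub>R q"
    using dec \<phi>0(2) unfolding decomposes_def AE_lebesgue_iff
    by eventually_elim (simp add: green_eq_yukawa scaleR_conv_of_real mult.commute)
  have wm: "weak_partial j \<phi> \<in> borel_measurable lebesgue" for j
  proof -
    obtain h where "has_weak_partial j \<phi> h" using \<phi> by auto
    from weak_partial_AE(1)[OF this] show ?thesis by (auto simp: has_weak_partial_def intro: locally_integrable_measurable)
  qed
  have n: "(norm (weak_grad \<phi> x))\<^sup>2 = (\<Sum>j\<in>UNIV. (cmod (weak_partial j \<phi> x))\<^sup>2)" for x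
    by (simp add: weak_grad_def norm_vec_def L2_set_def sum_nonneg)
  have "(L2_norm (weak_grad \<phi>))\<^sup>2 = (\<integral>x. (\<Sum>j\<in>UNIV. (cmod (weak_partial j \<phi> x))\<^sup>2) \<partial>lebesgue)"
    by (simp add: L2_norm_def n[symmetric])
  also have "\<dots> = (LI x. (\<Sum>j\<in>UNIV. (cmod (f j x))\<^sup>2))"
  proof (rule integral_lebesgue_eq)
    show "(\<lambda>x. \<Sum>j\<in>UNIV. (cmod (weak_partial j \<phi> x))\<^sup>2) \<in> borel_measurable lebesgue"
      using wm by measurable
    have "AE x in lborel. \<forall>j. weak_partial j \<phi> x = f j x" using f(2) by (simp add: AE_all_countable)
    then show "AE x in lborel. (\<Sum>j\<in>UNIV. (cmod (weak_partial j \<phi> x))\<^sup>2) = (\<Sum>j\<in>UNIV. (cmod (f j x))\<^sup>2)"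
      by eventually_elim simp
  qed measurable
  also have "\<dots> = (\<Sum>j\<in>UNIV. LI x. (cmod (f j x))\<^sup>2)"
    by (rule Bochner_Integration.integral_sum) (rule sq_integrable_integrable[OF L2_partial_sq(2)[OF f(1)]])
  finally have g: "(L2_norm (weak_grad \<phi>))\<^sup>2 = (\<Sum>j\<in>UNIV. LI x. (cmod (f j x))\<^sup>2)" .
  have un: "(L2_norm u)\<^sup>2 = (LI x. (cmod (\<phi>0 x + yukawa (sqrt lam) x *\<^sub>R q))\<^sup>2)"
    by (rule L2_norm_eq[OF _ _ u0]) (use u in \<open>auto simp: L2_def\<close>)
  have "(L2_norm (weak_grad \<phi>))\<^sup>2 + lam * ((L2_norm \<phi>)\<^sup>2 - (L2_norm u)\<^sup>2) + (\<alpha> + sqrt lam / (4 * pi)) * (cmod q)\<^sup>2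
       = form_value \<alpha> (sqrt lam) q \<phi>0 f"
    using lam by (simp add: form_value_def g un L2_norm_eq[OF m\<phi> \<phi>0])
  then show ?thesis using \<phi>0 f(1) u0 by blast
qed

text \<open>Justifies the definite description in \<open>energy_form\<close>: any decomposition has
  the same charge by \<open>charge_unique\<close>, and for a fixed charge the value does not depend
  on the rate.\<close>

lemma energy_form_eq:
  assumes \<phi>: "\<phi> \<in> sobolev 1" and u: "u \<in> L2" and lam: "0 < lam" and dec: "decomposes u \<phi> q lam"
    and \<phi>0: "\<phi>0 \<in> borel_measurable borel" "AE x in lborel. \<phi> x = \<phi>0 x" and f0: "\<And>j. L2_partial j \<phi>0 (f0 j)"
  shows "energy_form \<alpha> u = form_value \<alpha> (sqrt lam) q \<phi>0 f0"
  unfolding energy_form_def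
proof (rule the_equality)
  have u0: "AE x in lborel. u x = \<phi>0 x + yukawa (sqrt lam) x *\<^sub>R q"
    using dec \<phi>0(2) unfolding decomposes_def AE_lebesgue_iff
    by eventually_elim (simp add: green_eq_yukawa scaleR_conv_of_real mult.commute)
  have inv: "(L2_norm (weak_grad \<psi>))\<^sup>2 + mu * ((L2_norm \<psi>)\<^sup>2 - (L2_norm u)\<^sup>2) + (\<alpha> + sqrt mu / (4 * pi)) * (cmod p)\<^sup>2
      = form_value \<alpha> (sqrt lam) q \<phi>0 f0"
    if \<psi>: "\<psi> \<in> sobolev 1" and mu: "0 < mu" and d: "decomposes u \<psi> p mu" for \<psi> mu p
  proof -
    obtain \<psi>0 g where g: "\<And>j. L2_partial j \<psi>0 (g j)" "AE x in lborel. u x = \<psi>0 x + yukawa (sqrt mu) x *\<^sub>R p"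
      and e: "(L2_norm (weak_grad \<psi>))\<^sup>2 + mu * ((L2_norm \<psi>)\<^sup>2 - (L2_norm u)\<^sup>2) + (\<alpha> + sqrt mu / (4 * pi)) * (cmod p)\<^sup>2
        = form_value \<alpha> (sqrt mu) p \<psi>0 g"
      using sobolev_1_form_value[OF \<psi> u mu d, of \<alpha>] by blast
    have ae: "AE x in lborel. \<phi>0 x + yukawa (sqrt lam) x *\<^sub>R q = \<psi>0 x + yukawa (sqrt mu) x *\<^sub>R p"
      using u0 g(2) by eventually_elim simp
    have pq: "q = p" by (rule charge_unique[OF f0 g(1) _ _ ae]) (use lam mu in auto)
    have "form_value \<alpha> (sqrt mu) p \<psi>0 g = form_value \<alpha> (sqrt lam) q \<phi>0 f0"
      unfolding pq by (rule form_value_invariant[OF f0 g(1)]) (use lam mu ae pq in auto)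
    then show ?thesis using e by simp
  qed
  show "\<exists>\<psi> p mu. \<psi> \<in> sobolev 1 \<and> 0 < mu \<and> decomposes u \<psi> p mu \<and> form_value \<alpha> (sqrt lam) q \<phi>0 f0 =
      (L2_norm (weak_grad \<psi>))\<^sup>2 + mu * ((L2_norm \<psi>)\<^sup>2 - (L2_norm u)\<^sup>2) + (\<alpha> + sqrt mu / (4 * pi)) * (cmod p)\<^sup>2"
    using inv[OF \<phi> lam dec] \<phi> lam dec by (intro exI[of _ \<phi>] exI[of _ q] exI[of _ lam]) simp
  fix r
  assume "\<exists>\<psi> p mu. \<psi> \<in> sobolev 1 \<and> 0 < mu \<and> decomposes u \<psi> p mu \<and> r =
      (L2_norm (weak_grad \<psi>))\<^sup>2 + mu * ((L2_norm \<psi>)\<^sup>2 - (L2_norm u)\<^sup>2) + (\<alpha> + sqrt mu / (4 * pi)) * (cmod p)\<^sup>2"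
  then show "r = form_value \<alpha> (sqrt lam) q \<phi>0 f0" using inv by blast
qed

section \<open>Shear flows\<close>

text \<open>\<open>\<xi> 0 = 0\<close> together with slope at most 1 gives |\<xi>(s)| \<le> |s|: the
  origin stays fixed, and points near it move by a small fraction of their distance to it. This is
  what keeps the singular part of \<open>u\<close> under control. A continuous derivative makes the
  change of variables elementary.\<close>

definition shear_field :: "(real \<Rightarrow> real) \<Rightarrow> (real \<Rightarrow> real) \<Rightarrow> real \<Rightarrow> real \<Rightarrow> bool" where
  "shear_field \<xi> \<xi>' M L \<longleftrightarrow> weight \<xi> \<xi>' M L \<and> (\<forall>s. (\<xi> has_real_derivative \<xi>' s) (at s)) \<and>
     continuous_on UNIV \<xi>' \<and> (\<forall>s. 0 \<le> \<xi>' s) \<and> \<xi> 0 = 0"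

lemma shear_field_bounds:
  assumes "shear_field \<xi> \<xi>' M L"
  shows "\<bar>\<xi> s\<bar> \<le> M" "0 \<le> \<xi>' s" "\<xi>' s \<le> 1" "\<bar>\<xi> a - \<xi> b\<bar> \<le> \<bar>a - b\<bar>" "\<bar>\<xi> s\<bar> \<le> \<bar>s\<bar>" "0 \<le> M"
proof -
  have w: "weight \<xi> \<xi>' M L" using assms by (simp add: shear_field_def)
  show 1: "\<bar>\<xi> s\<bar> \<le> M" for s using w by (simp add: weight_def)
  show "0 \<le> \<xi>' s" using assms by (simp add: shear_field_def)
  show "\<xi>' s \<le> 1" using w by (auto simp: weight_def abs_le_iff)
  have l: "\<bar>\<xi> (s + t) - \<xi> s\<bar> \<le> \<bar>t\<bar>" for s t using w by (simp add: weight_def)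
  show 2: "\<bar>\<xi> a - \<xi> b\<bar> \<le> \<bar>a - b\<bar>" for a b using l[of b "a - b"] by simp
  show "\<bar>\<xi> s\<bar> \<le> \<bar>s\<bar>" using 2[of s 0] assms by (simp add: shear_field_def)
  show "0 \<le> M" using 1[of 0] by linarith
qed

text \<open>The inverse of r - t \<xi>(r). Defining the map through its inverse makes the inverse
  and its Jacobian explicit; an ODE flow would have them only implicitly, and the first-order
  behaviour in t is the same.\<close>

definition shear :: "(real \<Rightarrow> real) \<Rightarrow> real \<Rightarrow> real \<Rightarrow> real" where
  "shear \<xi> t s = (THE r. r - t * \<xi> r = s)"

text \<open>Existence by the intermediate value theorem, since t \<xi> is bounded by M; uniqueness
  because t \<xi> contracts by the factor 1/2.\<close>

lemma shear_ex1:
  assumes \<xi>: "shear_field \<xi> \<xi>' M L" and t: "\<bar>t\<bar> \<le> 1 / 2"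
  shows "\<exists>!r. r - t * \<xi> r = s"
proof (rule ex_ex1I)
  note b = shear_field_bounds[OF \<xi>]
  have tM: "\<bar>t * \<xi> r\<bar> \<le> M" for r
  proof -
    have "\<bar>t * \<xi> r\<bar> \<le> 1 * M" unfolding abs_mult using t b(1)[of r] by (intro mult_mono) auto
    then show ?thesis by simp
  qed
  have "continuous_on UNIV \<xi>"
    using \<xi> by (auto simp: shear_field_def intro!: continuous_at_imp_continuous_on DERIV_isCont)
  then have "continuous_on {s - M..s + M} (\<lambda>r. r - t * \<xi> r)"
    by (intro continuous_intros) (auto intro: continuous_on_subset)
  moreover have "(s - M) - t * \<xi> (s - M) \<le> s" "s \<le> (s + M) - t * \<xi> (s + M)"
    using tM[of "s - M"] tM[of "s + M"] by (auto simp: abs_le_iff)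
  moreover have "s - M \<le> s + M" using b(6) by simp
  ultimately show "\<exists>r. r - t * \<xi> r = s" using IVT'[of "\<lambda>r. r - t * \<xi> r" "s - M" s "s + M"] by blast
  fix r r' assume "r - t * \<xi> r = s" "r' - t * \<xi> r' = s"
  then have "r - r' = t * (\<xi> r - \<xi> r')" by (simp add: algebra_simps)
  then have "\<bar>r - r'\<bar> = \<bar>t\<bar> * \<bar>\<xi> r - \<xi> r'\<bar>" by (simp add: abs_mult)
  also have "\<dots> \<le> 1 / 2 * \<bar>r - r'\<bar>" by (intro mult_mono b t) auto
  finally show "r = r'" by simp
qed

lemma shear_eq:
  assumes \<xi>: "shear_field \<xi> \<xi>' M L" and t: "\<bar>t\<bar> \<le> 1 / 2"
  shows "shear \<xi> t s - t * \<xi> (shear \<xi> t s) = s" "shear \<xi> t (r - t * \<xi> r) = r"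
proof -
  show "shear \<xi> t s - t * \<xi> (shear \<xi> t s) = s"
    unfolding shear_def by (rule theI') (rule shear_ex1[OF assms])
  show "shear \<xi> t (r - t * \<xi> r) = r"
    unfolding shear_def by (rule the1_equality[OF shear_ex1[OF assms]]) simp
qed

text \<open>The first two bounds are the expansion in t. The third bounds the displacement relative
  to |s|, as needed at the singularity. The fourth makes the map continuous and so
  measurable.\<close>

lemma shear_bounds:
  assumes \<xi>: "shear_field \<xi> \<xi>' M L" and t: "\<bar>t\<bar> \<le> 1 / 2"
  shows "\<bar>shear \<xi> t s - s\<bar> \<le> \<bar>t\<bar> * M" "\<bar>shear \<xi> t s - s - t * \<xi> s\<bar> \<le> t\<^sup>2 * M"
    "\<bar>shear \<xi> t s - s\<bar> \<le> 2 * \<bar>t\<bar> * \<bar>s\<bar>" "\<bar>shear \<xi> t a - shear \<xi> t b\<bar> \<le> 2 * \<bar>a - b\<bar>"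
proof -
  note b = shear_field_bounds[OF \<xi>]
  have e: "shear \<xi> t s - s = t * \<xi> (shear \<xi> t s)" for s using shear_eq(1)[OF assms, of s] by simp
  show 1: "\<bar>shear \<xi> t s - s\<bar> \<le> \<bar>t\<bar> * M" unfolding e abs_mult by (intro mult_left_mono b) auto
  have "shear \<xi> t s - s - t * \<xi> s = t * (\<xi> (shear \<xi> t s) - \<xi> s)" unfolding e by (simp add: algebra_simps)
  then have "\<bar>shear \<xi> t s - s - t * \<xi> s\<bar> = \<bar>t\<bar> * \<bar>\<xi> (shear \<xi> t s) - \<xi> s\<bar>" by (simp add: abs_mult)
  also have "\<dots> \<le> \<bar>t\<bar> * (\<bar>t\<bar> * M)" by (intro mult_left_mono order_trans[OF b(4) 1]) auto
  finally show "\<bar>shear \<xi> t s - s - t * \<xi> s\<bar> \<le> t\<^sup>2 * M" by (simp add: power2_eq_square mult.assoc[symmetric])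
  have "\<bar>shear \<xi> t s - s\<bar> \<le> \<bar>t\<bar> * \<bar>shear \<xi> t s\<bar>" unfolding e abs_mult by (intro mult_left_mono b) auto
  also have "\<dots> \<le> \<bar>t\<bar> * (\<bar>s\<bar> + \<bar>shear \<xi> t s - s\<bar>)" by (intro mult_left_mono) auto
  also have "\<dots> \<le> \<bar>t\<bar> * \<bar>s\<bar> + 1 / 2 * \<bar>shear \<xi> t s - s\<bar>" unfolding distrib_left using t by (intro add_left_mono mult_right_mono) auto
  finally show "\<bar>shear \<xi> t s - s\<bar> \<le> 2 * \<bar>t\<bar> * \<bar>s\<bar>" by simp
  have "shear \<xi> t a - shear \<xi> t b = (a - b) + t * (\<xi> (shear \<xi> t a) - \<xi> (shear \<xi> t b))"
    using e[of a] e[of b] by (simp add: algebra_simps)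
  then have "\<bar>shear \<xi> t a - shear \<xi> t b\<bar> \<le> \<bar>a - b\<bar> + \<bar>t\<bar> * \<bar>\<xi> (shear \<xi> t a) - \<xi> (shear \<xi> t b)\<bar>"
    by (metis abs_mult abs_triangle_ineq)
  also have "\<dots> \<le> \<bar>a - b\<bar> + 1 / 2 * \<bar>shear \<xi> t a - shear \<xi> t b\<bar>" by (intro add_left_mono mult_mono b t) auto
  finally show "\<bar>shear \<xi> t a - shear \<xi> t b\<bar> \<le> 2 * \<bar>a - b\<bar>" by simp
qed

section \<open>Shears of space and the change of variables\<close>

definition shear_map :: "(real \<Rightarrow> real) \<Rightarrow> real \<Rightarrow> 3 \<Rightarrow> space \<Rightarrow> space" where
  "shear_map \<xi> t i x = x + (shear \<xi> t (x $ i) - x $ i) *\<^sub>R axis i 1"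

definition shear_inv :: "(real \<Rightarrow> real) \<Rightarrow> real \<Rightarrow> 3 \<Rightarrow> space \<Rightarrow> space" where
  "shear_inv \<xi> t i x = x - (t * \<xi> (x $ i)) *\<^sub>R axis i 1"

lemma shear_map_inverse:
  assumes \<xi>: "shear_field \<xi> \<xi>' M L" and t: "\<bar>t\<bar> \<le> 1 / 2"
  shows "shear_map \<xi> t i (shear_inv \<xi> t i x) = x" "shear_inv \<xi> t i (shear_map \<xi> t i x) = x"
proof -
  have "(shear_inv \<xi> t i x) $ i = x $ i - t * \<xi> (x $ i)" by (simp add: shear_inv_def)
  then have "shear_map \<xi> t i (shear_inv \<xi> t i x) = shear_inv \<xi> t i x + (x $ i - (x $ i - t * \<xi> (x $ i))) *\<^sub>R axis i 1"
    unfolding shear_map_def by (simp only: shear_eq(2)[OF assms])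
  then show "shear_map \<xi> t i (shear_inv \<xi> t i x) = x" by (simp add: shear_inv_def)
  have "(shear_map \<xi> t i x) $ i = shear \<xi> t (x $ i)" by (simp add: shear_map_def)
  then have "shear_inv \<xi> t i (shear_map \<xi> t i x) = shear_map \<xi> t i x - (t * \<xi> (shear \<xi> t (x $ i))) *\<^sub>R axis i 1"
    by (simp add: shear_inv_def)
  also have "t * \<xi> (shear \<xi> t (x $ i)) = shear \<xi> t (x $ i) - x $ i" using shear_eq(1)[OF assms, of "x $ i"] by simp
  finally show "shear_inv \<xi> t i (shear_map \<xi> t i x) = x" by (simp add: shear_map_def)
qed

lemma shear_map_measurable:
  assumes \<xi>: "shear_field \<xi> \<xi>' M L" and t: "\<bar>t\<bar> \<le> 1 / 2"
  shows "shear_map \<xi> t i \<in> borel_measurable borel"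
proof -
  have "continuous_on UNIV (shear \<xi> t)"
  proof (rule lipschitz_on_continuous_on[of 2])
    show "2-lipschitz_on UNIV (shear \<xi> t)"
      by (rule lipschitz_onI) (use shear_bounds(4)[OF assms] in \<open>auto simp: dist_real_def\<close>)
  qed
  then have [measurable]: "shear \<xi> t \<in> borel_measurable borel" by (rule borel_measurable_continuous_onI)
  show ?thesis unfolding shear_map_def[abs_def] by measurable
qed

lemma shear_inv_jacobian:
  fixes i :: 3
  shows "det (matrix (\<lambda>v::space. v - (c * v $ i) *\<^sub>R axis i 1)) = 1 - c"
proof -
  let ?A = "matrix (\<lambda>v::space. v - (c * v $ i) *\<^sub>R axis i 1)"
  have e: "?A $ j $ k = (if j = k then (if j = i then 1 - c else 1) else 0)" for j k
    by (auto simp: matrix_def axis_def)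
  have "det ?A = prod (\<lambda>j. ?A $ j $ j) UNIV"
    by (rule det_diagonal) (simp add: e)
  also have "\<dots> = (\<Prod>j\<in>UNIV. if j = i then 1 - c else 1)" by (simp add: e)
  also have "\<dots> = 1 - c" by (simp add: prod.delta)
  finally show ?thesis .
qed

text \<open>The preimage of a box under the implicitly defined map is the image of the box under its
  explicit inverse, which is differentiable and injective; its volume is the integral of the
  Jacobian over the box. Boxes determine the measure.\<close>

lemma distr_shear_map:
  assumes \<xi>: "shear_field \<xi> \<xi>' M L" and t: "\<bar>t\<bar> \<le> 1 / 2"
  shows "distr lborel borel (shear_map \<xi> t i) = density lborel (\<lambda>x. ennreal (1 - t * \<xi>' (x $ i)))"
proof -
  note [measurable] = shear_map_measurable[OF assms, of i]
  have c\<xi>': "continuous_on UNIV \<xi>'" using \<xi> by (simp add: shear_field_def)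
  have [measurable]: "\<xi>' \<in> borel_measurable borel" by (rule borel_measurable_continuous_onI[OF c\<xi>'])
  have J0: "0 \<le> 1 - t * \<xi>' s" for s
  proof -
    have "\<bar>t * \<xi>' s\<bar> \<le> 1 * 1" unfolding abs_mult using t shear_field_bounds(2,3)[OF \<xi>, of s] by (intro mult_mono) auto
    then show ?thesis by linarith
  qed
  have main: "emeasure (distr lborel borel (shear_map \<xi> t i)) (box a b) = emeasure (density lborel (\<lambda>x. ennreal (1 - t * \<xi>' (x $ i)))) (box a b) \<and>
      emeasure (density lborel (\<lambda>x. ennreal (1 - t * \<xi>' (x $ i)))) (box a b) \<noteq> \<infinity>" for a b :: space
  proof -
    let ?S = "box a b"
    let ?f' = "\<lambda>x v. v - (t * \<xi>' (x $ i) * v $ i) *\<^sub>R axis i 1 :: space"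
    let ?J = "\<lambda>x. 1 - t * \<xi>' (x $ i)"
    have der: "(shear_inv \<xi> t i has_derivative ?f' x) (at x within ?S)" for x
    proof -
      have "(\<xi> has_derivative (*) (\<xi>' (x $ i))) (at (x $ i))" using \<xi> by (simp add: shear_field_def has_field_derivative_def)
      then have "((\<lambda>x. \<xi> (x $ i)) has_derivative (\<lambda>v. \<xi>' (x $ i) * (v $ i))) (at x within ?S)"
        by (rule has_derivative_compose[rotated]) (intro bounded_linear.has_derivative[OF bounded_linear_vec_nth] has_derivative_ident)
      then show ?thesis unfolding shear_inv_def[abs_def]
        by (auto intro!: derivative_eq_intros simp: mult.assoc)
    qed
    have inj: "inj_on (shear_inv \<xi> t i) ?S" by (metis inj_onI shear_map_inverse(1)[OF assms])
    have cJ: "continuous_on S ?J" for S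
      by (intro continuous_intros continuous_on_compose2[OF c\<xi>']) auto
    have intJ: "integrable lborel (\<lambda>x. indicator (cbox a b) x *\<^sub>R ?J x)"
      by (rule borel_integrable_compact) (auto intro: cJ)
    have intB: "integrable lborel (\<lambda>x. indicator ?S x *\<^sub>R ?J x)"
    proof (rule Bochner_Integration.integrable_bound[OF intJ])
      show "AE x in lborel. norm (indicator ?S x *\<^sub>R ?J x) \<le> norm (indicator (cbox a b) x *\<^sub>R ?J x)"
        using box_subset_cbox[of a b] by (auto simp: indicator_def)
    qed measurable
    have hi: "(?J has_integral (LI x. indicator ?S x *\<^sub>R ?J x)) ?S"
    proof -
      have "((\<lambda>x. indicator ?S x *\<^sub>R ?J x) has_integral (LI x. indicator ?S x *\<^sub>R ?J x)) UNIV"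
        by (rule has_integral_integral_lborel[OF intB])
      moreover have "(\<lambda>x. indicator ?S x *\<^sub>R ?J x) = (\<lambda>x. if x \<in> ?S then ?J x else 0)" by (auto simp: indicator_def)
      ultimately show ?thesis by (simp add: has_integral_restrict_UNIV)
    qed
    have absJ: "\<bar>det (matrix (?f' x))\<bar> = ?J x" for x
      unfolding shear_inv_jacobian using J0[of "x $ i"] by simp
    have hm: "shear_inv \<xi> t i ` ?S \<in> lmeasurable \<and> measure lebesgue (shear_inv \<xi> t i ` ?S) = (LI x. indicator ?S x *\<^sub>R ?J x)"
      by (subst has_measure_differentiable_image[OF _ der inj]) (use hi in \<open>auto simp: absJ\<close>)
    have im: "shear_inv \<xi> t i ` ?S = shear_map \<xi> t i -` ?S"
      using shear_map_inverse[OF assms, of i] by (auto simp: image_iff) metis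
    have bm: "shear_map \<xi> t i -` ?S \<in> sets borel"
      using measurable_sets[OF shear_map_measurable[OF assms, of i], of ?S] by simp
    have "emeasure (distr lborel borel (shear_map \<xi> t i)) ?S = emeasure lborel (shear_map \<xi> t i -` ?S)"
      by (subst emeasure_distr) auto
    also have "\<dots> = emeasure lebesgue (shear_inv \<xi> t i ` ?S)"
      unfolding im using bm by simp
    also have "\<dots> = ennreal (LI x. indicator ?S x *\<^sub>R ?J x)"
      unfolding emeasure_eq_measure2[OF conjunct1[OF hm]] conjunct2[OF hm] ..
    also have "\<dots> = (NI x. ennreal (indicator ?S x *\<^sub>R ?J x))"
      by (rule nn_integral_eq_integral[symmetric, OF intB]) (use J0 in auto)
    also have "\<dots> = emeasure (density lborel (\<lambda>x. ennreal (?J x))) ?S"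
      by (subst emeasure_density) (auto intro!: nn_integral_cong simp: indicator_def)
    finally have e: "emeasure (distr lborel borel (shear_map \<xi> t i)) ?S = emeasure (density lborel (\<lambda>x. ennreal (?J x))) ?S" .
    moreover have "emeasure (density lborel (\<lambda>x. ennreal (?J x))) ?S = (NI x. ennreal (indicator ?S x *\<^sub>R ?J x))"
      by (subst emeasure_density) (auto intro!: nn_integral_cong simp: indicator_def)
    moreover have "(NI x. ennreal (indicator ?S x *\<^sub>R ?J x)) = ennreal (LI x. indicator ?S x *\<^sub>R ?J x)"
      by (rule nn_integral_eq_integral[OF intB]) (use J0 in auto)
    ultimately show ?thesis by simp
  qed
  show ?thesis
  proof (rule measure_eqI_generator_eq[where E = "range (\<lambda>(a, b). box a b)" and \<Omega> = UNIV and A = "\<lambda>n::nat. box (- (real n *\<^sub>R One)) (real n *\<^sub>R One)"])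
    show "Int_stable (range (\<lambda>(a, b). box a b :: space set))"
      by (force simp: Int_stable_def box_Int_box)
    show "sets (distr lborel borel (shear_map \<xi> t i)) = sigma_sets UNIV (range (\<lambda>(a, b). box a b))"
      "sets (density lborel (\<lambda>x. ennreal (1 - t * \<xi>' (x $ i)))) = sigma_sets UNIV (range (\<lambda>(a, b). box a b))"
      by (simp_all add: borel_eq_box)
    show "(\<Union>n::nat. box (- (real n *\<^sub>R One)) (real n *\<^sub>R One)) = (UNIV :: space set)"
      by (rule UN_box_eq_UNIV)
    show "emeasure (distr lborel borel (shear_map \<xi> t i)) (box (- (real n *\<^sub>R One)) (real n *\<^sub>R One)) \<noteq> \<infinity>" for n :: nat
      using main[of "- (real n *\<^sub>R One)" "real n *\<^sub>R One"] by (simp only:) blast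
  qed (use main in auto)
qed

lemma nn_integral_shear_map:
  assumes \<xi>: "shear_field \<xi> \<xi>' M L" and t: "\<bar>t\<bar> \<le> 1 / 2" and [measurable]: "k \<in> borel_measurable borel"
  shows "(NI x. k (shear_map \<xi> t i x)) = (NI x. ennreal (1 - t * \<xi>' (x $ i)) * k x)"
proof -
  note [measurable] = shear_map_measurable[OF \<xi> t, of i]
  have [measurable]: "\<xi>' \<in> borel_measurable borel"
    using \<xi> by (auto simp: shear_field_def intro!: borel_measurable_continuous_onI)
  have "(NI x. k (shear_map \<xi> t i x)) = (\<integral>\<^sup>+x. k x \<partial>distr lborel borel (shear_map \<xi> t i))"
    by (rule nn_integral_distr[symmetric]) measurable
  also have "\<dots> = (NI x. ennreal (1 - t * \<xi>' (x $ i)) * k x)"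
    unfolding distr_shear_map[OF \<xi> t] by (rule nn_integral_density) measurable
  finally show ?thesis .
qed

section \<open>Taylor remainders uniform in the shift\<close>

lemma nn_integral_segment_le:
  fixes F :: "real \<Rightarrow> ennreal"
  assumes [measurable]: "F \<in> borel_measurable borel" and c: "\<bar>c\<bar> \<le> a"
  shows "ennreal \<bar>c\<bar> * (\<integral>\<^sup>+s. F (s * c) \<partial>unif01) \<le> (NI r. indicator {-a..a} r * F r)"
proof (cases "c = 0")
  case False
  have "ennreal \<bar>c\<bar> * (\<integral>\<^sup>+s. F (s * c) \<partial>unif01) = ennreal \<bar>c\<bar> * (NI s. indicator {0..1} s * F (s * c))"
    unfolding unif01_def by (subst nn_integral_density) auto
  also have "\<dots> \<le> ennreal \<bar>c\<bar> * (NI s. indicator {-a..a} (0 + c * s) * F (0 + c * s))"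
  proof (intro mult_left_mono nn_integral_mono)
    fix s :: real
    show "indicator {0..1} s * F (s * c) \<le> indicator {-a..a} (0 + c * s) * F (0 + c * s)"
    proof (cases "s \<in> {0..1}")
      case True
      have "\<bar>c * s\<bar> \<le> \<bar>c\<bar> * 1" unfolding abs_mult using True by (intro mult_left_mono) auto
      then have "c * s \<in> {-a..a}" using c by (auto simp: abs_le_iff)
      then show ?thesis using True by (simp add: mult.commute)
    qed simp
  qed simp
  also have "\<dots> = (NI r. indicator {-a..a} r * F r)"
    by (rule nn_integral_real_affine[symmetric]) (use False in auto)
  finally show ?thesis .
qed simp

text \<open>The integral of |k| over the symmetric segment of radius a. It dominates the increments
  of a function with derivative \<open>k\<close> for every shift of size at most a, so it can serve
  when the shift depends on the point.\<close>

definition line_sum :: "3 \<Rightarrow> (space \<Rightarrow> complex) \<Rightarrow> real \<Rightarrow> space \<Rightarrow> ennreal" where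
  "line_sum i k a x = (NI r. indicator {-a..a} r * ennreal (cmod (k (x + r *\<^sub>R axis i 1))))"

lemma line_sum_measurable [measurable]:
  assumes [measurable]: "k \<in> borel_measurable borel"
  shows "line_sum i k a \<in> borel_measurable borel"
  unfolding line_sum_def[abs_def] by measurable

text \<open>One factor 2 a comes from Cauchy-Schwarz on the segment, the other from integrating over
  the translations.\<close>

lemma line_sum_square:
  assumes k: "sq_integrable k" and a: "0 < a"
  shows "(NI x. (line_sum i k a x)\<^sup>2) \<le> ennreal (4 * a\<^sup>2 * (LI x. (cmod (k x))\<^sup>2))"
proof -
  note [measurable] = sq_integrable_measurable[OF k]
  have cs: "(line_sum i k a x)\<^sup>2 \<le> ennreal (2 * a) * (NI r. indicator {-a..a} r * ennreal ((cmod (k (x + r *\<^sub>R axis i 1)))\<^sup>2))" for x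
  proof -
    have "(line_sum i k a x)\<^sup>2 = (NI r. indicator {-a..a} r * (indicator {-a..a} r * ennreal (cmod (k (x + r *\<^sub>R axis i 1)))))\<^sup>2"
      unfolding line_sum_def by (intro arg_cong[where f = "\<lambda>z. z\<^sup>2"] nn_integral_cong) (simp add: indicator_def)
    also have "\<dots> \<le> (NI r. (indicator {-a..a} r)\<^sup>2) * (NI r. (indicator {-a..a} r * ennreal (cmod (k (x + r *\<^sub>R axis i 1))))\<^sup>2)"
      by (rule Cauchy_Schwarz_nn_integral) measurable
    also have "(NI r. (indicator {-a..a} r)\<^sup>2) = (NI r. indicator {-a..a} r)"
      by (intro nn_integral_cong) (simp add: indicator_def)
    also have "\<dots> = ennreal (2 * a)" using a by simp
    also have "(NI r. (indicator {-a..a} r * ennreal (cmod (k (x + r *\<^sub>R axis i 1))))\<^sup>2) = (NI r. indicator {-a..a} r * ennreal ((cmod (k (x + r *\<^sub>R axis i 1)))\<^sup>2))"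
      by (intro nn_integral_cong) (simp add: indicator_def ennreal_power)
    finally show ?thesis .
  qed
  have "(NI x. (line_sum i k a x)\<^sup>2) \<le> (NI x. ennreal (2 * a) * (NI r. indicator {-a..a} r * ennreal ((cmod (k (x + r *\<^sub>R axis i 1)))\<^sup>2)))"
    by (intro nn_integral_mono cs)
  also have "\<dots> = ennreal (2 * a) * (NI x. (NI r. indicator {-a..a} r * ennreal ((cmod (k (x + r *\<^sub>R axis i 1)))\<^sup>2)))"
    by (rule nn_integral_cmult) measurable
  also have "(NI x. (NI r. indicator {-a..a} r * ennreal ((cmod (k (x + r *\<^sub>R axis i 1)))\<^sup>2)))
      = (NI r. (NI x. indicator {-a..a} r * ennreal ((cmod (k (x + r *\<^sub>R axis i 1)))\<^sup>2)))"
    by (rule lborel_pair.Fubini'[symmetric]) measurable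
  also have "\<dots> = (NI r. ennreal (LI x. (cmod (k x))\<^sup>2) * indicator {-a..a} r)"
  proof (rule nn_integral_cong)
    fix r :: real
    have "(NI x. indicator {-a..a} r * ennreal ((cmod (k (x + r *\<^sub>R axis i 1)))\<^sup>2)) = indicator {-a..a} r * (NI x. ennreal ((cmod (k (x + r *\<^sub>R axis i 1)))\<^sup>2))"
      by (rule nn_integral_cmult) measurable
    also have "(NI x. ennreal ((cmod (k (x + r *\<^sub>R axis i 1)))\<^sup>2)) = (NI x. ennreal ((cmod (k x))\<^sup>2))"
      by (rule nn_integral_shift[of "\<lambda>x. ennreal ((cmod (k x))\<^sup>2)"]) measurable
    finally show "(NI x. indicator {-a..a} r * ennreal ((cmod (k (x + r *\<^sub>R axis i 1)))\<^sup>2)) = ennreal (LI x. (cmod (k x))\<^sup>2) * indicator {-a..a} r"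
      by (simp add: nn_sq_integrable[OF k] mult.commute)
  qed
  also have "\<dots> = ennreal (LI x. (cmod (k x))\<^sup>2) * ennreal (2 * a)"
    using a by (simp add: nn_integral_cmult_indicator)
  also have "ennreal (2 * a) * \<dots> = ennreal (4 * a\<^sup>2 * (LI x. (cmod (k x))\<^sup>2))"
    using a by (simp add: ennreal_mult[symmetric] power2_eq_square mult_ac)
  finally show ?thesis .
qed

lemma norm_integral_le_nn_integral:
  fixes f :: "'a \<Rightarrow> 'b::{banach, second_countable_topology}"
  shows "ennreal (norm (\<integral>x. f x \<partial>M)) \<le> (\<integral>\<^sup>+x. ennreal (norm (f x)) \<partial>M)"
  by (cases "integrable M f") (auto simp: integral_norm_bound_ennreal not_integrable_integral_eq)

lemma L2_partial_increment_bound: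
  assumes LP: "L2_partial i g k" and c: "\<bar>c\<bar> \<le> a"
  shows "AE x in lborel. ennreal (cmod (g (x + c *\<^sub>R axis i 1) - g x)) \<le> line_sum i k a x"
  using L2_partialD[OF LP, of c]
proof eventually_elim
  case (elim x)
  note [measurable] = sq_integrable_measurable[OF L2_partial_sq(2)[OF LP]]
  have "ennreal (cmod (g (x + c *\<^sub>R axis i 1) - g x)) = ennreal \<bar>c\<bar> * ennreal (cmod (\<integral>s. k (x + (s * c) *\<^sub>R axis i 1) \<partial>unif01))"
    unfolding elim by (simp add: ennreal_mult)
  also have "\<dots> \<le> ennreal \<bar>c\<bar> * (\<integral>\<^sup>+s. ennreal (cmod (k (x + (s * c) *\<^sub>R axis i 1))) \<partial>unif01)"
    by (intro mult_left_mono norm_integral_le_nn_integral) simp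
  also have "\<dots> \<le> line_sum i k a x"
    unfolding line_sum_def by (rule nn_integral_segment_le[of "\<lambda>r. ennreal (cmod (k (x + r *\<^sub>R axis i 1)))", OF _ c]) measurable
  finally show ?case .
qed

lemma taylor_fixed_shift:
  assumes f: "L2_partial i \<phi> g" and g: "L2_partial i g k" and h: "\<bar>h\<bar> \<le> a"
  shows "AE x in lborel. ennreal (cmod (\<phi> (x + h *\<^sub>R axis i 1) - \<phi> x - h *\<^sub>R g x)) \<le> ennreal \<bar>h\<bar> * line_sum i k a x"
proof -
  note sg = L2_partial_sq(1)[OF g]
  note [measurable] = sq_integrable_measurable[OF sg] sq_integrable_measurable[OF L2_partial_sq(2)[OF g]]
  interpret pair_sigma_finite "lborel :: space measure" unif01 by (rule pair_sigma_finite_unif01)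
  interpret finite_measure unif01 by (rule finite_unif01)
  have "AE s in unif01. AE x in lborel. ennreal (cmod (g (x + (s * h) *\<^sub>R axis i 1) - g x)) \<le> line_sum i k a x"
    using AE_unif01
  proof eventually_elim
    case (elim s)
    have "\<bar>s * h\<bar> \<le> 1 * a" unfolding abs_mult using elim h by (intro mult_mono) auto
    then show ?case by (intro L2_partial_increment_bound[OF g]) simp
  qed
  moreover have "{p \<in> space (lborel \<Otimes>\<^sub>M unif01). ennreal (cmod (g (fst p + (snd p * h) *\<^sub>R axis i 1) - g (fst p))) \<le> line_sum i k a (fst p)} \<in> sets (lborel \<Otimes>\<^sub>M unif01)"
    by measurable
  \<comment> \<open>The increment bound holds for each s outside a null set of x that depends on s;
    Fubini exchanges the two, after which the bound can be averaged over s at almost every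
    x.\<close>
  ultimately have "AE x in lborel. AE s in unif01. ennreal (cmod (g (x + (s * h) *\<^sub>R axis i 1) - g x)) \<le> line_sum i k a x"
    using AE_commute[of "\<lambda>x s. ennreal (cmod (g (x + (s * h) *\<^sub>R axis i 1) - g x)) \<le> line_sum i k a x"] by simp
  then show ?thesis
    using L2_partialD[OF f, of h] AE_integrable_line[OF sg, of h i]
  proof eventually_elim
    case (elim x)
    have "(\<integral>s. g (x + (s * h) *\<^sub>R axis i 1) - g x \<partial>unif01) = (\<integral>s. g (x + (s * h) *\<^sub>R axis i 1) \<partial>unif01) - g x"
      by (subst Bochner_Integration.integral_diff[OF elim(3) integrable_const]) (simp only: integral_unif01_const)
    then have "\<phi> (x + h *\<^sub>R axis i 1) - \<phi> x - h *\<^sub>R g x = h *\<^sub>R (\<integral>s. g (x + (s * h) *\<^sub>R axis i 1) - g x \<partial>unif01)"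
      using elim(2) by (simp add: scaleR_diff_right)
    then have "ennreal (cmod (\<phi> (x + h *\<^sub>R axis i 1) - \<phi> x - h *\<^sub>R g x)) = ennreal \<bar>h\<bar> * ennreal (cmod (\<integral>s. g (x + (s * h) *\<^sub>R axis i 1) - g x \<partial>unif01))"
      by (simp add: ennreal_mult)
    also have "\<dots> \<le> ennreal \<bar>h\<bar> * (\<integral>\<^sup>+s. ennreal (cmod (g (x + (s * h) *\<^sub>R axis i 1) - g x)) \<partial>unif01)"
      by (intro mult_left_mono norm_integral_le_nn_integral) simp
    also have "\<dots> \<le> ennreal \<bar>h\<bar> * (\<integral>\<^sup>+s. line_sum i k a x \<partial>unif01)"
      by (intro mult_left_mono nn_integral_mono_AE elim(1)) simp
    finally show ?case by (simp only: nn_integral_unif01_const)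
  qed
qed

text \<open>Since \<open>\<phi>\<close> is continuous, the exceptional null set can be chosen independently of the shift; this
  allows shifts that depend on the point.\<close>

lemma taylor_all_shifts:
  assumes c: "continuous_on UNIV \<phi>" and f: "L2_partial i \<phi> g" and g: "L2_partial i g k" and a: "0 < a"
  shows "AE x in lborel. \<forall>h. \<bar>h\<bar> \<le> a \<longrightarrow> ennreal (cmod (\<phi> (x + h *\<^sub>R axis i 1) - \<phi> x - h *\<^sub>R g x)) \<le> ennreal \<bar>h\<bar> * line_sum i k a x"
proof -
  \<comment> \<open>A countable dense grid of multiples of a/(n + 1). Since -a is a grid point,
    rounding an admissible shift down stays in [-a, a].\<close>
  define H where "H n z = a * real_of_int z / real (Suc n)" for n z
  have "AE x in lborel. \<forall>n z. \<bar>H n z\<bar> \<le> a \<longrightarrow> ennreal (cmod (\<phi> (x + H n z *\<^sub>R axis i 1) - \<phi> x - H n z *\<^sub>R g x)) \<le> ennreal \<bar>H n z\<bar> * line_sum i k a x"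
    unfolding AE_all_countable
  proof (intro allI)
    fix n z
    show "AE x in lborel. \<bar>H n z\<bar> \<le> a \<longrightarrow> ennreal (cmod (\<phi> (x + H n z *\<^sub>R axis i 1) - \<phi> x - H n z *\<^sub>R g x)) \<le> ennreal \<bar>H n z\<bar> * line_sum i k a x"
    proof (cases "\<bar>H n z\<bar> \<le> a")
      case True
      then show ?thesis using taylor_fixed_shift[OF f g True] by simp
    qed simp
  qed
  then show ?thesis
  proof eventually_elim
    case (elim x)
    show ?case
    proof (intro allI impI)
      fix h :: real assume h: "\<bar>h\<bar> \<le> a"
      show "ennreal (cmod (\<phi> (x + h *\<^sub>R axis i 1) - \<phi> x - h *\<^sub>R g x)) \<le> ennreal \<bar>h\<bar> * line_sum i k a x"
      proof (cases "line_sum i k a x")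
        case top
        \<comment> \<open>If the majorant is infinite, only h = 0 needs attention, where
          \<open>0 * top\<close> is 0 but the left side vanishes as well.\<close>
        then show ?thesis by (cases "h = 0") (auto simp: ennreal_mult_top)
      next
        case (real b)
        define z where "z n = \<lfloor>real (Suc n) * h / a\<rfloor>" for n
        have zb: "\<bar>H n (z n)\<bar> \<le> a" "\<bar>H n (z n) - h\<bar> \<le> a * (1 / real (Suc n))" for n
        proof -
          have l: "real_of_int (z n) \<le> real (Suc n) * h / a" and l': "real (Suc n) * h / a < real_of_int (z n) + 1"
            unfolding z_def by linarith+
          have "h / a \<le> 1" "-1 \<le> h / a" using h a by (auto simp: field_simps abs_le_iff)
          then have r: "real (Suc n) * (h / a) \<le> real (Suc n) * 1" "real (Suc n) * (-1) \<le> real (Suc n) * (h / a)"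
            by (intro mult_left_mono; simp)+
          then have "real_of_int (z n) \<le> real (Suc n)" using l by simp
          moreover have "real_of_int (- int (Suc n)) \<le> real (Suc n) * h / a" using r by simp
          then have "- int (Suc n) \<le> z n" unfolding z_def by (simp only: le_floor_iff)
          then have "real_of_int (- int (Suc n)) \<le> real_of_int (z n)" by (simp only: of_int_le_iff)
          ultimately have "\<bar>real_of_int (z n)\<bar> \<le> real (Suc n)" by (simp add: abs_le_iff)
          then have "a * \<bar>real_of_int (z n)\<bar> \<le> a * real (Suc n)" using a by (intro mult_left_mono) auto
          then show "\<bar>H n (z n)\<bar> \<le> a" using a by (simp add: H_def abs_mult field_simps)
          have "H n (z n) - h = a * (1 / real (Suc n)) * (real_of_int (z n) - real (Suc n) * h / a)"
          proof -
            define m where "m = real (Suc n)"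
            have "m \<noteq> 0" by (simp add: m_def)
            then show ?thesis unfolding H_def m_def[symmetric] using a by (simp add: field_simps)
          qed
          moreover have "\<bar>real_of_int (z n) - real (Suc n) * h / a\<bar> \<le> 1" using l l' by linarith
          ultimately have "\<bar>H n (z n) - h\<bar> \<le> \<bar>a * (1 / real (Suc n))\<bar> * 1"
            unfolding abs_mult by (metis abs_ge_zero abs_mult mult_left_mono)
          then show "\<bar>H n (z n) - h\<bar> \<le> a * (1 / real (Suc n))" using a by simp
        qed
        have "(\<lambda>n. a * (1 / real (Suc n))) \<longlonglongrightarrow> a * 0" by (intro tendsto_mult tendsto_const LIMSEQ_Suc lim_1_over_n)
        then have l0: "(\<lambda>n. a * (1 / real (Suc n))) \<longlonglongrightarrow> 0" by (simp only: mult_zero_right)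
        have "(\<lambda>n. H n (z n) - h) \<longlonglongrightarrow> 0"
          by (rule Lim_null_comparison[OF _ l0], rule always_eventually) (simp only: real_norm_def zb(2) simp_thms)
        then have lim: "(\<lambda>n. H n (z n)) \<longlonglongrightarrow> h" by (simp add: LIM_zero_iff)
        have "isCont \<phi> y" for y using c by (simp add: continuous_on_eq_continuous_at)
        then have "(\<lambda>n. \<phi> (x + H n (z n) *\<^sub>R axis i 1)) \<longlonglongrightarrow> \<phi> (x + h *\<^sub>R axis i 1)"
          by (intro isCont_tendsto_compose[of _ \<phi>] tendsto_intros lim)
        then have l1: "(\<lambda>n. cmod (\<phi> (x + H n (z n) *\<^sub>R axis i 1) - \<phi> x - H n (z n) *\<^sub>R g x)) \<longlonglongrightarrow> cmod (\<phi> (x + h *\<^sub>R axis i 1) - \<phi> x - h *\<^sub>R g x)"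
          by (intro tendsto_intros lim)
        have l2: "(\<lambda>n. \<bar>H n (z n)\<bar> * b) \<longlonglongrightarrow> \<bar>h\<bar> * b" by (intro tendsto_intros lim)
        have l3: "cmod (\<phi> (x + H n (z n) *\<^sub>R axis i 1) - \<phi> x - H n (z n) *\<^sub>R g x) \<le> \<bar>H n (z n)\<bar> * b" for n
        proof -
          have "ennreal (cmod (\<phi> (x + H n (z n) *\<^sub>R axis i 1) - \<phi> x - H n (z n) *\<^sub>R g x)) \<le> ennreal (\<bar>H n (z n)\<bar> * b)"
            using elim zb(1)[of n] real by (auto simp: ennreal_mult)
          then show ?thesis using real by (subst (asm) ennreal_le_iff) auto
        qed
        have "cmod (\<phi> (x + h *\<^sub>R axis i 1) - \<phi> x - h *\<^sub>R g x) \<le> \<bar>h\<bar> * b"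
          by (rule LIMSEQ_le[OF l1 l2], rule exI[of _ 0]) (simp only: l3 simp_thms)
        then show ?thesis using real by (simp add: ennreal_mult[symmetric] ennreal_leI)
      qed
    qed
  qed
qed

section \<open>Pairings along the shear\<close>

lemma sq_integrable_shear_map:
  assumes \<xi>: "shear_field \<xi> \<xi>' M L" and t: "\<bar>t\<bar> \<le> 1 / 2" and u: "sq_integrable u"
  shows "sq_integrable (\<lambda>x. u (shear_map \<xi> t i x))"
    "(LI x. (cmod (u (shear_map \<xi> t i x)))\<^sup>2) = (LI x. (cmod (u x))\<^sup>2) - t * (LI x. \<xi>' (x $ i) * (cmod (u x))\<^sup>2)"
proof -
  note [measurable] = sq_integrable_measurable[OF u] shear_map_measurable[OF \<xi> t, of i]
  have [measurable]: "\<xi>' \<in> borel_measurable borel"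
    using \<xi> by (auto simp: shear_field_def intro!: borel_measurable_continuous_onI)
  note b = shear_field_bounds[OF \<xi>]
  have J: "0 \<le> 1 - t * \<xi>' s" for s
  proof -
    have "\<bar>t * \<xi>' s\<bar> \<le> 1 * 1" unfolding abs_mult using t b(2,3)[of s] by (intro mult_mono) auto
    then show ?thesis by linarith
  qed
  have i1: "integrable lborel (\<lambda>x. \<xi>' (x $ i) * (cmod (u x))\<^sup>2)"
  proof (rule Bochner_Integration.integrable_bound[OF sq_integrable_integrable[OF u]])
    show "AE x in lborel. norm (\<xi>' (x $ i) * (cmod (u x))\<^sup>2) \<le> norm ((cmod (u x))\<^sup>2)"
      using b(2,3) by (auto intro!: mult_left_le_one_le)
  qed measurable
  have i2: "integrable lborel (\<lambda>x. (1 - t * \<xi>' (x $ i)) * (cmod (u x))\<^sup>2)"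
    using Bochner_Integration.integrable_diff[OF sq_integrable_integrable[OF u] integrable_mult_right[OF i1, of t]]
    by (simp add: algebra_simps)
  have "(NI x. ennreal ((cmod (u (shear_map \<xi> t i x)))\<^sup>2)) = (NI x. ennreal (1 - t * \<xi>' (x $ i)) * ennreal ((cmod (u x))\<^sup>2))"
    by (rule nn_integral_shear_map[OF \<xi> t, of "\<lambda>x. ennreal ((cmod (u x))\<^sup>2)"]) measurable
  also have "\<dots> = (NI x. ennreal ((1 - t * \<xi>' (x $ i)) * (cmod (u x))\<^sup>2))"
    by (intro nn_integral_cong ennreal_mult[symmetric] J) simp
  also have "\<dots> = ennreal (LI x. (1 - t * \<xi>' (x $ i)) * (cmod (u x))\<^sup>2)"
    by (rule nn_integral_eq_integral[OF i2], rule AE_I2, rule mult_nonneg_nonneg[OF J]) simp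
  finally have e: "(NI x. ennreal ((cmod (u (shear_map \<xi> t i x)))\<^sup>2)) = ennreal (LI x. (1 - t * \<xi>' (x $ i)) * (cmod (u x))\<^sup>2)" .
  show s: "sq_integrable (\<lambda>x. u (shear_map \<xi> t i x))" by (rule sq_integrableI_nn) (measurable, simp add: e)
  have "(LI x. (cmod (u (shear_map \<xi> t i x)))\<^sup>2) = (LI x. (1 - t * \<xi>' (x $ i)) * (cmod (u x))\<^sup>2)"
    using e unfolding nn_sq_integrable[OF s] 
    by (subst (asm) ennreal_inj) (auto intro!: Bochner_Integration.integral_nonneg mult_nonneg_nonneg J simp del: diff_ge_0_iff_ge)
  also have "\<dots> = (LI x. (cmod (u x))\<^sup>2 - t * (\<xi>' (x $ i) * (cmod (u x))\<^sup>2))"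
    by (intro Bochner_Integration.integral_cong refl) (simp add: algebra_simps)
  also have "\<dots> = (LI x. (cmod (u x))\<^sup>2) - t * (LI x. \<xi>' (x $ i) * (cmod (u x))\<^sup>2)"
    using sq_integrable_integrable[OF u] i1 by simp
  finally show "(LI x. (cmod (u (shear_map \<xi> t i x)))\<^sup>2) = (LI x. (cmod (u x))\<^sup>2) - t * (LI x. \<xi>' (x $ i) * (cmod (u x))\<^sup>2)" .
qed

text \<open>The displacement h of the shear depends on x but is at most a = |t| M. The Taylor
  remainder is therefore dominated by a times \<open>line_sum\<close>, itself O(a) in L^2, and
  replacing h by t \<xi> costs t^2 M |g|. In total the error is O(t^2) in L^2.\<close>

lemma regular_part_flow:
  assumes \<xi>: "shear_field \<xi> \<xi>' M L" and M: "0 < M" and c: "continuous_on UNIV \<phi>"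
    and f: "L2_partial i \<phi> g" and g: "L2_partial i g k" and F: "sq_integrable F"
  shows "\<exists>K. \<forall>t. \<bar>t\<bar> \<le> 1 / 2 \<longrightarrow> \<bar>(LI x. F x \<bullet> (\<phi> (shear_map \<xi> t i x) - \<phi> x)) - t * (LI x. F x \<bullet> (\<xi> (x $ i) *\<^sub>R g x))\<bar> \<le> t\<^sup>2 * K"
proof -
  have w: "weight \<xi> \<xi>' M L" using \<xi> by (simp add: shear_field_def)
  note s\<phi> = L2_partial_sq(1)[OF f] and sg = L2_partial_sq(1)[OF g] and sk = L2_partial_sq(2)[OF g]
  have wg: "sq_integrable (\<lambda>x. \<xi> (x $ i) *\<^sub>R g x)" by (rule sq_integrable_weight(1)[OF w sg])
  note [measurable] = sq_integrable_measurable[OF s\<phi>] sq_integrable_measurable[OF sg] sq_integrable_measurable[OF sk]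
    sq_integrable_measurable[OF F]
  define nk where "nk = (LI x. (cmod (k x))\<^sup>2)"
  define ng where "ng = (LI x. (cmod (g x))\<^sup>2)"
  define nF where "nF = (LI x. (cmod (F x))\<^sup>2)"
  \<comment> \<open>The two terms are 2 a^2 (4 a^2 nk) and 2 (t^2 M)^2 ng with a = |t| M and the
    factor t^4 taken out; the leading 2 is that of |z + w|^2 \<le> 2|z|^2 + 2|w|^2.\<close>
  define K0 where "K0 = 8 * M ^ 4 * nk + 2 * M\<^sup>2 * ng"
  define K where "K = (nF + K0) / 2"
  have "\<bar>(LI x. F x \<bullet> (\<phi> (shear_map \<xi> t i x) - \<phi> x)) - t * (LI x. F x \<bullet> (\<xi> (x $ i) *\<^sub>R g x))\<bar> \<le> t\<^sup>2 * K"
    if t: "\<bar>t\<bar> \<le> 1 / 2" for t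
  proof (cases "t = 0")
    case True
    have "shear_map \<xi> 0 i x = x" for x
      using shear_bounds(3)[OF \<xi>, of 0 "x $ i"] by (simp add: shear_map_def)
    then show ?thesis using True by simp
  next
    case False
    define a where "a = \<bar>t\<bar> * M"
    have a: "0 < a" using False M by (simp add: a_def)
    let ?R = "\<lambda>x. (\<phi> (shear_map \<xi> t i x) - \<phi> x) - t *\<^sub>R (\<xi> (x $ i) *\<^sub>R g x)"
    have sS: "sq_integrable (\<lambda>x. \<phi> (shear_map \<xi> t i x))" by (rule sq_integrable_shear_map[OF \<xi> t s\<phi>])
    have sD: "sq_integrable (\<lambda>x. \<phi> (shear_map \<xi> t i x) - \<phi> x)" by (rule sq_integrable_diff[OF sS s\<phi>])
    have sR: "sq_integrable ?R" by (rule sq_integrable_diff[OF sD sq_integrable_scaleR[OF wg]])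
    define b where "b x = enn2real (line_sum i k a x)" for x
    have [measurable]: "b \<in> borel_measurable borel" unfolding b_def by measurable
    have b0: "0 \<le> b x" for x by (simp add: b_def)
    have B2: "(NI x. (line_sum i k a x)\<^sup>2) \<le> ennreal (4 * a\<^sup>2 * nk)"
      unfolding nk_def by (rule line_sum_square[OF sk a])
    have "AE x in lborel. (line_sum i k a x)\<^sup>2 \<noteq> \<infinity>"
    proof (rule nn_integral_PInf_AE)
      show "(NI x. (line_sum i k a x)\<^sup>2) \<noteq> \<infinity>" using B2 by (auto simp: top_unique)
    qed measurable
    then have fin: "AE x in lborel. line_sum i k a x = ennreal (b x)"
      by eventually_elim (auto simp: b_def ennreal_enn2real_if power2_eq_square ennreal_mult_eq_top_iff)
    have b2: "(NI x. ennreal ((b x)\<^sup>2)) \<le> ennreal (4 * a\<^sup>2 * nk)"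
    proof -
      have "(NI x. ennreal ((b x)\<^sup>2)) = (NI x. (line_sum i k a x)\<^sup>2)"
      proof (rule nn_integral_cong_AE)
        show "AE x in lborel. ennreal ((b x)\<^sup>2) = (line_sum i k a x)\<^sup>2"
          using fin by eventually_elim (simp add: ennreal_power b0)
      qed
      then show ?thesis using B2 by simp
    qed
    have ib: "integrable lborel (\<lambda>x. (b x)\<^sup>2)"
      by (rule integrableI_bounded) (use b2 in \<open>auto simp: less_top[symmetric] top_unique\<close>)
    have b2': "(LI x. (b x)\<^sup>2) \<le> 4 * a\<^sup>2 * nk"
      using b2 by (subst (asm) nn_integral_eq_integral[OF ib]) (auto simp: nk_def)
    have pt: "AE x in lborel. (cmod (?R x))\<^sup>2 \<le> 2 * a\<^sup>2 * (b x)\<^sup>2 + 2 * (t\<^sup>2 * M)\<^sup>2 * (cmod (g x))\<^sup>2"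
      using taylor_all_shifts[OF c f g a] fin
    proof eventually_elim
      case (elim x)
      define h where "h = shear \<xi> t (x $ i) - x $ i"
      have h: "\<bar>h\<bar> \<le> a" "\<bar>h - t * \<xi> (x $ i)\<bar> \<le> t\<^sup>2 * M" using shear_bounds(1,2)[OF \<xi> t, of "x $ i"] by (simp_all add: h_def a_def)
      have "ennreal (cmod (\<phi> (x + h *\<^sub>R axis i 1) - \<phi> x - h *\<^sub>R g x)) \<le> ennreal (\<bar>h\<bar> * b x)"
        using elim(1)[rule_format, OF h(1)] unfolding elim(2) by (simp only: ennreal_mult[OF abs_ge_zero b0])
      then have "cmod (\<phi> (x + h *\<^sub>R axis i 1) - \<phi> x - h *\<^sub>R g x) \<le> \<bar>h\<bar> * b x"
        by (rule ennreal_le_iff[THEN iffD1, rotated]) (simp add: b0)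
      also have "\<dots> \<le> a * b x" by (intro mult_right_mono h b0)
      finally have e1: "cmod (\<phi> (x + h *\<^sub>R axis i 1) - \<phi> x - h *\<^sub>R g x) \<le> a * b x" .
      have e2: "cmod ((h - t * \<xi> (x $ i)) *\<^sub>R g x) \<le> t\<^sup>2 * M * cmod (g x)"
        unfolding norm_scaleR by (intro mult_right_mono h) auto
      have "?R x = (\<phi> (x + h *\<^sub>R axis i 1) - \<phi> x - h *\<^sub>R g x) + (h - t * \<xi> (x $ i)) *\<^sub>R g x"
        by (simp add: shear_map_def h_def scaleR_diff_left)
      then have "(cmod (?R x))\<^sup>2 \<le> 2 * (cmod (\<phi> (x + h *\<^sub>R axis i 1) - \<phi> x - h *\<^sub>R g x))\<^sup>2 + 2 * (cmod ((h - t * \<xi> (x $ i)) *\<^sub>R g x))\<^sup>2"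
        using norm_add_sq_le by metis
      also have "\<dots> \<le> 2 * (a * b x)\<^sup>2 + 2 * (t\<^sup>2 * M * cmod (g x))\<^sup>2"
        by (intro add_mono mult_left_mono power_mono e1 e2) auto
      finally show ?case by (simp add: power_mult_distrib)
    qed
    have "(LI x. (cmod (?R x))\<^sup>2) \<le> (LI x. 2 * a\<^sup>2 * (b x)\<^sup>2 + 2 * (t\<^sup>2 * M)\<^sup>2 * (cmod (g x))\<^sup>2)"
      by (intro integral_mono_AE pt sq_integrable_integrable[OF sR] Bochner_Integration.integrable_add integrable_mult_right ib sq_integrable_integrable[OF sg])
    also have "\<dots> = 2 * a\<^sup>2 * (LI x. (b x)\<^sup>2) + 2 * (t\<^sup>2 * M)\<^sup>2 * ng"
      using ib sq_integrable_integrable[OF sg] by (simp add: ng_def)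
    also have "\<dots> \<le> 2 * a\<^sup>2 * (4 * a\<^sup>2 * nk) + 2 * (t\<^sup>2 * M)\<^sup>2 * ng"
      by (intro add_right_mono mult_left_mono b2') auto
    also have "\<dots> = t^4 * K0"
    proof -
      have "a\<^sup>2 = t\<^sup>2 * M\<^sup>2" by (simp add: a_def power_mult_distrib)
      then show ?thesis by (simp add: K0_def algebra_simps power2_eq_square power4_eq_xxxx)
    qed
    finally have Rn: "(LI x. (cmod (?R x))\<^sup>2) \<le> t^4 * K0" .
    have t2: "0 < t\<^sup>2" using False by simp
    have "(LI x. F x \<bullet> (\<phi> (shear_map \<xi> t i x) - \<phi> x)) - t * (LI x. F x \<bullet> (\<xi> (x $ i) *\<^sub>R g x)) = (LI x. F x \<bullet> ?R x)"
    proof -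
      have "(LI x. F x \<bullet> ?R x) = (LI x. F x \<bullet> (\<phi> (shear_map \<xi> t i x) - \<phi> x) - t * (F x \<bullet> (\<xi> (x $ i) *\<^sub>R g x)))"
        by (intro Bochner_Integration.integral_cong refl) (simp only: inner_diff_right inner_scaleR_right)
      also have "\<dots> = (LI x. F x \<bullet> (\<phi> (shear_map \<xi> t i x) - \<phi> x)) - (LI x. t * (F x \<bullet> (\<xi> (x $ i) *\<^sub>R g x)))"
        by (rule Bochner_Integration.integral_diff[OF integrable_inner_sq[OF F sD] integrable_mult_right[OF integrable_inner_sq[OF F wg]]])
      finally show ?thesis by (simp only: integral_mult_right_zero)
    qed
    also have "\<bar>\<dots>\<bar> \<le> (t\<^sup>2 * nF + (LI x. (cmod (?R x))\<^sup>2) / t\<^sup>2) / 2"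
      unfolding nF_def by (rule integral_inner_amgm[OF F sR t2])
    also have "\<dots> \<le> (t\<^sup>2 * nF + (t^4 * K0) / t\<^sup>2) / 2"
      by (intro divide_right_mono add_left_mono Rn) (use t2 in auto)
    also have "\<dots> = t\<^sup>2 * K" using False by (simp add: K_def field_simps power2_eq_square power4_eq_xxxx)
    finally show ?thesis .
  qed
  then show ?thesis by blast
qed

text \<open>The mean value inequality along a segment that keeps at least half the distance to the
  origin. On it the derivative is of order |x|^-2, and halving the distance costs half of the decay
  rate.\<close>

lemma yukawa_shift_bound:
  assumes c: "0 < c" and x: "x \<noteq> 0" and h: "\<bar>h\<bar> \<le> norm x / 2"
  shows "\<bar>yukawa c (x + h *\<^sub>R axis i 1) - yukawa c x\<bar> \<le> \<bar>h\<bar> * (2 * (c + 2) * (exp (- (c / 2) * norm x) * (1 + 1 / norm x)) / norm x)"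
proof (cases "h = 0")
  case False
  let ?r = "norm x"
  have r: "0 < ?r" using x by simp
  have far: "?r / 2 \<le> norm (x + s *\<^sub>R axis i 1)" if "\<bar>s\<bar> \<le> \<bar>h\<bar>" for s
  proof -
    have "?r \<le> norm (x + s *\<^sub>R axis i 1) + norm (s *\<^sub>R axis i 1 :: space)"
      using norm_triangle_ineq4[of "x + s *\<^sub>R axis i 1" "s *\<^sub>R axis i 1"] by simp
    then show ?thesis using that h by simp
  qed
  have der: "((\<lambda>s. yukawa c (x + s *\<^sub>R axis i 1)) has_real_derivative yukawa_partial c i (x + s *\<^sub>R axis i 1)) (at s)"
    if s: "\<bar>s\<bar> \<le> \<bar>h\<bar>" for s
  proof -
    have "x + s *\<^sub>R axis i 1 \<noteq> 0" using far[OF s] r by auto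
    from yukawa_has_partial[OF this, of c i]
    have "((\<lambda>r. yukawa c (x + s *\<^sub>R axis i 1 + r *\<^sub>R axis i 1)) has_real_derivative yukawa_partial c i (x + s *\<^sub>R axis i 1)) (at (s - s))" by simp
    then have "((\<lambda>r. yukawa c (x + s *\<^sub>R axis i 1 + (r - s) *\<^sub>R axis i 1)) has_real_derivative yukawa_partial c i (x + s *\<^sub>R axis i 1) * 1) (at s)"
      by (intro DERIV_chain2[where g = "\<lambda>r. r - s"]) (auto intro!: derivative_eq_intros)
    moreover have "x + s *\<^sub>R axis i 1 + (r - s) *\<^sub>R axis i 1 = x + r *\<^sub>R axis i 1" for r by (simp add: scaleR_diff_left)
    ultimately show ?thesis by simp
  qed
  have bound: "\<bar>yukawa_partial c i (x + s *\<^sub>R axis i 1)\<bar> \<le> 2 * (c + 2) * (exp (- (c / 2) * ?r) * (1 + 1 / ?r)) / ?r"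
    if s: "\<bar>s\<bar> \<le> \<bar>h\<bar>" for s
  proof -
    define y where "y = x + s *\<^sub>R axis i 1"
    have y: "?r / 2 \<le> norm y" "0 < norm y" using far[OF s] r by (auto simp: y_def)
    have "yukawa_partial c i y = - ((y $ i / norm y) * ((c + 1 / norm y) * exp (- c * norm y) / (4 * pi) * (1 / norm y)))"
      using y by (simp add: yukawa_partial_def field_simps power3_eq_cube)
    then have "\<bar>yukawa_partial c i y\<bar> = \<bar>y $ i / norm y\<bar> * ((c + 1 / norm y) * exp (- c * norm y) / (4 * pi) * (1 / norm y))"
      using y c by (simp only: abs_minus_cancel abs_mult) simp
    also have "\<dots> \<le> 1 * ((c + 2 / ?r) * exp (- (c / 2) * ?r) / 1 * (2 / ?r))"
    proof -
      have i2: "1 / norm y \<le> 2 / ?r" using y r by (simp add: field_simps)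
      then have i3: "c + 1 / norm y \<le> c + 2 / ?r" by simp
      have "c * (?r / 2) \<le> c * norm y" using y c by (intro mult_left_mono) auto
      then have i4: "exp (- c * norm y) \<le> exp (- (c / 2) * ?r)" by simp
      have m: "(c + 1 / norm y) * exp (- c * norm y) \<le> (c + 2 / ?r) * exp (- (c / 2) * ?r)"
        by (rule mult_mono[OF i3 i4]) (use c r in auto)
      have d: "(c + 1 / norm y) * exp (- c * norm y) / (4 * pi) \<le> (c + 2 / ?r) * exp (- (c / 2) * ?r) / 1"
        by (rule frac_le[OF _ m]) (use c r pi_gt3 in auto)
      have e: "(c + 1 / norm y) * exp (- c * norm y) / (4 * pi) * (1 / norm y) \<le> (c + 2 / ?r) * exp (- (c / 2) * ?r) / 1 * (2 / ?r)"
        by (rule mult_mono[OF d i2]) (use c r in auto)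
      show ?thesis by (rule mult_mono[OF abs_nth_over_norm e]) (use c y in auto)
    qed
    also have "\<dots> \<le> 2 * (c + 2) * (exp (- (c / 2) * ?r) * (1 + 1 / ?r)) / ?r"
    proof -
      have "c + 2 / ?r \<le> (c + 2) * (1 + 1 / ?r)" using c r by (simp add: field_simps)
      then have "(c + 2 / ?r) * (exp (- (c / 2) * ?r) * (2 / ?r)) \<le> ((c + 2) * (1 + 1 / ?r)) * (exp (- (c / 2) * ?r) * (2 / ?r))"
        by (rule mult_right_mono) (use r in auto)
      moreover have "v * (E * (2 / ?r)) = 1 * (v * E / 1 * (2 / ?r))" "(C * R) * (E * (2 / ?r)) = 2 * C * (E * R) / ?r" for v C E R :: real
        by (simp_all add: mult_ac)
      ultimately show ?thesis by metis
    qed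
    finally show ?thesis by (simp add: y_def)
  qed
  have "\<bar>yukawa c (x + h *\<^sub>R axis i 1) - yukawa c (x + 0 *\<^sub>R axis i 1)\<bar> \<le> (2 * (c + 2) * (exp (- (c / 2) * ?r) * (1 + 1 / ?r)) / ?r) * \<bar>h - 0\<bar>"
  proof -
    have "norm ((\<lambda>s. yukawa c (x + s *\<^sub>R axis i 1)) h - (\<lambda>s. yukawa c (x + s *\<^sub>R axis i 1)) 0) \<le> (2 * (c + 2) * (exp (- (c / 2) * ?r) * (1 + 1 / ?r)) / ?r) * norm (h - 0)"
    proof (rule field_differentiable_bound[of "{s. \<bar>s\<bar> \<le> \<bar>h\<bar>}"])
      have "{s. \<bar>s\<bar> \<le> \<bar>h\<bar>} = {- \<bar>h\<bar>..\<bar>h\<bar>}" by (auto simp: abs_le_iff)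
      then show "convex {s. \<bar>s\<bar> \<le> \<bar>h\<bar>}" by simp
    qed (use der bound in \<open>auto intro: has_field_derivative_at_within\<close>)
    then show ?thesis by simp
  qed
  then show ?thesis by (simp add: mult.commute)
qed simp

text \<open>The gradient of the Green function is not in L^2, but the displacement is at most
  2|t||x|, which compensates one power of 1/|x|. The difference quotients thus have a common square
  integrable majorant, and dominated convergence applies.\<close>

lemma singular_part_flow:
  assumes \<xi>: "shear_field \<xi> \<xi>' M L" and c: "0 < c" and F: "sq_integrable F"
    and t: "\<And>n. t n \<noteq> 0" "\<And>n. \<bar>t n\<bar> \<le> 1 / 4" "t \<longlonglongrightarrow> 0"
  shows "(\<lambda>n. (LI x. F x \<bullet> ((yukawa c (shear_map \<xi> (t n) i x) - yukawa c x) *\<^sub>R q)) / t n) \<longlonglongrightarrow>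
     (LI x. F x \<bullet> ((\<xi> (x $ i) * yukawa_partial c i x) *\<^sub>R q))"
proof -
  have t2: "\<bar>t n\<bar> \<le> 1 / 2" for n using t(2)[of n] by simp
  note [measurable] = sq_integrable_measurable[OF F] shear_map_measurable[OF \<xi> t2]
  have [measurable]: "\<xi> \<in> borel_measurable borel"
    using \<xi> weight_measurable(1) by (auto simp: shear_field_def)
  define B where "B x = 4 * (c + 2) * (exp (- (c / 2) * norm x) * (1 + 1 / norm x))" for x :: space
  have sB: "sq_integrable (\<lambda>x. B x *\<^sub>R q)" unfolding B_def by (rule exp_decay_dominant) (use c in auto)
  have "(\<lambda>n. (LI x. (F x \<bullet> ((yukawa c (shear_map \<xi> (t n) i x) - yukawa c x) *\<^sub>R q)) / t n)) \<longlonglongrightarrow>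
     (LI x. F x \<bullet> ((\<xi> (x $ i) * yukawa_partial c i x) *\<^sub>R q))"
  proof (rule integral_dominated_convergence[where w = "\<lambda>x. \<bar>F x \<bullet> (B x *\<^sub>R q)\<bar>"])
    show "integrable lborel (\<lambda>x. \<bar>F x \<bullet> (B x *\<^sub>R q)\<bar>)" by (intro integrable_abs integrable_inner_sq F sB)
    show "AE x in lborel. (\<lambda>n. (F x \<bullet> ((yukawa c (shear_map \<xi> (t n) i x) - yukawa c x) *\<^sub>R q)) / t n) \<longlonglongrightarrow> F x \<bullet> ((\<xi> (x $ i) * yukawa_partial c i x) *\<^sub>R q)"
      using AE_nonzero
    proof eventually_elim
      case (elim x)
      define h where "h n = shear \<xi> (t n) (x $ i) - x $ i" for n
      have hq: "(\<lambda>n. h n / t n) \<longlonglongrightarrow> \<xi> (x $ i)"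
      proof -
        have "\<bar>h n / t n - \<xi> (x $ i)\<bar> \<le> \<bar>t n\<bar> * M" for n
        proof -
          have "\<bar>h n / t n - \<xi> (x $ i)\<bar> = \<bar>h n - t n * \<xi> (x $ i)\<bar> / \<bar>t n\<bar>"
            using t(1)[of n] by (simp add: abs_divide[symmetric] diff_divide_distrib)
          also have "\<dots> \<le> ((t n)\<^sup>2 * M) / \<bar>t n\<bar>"
            using shear_bounds(2)[OF \<xi> t2, of n "x $ i"] unfolding h_def by (intro divide_right_mono) auto
          also have "\<dots> = \<bar>t n\<bar> * M" using t(1)[of n] by (simp add: power2_eq_square field_simps abs_if)
          finally show ?thesis .
        qed
        moreover have "(\<lambda>n. \<bar>t n\<bar> * M) \<longlonglongrightarrow> \<bar>0\<bar> * M" by (rule tendsto_mult[OF tendsto_rabs[OF t(3)] tendsto_const])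
        ultimately have "(\<lambda>n. h n / t n - \<xi> (x $ i)) \<longlonglongrightarrow> 0"
          by (intro Lim_null_comparison[of "\<lambda>n. h n / t n - \<xi> (x $ i)" "\<lambda>n. \<bar>t n\<bar> * M" sequentially] eventuallyI)
             (simp_all only: real_norm_def abs_zero mult_zero_left)
        then show ?thesis by (simp add: LIM_zero_iff)
      qed
      have h0: "h \<longlonglongrightarrow> 0"
      proof -
        have "(\<lambda>n. h n / t n * t n) \<longlonglongrightarrow> \<xi> (x $ i) * 0" by (intro tendsto_mult hq t(3))
        then show ?thesis using t(1) by simp
      qed
      \<comment> \<open>Caratheodory's form of the derivative: the displacement \<open>h n\<close>
        may vanish, so dividing by it is avoided.\<close>
      obtain G where G: "\<And>s. yukawa c (x + s *\<^sub>R axis i 1) - yukawa c (x + 0 *\<^sub>R axis i 1) = G s * (s - 0)" "isCont G 0" "G 0 = yukawa_partial c i x"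
        using CARAT_DERIV[THEN iffD1, OF yukawa_has_partial[OF elim, of c i]] by blast
      have "(\<lambda>n. G (h n)) \<longlonglongrightarrow> G 0" by (rule isCont_tendsto_compose[OF G(2) h0])
      then have "(\<lambda>n. (G (h n) * (h n / t n)) * (F x \<bullet> q)) \<longlonglongrightarrow> (yukawa_partial c i x * \<xi> (x $ i)) * (F x \<bullet> q)"
        unfolding G(3) by (intro tendsto_mult hq tendsto_const)
      moreover have "(F x \<bullet> ((yukawa c (shear_map \<xi> (t n) i x) - yukawa c x) *\<^sub>R q)) / t n = (G (h n) * (h n / t n)) * (F x \<bullet> q)" for n
        using G(1)[of "h n"] by (simp add: shear_map_def h_def[symmetric])
      moreover have "F x \<bullet> ((\<xi> (x $ i) * yukawa_partial c i x) *\<^sub>R q) = (yukawa_partial c i x * \<xi> (x $ i)) * (F x \<bullet> q)"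
        by (simp add: mult.commute)
      ultimately show ?case by presburger
    qed
    show "AE x in lborel. norm ((F x \<bullet> ((yukawa c (shear_map \<xi> (t n) i x) - yukawa c x) *\<^sub>R q)) / t n) \<le> \<bar>F x \<bullet> (B x *\<^sub>R q)\<bar>" for n
      using AE_nonzero
    proof eventually_elim
      case (elim x)
      define h where "h = shear \<xi> (t n) (x $ i) - x $ i"
      have r: "0 < norm x" using elim by simp
      have h: "\<bar>h\<bar> \<le> 2 * \<bar>t n\<bar> * norm x"
      proof -
        have "\<bar>h\<bar> \<le> 2 * \<bar>t n\<bar> * \<bar>x $ i\<bar>" unfolding h_def by (rule shear_bounds(3)[OF \<xi> t2])
        also have "\<dots> \<le> 2 * \<bar>t n\<bar> * norm x" by (intro mult_left_mono component_le_norm_cart) auto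
        finally show ?thesis .
      qed
      \<comment> \<open>The restriction |t n| \<le> 1/4 makes the displacement at most half the
        distance to the origin, as \<open>yukawa_shift_bound\<close> requires.\<close>
      also have "\<dots> \<le> 2 * (1 / 4) * norm x" by (intro mult_right_mono mult_left_mono t) auto
      finally have h2: "\<bar>h\<bar> \<le> norm x / 2" by simp
      define E where "E = exp (- (c / 2) * norm x) * (1 + 1 / norm x)"
      have E0: "0 \<le> E" unfolding E_def using r by simp
      have BE: "B x = 4 * (c + 2) * E" by (simp only: B_def E_def)
      have "\<bar>yukawa c (shear_map \<xi> (t n) i x) - yukawa c x\<bar> \<le> \<bar>h\<bar> * (2 * (c + 2) * E / norm x)"
        unfolding shear_map_def h_def[symmetric] E_def by (rule yukawa_shift_bound[OF c elim h2])
      also have "\<dots> \<le> (2 * \<bar>t n\<bar> * norm x) * (2 * (c + 2) * E / norm x)"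
        using c r E0 by (intro mult_right_mono h) auto
      also have "\<dots> = \<bar>t n\<bar> * B x" unfolding BE using r by (simp add: field_simps)
      finally have "\<bar>yukawa c (shear_map \<xi> (t n) i x) - yukawa c x\<bar> / \<bar>t n\<bar> \<le> B x"
        using t(1)[of n] by (simp add: divide_le_eq mult.commute)
      moreover have "0 \<le> B x" using c E0 by (simp add: BE)
      ultimately have "\<bar>yukawa c (shear_map \<xi> (t n) i x) - yukawa c x\<bar> / \<bar>t n\<bar> * \<bar>F x \<bullet> q\<bar> \<le> \<bar>B x\<bar> * \<bar>F x \<bullet> q\<bar>"
        by (intro mult_right_mono) auto
      then show ?case by (simp add: abs_mult)
    qed
  qed measurable
  then show ?thesis by simp
qed

lemma sq_integrable_weighted_yukawa_partial:
  assumes \<xi>: "shear_field \<xi> \<xi>' M L" and a: "0 < a"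
  shows "sq_integrable (\<lambda>x. (\<xi> (x $ i) * yukawa_partial a i x) *\<^sub>R q)"
proof (rule sq_integrable_bound[OF coord_yukawa_L2_partial(2)[OF a, of i q], of _ 1])
  have [measurable]: "\<xi> \<in> borel_measurable borel"
    using \<xi> weight_measurable(1) by (auto simp: shear_field_def)
  show "(\<lambda>x. (\<xi> (x $ i) * yukawa_partial a i x) *\<^sub>R q) \<in> borel_measurable borel" by measurable
  fix x :: space
  have "\<bar>\<xi> (x $ i)\<bar> * \<bar>yukawa_partial a i x\<bar> * cmod q \<le> \<bar>x $ i\<bar> * \<bar>yukawa_partial a i x\<bar> * cmod q"
    by (intro mult_right_mono shear_field_bounds(5)[OF \<xi>]) auto
  then show "cmod ((\<xi> (x $ i) * yukawa_partial a i x) *\<^sub>R q) \<le> 1 * cmod ((x $ i * yukawa_partial a i x) *\<^sub>R q)"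
    by (simp add: abs_mult)
qed

text \<open>An inequality for the increments of a pairing along the flow that is sharp to first order in both
  time directions determines the derivative.\<close>

lemma flow_derivative:
  assumes \<xi>: "shear_field \<xi> \<xi>' M L" and M: "0 < M" and cont: "continuous_on UNIV \<phi>"
    and f: "L2_partial i \<phi> g" and g: "L2_partial i g k" and F: "sq_integrable F" and a: "0 < a"
    and u: "\<And>x. u x = \<phi> x + yukawa a x *\<^sub>R q"
    and le: "\<And>t. \<bar>t\<bar> \<le> 1 / 16 \<Longrightarrow> (LI x. F x \<bullet> (u (shear_map \<xi> t i x) - u x)) \<le> t * C + t\<^sup>2 * K"
  shows "(LI x. F x \<bullet> (\<xi> (x $ i) *\<^sub>R (g x + yukawa_partial a i x *\<^sub>R q))) = C"
proof -
  have w: "weight \<xi> \<xi>' M L" using \<xi> by (simp add: shear_field_def)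
  note s\<phi> = L2_partial_sq(1)[OF f] and sg = L2_partial_sq(1)[OF g]
  have wg: "sq_integrable (\<lambda>x. \<xi> (x $ i) *\<^sub>R g x)" by (rule sq_integrable_weight(1)[OF w sg])
  note wy = sq_integrable_weighted_yukawa_partial[OF \<xi> a, of i q]
  obtain K' where K': "\<And>t. \<bar>t\<bar> \<le> 1 / 2 \<Longrightarrow> \<bar>(LI x. F x \<bullet> (\<phi> (shear_map \<xi> t i x) - \<phi> x)) - t * (LI x. F x \<bullet> (\<xi> (x $ i) *\<^sub>R g x))\<bar> \<le> t\<^sup>2 * K'"
    using regular_part_flow[OF \<xi> M cont f g F] by blast
  define D where "D = (LI x. F x \<bullet> (\<xi> (x $ i) *\<^sub>R (g x + yukawa_partial a i x *\<^sub>R q)))"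
  have D: "D = (LI x. F x \<bullet> (\<xi> (x $ i) *\<^sub>R g x)) + (LI x. F x \<bullet> ((\<xi> (x $ i) * yukawa_partial a i x) *\<^sub>R q))"
    unfolding D_def
    by (subst Bochner_Integration.integral_add[OF integrable_inner_sq[OF F wg] integrable_inner_sq[OF F wy], symmetric])
       (simp add: inner_add_right scaleR_add_right distrib_left mult.assoc)
  have lim: "(\<lambda>n. (LI x. F x \<bullet> (u (shear_map \<xi> (t n) i x) - u x)) / t n) \<longlonglongrightarrow> D"
    if t: "\<And>n. t n \<noteq> 0" "\<And>n. \<bar>t n\<bar> \<le> 1 / 4" "t \<longlonglongrightarrow> 0" for t
  proof -
    have t2: "\<bar>t n\<bar> \<le> 1 / 2" for n using t(2)[of n] by simp
    have sD: "sq_integrable (\<lambda>x. \<phi> (shear_map \<xi> (t n) i x) - \<phi> x)" for n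
      by (intro sq_integrable_diff sq_integrable_shear_map(1)[OF \<xi> t2] s\<phi>)
    have sY: "sq_integrable (\<lambda>x. (yukawa a (shear_map \<xi> (t n) i x) - yukawa a x) *\<^sub>R q)" for n
    proof -
      have "sq_integrable (\<lambda>x. yukawa a (shear_map \<xi> (t n) i x) *\<^sub>R q - yukawa a x *\<^sub>R q)"
        by (rule sq_integrable_diff[OF sq_integrable_shear_map(1)[OF \<xi> t2 yukawa_sq_integrable[OF a]] yukawa_sq_integrable[OF a]])
      then show ?thesis by (simp add: scaleR_diff_left)
    qed
    have split: "(LI x. F x \<bullet> (u (shear_map \<xi> (t n) i x) - u x)) =
       (LI x. F x \<bullet> (\<phi> (shear_map \<xi> (t n) i x) - \<phi> x)) + (LI x. F x \<bullet> ((yukawa a (shear_map \<xi> (t n) i x) - yukawa a x) *\<^sub>R q))" for n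
      by (subst Bochner_Integration.integral_add[OF integrable_inner_sq[OF F sD] integrable_inner_sq[OF F sY], symmetric])
         (auto simp: u inner_add_right inner_diff_right algebra_simps intro!: Bochner_Integration.integral_cong)
    have "(\<lambda>n. (LI x. F x \<bullet> (\<phi> (shear_map \<xi> (t n) i x) - \<phi> x)) / t n - (LI x. F x \<bullet> (\<xi> (x $ i) *\<^sub>R g x))) \<longlonglongrightarrow> 0"
    proof (rule Lim_null_comparison)
      have "(\<lambda>n. \<bar>t n\<bar> * K') \<longlonglongrightarrow> \<bar>0\<bar> * K'" by (rule tendsto_mult[OF tendsto_rabs[OF t(3)] tendsto_const])
      then show "(\<lambda>n. \<bar>t n\<bar> * K') \<longlonglongrightarrow> 0" by simp
      show "\<forall>\<^sub>F n in sequentially. norm ((LI x. F x \<bullet> (\<phi> (shear_map \<xi> (t n) i x) - \<phi> x)) / t n - (LI x. F x \<bullet> (\<xi> (x $ i) *\<^sub>R g x))) \<le> \<bar>t n\<bar> * K'"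
      proof (intro always_eventually allI)
        fix n
        define I1 where "I1 = (LI x. F x \<bullet> (\<phi> (shear_map \<xi> (t n) i x) - \<phi> x))"
        define I2 where "I2 = (LI x. F x \<bullet> (\<xi> (x $ i) *\<^sub>R g x))"
        have "\<bar>I1 - t n * I2\<bar> \<le> (t n)\<^sup>2 * K'" unfolding I1_def I2_def by (rule K'[OF t2])
        then have "\<bar>I1 - t n * I2\<bar> / \<bar>t n\<bar> \<le> ((t n)\<^sup>2 * K') / \<bar>t n\<bar>" by (intro divide_right_mono) auto
        moreover have "\<bar>I1 - t n * I2\<bar> / \<bar>t n\<bar> = \<bar>I1 / t n - I2\<bar>" using t(1)[of n] by (simp add: abs_divide[symmetric] diff_divide_distrib)
        moreover have "((t n)\<^sup>2 * K') / \<bar>t n\<bar> = \<bar>t n\<bar> * K'" using t(1)[of n] by (simp add: power2_eq_square field_simps abs_if)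
        ultimately show "norm (I1 / t n - I2) \<le> \<bar>t n\<bar> * K'" by simp
      qed
    qed
    then have "(\<lambda>n. (LI x. F x \<bullet> (\<phi> (shear_map \<xi> (t n) i x) - \<phi> x)) / t n) \<longlonglongrightarrow> (LI x. F x \<bullet> (\<xi> (x $ i) *\<^sub>R g x))"
      by (simp add: LIM_zero_iff)
    from tendsto_add[OF this singular_part_flow[OF \<xi> a F t, of i q]]
    show ?thesis unfolding D split by (simp add: add_divide_distrib)
  qed
  \<comment> \<open>The offset 16 makes every time admissible for the hypothesis, from index 0
    on.\<close>
  define \<tau> where "\<tau> n = 1 / real (n + 16)" for n
  have \<tau>: "\<tau> n > 0" "\<bar>\<tau> n\<bar> \<le> 1 / 4" "\<bar>\<tau> n\<bar> \<le> 1 / 16" for n by (auto simp: \<tau>_def field_simps)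
  have \<tau>0: "\<tau> \<longlonglongrightarrow> 0" unfolding \<tau>_def using LIMSEQ_ignore_initial_segment[OF lim_1_over_n, of 16] by simp
  have "D \<le> C"
  proof (rule LIMSEQ_le)
    show "(\<lambda>n. (LI x. F x \<bullet> (u (shear_map \<xi> (\<tau> n) i x) - u x)) / \<tau> n) \<longlonglongrightarrow> D"
      by (rule lim) (use \<tau> \<tau>0 in \<open>auto simp: less_imp_neq[symmetric]\<close>)
    have "(\<lambda>n. C + \<tau> n * K) \<longlonglongrightarrow> C + 0 * K" by (intro tendsto_intros \<tau>0)
    then show "(\<lambda>n. C + \<tau> n * K) \<longlonglongrightarrow> C" by simp
    show "\<exists>N. \<forall>n\<ge>N. (LI x. F x \<bullet> (u (shear_map \<xi> (\<tau> n) i x) - u x)) / \<tau> n \<le> C + \<tau> n * K"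
    proof (intro exI allI impI)
      fix n
      have "(LI x. F x \<bullet> (u (shear_map \<xi> (\<tau> n) i x) - u x)) / \<tau> n \<le> (\<tau> n * C + (\<tau> n)\<^sup>2 * K) / \<tau> n"
        using \<tau>[of n] by (intro divide_right_mono le) auto
      also have "\<dots> = C + \<tau> n * K" using \<tau>(1)[of n] by (simp add: power2_eq_square field_simps)
      finally show "(LI x. F x \<bullet> (u (shear_map \<xi> (\<tau> n) i x) - u x)) / \<tau> n \<le> C + \<tau> n * K" .
    qed
  qed
  \<comment> \<open>At negative times the same upper bound is divided by a negative number and
    becomes a lower bound for the difference quotient.\<close>
  moreover have "C \<le> D"
  proof (rule LIMSEQ_le)
    show "(\<lambda>n. (LI x. F x \<bullet> (u (shear_map \<xi> (- \<tau> n) i x) - u x)) / (- \<tau> n)) \<longlonglongrightarrow> D"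
    proof (rule lim)
      show "- \<tau> n \<noteq> 0" "\<bar>- \<tau> n\<bar> \<le> 1 / 4" for n using \<tau>[of n] by auto
      show "(\<lambda>n. - \<tau> n) \<longlonglongrightarrow> 0" using tendsto_minus[OF \<tau>0] by simp
    qed
    have "(\<lambda>n. C - \<tau> n * K) \<longlonglongrightarrow> C - 0 * K" by (intro tendsto_intros \<tau>0)
    then show "(\<lambda>n. C - \<tau> n * K) \<longlonglongrightarrow> C" by simp
    show "\<exists>N. \<forall>n\<ge>N. C - \<tau> n * K \<le> (LI x. F x \<bullet> (u (shear_map \<xi> (- \<tau> n) i x) - u x)) / (- \<tau> n)"
    proof (intro exI allI impI)
      fix n
      have "((- \<tau> n) * C + (- \<tau> n)\<^sup>2 * K) / (- \<tau> n) \<le> (LI x. F x \<bullet> (u (shear_map \<xi> (- \<tau> n) i x) - u x)) / (- \<tau> n)"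
        using \<tau>[of n] by (intro divide_right_mono_neg le) auto
      moreover have "((- \<tau> n) * C + (- \<tau> n)\<^sup>2 * K) / (- \<tau> n) = C - \<tau> n * K" using \<tau>(1)[of n] by (simp add: power2_eq_square field_simps)
      ultimately show "C - \<tau> n * K \<le> (LI x. F x \<bullet> (u (shear_map \<xi> (- \<tau> n) i x) - u x)) / (- \<tau> n)" by simp
    qed
  qed
  ultimately show ?thesis unfolding D_def by simp
qed

text \<open>The quadratic case of the convexity argument: u \<bullet> (w - u) \<le> (|w|^2 -
  |u|^2)/2, and the norm of the sheared function is exactly affine in t, so no second-order term
  occurs.\<close>

lemma mass_term:
  assumes \<xi>: "shear_field \<xi> \<xi>' M L" and M: "0 < M" and cont: "continuous_on UNIV \<phi>"
    and f: "L2_partial i \<phi> g" and g: "L2_partial i g k" and a: "0 < a"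
    and u: "\<And>x. u x = \<phi> x + yukawa a x *\<^sub>R q"
  shows "(LI x. u x \<bullet> (\<xi> (x $ i) *\<^sub>R (g x + yukawa_partial a i x *\<^sub>R q))) = - (1 / 2) * (LI x. \<xi>' (x $ i) * (cmod (u x))\<^sup>2)"
proof -
  have su: "sq_integrable u"
    using sq_integrable_add[OF L2_partial_sq(1)[OF f] yukawa_sq_integrable[OF a, of q]] by (simp add: u[abs_def] fun_eq_iff[symmetric] u)
  show ?thesis
  proof (rule flow_derivative[OF \<xi> M cont f g su a u, where K = 0])
    fix t :: real assume "\<bar>t\<bar> \<le> 1 / 16"
    then have t: "\<bar>t\<bar> \<le> 1 / 2" by simp
    note sS = sq_integrable_shear_map[OF \<xi> t su, of i]
    have "(LI x. u x \<bullet> (u (shear_map \<xi> t i x) - u x)) \<le> (LI x. 1 / 2 * (cmod (u (shear_map \<xi> t i x)))\<^sup>2 - 1 / 2 * (cmod (u x))\<^sup>2)"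
    proof (rule integral_mono)
      show "integrable lborel (\<lambda>x. u x \<bullet> (u (shear_map \<xi> t i x) - u x))"
        by (intro integrable_inner_sq su sq_integrable_diff sS)
      show "integrable lborel (\<lambda>x. 1 / 2 * (cmod (u (shear_map \<xi> t i x)))\<^sup>2 - 1 / 2 * (cmod (u x))\<^sup>2)"
        by (intro Bochner_Integration.integrable_diff integrable_mult_right sq_integrable_integrable su sS)
      fix x
      show "u x \<bullet> (u (shear_map \<xi> t i x) - u x) \<le> 1 / 2 * (cmod (u (shear_map \<xi> t i x)))\<^sup>2 - 1 / 2 * (cmod (u x))\<^sup>2"
        using inner_amgm[of 1 "u x" "u (shear_map \<xi> t i x)"] by (simp add: inner_diff_right power2_norm_eq_inner)
    qed
    also have "\<dots> = t * (- (1 / 2) * (LI x. \<xi>' (x $ i) * (cmod (u x))\<^sup>2)) + t\<^sup>2 * 0"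
      using sq_integrable_integrable[OF su] sq_integrable_integrable[OF sS(1)] sS(2) by (simp add: field_simps)
    finally show "(LI x. u x \<bullet> (u (shear_map \<xi> t i x) - u x)) \<le> t * (- (1 / 2) * (LI x. \<xi>' (x $ i) * (cmod (u x))\<^sup>2)) + t\<^sup>2 * 0" .
  qed
qed

section \<open>The arctangent truncation\<close>

definition soft :: "real \<Rightarrow> real \<Rightarrow> real" where
  "soft \<epsilon> s = arctan (\<epsilon> * s) / \<epsilon>"

definition soft' :: "real \<Rightarrow> real \<Rightarrow> real" where
  "soft' \<epsilon> s = 1 / (1 + (\<epsilon> * s)\<^sup>2)"

text \<open>\<open>pi / (2 * \<epsilon>)\<close> is the supremum of the arctangent divided by
  \<epsilon>. The remainder constant \<epsilon> bounds the second derivative: with y = \<epsilon> s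
  it is 2 \<epsilon> |y|/(1 + y^2)^2, and 2|y| \<le> 1 + y^2 \<le> (1 + y^2)^2.\<close>

lemma shear_field_soft:
  assumes e: "0 < \<epsilon>"
  shows "shear_field (soft \<epsilon>) (soft' \<epsilon>) (pi / (2 * \<epsilon>)) \<epsilon>"
proof -
  have d: "(soft \<epsilon> has_real_derivative soft' \<epsilon> s) (at s)" for s
    unfolding soft_def[abs_def] soft'_def using e
    by (auto intro!: derivative_eq_intros simp: divide_inverse)
  have pos: "0 < 1 + (\<epsilon> * s)\<^sup>2" for s using zero_le_power2[of "\<epsilon> * s"] by linarith
  have s'b: "0 \<le> soft' \<epsilon> s" "soft' \<epsilon> s \<le> 1" for s
    using pos[of s] by (auto simp: soft'_def)
  have c': "continuous_on UNIV (soft' \<epsilon>)"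
    unfolding soft'_def[abs_def] using pos by (intro continuous_intros) (auto simp: less_imp_neq[symmetric])
  have c: "continuous_on UNIV (soft \<epsilon>)"
    using d by (auto intro!: continuous_at_imp_continuous_on DERIV_isCont)
  have lip: "\<bar>soft \<epsilon> (s + t) - soft \<epsilon> s\<bar> \<le> \<bar>t\<bar>" for s t
  proof -
    have "norm (soft \<epsilon> (s + t) - soft \<epsilon> s) \<le> 1 * norm (s + t - s)"
      by (rule field_differentiable_bound[of UNIV]) (use d s'b in \<open>auto\<close>)
    then show ?thesis by simp
  qed
  have d2: "(soft' \<epsilon> has_real_derivative (- (2 * \<epsilon>\<^sup>2 * s) / (1 + (\<epsilon> * s)\<^sup>2)\<^sup>2)) (at s)" for s
    unfolding soft'_def[abs_def] using pos[of s]
    by (auto intro!: derivative_eq_intros simp: power2_eq_square)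
  have d2b: "\<bar>- (2 * \<epsilon>\<^sup>2 * s) / (1 + (\<epsilon> * s)\<^sup>2)\<^sup>2\<bar> \<le> \<epsilon>" for s
  proof -
    define y where "y = \<epsilon> * s"
    have y: "2 * \<bar>y\<bar> \<le> 1 + y\<^sup>2" using zero_le_power2[of "\<bar>y\<bar> - 1"] by (simp add: power2_eq_square algebra_simps)
    have y1: "1 \<le> 1 + y\<^sup>2" by simp
    have "(1 + y\<^sup>2) * 1 \<le> (1 + y\<^sup>2) * (1 + y\<^sup>2)" using y1 by (intro mult_left_mono) auto
    then have "2 * \<bar>y\<bar> \<le> (1 + y\<^sup>2)\<^sup>2" using y by (simp add: power2_eq_square)
    then have "\<epsilon> * (2 * \<bar>y\<bar>) \<le> \<epsilon> * (1 + y\<^sup>2)\<^sup>2" using e by (intro mult_left_mono) auto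
    then have "\<epsilon> * (2 * \<bar>y\<bar>) / (1 + y\<^sup>2)\<^sup>2 \<le> \<epsilon>" using pos[of s] by (simp add: y_def divide_le_eq)
    moreover have "\<bar>- (2 * \<epsilon>\<^sup>2 * s) / (1 + (\<epsilon> * s)\<^sup>2)\<^sup>2\<bar> = \<epsilon> * (2 * \<bar>y\<bar>) / (1 + y\<^sup>2)\<^sup>2"
      using e by (simp add: y_def abs_mult power2_eq_square)
    ultimately show ?thesis by simp
  qed
  have lip': "\<bar>soft' \<epsilon> r - soft' \<epsilon> s\<bar> \<le> \<epsilon> * \<bar>r - s\<bar>" for r s
  proof -
    have "norm (soft' \<epsilon> r - soft' \<epsilon> s) \<le> \<epsilon> * norm (r - s)"
      by (rule field_differentiable_bound[of UNIV]) (use d2 d2b in \<open>auto simp only: real_norm_def UNIV_I convex_UNIV has_field_derivative_at_within\<close>)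
    then show ?thesis by simp
  qed
  have quad: "\<bar>soft \<epsilon> (s + t) - soft \<epsilon> s - t * soft' \<epsilon> s\<bar> \<le> \<epsilon> * t\<^sup>2" for s t
  proof -
    define S where "S = {r. \<bar>r - s\<bar> \<le> \<bar>t\<bar>}"
    have S: "S = {s - \<bar>t\<bar>..s + \<bar>t\<bar>}" by (auto simp: S_def abs_le_iff)
    have "norm ((\<lambda>r. soft \<epsilon> r - r * soft' \<epsilon> s) (s + t) - (\<lambda>r. soft \<epsilon> r - r * soft' \<epsilon> s) s) \<le> (\<epsilon> * \<bar>t\<bar>) * norm (s + t - s)"
    proof (rule field_differentiable_bound[of S _ "\<lambda>r. soft' \<epsilon> r - soft' \<epsilon> s"])
      show "convex S" unfolding S by simp
      fix r assume r: "r \<in> S"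
      have "((\<lambda>r. soft \<epsilon> r - r * soft' \<epsilon> s) has_real_derivative soft' \<epsilon> r - 1 * soft' \<epsilon> s) (at r)"
        by (intro DERIV_diff d DERIV_cmult_right DERIV_ident)
      then show "((\<lambda>r. soft \<epsilon> r - r * soft' \<epsilon> s) has_real_derivative soft' \<epsilon> r - soft' \<epsilon> s) (at r within S)"
        by (simp add: has_field_derivative_at_within)
      have "\<epsilon> * \<bar>r - s\<bar> \<le> \<epsilon> * \<bar>t\<bar>" using r e by (intro mult_left_mono) (auto simp: S_def)
      then show "norm (soft' \<epsilon> r - soft' \<epsilon> s) \<le> \<epsilon> * \<bar>t\<bar>" using lip'[of r s] by simp
    qed (auto simp: S_def)
    then show ?thesis by (simp add: algebra_simps power2_eq_square abs_mult_self_eq)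
  qed
  have b: "\<bar>soft \<epsilon> s\<bar> \<le> pi / (2 * \<epsilon>)" for s
  proof -
    have "\<bar>arctan (\<epsilon> * s)\<bar> \<le> pi / 2" using arctan_bounded[of "\<epsilon> * s"] by linarith
    then have "\<bar>arctan (\<epsilon> * s)\<bar> / \<epsilon> \<le> (pi / 2) / \<epsilon>" using e by (intro divide_right_mono) auto
    then show ?thesis using e by (simp add: soft_def abs_divide)
  qed
  show ?thesis
    unfolding shear_field_def weight_def
    using d c' s'b lip quad b by (auto intro: borel_measurable_continuous_onI c c' simp: soft_def)
qed

section \<open>Riesz kernels\<close>

lemma nn_integral_swap:
  fixes f :: "'a::euclidean_space \<Rightarrow> 'b::euclidean_space \<Rightarrow> ennreal"
  assumes "(\<lambda>(x, y). f x y) \<in> borel_measurable (borel \<Otimes>\<^sub>M borel)"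
  shows "(NI x. NI y. f x y) = (NI y. NI x. f x y)"
  using assms by (intro lborel_pair.Fubini'[symmetric]) simp

text \<open>A Gaussian is the convolution square of a narrower one, by the parallelogram law about
  the midpoint m: 2|x - w|^2 + 2|y - w|^2 = |x - y|^2 + 4|w - m|^2. The constant normalises the
  remaining Gaussian in w. This factorisation is what makes the kernel positive definite.\<close>

lemma gaussian_convolution:
  assumes v: "0 < v"
  shows "\<exists>C. \<forall>x y :: space. ennreal (exp (- v * (norm (x - y))\<^sup>2)) =
     C * (NI w. ennreal (exp (- 2 * v * (norm (x - w))\<^sup>2)) * ennreal (exp (- 2 * v * (norm (y - w))\<^sup>2)))"
proof -
  define Z where "Z = (NI w. ennreal (exp (- 4 * v * (norm (w :: space))\<^sup>2)))"
  have fin: "Z \<noteq> \<infinity>"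
  proof -
    \<comment> \<open>Completing the square compares the Gaussian with exp(-r), whose integral over
      space is already known to be finite.\<close>
    have e: "exp (- 4 * v * r\<^sup>2) \<le> exp (1 / (16 * v)) * exp (- 1 * r)" for r :: real
    proof -
      have "0 \<le> 4 * v * (r - 1 / (8 * v))\<^sup>2" using v by simp
      also have "\<dots> = 4 * v * r\<^sup>2 - r + 1 / (16 * v)" using v by (simp add: field_simps power2_eq_square)
      finally show ?thesis by (simp add: exp_add[symmetric])
    qed
    have "Z \<le> (NI w. ennreal (exp (1 / (16 * v))) * ennreal (exp (- 1 * norm (w :: space))))"
      unfolding Z_def by (intro nn_integral_mono) (simp only: ennreal_mult[symmetric] exp_ge_zero ennreal_leI e)
    also have "\<dots> = ennreal (exp (1 / (16 * v))) * (NI w. ennreal (exp (- 1 * norm (w :: space))))"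
      by (rule nn_integral_cmult) measurable
    also have "\<dots> < \<infinity>"
    proof -
      have "integrable lborel (\<lambda>w::space. (cmod (expo (1 / 2) w *\<^sub>R 1))\<^sup>2)"
        by (rule sq_integrable_integrable[OF expo_sq_integrable(1)]) simp
      moreover have "(cmod (expo (1 / 2) w *\<^sub>R 1))\<^sup>2 = exp (- 1 * norm w)" for w :: space
        by (simp add: expo_def power2_eq_square exp_add[symmetric])
      ultimately have "integrable lborel (\<lambda>w::space. exp (- 1 * norm w))" by simp
      from nn_integral_eq_integral[OF this] show ?thesis by (simp add: ennreal_mult_less_top)
    qed
    finally show ?thesis by simp
  qed
  have "Z \<noteq> 0"
  proof
    assume "Z = 0"
    then have "AE w::space in lborel. ennreal (exp (- 4 * v * (norm w)\<^sup>2)) = 0"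
      unfolding Z_def by (subst (asm) nn_integral_0_iff_AE) auto
    then show False by (simp add: eventually_False ae_filter_eq_bot_iff)
  qed
  with fin obtain z where z: "Z = ennreal z" "0 < z"
    by (cases Z) (auto simp: less_le)
  have "ennreal (exp (- v * (norm (x - y))\<^sup>2)) =
     ennreal (1 / z) * (NI w. ennreal (exp (- 2 * v * (norm (x - w))\<^sup>2)) * ennreal (exp (- 2 * v * (norm (y - w))\<^sup>2)))" for x y :: space
  proof -
    define m where "m = (1 / 2) *\<^sub>R (x + y)"
    have "(NI w. ennreal (exp (- 2 * v * (norm (x - w))\<^sup>2)) * ennreal (exp (- 2 * v * (norm (y - w))\<^sup>2)))
       = (NI w. ennreal (exp (- v * (norm (x - y))\<^sup>2)) * ennreal (exp (- 4 * v * (norm (w + - m))\<^sup>2)))"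
    proof (rule nn_integral_cong)
      fix w :: space
      have "2 * (norm (x - w))\<^sup>2 + 2 * (norm (y - w))\<^sup>2 = (norm (x - y))\<^sup>2 + 4 * (norm (w + - m))\<^sup>2"
        unfolding power2_norm_eq_inner m_def by (simp add: inner_diff inner_add inner_commute algebra_simps)
      then have "v * (2 * (norm (x - w))\<^sup>2 + 2 * (norm (y - w))\<^sup>2) = v * ((norm (x - y))\<^sup>2 + 4 * (norm (w + - m))\<^sup>2)" by (simp only:)
      then have "- 2 * v * (norm (x - w))\<^sup>2 + - 2 * v * (norm (y - w))\<^sup>2 = - v * (norm (x - y))\<^sup>2 + - 4 * v * (norm (w + - m))\<^sup>2"
        by (simp add: algebra_simps)
      then show "ennreal (exp (- 2 * v * (norm (x - w))\<^sup>2)) * ennreal (exp (- 2 * v * (norm (y - w))\<^sup>2)) = ennreal (exp (- v * (norm (x - y))\<^sup>2)) * ennreal (exp (- 4 * v * (norm (w + - m))\<^sup>2))"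
        by (simp only: ennreal_mult[symmetric] exp_ge_zero exp_add[symmetric])
    qed
    also have "\<dots> = ennreal (exp (- v * (norm (x - y))\<^sup>2)) * (NI w. ennreal (exp (- 4 * v * (norm (w + - m))\<^sup>2)))"
      by (rule nn_integral_cmult) measurable
    also have "(NI w. ennreal (exp (- 4 * v * (norm (w + - m))\<^sup>2))) = Z"
      unfolding Z_def by (rule nn_integral_shift[of "\<lambda>w. ennreal (exp (- 4 * v * (norm w)\<^sup>2))"]) measurable
    finally show ?thesis using z by (simp add: ennreal_mult[symmetric])
  qed
  then show ?thesis by blast
qed

lemma two_mult_le_squares_ennreal: "2 * (a * b) \<le> a * a + b * (b :: ennreal)"
proof (cases a)
  case a: (real r)
  show ?thesis
  proof (cases b)
    case b: (real t)
    have "2 * (r * t) \<le> r * r + t * t" using sum_squares_bound[of r t] by (simp add: power2_eq_square algebra_simps)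
    then show ?thesis using a b by (simp add: ennreal_mult[symmetric] ennreal_plus[symmetric] ennreal_leI flip: ennreal_numeral del: ennreal_plus)
  qed simp
qed simp

text \<open>With \<open>A k\<close> the Gaussian average of \<open>k\<close>, the mixed energy of
  two densities is C times the integral of the product of their averages, and 2 A B \<le> A^2 + B^2
  pointwise. Positive definiteness is stated in this form because it makes sense for infinite
  energies, without subtraction.\<close>

lemma gaussian_energy_le:
  fixes f g :: "space \<Rightarrow> ennreal"
  assumes v: "0 < v" and [measurable]: "f \<in> borel_measurable borel" "g \<in> borel_measurable borel"
  defines "G \<equiv> \<lambda>x y :: space. ennreal (exp (- v * (norm (x - y))\<^sup>2))"
  shows "2 * (NI x. NI y. G x y * (f x * g y)) \<le>
     (NI x. NI y. G x y * (f x * f y)) + (NI x. NI y. G x y * (g x * g y))"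
proof -
  define h where "h x w = ennreal (exp (- 2 * v * (norm (x - w))\<^sup>2))" for x w :: space
  have hm[measurable]: "(\<lambda>p. h (fst p) (snd p)) \<in> borel_measurable (borel \<Otimes>\<^sub>M borel)" unfolding h_def by measurable
  have hm1[measurable]: "h x \<in> borel_measurable borel" "(\<lambda>x. h x w) \<in> borel_measurable borel" for x w unfolding h_def[abs_def] by measurable
  obtain C where C: "\<And>x y. G x y = C * (NI w. h x w * h y w)"
    using gaussian_convolution[OF v] unfolding G_def h_def by blast
  define A where "A k w = (NI x. h x w * k x)" for k w
  have Am: "A k \<in> borel_measurable borel" if [measurable]: "k \<in> borel_measurable borel" for k
    unfolding A_def[abs_def] h_def by measurable
  have rep: "(NI x. NI y. G x y * (k x * l y)) = C * (NI w. A k w * A l w)"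
    if k[measurable]: "k \<in> borel_measurable borel" and l[measurable]: "l \<in> borel_measurable borel" for k l
  proof -
    note Am[OF l, measurable] Am[OF k, measurable]
    have 1: "(NI y. G x y * (k x * l y)) = C * (NI w. h x w * k x * A l w)" for x
    proof -
      have "(NI y. G x y * (k x * l y)) = (NI y. NI w. C * (h x w * k x * (h y w * l y)))"
        unfolding C by (subst nn_integral_cmult[symmetric], measurable, subst nn_integral_multc[symmetric], measurable, simp add: mult_ac)
      also have "\<dots> = (NI w. NI y. C * (h x w * k x * (h y w * l y)))"
        by (rule nn_integral_swap) (simp add: h_def case_prod_beta)
      also have "\<dots> = (NI w. C * (h x w * k x * A l w))"
        unfolding A_def by (subst nn_integral_cmult, measurable, subst nn_integral_cmult, measurable)
      finally show ?thesis by (subst (asm) nn_integral_cmult) measurable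
    qed
    have "(NI x. NI y. G x y * (k x * l y)) = C * (NI x. NI w. h x w * k x * A l w)"
      unfolding 1 by (rule nn_integral_cmult) (simp add: h_def)
    also have "(NI x. NI w. h x w * k x * A l w) = (NI w. NI x. h x w * k x * A l w)"
      by (rule nn_integral_swap) (simp add: h_def case_prod_beta)
    also have "\<dots> = (NI w. A k w * A l w)"
      unfolding A_def[of k] by (subst nn_integral_multc, measurable)
    finally show ?thesis .
  qed
  note Am[OF assms(2), measurable] Am[OF assms(3), measurable]
  have "2 * (C * (NI w. A f w * A g w)) = C * (NI w. 2 * (A f w * A g w))"
    by (subst nn_integral_cmult, measurable) (simp add: mult_ac)
  also have "\<dots> \<le> C * (NI w. A f w * A f w + A g w * A g w)"
    by (intro mult_left_mono nn_integral_mono two_mult_le_squares_ennreal) simp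
  also have "\<dots> = C * (NI w. A f w * A f w) + C * (NI w. A g w * A g w)"
    by (subst nn_integral_add, measurable) (simp add: distrib_left)
  finally show ?thesis using rep assms(2,3) by simp
qed

section \<open>The Riesz kernel as a mixture of Gaussians\<close>

definition riesz_kernel :: "real \<Rightarrow> space \<Rightarrow> real" where
  "riesz_kernel s z = 1 / norm z powr s"

lemma riesz_kernel_measurable[measurable]: "riesz_kernel s \<in> borel_measurable borel"
  unfolding riesz_kernel_def[abs_def] by measurable

lemma riesz_kernel_nonneg[simp]: "0 \<le> riesz_kernel s z"
  by (simp add: riesz_kernel_def)

text \<open>The Gamma integral with the substitution v = t/|z|^2: an inverse power of |z| is a
  positive superposition of Gaussians in z.\<close>

lemma riesz_kernel_gaussian:
  assumes s: "0 < s" and z: "z \<noteq> 0"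
  shows "(NI v. ennreal (indicator {0<..} v * v powr (s / 2 - 1)) * ennreal (exp (- v * (norm z)\<^sup>2))) =
     ennreal (Gamma (s / 2)) * ennreal (riesz_kernel s z)"
proof -
  define c where "c = 1 / (norm z)\<^sup>2"
  have c: "0 < c" using z by (simp add: c_def)
  define b where "b = s / 2"
  have b: "0 < b" using s by (simp add: b_def)
  have G: "(NI t. ennreal (indicator {0<..} t * t powr (b - 1) * exp (- t))) = ennreal (Gamma b)"
  proof -
    have "(NI t. ennreal (indicator {0<..} t * t powr (b - 1) * exp (- t))) = (NI t. indicator {0..} t * ennreal (t powr (b - 1) / exp t))"
      by (intro nn_integral_cong) (auto simp: indicator_def exp_minus field_simps)
    also have "\<dots> = ennreal (Gamma b)"
      using nn_integral_has_integral_lebesgue'[OF _ Gamma_integral_real[OF b]] by (simp add: mult.commute)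
    finally show ?thesis .
  qed
  have "(NI v. ennreal (indicator {0<..} v * v powr (b - 1) * exp (- v * (norm z)\<^sup>2))) =
    \<bar>c\<bar> * (NI t. ennreal (indicator {0<..} (0 + c * t) * (0 + c * t) powr (b - 1) * exp (- (0 + c * t) * (norm z)\<^sup>2)))"
    by (rule nn_integral_real_affine) (use c in auto)
  also have "(NI t. ennreal (indicator {0<..} (0 + c * t) * (0 + c * t) powr (b - 1) * exp (- (0 + c * t) * (norm z)\<^sup>2)))
     = (NI t. ennreal (c powr (b - 1)) * ennreal (indicator {0<..} t * t powr (b - 1) * exp (- t)))"
  proof (rule nn_integral_cong)
    fix t :: real
    have "c * (norm z)\<^sup>2 = 1" using z by (simp add: c_def)
    then have "(0 + c * t) * (norm z)\<^sup>2 = t" by (metis add_0 mult.assoc mult.commute mult_1)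
    then have "exp (- (0 + c * t) * (norm z)\<^sup>2) = exp (- t)" by simp
    then show "ennreal (indicator {0<..} (0 + c * t) * (0 + c * t) powr (b - 1) * exp (- (0 + c * t) * (norm z)\<^sup>2)) = ennreal (c powr (b - 1)) * ennreal (indicator {0<..} t * t powr (b - 1) * exp (- t))"
      using c by (auto simp: indicator_def zero_less_mult_iff powr_mult ennreal_mult[symmetric] mult_ac)
  qed
  also have "\<dots> = ennreal (c powr (b - 1)) * ennreal (Gamma b)"
    by (subst nn_integral_cmult) (auto simp: G)
  also have "\<bar>c\<bar> * (ennreal (c powr (b - 1)) * ennreal (Gamma b)) = ennreal (Gamma b) * ennreal (c * c powr (b - 1))"
    using c by (simp add: ennreal_mult mult_ac)
  also have "c * c powr (b - 1) = riesz_kernel s z"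
  proof -
    have "c * c powr (b - 1) = c powr b" using c powr_add[of c 1 "b - 1"] by simp
    also have "\<dots> = 1 / ((norm z)\<^sup>2) powr b" by (simp add: c_def powr_divide)
    also have "((norm z)\<^sup>2) powr b = norm z powr s"
      using z by (simp add: powr_powr b_def flip: powr_numeral)
    finally show ?thesis by (simp add: riesz_kernel_def)
  qed
  finally show ?thesis by (simp add: b_def ennreal_mult'[symmetric] mult.assoc)
qed

text \<open>Positive definiteness is inherited from the Gaussians by integrating over their width v.
  The factor Gamma(s/2), positive and finite, is carried through and cancelled at the end; the
  diagonal x = y, where the Gaussian formula fails, is a null set.\<close>

lemma riesz_energy_le:
  fixes f g :: "space \<Rightarrow> ennreal"
  assumes s: "0 < s" and [measurable]: "f \<in> borel_measurable borel" "g \<in> borel_measurable borel"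
  defines "k \<equiv> \<lambda>x y :: space. ennreal (riesz_kernel s (x - y))"
  shows "2 * (NI x. NI y. k x y * (f x * g y)) \<le>
     (NI x. NI y. k x y * (f x * f y)) + (NI x. NI y. k x y * (g x * g y))"
proof -
  define \<Gamma> where "\<Gamma> = ennreal (Gamma (s / 2))"
  have \<Gamma>: "\<Gamma> \<noteq> 0" "\<Gamma> \<noteq> top" using Gamma_real_pos[of "s / 2"] s by (auto simp: \<Gamma>_def ennreal_eq_0_iff not_le)
  define m where "m v = ennreal (indicator {0<..} v * v powr (s / 2 - 1))" for v :: real
  define G where "G v x y = ennreal (exp (- v * (norm (x - y :: space))\<^sup>2))" for v x y
  define E where "E v p r = (NI x. NI y. G v x y * (p x * r y))" for v p r
  have [measurable]: "m \<in> borel_measurable borel" unfolding m_def[abs_def] by measurable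
  have Em: "(\<lambda>v. E v p r) \<in> borel_measurable borel"
    if [measurable]: "p \<in> borel_measurable borel" "r \<in> borel_measurable borel" for p r
    unfolding E_def[abs_def] G_def by measurable
  have rep: "\<Gamma> * (NI x. NI y. k x y * (p x * r y)) = (NI v. m v * E v p r)"
    if [measurable]: "p \<in> borel_measurable borel" "r \<in> borel_measurable borel" for p r
  proof -
    have 1: "\<Gamma> * (NI y. k x y * (p x * r y)) = (NI v. m v * (NI y. G v x y * (p x * r y)))" for x
    proof -
      have "\<Gamma> * (NI y. k x y * (p x * r y)) = (NI y. \<Gamma> * (k x y * (p x * r y)))"
        unfolding k_def by (rule nn_integral_cmult[symmetric]) measurable
      also have "\<dots> = (NI y. NI v. m v * (G v x y * (p x * r y)))"
      proof (rule nn_integral_cong_AE)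
        have "AE y in lborel. x \<noteq> (y :: space)" by (rule AE_I[of _ _ "{x}"]) auto
        then show "AE y in lborel. \<Gamma> * (k x y * (p x * r y)) = (NI v. m v * (G v x y * (p x * r y)))"
        proof eventually_elim
          case (elim y)
          have "(NI v. m v * (G v x y * (p x * r y))) = (NI v. m v * G v x y * (p x * r y))" by (simp add: mult_ac)
          also have "\<dots> = (NI v. m v * G v x y) * (p x * r y)"
            by (rule nn_integral_multc) (simp add: G_def)
          also have "(NI v. m v * G v x y) = \<Gamma> * k x y"
            unfolding m_def G_def \<Gamma>_def k_def by (rule riesz_kernel_gaussian[OF s]) (use elim in simp)
          finally show ?case by (simp add: mult_ac)
        qed
      qed
      also have "\<dots> = (NI v. NI y. m v * (G v x y * (p x * r y)))"
        by (rule nn_integral_swap) (simp add: G_def case_prod_beta)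
      also have "\<dots> = (NI v. m v * (NI y. G v x y * (p x * r y)))"
        by (intro nn_integral_cong nn_integral_cmult) (simp add: G_def)
      finally show ?thesis .
    qed
    have "\<Gamma> * (NI x. NI y. k x y * (p x * r y)) = (NI x. \<Gamma> * (NI y. k x y * (p x * r y)))"
      by (rule nn_integral_cmult[symmetric]) (simp add: k_def)
    also have "\<dots> = (NI v. NI x. m v * (NI y. G v x y * (p x * r y)))"
      unfolding 1 by (rule nn_integral_swap) (simp add: G_def case_prod_beta)
    also have "\<dots> = (NI v. m v * E v p r)"
      unfolding E_def by (intro nn_integral_cong nn_integral_cmult) (simp add: G_def)
    finally show ?thesis .
  qed
  note Em[OF assms(2,3), measurable] Em[OF assms(2,2), measurable] Em[OF assms(3,3), measurable]
  have "\<Gamma> * (2 * (NI x. NI y. k x y * (f x * g y))) = 2 * (NI v. m v * E v f g)"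
    by (subst rep[symmetric]) (measurable, simp add: mult_ac)
  also have "\<dots> = (NI v. 2 * (m v * E v f g))" by (rule nn_integral_cmult[symmetric]) measurable
  also have "\<dots> \<le> (NI v. m v * E v f f + m v * E v g g)"
  proof (rule nn_integral_mono)
    fix v :: real
    show "2 * (m v * E v f g) \<le> m v * E v f f + m v * E v g g"
    proof (cases "0 < v")
      case True
      have "m v * (2 * E v f g) \<le> m v * (E v f f + E v g g)"
        unfolding E_def G_def by (intro mult_left_mono gaussian_energy_le True) simp_all
      then show ?thesis by (simp add: distrib_left mult_ac)
    qed (simp add: m_def)
  qed
  also have "\<dots> = (NI v. m v * E v f f) + (NI v. m v * E v g g)" by (rule nn_integral_add) measurable
  also have "\<dots> = \<Gamma> * ((NI x. NI y. k x y * (f x * f y)) + (NI x. NI y. k x y * (g x * g y)))"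
    unfolding distrib_left by (subst (1 2) rep) simp_all
  finally show ?thesis by (rule ennreal_mult_le_mult_iff[OF \<Gamma>, THEN iffD1])
qed

text \<open>Division by zero gives the kernel the value 0 at the origin, so statements about pairs
  x, y hold on the diagonal without an exception.\<close>

lemma riesz_kernel_zero[simp]: "riesz_kernel s 0 = 0"
  by (simp add: riesz_kernel_def)

section \<open>First variation of the kernel under a shear\<close>

lemma exp_le_quadratic:
  assumes "\<bar>x\<bar> \<le> (1::real)"
  shows "exp x \<le> 1 + x + x\<^sup>2"
proof (cases "0 \<le> x")
  case True
  then show ?thesis using assms by (intro exp_bound) auto
next
  case False
  have "1 - x \<le> exp (- x)" using exp_ge_add_one_self[of "- x"] by simp
  moreover have "0 < 1 - x" using False by simp
  ultimately have "exp x \<le> 1 / (1 - x)" by (simp add: exp_minus field_simps)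
  also have "\<dots> \<le> 1 + x + x\<^sup>2"
  proof -
    have "(1 + x + x\<^sup>2) * (1 - x) = 1 + x\<^sup>2 * (- x)" by (simp add: algebra_simps power2_eq_square)
    moreover have "0 \<le> x\<^sup>2 * (- x)" using False by (intro mult_nonneg_nonneg) auto
    ultimately show ?thesis using False by (simp add: divide_le_eq)
  qed
  finally show ?thesis .
qed

text \<open>The logarithmic derivative at t = 0 of the kernel between the two points moved by
  \<open>shear_inv\<close>, times the Jacobians at both points.\<close>

definition kernel_variation :: "real \<Rightarrow> (real \<Rightarrow> real) \<Rightarrow> (real \<Rightarrow> real) \<Rightarrow> 3 \<Rightarrow> space \<Rightarrow> space \<Rightarrow> real" where
  "kernel_variation s \<xi> \<xi>' i x y =
     s * ((\<xi> (x $ i) - \<xi> (y $ i)) * (x $ i - y $ i) / (norm (x - y))\<^sup>2) - \<xi>' (x $ i) - \<xi>' (y $ i)"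

lemma shear_quotient_bounds:
  assumes \<xi>: "shear_field \<xi> \<xi>' M L"
  shows "\<bar>(\<xi> (x $ i) - \<xi> (y $ i)) * (x $ i - y $ i) / (norm (x - y))\<^sup>2\<bar> \<le> 1"
    "(\<xi> (x $ i) - \<xi> (y $ i))\<^sup>2 / (norm (x - y :: space))\<^sup>2 \<le> 1"
proof -
  have 1: "\<bar>x $ i - y $ i\<bar> \<le> norm (x - y)" using component_le_norm_cart[of "x - y" i] by simp
  have 2: "\<bar>\<xi> (x $ i) - \<xi> (y $ i)\<bar> \<le> norm (x - y)" using shear_field_bounds(4)[OF \<xi>, of "x $ i" "y $ i"] 1 by linarith
  have "\<bar>(\<xi> (x $ i) - \<xi> (y $ i)) * (x $ i - y $ i)\<bar> \<le> (norm (x - y))\<^sup>2"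
    unfolding abs_mult power2_eq_square by (intro mult_mono 1 2) auto
  then show "\<bar>(\<xi> (x $ i) - \<xi> (y $ i)) * (x $ i - y $ i) / (norm (x - y))\<^sup>2\<bar> \<le> 1"
    by (simp add: divide_le_eq)
  have "(\<xi> (x $ i) - \<xi> (y $ i))\<^sup>2 \<le> (norm (x - y))\<^sup>2" using power_mono[OF 2, of 2] by simp
  then show "(\<xi> (x $ i) - \<xi> (y $ i))\<^sup>2 / (norm (x - y))\<^sup>2 \<le> 1"
    by (simp add: divide_le_eq)
qed

lemma kernel_variation_bound:
  assumes \<xi>: "shear_field \<xi> \<xi>' M L" and s: "0 < s" "s < 3"
  shows "\<bar>kernel_variation s \<xi> \<xi>' i x y\<bar> \<le> 5"
proof -
  define Q where "Q = (\<xi> (x $ i) - \<xi> (y $ i)) * (x $ i - y $ i) / (norm (x - y))\<^sup>2"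
  have "\<bar>Q\<bar> \<le> 1" unfolding Q_def by (rule shear_quotient_bounds[OF \<xi>])
  then have "\<bar>s * Q\<bar> \<le> 3 * 1" unfolding abs_mult using s by (intro mult_mono) auto
  then show ?thesis
    using shear_field_bounds(2,3)[OF \<xi>, of "x $ i"] shear_field_bounds(2,3)[OF \<xi>, of "y $ i"]
    unfolding kernel_variation_def Q_def[symmetric] by linarith
qed

lemma kernel_variation_factor_nonneg:
  assumes \<xi>: "shear_field \<xi> \<xi>' M L" and s: "0 < s" "s < 3" and t: "\<bar>t\<bar> \<le> 1 / 16"
  shows "0 \<le> 1 + t * kernel_variation s \<xi> \<xi>' i x y + 100 * t\<^sup>2"
proof -
  have "\<bar>t * kernel_variation s \<xi> \<xi>' i x y\<bar> \<le> 1 / 16 * 5"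
    unfolding abs_mult by (intro mult_mono t kernel_variation_bound[OF \<xi> s]) auto
  moreover have "0 \<le> 100 * t\<^sup>2" by simp
  ultimately show ?thesis by linarith
qed

text \<open>The estimate is made in the exponent: ln(1 + h) \<ge> h - 2 h^2 for the kernel and 1 - t
  \<xi>' \<le> exp(-t \<xi>') for the Jacobians. Only an upper bound is required, but for both signs
  of t and with an error relative to the kernel itself, uniformly up to the diagonal.\<close>

lemma riesz_kernel_flow_le:
  assumes \<xi>: "shear_field \<xi> \<xi>' M L" and s: "0 < s" "s < 3" and t: "\<bar>t\<bar> \<le> 1 / 16"
  shows "riesz_kernel s (shear_inv \<xi> t i x - shear_inv \<xi> t i y) * ((1 - t * \<xi>' (x $ i)) * (1 - t * \<xi>' (y $ i)))
     \<le> (1 + t * kernel_variation s \<xi> \<xi>' i x y + 100 * t\<^sup>2) * riesz_kernel s (x - y)"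
proof (cases "x = y")
  case False
  define D where "D = x - y"
  define d where "d = \<xi> (x $ i) - \<xi> (y $ i)"
  define \<delta> where "\<delta> = x $ i - y $ i"
  define r2 where "r2 = (norm D)\<^sup>2"
  define A where "A = kernel_variation s \<xi> \<xi>' i x y"
  define Q where "Q = d * \<delta> / r2"
  define P where "P = d\<^sup>2 / r2"
  have D: "D \<noteq> 0" "0 < norm D" and r2: "0 < r2" using False by (auto simp: D_def r2_def)
  have Q: "\<bar>Q\<bar> \<le> 1" and P: "P \<le> 1" "0 \<le> P"
    using shear_quotient_bounds[OF \<xi>, of x i y] by (auto simp: Q_def P_def d_def \<delta>_def r2_def D_def)
  \<comment> \<open>The relative change of the squared distance: |D - t d e_i|^2 = r2 (1 + h). It is
    uniformly small because \<xi> has slope at most 1.\<close>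
  define h where "h = t\<^sup>2 * P - 2 * t * Q"
  have t2: "t\<^sup>2 \<le> \<bar>t\<bar>"
  proof -
    have "\<bar>t\<bar> * \<bar>t\<bar> \<le> 1 * \<bar>t\<bar>" using t by (intro mult_right_mono) auto
    then show ?thesis by (simp add: power2_eq_square)
  qed
  have h: "\<bar>h\<bar> \<le> 3 * \<bar>t\<bar>"
  proof -
    have "\<bar>t\<^sup>2 * P\<bar> \<le> t\<^sup>2 * 1" unfolding abs_mult using P by (intro mult_mono) auto
    moreover have "\<bar>2 * t * Q\<bar> \<le> 2 * \<bar>t\<bar> * 1" unfolding abs_mult using Q by (intro mult_mono) auto
    ultimately show ?thesis using t2 unfolding h_def by linarith
  qed
  have h2: "\<bar>h\<bar> \<le> 1 / 2" "0 < 1 + h" using h t by linarith+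
  have hsq: "h\<^sup>2 \<le> 9 * t\<^sup>2"
    using power_mono[OF h, of 2] by (simp add: power_mult_distrib)
  have diff: "shear_inv \<xi> t i x - shear_inv \<xi> t i y = D - (t * d) *\<^sub>R axis i 1"
    by (simp add: shear_inv_def D_def d_def algebra_simps)
  have nsq: "(norm (D - (t * d) *\<^sub>R axis i 1))\<^sup>2 = r2 * (1 + h)"
  proof -
    have "(norm (D - (t * d) *\<^sub>R axis i 1))\<^sup>2 = r2 - 2 * (t * d) * (D $ i) + (t * d)\<^sup>2"
      unfolding r2_def power2_norm_eq_inner
      by (simp add: inner_diff_left inner_diff_right inner_axis inner_axis' inner_commute[of "axis i 1"] power2_eq_square algebra_simps)
    also have "D $ i = \<delta>" by (simp add: D_def \<delta>_def)
    also have "r2 - 2 * (t * d) * \<delta> + (t * d)\<^sup>2 = r2 * (1 + h)"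
      using r2 by (simp add: h_def P_def Q_def field_simps power2_eq_square)
    finally show ?thesis .
  qed
  have nrm: "norm (D - (t * d) *\<^sub>R axis i 1) = norm D * sqrt (1 + h)"
    by (rule power2_eq_imp_eq) (use nsq h2 in \<open>auto simp: power_mult_distrib r2_def\<close>)
  have k: "riesz_kernel s (D - (t * d) *\<^sub>R axis i 1) = exp (- (s / 2) * ln (1 + h)) * riesz_kernel s D"
  proof -
    have "sqrt (1 + h) powr s = exp (s / 2 * ln (1 + h))"
      using h2 by (simp add: powr_def ln_sqrt)
    then show ?thesis using D h2 unfolding riesz_kernel_def nrm
      by (simp add: powr_mult exp_minus field_simps)
  qed
  have J: "0 \<le> 1 - t * \<xi>' r" "1 - t * \<xi>' r \<le> exp (- (t * \<xi>' r))" for r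
  proof -
    have "\<bar>t * \<xi>' r\<bar> \<le> 1 * 1" unfolding abs_mult using t shear_field_bounds(2,3)[OF \<xi>, of r] by (intro mult_mono) auto
    then show "0 \<le> 1 - t * \<xi>' r" by linarith
    show "1 - t * \<xi>' r \<le> exp (- (t * \<xi>' r))" using exp_ge_add_one_self[of "- (t * \<xi>' r)"] by simp
  qed
  have tA: "\<bar>t * A\<bar> \<le> \<bar>t\<bar> * 5" unfolding abs_mult A_def by (intro mult_left_mono kernel_variation_bound[OF \<xi> s]) auto
  \<comment> \<open>27 comes from s h^2 \<le> 3 * 9 t^2. Then |E| \<le> (5 + 27/16)|t| \<le> 7|t|,
    so E^2 \<le> 49 t^2, and 27 + 49 stays below the 100 of the statement.\<close>
  define E where "E = t * A + 27 * t\<^sup>2"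
  have E1: "\<bar>E\<bar> \<le> 7 * \<bar>t\<bar>"
  proof -
    have "\<bar>t\<bar> * \<bar>t\<bar> \<le> 1 / 16 * \<bar>t\<bar>" using t by (intro mult_right_mono) auto
    then have "27 * t\<^sup>2 \<le> 27 / 16 * \<bar>t\<bar>" by (simp add: power2_eq_square)
    moreover have "0 \<le> 27 * t\<^sup>2" by simp
    ultimately show ?thesis using tA unfolding E_def by linarith
  qed
  have ex: "- (s / 2) * ln (1 + h) - t * \<xi>' (x $ i) - t * \<xi>' (y $ i) \<le> E"
  proof -
    have "h - 2 * h\<^sup>2 \<le> ln (1 + h)" using abs_ln_one_plus_x_minus_x_bound[OF h2(1)] by linarith
    then have "s / 2 * (h - 2 * h\<^sup>2) \<le> s / 2 * ln (1 + h)" using s by (intro mult_left_mono) auto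
    moreover have "s / 2 * (h - 2 * h\<^sup>2) = s / 2 * (t\<^sup>2 * P) - s * t * Q - s * h\<^sup>2" by (simp add: h_def algebra_simps)
    moreover have "0 \<le> s / 2 * (t\<^sup>2 * P)" using s P by (intro mult_nonneg_nonneg) auto
    moreover have "s * h\<^sup>2 \<le> 3 * (9 * t\<^sup>2)" using s hsq by (intro mult_mono) auto
    moreover have "t * A = s * t * Q - t * \<xi>' (x $ i) - t * \<xi>' (y $ i)"
      by (simp add: A_def kernel_variation_def Q_def d_def \<delta>_def r2_def D_def algebra_simps)
    ultimately show ?thesis unfolding E_def by linarith
  qed
  have "exp (- (s / 2) * ln (1 + h)) * ((1 - t * \<xi>' (x $ i)) * (1 - t * \<xi>' (y $ i)))
      \<le> exp (- (s / 2) * ln (1 + h)) * (exp (- (t * \<xi>' (x $ i))) * exp (- (t * \<xi>' (y $ i))))"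
    by (intro mult_left_mono mult_mono J) auto
  also have "\<dots> = exp (- (s / 2) * ln (1 + h) - t * \<xi>' (x $ i) - t * \<xi>' (y $ i))"
    by (simp only: exp_add[symmetric] diff_conv_add_uminus add.assoc)
  also have "\<dots> \<le> exp E" using ex by simp
  also have "\<dots> \<le> 1 + E + E\<^sup>2" by (rule exp_le_quadratic) (use E1 t in linarith)
  also have "\<dots> \<le> 1 + t * A + 100 * t\<^sup>2"
  proof -
    have "E\<^sup>2 \<le> 49 * t\<^sup>2" using power_mono[OF E1, of 2] by (simp add: power_mult_distrib)
    moreover have "0 \<le> t\<^sup>2" by simp
    ultimately show ?thesis unfolding E_def by linarith
  qed
  finally have "exp (- (s / 2) * ln (1 + h)) * ((1 - t * \<xi>' (x $ i)) * (1 - t * \<xi>' (y $ i))) * riesz_kernel s D \<le> (1 + t * A + 100 * t\<^sup>2) * riesz_kernel s D"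
    by (rule mult_right_mono) simp
  then show ?thesis unfolding diff k by (simp add: D_def A_def mult_ac)
qed simp

section \<open>Local integrability and finiteness of potentials\<close>

lemma riesz_kernel_locally_integrable:
  assumes s: "0 < s" "s < 3"
  shows "(NI z. ennreal (riesz_kernel s z) * indicator (ball 0 R) z) < \<infinity>"
proof -
  define R' where "R' = max R 0"
  define f where "f r = ennreal (1 / r powr s) * indicator {..<R} r" for r :: real
  have "(NI z. ennreal (riesz_kernel s z) * indicator (ball 0 R) z) = (NI z. f (norm (z :: space)))"
    by (intro nn_integral_cong) (simp add: f_def riesz_kernel_def indicator_def)
  also have "\<dots> = (NI r. ennreal (4 * pi * r\<^sup>2) * f r * indicator {0..} r)"
    by (rule nn_integral_radial) (simp add: f_def[abs_def])
  also have "\<dots> \<le> (NI r. ennreal (4 * pi) * (ennreal (r powr (2 - s)) * indicator {0..R'} r))"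
  proof (rule nn_integral_mono)
    fix r :: real
    have "4 * pi * r\<^sup>2 * (1 / r powr s) = 4 * pi * r powr (2 - s)" if "0 \<le> r"
      using that by (cases "r = 0") (auto simp: powr_diff)
    then show "ennreal (4 * pi * r\<^sup>2) * f r * indicator {0..} r \<le> ennreal (4 * pi) * (ennreal (r powr (2 - s)) * indicator {0..R'} r)"
      by (cases "0 \<le> r"; cases "r < R")
         (simp_all add: f_def R'_def ennreal_mult[symmetric] del: times_divide_eq_right)
  qed
  also have "\<dots> = ennreal (4 * pi) * (NI r. ennreal (r powr (2 - s)) * indicator {0..R'} r)"
    by (rule nn_integral_cmult) measurable
  also have "\<dots> < \<infinity>"
  proof -
    have "((\<lambda>r. r powr (2 - s)) has_integral R' powr (2 - s + 1) / (2 - s + 1)) {0..R'}"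
      by (rule has_integral_powr_from_0) (use s in \<open>auto simp: R'_def\<close>)
    from nn_integral_has_integral_lebesgue'[OF _ this] show ?thesis by (simp add: ennreal_mult_less_top)
  qed
  finally show ?thesis .
qed

text \<open>If the potential is finite at one point z, it is integrable on every ball of radius
  larger than |z|: the nearby part of \<rho> has finite mass against a locally integrable kernel,
  and the distant part acts on the whole ball about as it does on z.\<close>

lemma riesz_kernel_potential_dichotomy:
  fixes \<rho> :: "space \<Rightarrow> ennreal"
  assumes s: "0 < s" "s < 3" and [measurable]: "\<rho> \<in> borel_measurable borel"
    and loc: "\<And>R. (NI y. \<rho> y * indicator (ball 0 R) y) < \<infinity>"
  defines "V \<equiv> \<lambda>x. NI y. ennreal (riesz_kernel s (x - y)) * \<rho> y"
  shows "(AE x in lborel. V x < \<infinity>) \<or> (\<forall>x. V x = \<infinity>)"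
proof (cases "\<forall>x. V x = \<infinity>")
  case False
  then obtain z where z: "V z < \<infinity>" by (auto simp: less_top)
  have [measurable]: "V \<in> borel_measurable borel" unfolding V_def by measurable
  have [measurable]: "ball (0 :: space) r \<in> sets borel" for r by simp
  have fin: "(NI x. V x * indicator (ball 0 R) x) < \<infinity>" if R: "norm z < R" for R
  proof -
    define C where "C = (NI x. ennreal (riesz_kernel s x) * indicator (ball 0 (3 * R)) x)"
    define B where "B = emeasure lborel (ball (0::space) R)"
    define h where "h y = (NI x. ennreal (riesz_kernel s (x - y)) * indicator (ball 0 R) x)" for y
    have C: "C < \<infinity>" unfolding C_def by (rule riesz_kernel_locally_integrable[OF s])
    have B: "B < \<infinity>" unfolding B_def using emeasure_lborel_ball_finite by (simp add: less_top)
    have near: "h y \<le> C" if y: "norm y < 2 * R" for y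
    proof -
      have "h y = (NI x. ennreal (riesz_kernel s (x + - y)) * indicator (ball 0 R) ((x + - y) + y))" by (simp add: h_def)
      also have "\<dots> = (NI x. ennreal (riesz_kernel s x) * indicator (ball 0 R) (x + y))"
        by (rule nn_integral_shift[of "\<lambda>x. ennreal (riesz_kernel s x) * indicator (ball 0 R) (x + y)"]) measurable
      also have "\<dots> \<le> C" unfolding C_def
      proof (intro nn_integral_mono mult_left_mono)
        fix x :: space
        have "norm x < 3 * R" if "norm (x + y) < R" using norm_triangle_ineq4[of "x + y" y] that y by simp
        then show "indicator (ball 0 R) (x + y) \<le> (indicator (ball 0 (3 * R)) x :: ennreal)" by (auto simp: indicator_def)
      qed simp
      finally show ?thesis .
    qed
    have far: "h y \<le> ennreal (3 powr s) * B * ennreal (riesz_kernel s (z - y))" if y: "2 * R \<le> norm y" for y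
    proof -
      have "h y \<le> (NI x. ennreal (3 powr s * riesz_kernel s (z - y)) * indicator (ball 0 R) (x :: space))"
        unfolding h_def
      proof (rule nn_integral_mono)
        fix x :: space
        show "ennreal (riesz_kernel s (x - y)) * indicator (ball 0 R) x \<le> ennreal (3 powr s * riesz_kernel s (z - y)) * indicator (ball 0 R) x"
        proof (cases "norm x < R")
          case True
          \<comment> \<open>For x and z inside radius R and |y| \<ge> 2R, |x - y| \<ge> |y|/2 and |z
            - y| \<le> 3|y|/2.\<close>
          have 1: "norm (z - y) \<le> 3 * norm (x - y)"
            using norm_triangle_ineq4[of z y] norm_triangle_ineq3[of y x] R y True by (simp add: norm_minus_commute)
          have "0 < R" using R norm_ge_zero[of z] by linarith
          then have 2: "0 < norm (z - y)" using R y by auto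
          have 3: "0 < norm (x - y)" using 1 2 by linarith
          have "norm (z - y) powr s \<le> 3 powr s * norm (x - y) powr s"
            using powr_mono2[OF _ _ 1, of s] s by (simp add: powr_mult)
          then have "riesz_kernel s (x - y) \<le> 3 powr s * riesz_kernel s (z - y)"
            unfolding riesz_kernel_def using 2 3 by (simp add: field_simps)
          then show ?thesis by (intro mult_right_mono ennreal_leI) auto
        qed simp
      qed
      also have "\<dots> = ennreal (3 powr s) * B * ennreal (riesz_kernel s (z - y))"
        unfolding B_def by (subst nn_integral_cmult_indicator) (auto simp: ennreal_mult mult_ac)
      finally show ?thesis .
    qed
    have "(NI x. V x * indicator (ball 0 R) x) = (NI x. NI y. ennreal (riesz_kernel s (x - y)) * \<rho> y * indicator (ball 0 R) x)"
      unfolding V_def by (intro nn_integral_cong nn_integral_multc[symmetric]) measurable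
    also have "\<dots> = (NI y. NI x. ennreal (riesz_kernel s (x - y)) * \<rho> y * indicator (ball 0 R) x)"
      by (rule nn_integral_swap) (unfold case_prod_beta, measurable)
    also have "\<dots> = (NI y. NI x. ennreal (riesz_kernel s (x - y)) * indicator (ball 0 R) x * \<rho> y)"
      by (simp add: mult_ac)
    also have "\<dots> = (NI y. h y * \<rho> y)"
      unfolding h_def by (intro nn_integral_cong nn_integral_multc) measurable
    also have "\<dots> \<le> (NI y. C * (\<rho> y * indicator (ball 0 (2 * R)) y) + (ennreal (3 powr s) * B) * (ennreal (riesz_kernel s (z - y)) * \<rho> y))"
    proof (rule nn_integral_mono)
      fix y :: space
      show "h y * \<rho> y \<le> C * (\<rho> y * indicator (ball 0 (2 * R)) y) + (ennreal (3 powr s) * B) * (ennreal (riesz_kernel s (z - y)) * \<rho> y)"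
      proof (cases "norm y < 2 * R")
        case True
        then have "h y * \<rho> y \<le> C * \<rho> y" by (intro mult_right_mono near) auto
        also have "\<dots> \<le> C * \<rho> y + (ennreal (3 powr s) * B) * (ennreal (riesz_kernel s (z - y)) * \<rho> y)" by simp
        finally show ?thesis using True by simp
      next
        case False
        then have "h y * \<rho> y \<le> (ennreal (3 powr s) * B * ennreal (riesz_kernel s (z - y))) * \<rho> y" by (intro mult_right_mono far) auto
        then show ?thesis using False by (simp add: mult_ac)
      qed
    qed
    also have "\<dots> = C * (NI y. \<rho> y * indicator (ball 0 (2 * R)) y) + (ennreal (3 powr s) * B) * V z"
      unfolding V_def by (subst nn_integral_add, measurable, subst nn_integral_cmult, measurable, subst nn_integral_cmult, measurable)
    also have "\<dots> < \<infinity>" using C B z loc[of "2 * R"] by (simp add: ennreal_mult_less_top)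
    finally show ?thesis .
  qed
  have "AE x in lborel. V x * indicator (ball 0 (norm z + 1 + real n)) x \<noteq> \<infinity>" for n :: nat
    by (rule nn_integral_PInf_AE) (measurable, use fin[of "norm z + 1 + real n"] in auto)
  then have "AE x in lborel. \<forall>n::nat. V x * indicator (ball 0 (norm z + 1 + real n)) x \<noteq> \<infinity>"
    by (simp add: AE_all_countable)
  then have "AE x in lborel. V x < \<infinity>"
  proof eventually_elim
    case (elim x)
    obtain n :: nat where "norm x < real n" using reals_Archimedean2 by blast
    then have "norm x < norm z + 1 + real n" using norm_ge_zero[of z] by linarith
    then have "x \<in> ball 0 (norm z + 1 + real n)" by simp
    then show ?case using elim[rule_format, of n] by (simp add: less_top)
  qed
  then show ?thesis ..
qed simp

section \<open>Virial identities\<close>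

text \<open>The tangent inequality for the convex function |.|^p / p, derived from Young's
  inequality with exponents p and p/(p - 1). It involves no derivative of |a|^(p-2) a, and at a = 0
  the left side is 0 even when p < 2.\<close>

lemma powr_convexity_pairing:
  fixes a b :: complex
  assumes p: "1 < p"
  shows "(cmod a powr (p - 2) *\<^sub>R a) \<bullet> (b - a) \<le> (cmod b powr p - cmod a powr p) / p"
proof (cases "a = 0")
  case False
  then have a: "0 < cmod a" by simp
  have e: "cmod a powr (p - 2) * (cmod a)\<^sup>2 = cmod a powr p" "cmod a powr (p - 2) * cmod a = cmod a powr (p - 1)"
    using a powr_add[of "cmod a" "p - 2" 2] powr_add[of "cmod a" "p - 2" 1] by simp_all
  have young: "cmod a powr (p - 1) * cmod b \<le> cmod b powr p / p + (p - 1) / p * cmod a powr p"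
  proof -
    define r where "r = p / (p - 1)"
    have r: "1 < r" "1 / p + 1 / r = 1" using p by (auto simp: r_def field_simps)
    have "cmod b * cmod a powr (p - 1) \<le> cmod b powr p / p + (cmod a powr (p - 1)) powr r / r"
      by (rule Youngs_inequality) (use p r in auto)
    moreover have "(cmod a powr (p - 1)) powr r / r = (p - 1) / p * cmod a powr p"
      using p by (simp add: powr_powr r_def)
    ultimately show ?thesis by (simp add: mult.commute)
  qed
  have "(cmod a powr (p - 2) *\<^sub>R a) \<bullet> (b - a) = cmod a powr (p - 2) * (a \<bullet> b) - cmod a powr p"
    by (simp add: inner_diff_right right_diff_distrib flip: power2_norm_eq_inner e(1))
  also have "\<dots> \<le> cmod a powr (p - 2) * (cmod a * cmod b) - cmod a powr p"
    by (intro diff_right_mono mult_left_mono norm_cauchy_schwarz) auto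
  also have "\<dots> = cmod a powr (p - 1) * cmod b - cmod a powr p" using e(2) by (simp only: mult.assoc[symmetric])
  also have "\<dots> \<le> (cmod b powr p - cmod a powr p) / p" using young p by (simp add: field_simps)
  finally show ?thesis .
qed (use p in simp)

lemma powr_pairing_self: "(cmod a powr (p - 2) *\<^sub>R a) \<bullet> a = cmod a powr p"
proof (cases "a = 0")
  case False
  then show ?thesis using powr_add[of "cmod a" "p - 2" 2] by (simp add: power2_norm_eq_inner[symmetric])
qed simp

section \<open>The interaction energy along a shear\<close>

definition pair_density :: "real \<Rightarrow> real \<Rightarrow> (space \<Rightarrow> complex) \<Rightarrow> space \<times> space \<Rightarrow> real" where
  "pair_density s p u z = riesz_kernel s (fst z - snd z) * (cmod (u (fst z)) powr p * cmod (u (snd z)) powr p)"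

text \<open>Taken as an extended nonnegative integral, so that finite and infinite potentials can be
  told apart; \<open>enn2real\<close> then reproduces the convention that a divergent Bochner
  integral is 0.\<close>

definition nn_potential :: "real \<Rightarrow> real \<Rightarrow> (space \<Rightarrow> complex) \<Rightarrow> space \<Rightarrow> ennreal" where
  "nn_potential s p u x = (NI y. ennreal (riesz_kernel s (x - y)) * ennreal (cmod (u y) powr p))"

definition riesz_force :: "real \<Rightarrow> real \<Rightarrow> (space \<Rightarrow> complex) \<Rightarrow> space \<Rightarrow> complex" where
  "riesz_force s p u x = enn2real (nn_potential s p u x) *\<^sub>R (cmod (u x) powr (p - 2) *\<^sub>R u x)"

lemma pair_density_nonneg: "0 \<le> pair_density s p u z"
  by (simp add: pair_density_def)

lemma potential_measurable:
  assumes [measurable]: "u \<in> borel_measurable borel"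
  shows "pair_density s p u \<in> borel_measurable lborel2" "nn_potential s p u \<in> borel_measurable borel"
    "riesz_force s p u \<in> borel_measurable borel"
proof -
  show "pair_density s p u \<in> borel_measurable lborel2"
    unfolding pair_density_def[abs_def] by measurable
  show [measurable]: "nn_potential s p u \<in> borel_measurable borel"
    unfolding nn_potential_def[abs_def] by measurable
  show "riesz_force s p u \<in> borel_measurable borel"
    unfolding riesz_force_def[abs_def] by measurable
qed

text \<open>Finiteness of the interaction energy is a consequence of the force being in L^2: the
  force paired with \<open>u\<close> is the potential times |u|^p, and a product of two square
  integrable functions is integrable.\<close>

lemma pair_density_integral:
  assumes u: "sq_integrable u" and F: "sq_integrable (riesz_force s p u)" and fin: "AE x in lborel. nn_potential s p u x < \<infinity>"
  shows "integrable lborel2 (pair_density s p u)"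
    "integrable lborel (\<lambda>x. enn2real (nn_potential s p u x) * cmod (u x) powr p)"
    "(\<integral>z. pair_density s p u z \<partial>lborel2) = (LI x. enn2real (nn_potential s p u x) * cmod (u x) powr p)"
proof -
  note [measurable] = sq_integrable_measurable[OF u]
  note [measurable] = potential_measurable[OF sq_integrable_measurable[OF u]]
  have e: "riesz_force s p u x \<bullet> u x = enn2real (nn_potential s p u x) * cmod (u x) powr p" for x
    unfolding riesz_force_def inner_scaleR_left[of "enn2real (nn_potential s p u x)"] powr_pairing_self ..
  show i: "integrable lborel (\<lambda>x. enn2real (nn_potential s p u x) * cmod (u x) powr p)"
    using integrable_inner_sq[OF F u] by (simp only: e)
  have "(\<integral>\<^sup>+z. ennreal (pair_density s p u z) \<partial>lborel2) = (NI x. NI y. ennreal (pair_density s p u (x, y)))"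
    by (rule lborel.nn_integral_fst[symmetric]) measurable
  also have "\<dots> = (NI x. nn_potential s p u x * ennreal (cmod (u x) powr p))"
  proof (rule nn_integral_cong)
    fix x :: space
    have "(NI y. ennreal (pair_density s p u (x, y))) = (NI y. ennreal (riesz_kernel s (x - y)) * ennreal (cmod (u y) powr p) * ennreal (cmod (u x) powr p))"
      by (intro nn_integral_cong) (simp add: pair_density_def ennreal_mult mult_ac)
    also have "\<dots> = nn_potential s p u x * ennreal (cmod (u x) powr p)"
      unfolding nn_potential_def by (rule nn_integral_multc) measurable
    finally show "(NI y. ennreal (pair_density s p u (x, y))) = nn_potential s p u x * ennreal (cmod (u x) powr p)" .
  qed
  also have "\<dots> = (NI x. ennreal (enn2real (nn_potential s p u x) * cmod (u x) powr p))"
    by (rule nn_integral_cong_AE, use fin in eventually_elim) (simp add: ennreal_mult ennreal_enn2real)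
  also have "\<dots> = ennreal (LI x. enn2real (nn_potential s p u x) * cmod (u x) powr p)"
    by (rule nn_integral_eq_integral[OF i]) auto
  finally have e2: "(\<integral>\<^sup>+z. ennreal (pair_density s p u z) \<partial>lborel2) = ennreal (LI x. enn2real (nn_potential s p u x) * cmod (u x) powr p)" .
  show iP: "integrable lborel2 (pair_density s p u)"
    by (rule integrableI_bounded) (simp_all add: e2 pair_density_nonneg)
  show "(\<integral>z. pair_density s p u z \<partial>lborel2) = (LI x. enn2real (nn_potential s p u x) * cmod (u x) powr p)"
    using e2 unfolding nn_integral_eq_integral[OF iP AE_I2[OF pair_density_nonneg]]
    by (subst (asm) ennreal_inj) (auto intro!: Bochner_Integration.integral_nonneg pair_density_nonneg)
qed

lemma kernel_variation_measurable:
  assumes \<xi>: "shear_field \<xi> \<xi>' M L"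
  shows "(\<lambda>z. kernel_variation s \<xi> \<xi>' i (fst z) (snd z)) \<in> borel_measurable lborel2"
proof -
  have [measurable]: "\<xi> \<in> borel_measurable borel" "\<xi>' \<in> borel_measurable borel"
    using \<xi> weight_measurable by (auto simp: shear_field_def)
  show ?thesis unfolding kernel_variation_def by measurable
qed

lemma integrable_kernel_variation:
  assumes \<xi>: "shear_field \<xi> \<xi>' M L" and s: "0 < s" "s < 3"
    and w: "integrable lborel2 w"
  shows "integrable lborel2 (\<lambda>z. kernel_variation s \<xi> \<xi>' i (fst z) (snd z) * w z)"
proof (rule Bochner_Integration.integrable_bound[OF integrable_mult_right[OF w, of 5]])
  note [measurable] = kernel_variation_measurable[OF \<xi>] borel_measurable_integrable[OF w]
  show "(\<lambda>z. kernel_variation s \<xi> \<xi>' i (fst z) (snd z) * w z) \<in> borel_measurable lborel2" by measurable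
  show "AE z in lborel2. norm (kernel_variation s \<xi> \<xi>' i (fst z) (snd z) * w z) \<le> norm (5 * w z)"
    using kernel_variation_bound[OF \<xi> s] by (auto simp: abs_mult intro!: mult_right_mono)
qed

text \<open>A change of variables in both x and y removes the shear from \<open>u\<close> and puts
  it on the kernel together with two Jacobians, where \<open>riesz_kernel_flow_le\<close> holds
  pointwise. Hence the energy of the transported density is controlled with no regularity of
  \<open>u\<close>.\<close>

lemma sheared_energy_le:
  assumes \<xi>: "shear_field \<xi> \<xi>' M L" and s: "0 < s" "s < 3" and t: "\<bar>t\<bar> \<le> 1 / 16"
    and [measurable]: "u \<in> borel_measurable borel" and w: "integrable lborel2 (pair_density s p u)"
  shows "(NI x. NI y. ennreal (riesz_kernel s (x - y)) * (ennreal (cmod (u (shear_map \<xi> t i x)) powr p) * ennreal (cmod (u (shear_map \<xi> t i y)) powr p)))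
     \<le> ennreal ((1 + 100 * t\<^sup>2) * (\<integral>z. pair_density s p u z \<partial>lborel2)
         + t * (\<integral>z. kernel_variation s \<xi> \<xi>' i (fst z) (snd z) * pair_density s p u z \<partial>lborel2))"
proof -
  have t2: "\<bar>t\<bar> \<le> 1 / 2" using t by simp
  note [measurable] = shear_map_measurable[OF \<xi> t2, of i]
  note [measurable] = potential_measurable[OF \<open>u \<in> borel_measurable borel\<close>]
  note [measurable] = kernel_variation_measurable[OF \<xi>]
  have [measurable]: "\<xi> \<in> borel_measurable borel" "\<xi>' \<in> borel_measurable borel"
    using \<xi> weight_measurable by (auto simp: shear_field_def)
  have [measurable]: "shear_inv \<xi> t i \<in> borel_measurable borel" unfolding shear_inv_def[abs_def] by measurable
  define \<rho> where "\<rho> x = ennreal (cmod (u x) powr p)" for x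
  have [measurable]: "\<rho> \<in> borel_measurable borel" unfolding \<rho>_def[abs_def] by measurable
  let ?S = "shear_map \<xi> t i" and ?\<Psi> = "shear_inv \<xi> t i"
  let ?J = "\<lambda>x :: space. ennreal (1 - t * \<xi>' (x $ i))"
  let ?A = "\<lambda>x y. kernel_variation s \<xi> \<xi>' i x y"
  have J0: "0 \<le> 1 - t * \<xi>' r" for r
  proof -
    have "\<bar>t * \<xi>' r\<bar> \<le> 1 * 1" unfolding abs_mult using t shear_field_bounds(2,3)[OF \<xi>, of r] by (intro mult_mono) auto
    then show ?thesis by linarith
  qed
  have inner: "(NI y. ennreal (riesz_kernel s (x - y)) * (\<rho> (?S x) * \<rho> (?S y))) =
      (NI y. ?J y * (ennreal (riesz_kernel s (x - ?\<Psi> y)) * (\<rho> (?S x) * \<rho> y)))" for x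
  proof -
    \<comment> \<open>Writing y as the inverse shear of its own image makes the integrand a function
      of the sheared point, the form required by the change of variables.\<close>
    have "(NI y. ennreal (riesz_kernel s (x - y)) * (\<rho> (?S x) * \<rho> (?S y))) =
       (NI y. ennreal (riesz_kernel s (x - ?\<Psi> (?S y))) * (\<rho> (?S x) * \<rho> (?S y)))"
      by (simp only: shear_map_inverse(2)[OF \<xi> t2])
    also have "\<dots> = (NI y. ?J y * (ennreal (riesz_kernel s (x - ?\<Psi> y)) * (\<rho> (?S x) * \<rho> y)))"
      by (rule nn_integral_shear_map[OF \<xi> t2, of "\<lambda>y. ennreal (riesz_kernel s (x - ?\<Psi> y)) * (\<rho> (?S x) * \<rho> y)"]) measurable
    finally show ?thesis .
  qed
  have "(NI x. NI y. ennreal (riesz_kernel s (x - y)) * (\<rho> (?S x) * \<rho> (?S y))) =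
     (NI x. NI y. ?J y * (ennreal (riesz_kernel s (?\<Psi> (?S x) - ?\<Psi> y)) * (\<rho> (?S x) * \<rho> y)))"
    unfolding inner shear_map_inverse(2)[OF \<xi> t2] ..
  also have "\<dots> = (NI x. ?J x * (NI y. ?J y * (ennreal (riesz_kernel s (?\<Psi> x - ?\<Psi> y)) * (\<rho> x * \<rho> y))))"
    by (rule nn_integral_shear_map[OF \<xi> t2, of "\<lambda>x. NI y. ?J y * (ennreal (riesz_kernel s (?\<Psi> x - ?\<Psi> y)) * (\<rho> x * \<rho> y))"]) measurable
  also have "\<dots> = (NI x. NI y. ?J x * (?J y * (ennreal (riesz_kernel s (?\<Psi> x - ?\<Psi> y)) * (\<rho> x * \<rho> y))))"
    by (intro nn_integral_cong nn_integral_cmult[symmetric]) measurable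
  also have "\<dots> \<le> (NI x. NI y. ennreal ((1 + t * ?A x y + 100 * t\<^sup>2) * pair_density s p u (x, y)))"
  proof (intro nn_integral_mono)
    fix x y :: space
    have "?J x * (?J y * (ennreal (riesz_kernel s (?\<Psi> x - ?\<Psi> y)) * (\<rho> x * \<rho> y)))
       = ennreal (riesz_kernel s (?\<Psi> x - ?\<Psi> y) * ((1 - t * \<xi>' (x $ i)) * (1 - t * \<xi>' (y $ i))) * (cmod (u x) powr p * cmod (u y) powr p))"
      unfolding \<rho>_def using J0 by (simp add: ennreal_mult mult_ac del: diff_ge_0_iff_ge)
    also have "\<dots> \<le> ennreal (((1 + t * ?A x y + 100 * t\<^sup>2) * riesz_kernel s (x - y)) * (cmod (u x) powr p * cmod (u y) powr p))"
      by (intro ennreal_leI mult_right_mono riesz_kernel_flow_le[OF \<xi> s t]) auto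
    finally show "?J x * (?J y * (ennreal (riesz_kernel s (?\<Psi> x - ?\<Psi> y)) * (\<rho> x * \<rho> y))) \<le> ennreal ((1 + t * ?A x y + 100 * t\<^sup>2) * pair_density s p u (x, y))"
      by (simp add: pair_density_def mult.assoc)
  qed
  also have "\<dots> = (\<integral>\<^sup>+z. ennreal ((1 + t * ?A (fst z) (snd z) + 100 * t\<^sup>2) * pair_density s p u z) \<partial>lborel2)"
    by (subst lborel.nn_integral_fst[symmetric]) auto
  also have "\<dots> = (\<integral>\<^sup>+z. ennreal ((1 + 100 * t\<^sup>2) * pair_density s p u z + t * (?A (fst z) (snd z) * pair_density s p u z)) \<partial>lborel2)"
    by (intro nn_integral_cong arg_cong[where f = ennreal]) (simp add: algebra_simps)
  also have "\<dots> = ennreal (\<integral>z. (1 + 100 * t\<^sup>2) * pair_density s p u z + t * (?A (fst z) (snd z) * pair_density s p u z) \<partial>lborel2)"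
  proof (rule nn_integral_eq_integral)
    show "integrable lborel2 (\<lambda>z. (1 + 100 * t\<^sup>2) * pair_density s p u z + t * (?A (fst z) (snd z) * pair_density s p u z))"
      by (intro Bochner_Integration.integrable_add integrable_mult_right w integrable_kernel_variation[OF \<xi> s])
    show "AE z in lborel2. 0 \<le> (1 + 100 * t\<^sup>2) * pair_density s p u z + t * (?A (fst z) (snd z) * pair_density s p u z)"
    proof (rule AE_I2)
      fix z :: "space \<times> space"
      have "0 \<le> (1 + t * ?A (fst z) (snd z) + 100 * t\<^sup>2) * pair_density s p u z"
        by (intro mult_nonneg_nonneg kernel_variation_factor_nonneg[OF \<xi> s t] pair_density_nonneg)
      then show "0 \<le> (1 + 100 * t\<^sup>2) * pair_density s p u z + t * (?A (fst z) (snd z) * pair_density s p u z)" by (simp add: algebra_simps)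
    qed
  qed
  also have "(\<integral>z. (1 + 100 * t\<^sup>2) * pair_density s p u z + t * (?A (fst z) (snd z) * pair_density s p u z) \<partial>lborel2) =
      (1 + 100 * t\<^sup>2) * (\<integral>z. pair_density s p u z \<partial>lborel2) + t * (\<integral>z. ?A (fst z) (snd z) * pair_density s p u z \<partial>lborel2)"
    by (subst Bochner_Integration.integral_add[OF integrable_mult_right[OF w] integrable_mult_right[OF integrable_kernel_variation[OF \<xi> s w]]]) (simp only: integral_mult_right_zero)
  finally show ?thesis unfolding \<rho>_def .
qed

text \<open>Convexity bounds the left side by (m - n)/p, where n is the energy of the density and m
  the mixed energy of the sheared and the original density. Positive definiteness gives 2 m \<le>
  (energy of the sheared density) + n, and the sheared energy is known to first order. Moving one
  density therefore yields half of the variation, whence 1/(2 p).\<close>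

lemma riesz_force_flow_le:
  assumes \<xi>: "shear_field \<xi> \<xi>' M L" and s: "0 < s" "s < 3" and t: "\<bar>t\<bar> \<le> 1 / 16" and p: "1 < p"
    and u: "sq_integrable u" and F: "sq_integrable (riesz_force s p u)" and fin: "AE x in lborel. nn_potential s p u x < \<infinity>"
  shows "(LI x. riesz_force s p u x \<bullet> (u (shear_map \<xi> t i x) - u x)) \<le>
     t * (1 / (2 * p) * (\<integral>z. kernel_variation s \<xi> \<xi>' i (fst z) (snd z) * pair_density s p u z \<partial>lborel2))
       + t\<^sup>2 * (50 / p * (\<integral>z. pair_density s p u z \<partial>lborel2))"
proof -
  have t2: "\<bar>t\<bar> \<le> 1 / 2" using t by simp
  note um[measurable] = sq_integrable_measurable[OF u]
  note [measurable] = potential_measurable[OF um] shear_map_measurable[OF \<xi> t2, of i]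
  note pd = pair_density_integral[OF u F fin]
  define n where "n = (\<integral>z. pair_density s p u z \<partial>lborel2)"
  define a where "a = (\<integral>z. kernel_variation s \<xi> \<xi>' i (fst z) (snd z) * pair_density s p u z \<partial>lborel2)"
  have n0: "0 \<le> n" unfolding n_def by (intro Bochner_Integration.integral_nonneg pair_density_nonneg)
  let ?S = "shear_map \<xi> t i"
  define V where "V x = enn2real (nn_potential s p u x)" for x
  have [measurable]: "V \<in> borel_measurable borel" unfolding V_def by measurable
  have V0: "0 \<le> V x" for x by (simp add: V_def)
  define \<rho> where "\<rho> x = cmod (u x) powr p" for x
  have [measurable]: "\<rho> \<in> borel_measurable borel" unfolding \<rho>_def[abs_def] by measurable
  have \<rho>0: "0 \<le> \<rho> x" for x by (simp add: \<rho>_def)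
  define Mt where "Mt = (NI x. NI y. ennreal (riesz_kernel s (x - y)) * (ennreal (\<rho> (?S x)) * ennreal (\<rho> y)))"
  have "2 * Mt \<le> (NI x. NI y. ennreal (riesz_kernel s (x - y)) * (ennreal (\<rho> (?S x)) * ennreal (\<rho> (?S y))))
      + (NI x. NI y. ennreal (riesz_kernel s (x - y)) * (ennreal (\<rho> x) * ennreal (\<rho> y)))"
    unfolding Mt_def by (rule riesz_energy_le[OF s(1)]) measurable
  also have "\<dots> \<le> ennreal ((1 + 100 * t\<^sup>2) * n + t * a) + ennreal n"
  proof (rule add_mono)
    show "(NI x. NI y. ennreal (riesz_kernel s (x - y)) * (ennreal (\<rho> (?S x)) * ennreal (\<rho> (?S y)))) \<le> ennreal ((1 + 100 * t\<^sup>2) * n + t * a)"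
      unfolding \<rho>_def n_def a_def by (rule sheared_energy_le[OF \<xi> s t um pd(1)])
    have "(NI x. NI y. ennreal (riesz_kernel s (x - y)) * (ennreal (\<rho> x) * ennreal (\<rho> y)))
        = (NI x. NI y. ennreal (pair_density s p u (x, y)))"
      by (intro nn_integral_cong) (simp add: pair_density_def \<rho>_def ennreal_mult)
    also have "\<dots> = (\<integral>\<^sup>+z. ennreal (pair_density s p u z) \<partial>lborel2)" by (rule lborel.nn_integral_fst) measurable
    also have "\<dots> = ennreal n" unfolding n_def by (rule nn_integral_eq_integral[OF pd(1) AE_I2[OF pair_density_nonneg]])
    finally show "(NI x. NI y. ennreal (riesz_kernel s (x - y)) * (ennreal (\<rho> x) * ennreal (\<rho> y))) \<le> ennreal n" by simp
  qed
  finally have M2: "2 * Mt \<le> ennreal ((1 + 100 * t\<^sup>2) * n + t * a) + ennreal n" .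
  have MV: "Mt = (NI x. ennreal (V x * \<rho> (?S x)))"
  proof -
    have "Mt = (NI x. nn_potential s p u x * ennreal (\<rho> (?S x)))"
      unfolding Mt_def
    proof (rule nn_integral_cong)
      fix x :: space
      have "(NI y. ennreal (riesz_kernel s (x - y)) * (ennreal (\<rho> (?S x)) * ennreal (\<rho> y))) = (NI y. ennreal (riesz_kernel s (x - y)) * ennreal (\<rho> y) * ennreal (\<rho> (?S x)))"
        by (simp add: mult_ac)
      also have "\<dots> = nn_potential s p u x * ennreal (\<rho> (?S x))"
        unfolding nn_potential_def \<rho>_def[symmetric] by (rule nn_integral_multc) measurable
      finally show "(NI y. ennreal (riesz_kernel s (x - y)) * (ennreal (\<rho> (?S x)) * ennreal (\<rho> y))) = nn_potential s p u x * ennreal (\<rho> (?S x))" .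
    qed
    also have "\<dots> = (NI x. ennreal (V x * \<rho> (?S x)))"
      by (rule nn_integral_cong_AE, use fin in eventually_elim) (simp add: ennreal_mult V_def \<rho>0 ennreal_enn2real)
    finally show ?thesis .
  qed
  have Mfin: "Mt < \<infinity>"
  proof -
    have "Mt \<le> 2 * Mt" by (simp add: mult_2)
    also note M2
    also have "ennreal ((1 + 100 * t\<^sup>2) * n + t * a) + ennreal n < \<infinity>" by simp
    finally show ?thesis .
  qed
  have iV: "integrable lborel (\<lambda>x. V x * \<rho> (?S x))"
    by (rule integrableI_bounded) (use Mfin in \<open>simp_all add: MV V0 \<rho>0\<close>)
  define m where "m = (LI x. V x * \<rho> (?S x))"
  have Mm: "Mt = ennreal m" unfolding MV m_def by (rule nn_integral_eq_integral[OF iV]) (simp add: V0 \<rho>0)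
  have m0: "0 \<le> m" unfolding m_def by (intro Bochner_Integration.integral_nonneg mult_nonneg_nonneg V0 \<rho>0)
  \<comment> \<open>\<open>ennreal\<close> sends negative reals to 0, so \<open>M2\<close> can be
    read in the reals only if its first summand is nonnegative; |a| \<le> 5 n and |t| \<le> 1/16
    keep the linear term below n.\<close>
  have A0: "0 \<le> (1 + 100 * t\<^sup>2) * n + t * a"
  proof -
    have "\<bar>a\<bar> \<le> (\<integral>z. 5 * pair_density s p u z \<partial>lborel2)"
      unfolding a_def real_norm_def[symmetric]
    proof (rule Bochner_Integration.integral_norm_bound_integral[OF integrable_kernel_variation[OF \<xi> s pd(1)] integrable_mult_right[OF pd(1)]])
      fix z :: "space \<times> space"
      show "norm (kernel_variation s \<xi> \<xi>' i (fst z) (snd z) * pair_density s p u z) \<le> 5 * pair_density s p u z"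
        using kernel_variation_bound[OF \<xi> s] by (simp add: abs_mult pair_density_nonneg mult_right_mono)
    qed
    also have "\<dots> = 5 * n" by (simp add: n_def)
    finally have "\<bar>t * a\<bar> \<le> 1 / 16 * (5 * n)" unfolding abs_mult using t by (intro mult_mono) auto
    moreover have "0 \<le> 100 * t\<^sup>2 * n" using n0 by simp
    ultimately show ?thesis using n0 unfolding distrib_right by linarith
  qed
  have "2 * m \<le> (1 + 100 * t\<^sup>2) * n + t * a + n"
  proof -
    have "ennreal (2 * m) \<le> ennreal ((1 + 100 * t\<^sup>2) * n + t * a + n)"
      using M2 unfolding Mm by (simp only: ennreal_plus[OF A0 n0] ennreal_mult[OF _ m0] ennreal_numeral)
    then show ?thesis by (subst (asm) ennreal_le_iff) (use A0 n0 in auto)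
  qed
  then have mb: "m - n \<le> (t * a + 100 * t\<^sup>2 * n) / 2" by (simp add: distrib_right)
  have sD: "sq_integrable (\<lambda>x. u (?S x) - u x)"
    by (intro sq_integrable_diff sq_integrable_shear_map(1)[OF \<xi> t2] u)
  have iN: "integrable lborel (\<lambda>x. V x * \<rho> x)" using pd(2) by (simp add: V_def \<rho>_def)
  have nV: "n = (LI x. V x * \<rho> x)" using pd(3) by (simp add: V_def \<rho>_def n_def)
  have "(LI x. riesz_force s p u x \<bullet> (u (?S x) - u x)) \<le> (LI x. (V x * \<rho> (?S x) - V x * \<rho> x) / p)"
  proof (rule integral_mono)
    show "integrable lborel (\<lambda>x. riesz_force s p u x \<bullet> (u (?S x) - u x))" by (rule integrable_inner_sq[OF F sD])
    show "integrable lborel (\<lambda>x. (V x * \<rho> (?S x) - V x * \<rho> x) / p)" using iV iN by simp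
    fix x :: space
    have "riesz_force s p u x \<bullet> (u (?S x) - u x) = V x * ((cmod (u x) powr (p - 2) *\<^sub>R u x) \<bullet> (u (?S x) - u x))"
      unfolding riesz_force_def V_def by (rule inner_scaleR_left)
    also have "\<dots> \<le> V x * ((\<rho> (?S x) - \<rho> x) / p)"
      unfolding \<rho>_def by (intro mult_left_mono powr_convexity_pairing p V0)
    finally show "riesz_force s p u x \<bullet> (u (?S x) - u x) \<le> (V x * \<rho> (?S x) - V x * \<rho> x) / p" by (simp add: right_diff_distrib)
  qed
  also have "\<dots> = (m - n) / p" using iV iN by (simp add: m_def nV)
  also have "\<dots> \<le> (t * a + 100 * t\<^sup>2 * n) / 2 / p" using mb p by (intro divide_right_mono) auto
  also have "\<dots> = t * (1 / (2 * p) * a) + t\<^sup>2 * (50 / p * n)" using p by (simp add: field_simps)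
  finally show ?thesis unfolding a_def n_def .
qed

section \<open>Removal of the truncation\<close>

lemma soft_limits:
  assumes e: "\<And>n. 0 < \<epsilon> n" and e0: "\<epsilon> \<longlonglongrightarrow> 0"
  shows "(\<lambda>n. soft (\<epsilon> n) s) \<longlonglongrightarrow> s" "(\<lambda>n. soft' (\<epsilon> n) s) \<longlonglongrightarrow> 1"
proof -
  have "(\<lambda>n. soft' (\<epsilon> n) s) \<longlonglongrightarrow> 1 / (1 + (0 * s)\<^sup>2)"
    unfolding soft'_def by (intro tendsto_divide tendsto_add tendsto_power tendsto_mult tendsto_const e0) auto
  then show "(\<lambda>n. soft' (\<epsilon> n) s) \<longlonglongrightarrow> 1" by simp
  have b: "\<bar>soft (\<epsilon> n) s - s\<bar> \<le> \<epsilon> n * s\<^sup>2" for n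
  proof -
    have w: "weight (soft (\<epsilon> n)) (soft' (\<epsilon> n)) (pi / (2 * \<epsilon> n)) (\<epsilon> n)"
      using shear_field_soft[OF e, of n] by (simp add: shear_field_def)
    have "\<bar>soft (\<epsilon> n) (0 + s) - soft (\<epsilon> n) 0 - s * soft' (\<epsilon> n) 0\<bar> \<le> \<epsilon> n * s\<^sup>2"
      using w unfolding weight_def by blast
    then show ?thesis by (simp add: soft_def soft'_def)
  qed
  have "(\<lambda>n. \<epsilon> n * s\<^sup>2) \<longlonglongrightarrow> 0 * s\<^sup>2" by (intro tendsto_mult e0 tendsto_const)
  then have "(\<lambda>n. \<epsilon> n * s\<^sup>2) \<longlonglongrightarrow> 0" by simp
  then have "(\<lambda>n. soft (\<epsilon> n) s - s) \<longlonglongrightarrow> 0"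
    by (rule Lim_null_comparison[rotated]) (use b in \<open>simp add: eventually_sequentially\<close>)
  then show "(\<lambda>n. soft (\<epsilon> n) s) \<longlonglongrightarrow> s" by (simp add: LIM_zero_iff)
qed

text \<open>For the full dilation \<xi>(r) = r the quotients sum over the coordinates to |D|^2/|D|^2
  = 1, and each of the three coordinates contributes -1 from either Jacobian: s - 6. The uniform
  bound 5 on the variation gives the majorant.\<close>

lemma kernel_variation_limit:
  assumes s: "0 < s" "s < 3" and w: "integrable lborel2 (pair_density s p u)"
    and e: "\<And>n. 0 < \<epsilon> n" and e0: "\<epsilon> \<longlonglongrightarrow> 0"
  shows "(\<lambda>n. \<Sum>i\<in>UNIV. \<integral>z. kernel_variation s (soft (\<epsilon> n)) (soft' (\<epsilon> n)) i (fst z) (snd z) * pair_density s p u z \<partial>lborel2)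
     \<longlonglongrightarrow> (s - 6) * (\<integral>z. pair_density s p u z \<partial>lborel2)"
proof -
  define A where "A n i z = kernel_variation s (soft (\<epsilon> n)) (soft' (\<epsilon> n)) i (fst z) (snd z)" for n i z
  define B where "B i z = s * ((fst z $ i - snd z $ i) * (fst z $ i - snd z $ i) / (norm (fst z - snd z))\<^sup>2) - 1 - 1" for i and z :: "space \<times> space"
  note sf = shear_field_soft[OF e]
  note [measurable] = borel_measurable_integrable[OF w]
  have [measurable]: "A n i \<in> borel_measurable lborel2" for n i
    unfolding A_def[abs_def] by (rule kernel_variation_measurable[OF sf])
  have [measurable]: "B i \<in> borel_measurable lborel2" for i
    unfolding B_def[abs_def] by measurable
  have lim: "(\<lambda>n. A n i z) \<longlonglongrightarrow> B i z" for i z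
    unfolding A_def B_def kernel_variation_def divide_inverse
    by (intro tendsto_diff tendsto_mult tendsto_const soft_limits e e0)
  have bnd: "\<bar>A n i z\<bar> \<le> 5" for n i z unfolding A_def by (rule kernel_variation_bound[OF sf s])
  have bndB: "\<bar>B i z\<bar> \<le> 5" for i z
    by (rule LIMSEQ_le_const2[OF tendsto_rabs[OF lim]]) (use bnd in auto)
  have L: "(\<lambda>n. \<integral>z. A n i z * pair_density s p u z \<partial>lborel2) \<longlonglongrightarrow> (\<integral>z. B i z * pair_density s p u z \<partial>lborel2)" for i
  proof (rule integral_dominated_convergence[where w = "\<lambda>z. 5 * pair_density s p u z"])
    show "integrable lborel2 (\<lambda>z. 5 * pair_density s p u z)" using w by simp
    show "AE z in lborel2. (\<lambda>n. A n i z * pair_density s p u z) \<longlonglongrightarrow> B i z * pair_density s p u z"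
      by (intro AE_I2 tendsto_mult lim tendsto_const)
    show "AE z in lborel2. norm (A n i z * pair_density s p u z) \<le> 5 * pair_density s p u z" for n
      using bnd by (intro AE_I2) (simp add: abs_mult pair_density_nonneg mult_right_mono)
  qed measurable
  have iB: "integrable lborel2 (\<lambda>z. B i z * pair_density s p u z)" for i
    by (rule Bochner_Integration.integrable_bound[OF integrable_mult_right[OF w, of 5]])
       (use bndB in \<open>auto simp: abs_mult pair_density_nonneg intro!: mult_right_mono AE_I2\<close>)
  have "(\<Sum>i\<in>UNIV. \<integral>z. B i z * pair_density s p u z \<partial>lborel2) = (\<integral>z. (\<Sum>i\<in>UNIV. B i z * pair_density s p u z) \<partial>lborel2)"
    using iB by (subst Bochner_Integration.integral_sum) auto
  also have "\<dots> = (\<integral>z. (s - 6) * pair_density s p u z \<partial>lborel2)"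
  proof (intro Bochner_Integration.integral_cong refl)
    fix z :: "space \<times> space"
    show "(\<Sum>i\<in>UNIV. B i z * pair_density s p u z) = (s - 6) * pair_density s p u z"
    \<comment> \<open>On the diagonal the quotients are 0 instead of summing to 1, but there the
      density vanishes, as the kernel is 0 at the origin.\<close>
    proof (cases "fst z = snd z")
      case False
      define D where "D = fst z - snd z"
      have "(norm D)\<^sup>2 \<noteq> 0" using False by (simp add: D_def)
      moreover have D: "(norm D)\<^sup>2 = (\<Sum>i\<in>UNIV. D $ i * D $ i)" by (simp add: power2_norm_eq_inner inner_vec_def)
      ultimately have D1: "(\<Sum>i\<in>UNIV. D $ i * D $ i) / (norm D)\<^sup>2 = 1" by simp
      have "(\<Sum>i\<in>UNIV. B i z) = s * ((\<Sum>i\<in>UNIV. D $ i * D $ i) / (norm D)\<^sup>2) - 6"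
        unfolding B_def by (simp add: sum_subtractf sum_distrib_left sum_divide_distrib D_def)
      also have "\<dots> = s - 6" unfolding D1 by simp
      finally show ?thesis by (simp add: sum_distrib_right[symmetric])
    qed (simp add: pair_density_def)
  qed
  finally have "(\<Sum>i\<in>UNIV. \<integral>z. B i z * pair_density s p u z \<partial>lborel2) = (s - 6) * (\<integral>z. pair_density s p u z \<partial>lborel2)"
    by simp
  moreover have "(\<lambda>n. \<Sum>i\<in>UNIV. \<integral>z. A n i z * pair_density s p u z \<partial>lborel2) \<longlonglongrightarrow> (\<Sum>i\<in>UNIV. \<integral>z. B i z * pair_density s p u z \<partial>lborel2)"
    by (intro tendsto_sum L)
  ultimately show ?thesis by (simp add: A_def)
qed

text \<open>On a ball the continuous part is bounded and the Green function is at most 1/|x|, so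
  |u|^p is at most a multiple of |x|^-p, the locally integrable kernel of exponent p < 3. This local
  mass is what the dichotomy for potentials asks for.\<close>

lemma powr_locally_integrable:
  assumes cont: "continuous_on UNIV \<phi>" and a: "0 < a" and p: "0 < p" "p < 3"
    and u: "\<And>x. u x = \<phi> x + yukawa a x *\<^sub>R q"
  shows "(NI x. ennreal (cmod (u x) powr p) * indicator (ball 0 R) x) < \<infinity>"
proof -
  obtain B where B: "\<And>x. norm x \<le> R \<Longrightarrow> cmod (\<phi> x) \<le> B"
  proof -
    have "compact (\<phi> ` cball 0 R)"
      by (intro compact_continuous_image continuous_on_subset[OF cont]) auto
    then obtain b where "\<forall>z\<in>\<phi> ` cball 0 R. cmod z \<le> b" using compact_imp_bounded bounded_iff by metis
    then show ?thesis using that[of b] by simp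
  qed
  define C where "C = \<bar>B\<bar> * \<bar>R\<bar> + cmod q"
  have pt: "cmod (u x) powr p \<le> C powr p * riesz_kernel p x" if x: "x \<noteq> 0" "norm x < R" for x
  proof -
    have r: "0 < norm x" using x by simp
    have y: "yukawa a x \<le> 1 / norm x"
    proof -
      have "exp (- a * norm x) \<le> 1" using a by simp
      then have "exp (- a * norm x) / (4 * pi * norm x) \<le> 1 / (1 * norm x)"
        using r pi_gt3 by (intro frac_le mult_right_mono) auto
      then show ?thesis by (simp add: yukawa_def)
    qed
    have "cmod (u x) \<le> cmod (\<phi> x) + yukawa a x * cmod q"
      unfolding u using norm_triangle_ineq[of "\<phi> x" "yukawa a x *\<^sub>R q"] by (simp add: yukawa_nonneg)
    also have "\<dots> \<le> \<bar>B\<bar> + 1 / norm x * cmod q"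
      using B[of x] x y by (intro add_mono mult_right_mono) auto
    also have "\<dots> \<le> C / norm x"
    proof -
      have "\<bar>B\<bar> * norm x \<le> \<bar>B\<bar> * \<bar>R\<bar>" using x by (intro mult_left_mono) auto
      then have "\<bar>B\<bar> \<le> \<bar>B\<bar> * \<bar>R\<bar> / norm x" using r by (simp add: pos_le_divide_eq)
      then show ?thesis by (simp add: C_def add_divide_distrib)
    qed
    finally have "cmod (u x) powr p \<le> (C / norm x) powr p" using p by (intro powr_mono2) auto
    also have "\<dots> = C powr p * riesz_kernel p x" using r by (simp add: C_def powr_divide riesz_kernel_def)
    finally show ?thesis .
  qed
  have [measurable]: "ball (0 :: space) R \<in> sets borel" by simp
  have "(NI x. ennreal (cmod (u x) powr p) * indicator (ball 0 R) x)
     \<le> (NI x. ennreal (C powr p) * (ennreal (riesz_kernel p x) * indicator (ball 0 R) x))"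
  proof (rule nn_integral_mono_AE)
    show "AE x in lborel. ennreal (cmod (u x) powr p) * indicator (ball 0 R) x \<le> ennreal (C powr p) * (ennreal (riesz_kernel p x) * indicator (ball 0 R) x)"
      using AE_nonzero
    proof eventually_elim
      case (elim x)
      show ?case
      proof (cases "norm x < R")
        case True
        then show ?thesis using pt[OF elim True] by (simp add: ennreal_mult[symmetric] ennreal_leI)
      qed simp
    qed
  qed
  also have "\<dots> = ennreal (C powr p) * (NI x. ennreal (riesz_kernel p x) * indicator (ball 0 R) x)"
    by (rule nn_integral_cmult) measurable
  also have "\<dots> < \<infinity>" using riesz_kernel_locally_integrable[OF p, of R] by (simp add: ennreal_mult_less_top)
  finally show ?thesis .
qed

text \<open>If the potential is not finite almost everywhere, then it is infinite everywhere; the Bochner integral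
  defining it is then \<open>0\<close> by convention, and both sides vanish.\<close>

lemma riesz_force_virial:
  assumes cont: "continuous_on UNIV \<phi>" and g: "\<And>i. L2_partial i \<phi> (g i)" and G: "\<And>i. L2_partial i (g i) (G i)"
    and a: "0 < a" and u: "\<And>x. u x = \<phi> x + yukawa a x *\<^sub>R q"
    and s: "0 < s" "s < 3" and p: "1 < p" "p < 3" and F: "sq_integrable (riesz_force s p u)"
    and e: "\<And>n. 0 < \<epsilon> n" and e0: "\<epsilon> \<longlonglongrightarrow> 0"
  shows "(\<lambda>n. \<Sum>i\<in>UNIV. LI x. riesz_force s p u x \<bullet> (soft (\<epsilon> n) (x $ i) *\<^sub>R (g i x + yukawa_partial a i x *\<^sub>R q)))
     \<longlonglongrightarrow> (s - 6) / (2 * p) * (LI x. enn2real (nn_potential s p u x) * cmod (u x) powr p)"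
proof -
  have ue: "u = (\<lambda>x. \<phi> x + yukawa a x *\<^sub>R q)" using u by auto
  have su: "sq_integrable u"
    unfolding ue by (rule sq_integrable_add[OF L2_partial_sq(1)[OF g] yukawa_sq_integrable[OF a]])
  note [measurable] = sq_integrable_measurable[OF su]
  have "(AE x in lborel. nn_potential s p u x < \<infinity>) \<or> (\<forall>x. nn_potential s p u x = \<infinity>)"
    unfolding nn_potential_def
    by (rule riesz_kernel_potential_dichotomy[OF s]) (measurable, use powr_locally_integrable[OF cont a _ p(2) u] p in simp)
  then show ?thesis
  proof
    assume fin: "AE x in lborel. nn_potential s p u x < \<infinity>"
    note pd = pair_density_integral[OF su F fin]
    have "(LI x. riesz_force s p u x \<bullet> (soft (\<epsilon> n) (x $ i) *\<^sub>R (g i x + yukawa_partial a i x *\<^sub>R q))) =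
       1 / (2 * p) * (\<integral>z. kernel_variation s (soft (\<epsilon> n)) (soft' (\<epsilon> n)) i (fst z) (snd z) * pair_density s p u z \<partial>lborel2)" for n i
    proof (rule flow_derivative[OF shear_field_soft[OF e] _ cont g G F a u])
      show "0 < pi / (2 * \<epsilon> n)" using e by simp
      show "(LI x. riesz_force s p u x \<bullet> (u (shear_map (soft (\<epsilon> n)) t i x) - u x)) \<le>
         t * (1 / (2 * p) * (\<integral>z. kernel_variation s (soft (\<epsilon> n)) (soft' (\<epsilon> n)) i (fst z) (snd z) * pair_density s p u z \<partial>lborel2))
           + t\<^sup>2 * (50 / p * (\<integral>z. pair_density s p u z \<partial>lborel2))" if "\<bar>t\<bar> \<le> 1 / 16" for t
        by (rule riesz_force_flow_le[OF shear_field_soft[OF e] s that p(1) su F fin])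
    qed
    then show ?thesis
      using tendsto_mult_left[OF kernel_variation_limit[OF s pd(1) e e0], of "1 / (2 * p)"]
      by (simp add: sum_distrib_left pd(3))
  next
    assume "\<forall>x. nn_potential s p u x = \<infinity>"
    then show ?thesis by (simp add: riesz_force_def)
  qed
qed

lemma soft_weight_limit:
  fixes F :: "space \<Rightarrow> real"
  assumes e: "\<And>n. 0 < \<epsilon> n" and e0: "\<epsilon> \<longlonglongrightarrow> 0" and F[measurable]: "F \<in> borel_measurable borel"
    and i: "integrable lborel (\<lambda>x. x $ i * F x)"
  shows "(\<lambda>n. LI x. soft (\<epsilon> n) (x $ i) * F x) \<longlonglongrightarrow> (LI x. x $ i * F x)"
proof (rule integral_dominated_convergence[where w = "\<lambda>x. \<bar>x $ i * F x\<bar>"])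
  note sf = shear_field_soft[OF e]
  have [measurable]: "soft (\<epsilon> n) \<in> borel_measurable borel" for n
    using sf[of n] weight_measurable by (auto simp: shear_field_def)
  show "(\<lambda>x. soft (\<epsilon> n) (x $ i) * F x) \<in> borel_measurable lborel" for n by measurable
  show "AE x in lborel. (\<lambda>n. soft (\<epsilon> n) (x $ i) * F x) \<longlonglongrightarrow> x $ i * F x"
    by (intro AE_I2 tendsto_mult tendsto_const soft_limits e e0)
  show "AE x in lborel. norm (soft (\<epsilon> n) (x $ i) * F x) \<le> \<bar>x $ i * F x\<bar>" for n
    using shear_field_bounds(5)[OF sf] by (intro AE_I2) (simp add: abs_mult mult_right_mono)
qed (use i in simp_all)

lemma soft'_weight_limit:
  fixes F :: "space \<Rightarrow> real"
  assumes e: "\<And>n. 0 < \<epsilon> n" and e0: "\<epsilon> \<longlonglongrightarrow> 0" and F: "integrable lborel F"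
  shows "(\<lambda>n. LI x. soft' (\<epsilon> n) (x $ i) * F x) \<longlonglongrightarrow> (LI x. F x)"
proof (rule integral_dominated_convergence[where w = "\<lambda>x. \<bar>F x\<bar>"])
  note sf = shear_field_soft[OF e]
  have [measurable]: "soft' (\<epsilon> n) \<in> borel_measurable borel" for n
    using sf[of n] weight_measurable by (auto simp: shear_field_def)
  note [measurable] = borel_measurable_integrable[OF F]
  show "(\<lambda>x. soft' (\<epsilon> n) (x $ i) * F x) \<in> borel_measurable lborel" for n by measurable
  show "AE x in lborel. (\<lambda>n. soft' (\<epsilon> n) (x $ i) * F x) \<longlonglongrightarrow> F x"
    using tendsto_mult[OF soft_limits(2)[OF e e0] tendsto_const] by (intro AE_I2) fastforce
  show "AE x in lborel. norm (soft' (\<epsilon> n) (x $ i) * F x) \<le> \<bar>F x\<bar>" for n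
    using shear_field_bounds(2,3)[OF sf] by (intro AE_I2) (simp add: abs_mult mult_left_le_one_le)
qed (use F in simp_all)

lemma mass_virial:
  assumes cont: "continuous_on UNIV \<phi>" and g: "\<And>i. L2_partial i \<phi> (g i)" and G: "\<And>i. L2_partial i (g i) (G i)"
    and a: "0 < a" and u: "\<And>x. u x = \<phi> x + yukawa a x *\<^sub>R q"
    and e: "\<And>n. 0 < \<epsilon> n" and e0: "\<epsilon> \<longlonglongrightarrow> 0"
  shows "(\<lambda>n. \<Sum>i\<in>UNIV. LI x. u x \<bullet> (soft (\<epsilon> n) (x $ i) *\<^sub>R (g i x + yukawa_partial a i x *\<^sub>R q)))
     \<longlonglongrightarrow> - (3 / 2) * (LI x. (cmod (u x))\<^sup>2)"
proof -
  have ue: "u = (\<lambda>x. \<phi> x + yukawa a x *\<^sub>R q)" using u by auto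
  have su: "sq_integrable u"
    unfolding ue by (rule sq_integrable_add[OF L2_partial_sq(1)[OF g] yukawa_sq_integrable[OF a]])
  have M: "0 < pi / (2 * \<epsilon> n)" for n using e by simp
  have "(\<lambda>n. \<Sum>i\<in>UNIV. - (1 / 2) * (LI x. soft' (\<epsilon> n) (x $ i) * (cmod (u x))\<^sup>2))
     \<longlonglongrightarrow> (\<Sum>i\<in>(UNIV :: 3 set). - (1 / 2) * (LI x. (cmod (u x))\<^sup>2))"
    by (intro tendsto_sum tendsto_mult tendsto_const soft'_weight_limit e e0 sq_integrable_integrable su)
  then show ?thesis
    unfolding mass_term[OF shear_field_soft[OF e] M cont g G a u] by simp
qed

text \<open>Splitting both factors into regular and singular parts gives four pairings. Regular with
  regular reduces to the second-derivative pairings, singular with singular is the mass identity for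
  the Green function. The two mixed ones converge by dominated convergence, since x_i times the
  Green function or its i-derivative is square integrable, and together they form
  \<open>virial_cross_term\<close>.\<close>

lemma hamiltonian_virial:
  assumes cont: "continuous_on UNIV \<phi>" and g: "\<And>i. L2_partial i \<phi> (g i)" and G: "\<And>i j. L2_partial j (g i) (G i j)"
    and a: "0 < a" and \<phi>0: "\<phi> 0 = (\<alpha> + a / (4 * pi)) *\<^sub>R q"
    and e: "\<And>n. 0 < \<epsilon> n" and e0: "\<epsilon> \<longlonglongrightarrow> 0"
  shows "(\<lambda>n. \<Sum>i\<in>UNIV. LI x. (- (\<Sum>j\<in>UNIV. G j j x) - a\<^sup>2 *\<^sub>R (yukawa a x *\<^sub>R q)) \<bullet> (soft (\<epsilon> n) (x $ i) *\<^sub>R (g i x + yukawa_partial a i x *\<^sub>R q)))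
     \<longlonglongrightarrow> - (1 / 2) * form_value \<alpha> a q \<phi> g - 1 / 2 * \<alpha> * (cmod q)\<^sup>2"
proof -
  note sf = shear_field_soft[OF e]
  have w: "weight (soft (\<epsilon> n)) (soft' (\<epsilon> n)) (pi / (2 * \<epsilon> n)) (\<epsilon> n)" for n using sf[of n] by (simp add: shear_field_def)
  have M: "0 < pi / (2 * \<epsilon> n)" for n using e by simp
  note s\<phi> = L2_partial_sq(1)[OF g] and sg = L2_partial_sq(1)[OF G] and sG = L2_partial_sq(2)[OF G]
  have sy: "sq_integrable (\<lambda>x. yukawa a x *\<^sub>R q)" by (rule yukawa_sq_integrable[OF a])
  define L where "L x = (\<Sum>j\<in>UNIV. G j j x)" for x
  have sL: "sq_integrable L" unfolding L_def by (intro sq_integrable_sum sG)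
  define S where "S = (\<Sum>j\<in>UNIV. LI x. (cmod (g j x))\<^sup>2)"
  define P where "P = (LI x. \<phi> x \<bullet> (yukawa a x *\<^sub>R q))"
  define Y where "Y = (LI x. (cmod (yukawa a x *\<^sub>R q))\<^sup>2)"
  have swg: "sq_integrable (\<lambda>x. soft (\<epsilon> n) (x $ i) *\<^sub>R g i x)" for n i by (rule sq_integrable_weight(1)[OF w sg])
  note [measurable] = sq_integrable_measurable[OF sL] sq_integrable_measurable[OF sg] sq_integrable_measurable[OF sy]
  have [measurable]: "soft (\<epsilon> n) \<in> borel_measurable borel" for n by (rule weight_measurable(1)[OF w])
  have sxy: "sq_integrable (\<lambda>x. (x $ i * yukawa a x) *\<^sub>R q)" for i by (rule L2_partial_sq(1)[OF coord_yukawa_L2_partial(1)[OF a]])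
  have sxp: "sq_integrable (\<lambda>x. (x $ i * yukawa_partial a i x) *\<^sub>R q)" for i by (rule coord_yukawa_L2_partial(2)[OF a])
  have swp: "sq_integrable (\<lambda>x. soft (\<epsilon> n) (x $ i) *\<^sub>R (yukawa_partial a i x *\<^sub>R q))" for n i
    using sq_integrable_weighted_yukawa_partial[OF sf[of n] a, of i q] by simp
  have l1: "(\<lambda>n. \<Sum>i\<in>UNIV. LI x. L x \<bullet> (soft (\<epsilon> n) (x $ i) *\<^sub>R g i x)) \<longlonglongrightarrow> 1 / 2 * S"
  proof -
    have row: "(LI x. L x \<bullet> (soft (\<epsilon> n) (x $ i) *\<^sub>R g i x)) =
      (\<Sum>j\<in>UNIV. (if j = i then - (1 / 2) else 1 / 2) * (LI x. soft' (\<epsilon> n) (x $ i) * (cmod (g j x))\<^sup>2))" for n i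
    proof -
      have "(LI x. L x \<bullet> (soft (\<epsilon> n) (x $ i) *\<^sub>R g i x)) = (\<Sum>j\<in>UNIV. LI x. G j j x \<bullet> (soft (\<epsilon> n) (x $ i) *\<^sub>R g i x))"
        unfolding L_def inner_sum_left by (rule Bochner_Integration.integral_sum) (rule integrable_inner_sq[OF sG swg])
      also have "\<dots> = (\<Sum>j\<in>UNIV. (if j = i then - (1 / 2) else 1 / 2) * (LI x. soft' (\<epsilon> n) (x $ i) * (cmod (g j x))\<^sup>2))"
      proof (rule sum.cong[OF refl])
        fix j
        show "(LI x. G j j x \<bullet> (soft (\<epsilon> n) (x $ i) *\<^sub>R g i x)) = (if j = i then - (1 / 2) else 1 / 2) * (LI x. soft' (\<epsilon> n) (x $ i) * (cmod (g j x))\<^sup>2)"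
          using second_derivative_pairing_same[OF w[of n] G[where i = i and j = i]]
            second_derivative_pairing_other[OF w[of n] _ g[of i] G[where i = i and j = i] g[of j] G[where i = j and j = j] G[where i = j and j = i]] by auto
      qed
      finally show ?thesis .
    qed
    have "(\<lambda>n. \<Sum>i\<in>UNIV. LI x. L x \<bullet> (soft (\<epsilon> n) (x $ i) *\<^sub>R g i x)) \<longlonglongrightarrow>
       (\<Sum>i\<in>UNIV. \<Sum>j\<in>UNIV. (if j = i then - (1 / 2) else 1 / 2) * (LI x. (cmod (g j x))\<^sup>2))"
      unfolding row by (intro tendsto_sum tendsto_mult tendsto_const soft'_weight_limit e e0 sq_integrable_integrable sg)
    \<comment> \<open>For fixed j the coefficient is -1/2 for one value of i and 1/2 for the other
      two; their sum 1/2 is the effect of dimension three.\<close>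
    also have "(\<Sum>i\<in>UNIV. \<Sum>j\<in>UNIV. (if j = i then - (1 / 2) else 1 / 2) * (LI x. (cmod (g j x))\<^sup>2)) = 1 / 2 * S"
      unfolding S_def by (simp add: sum_3)
    finally show ?thesis .
  qed
  have l2: "(\<lambda>n. LI x. L x \<bullet> (soft (\<epsilon> n) (x $ i) *\<^sub>R (yukawa_partial a i x *\<^sub>R q))) \<longlonglongrightarrow> (LI x. L x \<bullet> ((x $ i * yukawa_partial a i x) *\<^sub>R q))" for i
  proof -
    have "(\<lambda>n. LI x. soft (\<epsilon> n) (x $ i) * (L x \<bullet> (yukawa_partial a i x *\<^sub>R q))) \<longlonglongrightarrow> (LI x. x $ i * (L x \<bullet> (yukawa_partial a i x *\<^sub>R q)))"
      by (rule soft_weight_limit[OF e e0]) (measurable, use integrable_inner_sq[OF sL sxp[of i]] in \<open>simp add: mult.assoc\<close>)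
    then show ?thesis by (simp add: mult.assoc)
  qed
  have l3: "(\<lambda>n. LI x. (yukawa a x *\<^sub>R q) \<bullet> (soft (\<epsilon> n) (x $ i) *\<^sub>R g i x)) \<longlonglongrightarrow> (LI x. g i x \<bullet> ((x $ i * yukawa a x) *\<^sub>R q))" for i
  proof -
    have "(\<lambda>n. LI x. soft (\<epsilon> n) (x $ i) * (g i x \<bullet> (yukawa a x *\<^sub>R q))) \<longlonglongrightarrow> (LI x. x $ i * (g i x \<bullet> (yukawa a x *\<^sub>R q)))"
      by (rule soft_weight_limit[OF e e0]) (measurable, use integrable_inner_sq[OF sg sxy[of i]] in \<open>simp add: mult.assoc\<close>)
    then show ?thesis by (simp add: inner_commute[of q] mult_ac)
  qed
  have l4: "(\<lambda>n. \<Sum>i\<in>UNIV. LI x. (yukawa a x *\<^sub>R q) \<bullet> (soft (\<epsilon> n) (x $ i) *\<^sub>R (yukawa_partial a i x *\<^sub>R q))) \<longlonglongrightarrow> - (3 / 2) * Y"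
  proof -
    \<comment> \<open>The mass identity is applied to the Green function alone, as a decomposition
      with regular part 0.\<close>
    have z: "L2_partial i (\<lambda>_. 0) (\<lambda>_. 0)" for i
      by (simp add: L2_partial_def sq_integrable_zero)
    have "(\<lambda>n. \<Sum>i\<in>UNIV. LI x. (yukawa a x *\<^sub>R q) \<bullet> (soft (\<epsilon> n) (x $ i) *\<^sub>R (0 + yukawa_partial a i x *\<^sub>R q))) \<longlonglongrightarrow> - (3 / 2) * (LI x. (cmod (yukawa a x *\<^sub>R q))\<^sup>2)"
      by (rule mass_virial[OF continuous_on_const[of _ 0] z z a _ e e0]) simp
    then show ?thesis by (simp only: Y_def add_0)
  qed
  have split: "(LI x. (- L x - a\<^sup>2 *\<^sub>R (yukawa a x *\<^sub>R q)) \<bullet> (soft (\<epsilon> n) (x $ i) *\<^sub>R (g i x + yukawa_partial a i x *\<^sub>R q))) =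
     - (LI x. L x \<bullet> (soft (\<epsilon> n) (x $ i) *\<^sub>R g i x))
     + (- (LI x. L x \<bullet> (soft (\<epsilon> n) (x $ i) *\<^sub>R (yukawa_partial a i x *\<^sub>R q)))
        - a\<^sup>2 * (LI x. (yukawa a x *\<^sub>R q) \<bullet> (soft (\<epsilon> n) (x $ i) *\<^sub>R g i x)))
     - a\<^sup>2 * (LI x. (yukawa a x *\<^sub>R q) \<bullet> (soft (\<epsilon> n) (x $ i) *\<^sub>R (yukawa_partial a i x *\<^sub>R q)))" for n i
  proof -
    have expand: "- (l \<bullet> (r *\<^sub>R c)) + (- (l \<bullet> (r *\<^sub>R d)) - b * (y \<bullet> (r *\<^sub>R c))) - b * (y \<bullet> (r *\<^sub>R d)) = (- l - b *\<^sub>R y) \<bullet> (r *\<^sub>R (c + d))"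
      for l y c d :: complex and r b :: real
      by (simp add: inner_diff_left inner_add_right algebra_simps)
    have int: "(LI x. - f1 x + (- f2 x - b * f3 x) - b * f4 x) =
        - (LI x. f1 x) + (- (LI x. f2 x) - b * (LI x. f3 x)) - b * (LI x. f4 x)"
      if "integrable lborel f1" "integrable lborel f2" "integrable lborel f3" "integrable lborel f4"
      for f1 f2 f3 f4 :: "space \<Rightarrow> real" and b using that by simp
    show ?thesis
      unfolding expand[symmetric]
      by (rule int) (rule integrable_inner_sq[OF sL swg] integrable_inner_sq[OF sL swp] integrable_inner_sq[OF sy swg] integrable_inner_sq[OF sy swp])+
  qed
  have cross: "(\<Sum>i\<in>UNIV. - (LI x. L x \<bullet> ((x $ i * yukawa_partial a i x) *\<^sub>R q))
      - a\<^sup>2 * (LI x. g i x \<bullet> ((x $ i * yukawa a x) *\<^sub>R q))) = a\<^sup>2 * P - \<phi> 0 \<bullet> q"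
    unfolding L_def P_def
    by (rule virial_cross_term[OF g G _ a]) (use cont in \<open>simp add: continuous_on_eq_continuous_at\<close>)
  have "(\<lambda>n. - (\<Sum>i\<in>UNIV. LI x. L x \<bullet> (soft (\<epsilon> n) (x $ i) *\<^sub>R g i x))
     + (\<Sum>i\<in>UNIV. - (LI x. L x \<bullet> (soft (\<epsilon> n) (x $ i) *\<^sub>R (yukawa_partial a i x *\<^sub>R q)))
        - a\<^sup>2 * (LI x. (yukawa a x *\<^sub>R q) \<bullet> (soft (\<epsilon> n) (x $ i) *\<^sub>R g i x)))
     - a\<^sup>2 * (\<Sum>i\<in>UNIV. LI x. (yukawa a x *\<^sub>R q) \<bullet> (soft (\<epsilon> n) (x $ i) *\<^sub>R (yukawa_partial a i x *\<^sub>R q))))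
    \<longlonglongrightarrow> - (1 / 2 * S) + (a\<^sup>2 * P - \<phi> 0 \<bullet> q) - a\<^sup>2 * (- (3 / 2) * Y)"
    unfolding cross[symmetric]
    by (intro tendsto_add tendsto_diff tendsto_minus tendsto_mult tendsto_const tendsto_sum l1 l2 l3 l4)
  moreover have "- (1 / 2 * S) + (a\<^sup>2 * P - \<phi> 0 \<bullet> q) - a\<^sup>2 * (- (3 / 2) * Y) = - (1 / 2) * form_value \<alpha> a q \<phi> g - 1 / 2 * \<alpha> * (cmod q)\<^sup>2"
  proof -
    have q: "\<phi> 0 \<bullet> q = (\<alpha> + a / (4 * pi)) * (cmod q)\<^sup>2" unfolding \<phi>0 by (simp add: power2_norm_eq_inner)
    \<comment> \<open>With this value the multiples of a cancel. Compared with -1/2 of the form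
      there is an excess of a^2 Y and of half of - \<phi>(0) \<bullet> q; the former is a/(8 pi)
      |q|^2 and the latter - (\<alpha>/2 + a/(8 pi)) |q|^2.\<close>
    have Y: "a\<^sup>2 * Y = a / (8 * pi) * (cmod q)\<^sup>2"
    proof -
      have "Y = (LI x. (cmod q)\<^sup>2 * (yukawa a x * yukawa a x))"
        unfolding Y_def by (intro Bochner_Integration.integral_cong refl) (simp add: power_mult_distrib power2_eq_square yukawa_nonneg)
      also have "\<dots> = (cmod q)\<^sup>2 * (1 / (4 * pi * (a + a)))" using yukawa_product[OF a a] by simp
      finally show ?thesis using a by (simp add: field_simps power2_eq_square)
    qed
    have u: "(LI x. (cmod (\<phi> x + yukawa a x *\<^sub>R q))\<^sup>2) = (LI x. (cmod (\<phi> x))\<^sup>2) + 2 * P + Y"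
      unfolding P_def Y_def by (rule integral_norm_add_sq[OF s\<phi> sy])
    have "form_value \<alpha> a q \<phi> g = S - 2 * (a\<^sup>2 * P) - a\<^sup>2 * Y + (\<alpha> + a / (4 * pi)) * (cmod q)\<^sup>2"
      unfolding form_value_def u S_def[symmetric] by (simp add: algebra_simps)
    then show ?thesis unfolding q using Y by (simp add: algebra_simps)
  qed
  ultimately show ?thesis
    unfolding L_def[symmetric] split by (simp add: sum.distrib sum_subtractf sum_negf sum_distrib_left)
qed

section \<open>From the definitions to the virial identities\<close>

lemma sobolev_2_subset_1: "f \<in> sobolev 2 \<Longrightarrow> f \<in> sobolev 1"
  by (auto simp: numeral_2_eq_2)

text \<open>One decomposition of \<open>u\<close>, with the continuous representative of its regular
  part and Borel derivatives along lines. The continuous representative serves both the point value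
  at 0 and the transport by point-dependent shifts.\<close>

definition regular_representative where
  "regular_representative \<alpha> u \<phi> q lam \<psi> g G \<longleftrightarrow> continuous_on UNIV \<psi> \<and> (AE x in lborel. \<phi> x = \<psi> x) \<and>
     \<psi> 0 = (\<alpha> + sqrt lam / (4 * pi)) *\<^sub>R q \<and> (\<forall>i. L2_partial i \<psi> (g i)) \<and> (\<forall>i j. L2_partial j (g i) (G i j)) \<and>
     (AE x in lborel. weak_laplacian \<phi> x = (\<Sum>i\<in>UNIV. G i i x)) \<and>
     (AE x in lborel. u x = \<psi> x + yukawa (sqrt lam) x *\<^sub>R q)"

lemma admissible_representative:
  assumes "(\<phi>, q, lam) \<in> admissible \<alpha>" and "decomposes u \<phi> q lam"
  shows "\<exists>\<psi> g G. regular_representative \<alpha> u \<phi> q lam \<psi> g G"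
proof -
  have \<phi>: "\<phi> \<in> sobolev 2" and lam: "0 < lam"
    and "has_point_value \<phi> 0 (of_real (\<alpha> + sqrt lam / (4 * pi)) * q)" using assms(1) by (auto simp: admissible_def)
  then obtain \<psi> where \<psi>: "continuous_on UNIV \<psi>" "AE x in lborel. \<phi> x = \<psi> x" "\<psi> 0 = of_real (\<alpha> + sqrt lam / (4 * pi)) * q"
    unfolding has_point_value_def AE_lebesgue_iff by blast
  have \<psi>0: "\<psi> 0 = (\<alpha> + sqrt lam / (4 * pi)) *\<^sub>R q" using \<psi>(3) by (simp only: scaleR_conv_of_real)
  obtain g G where gG: "\<And>i. L2_partial i \<psi> (g i)" "\<And>i j. L2_partial j (g i) (G i j)"
      "\<And>i. AE x in lborel. weak_partial i (weak_partial i \<phi>) x = G i i x"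
    using sobolev_2_L2_partial[OF \<phi> borel_measurable_continuous_onI[OF \<psi>(1)] \<psi>(2)] by metis
  have "AE x in lborel. \<forall>i. weak_partial i (weak_partial i \<phi>) x = G i i x"
    using gG(3) by (simp add: AE_all_countable)
  then have lap: "AE x in lborel. weak_laplacian \<phi> x = (\<Sum>i\<in>UNIV. G i i x)"
    by eventually_elim (simp add: weak_laplacian_def)
  have dec: "AE x in lborel. u x = \<psi> x + yukawa (sqrt lam) x *\<^sub>R q"
    using assms(2) \<psi>(2) unfolding decomposes_def AE_lebesgue_iff
    by eventually_elim (simp add: green_eq_yukawa scaleR_conv_of_real mult.commute)
  show ?thesis unfolding regular_representative_def using \<psi>(1,2) \<psi>0 gG(1,2) lap dec by blast
qed

definition riesz_constant :: "real \<Rightarrow> real" where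
  "riesz_constant \<beta> = Gamma ((3 - \<beta>) / 2) / (Gamma (\<beta> / 2) * pi powr (3 / 2) * 2 powr \<beta>)"

text \<open>Both sides follow the same convention where the potential diverges: the Bochner integral
  is 0, and so is \<open>enn2real\<close> of infinity. The identity thus holds at every point,
  whether or not the potential is finite there.\<close>

lemma hartree_potential_eq:
  assumes u: "u \<in> borel_measurable lebesgue" and v[measurable]: "v \<in> borel_measurable borel" and uv: "AE x in lborel. u x = v x"
  shows "hartree_potential \<beta> p u x = riesz_constant \<beta> * enn2real (nn_potential (3 - \<beta>) p v x)"
proof -
  note [measurable] = u
  let ?k = "\<lambda>y. riesz_constant \<beta> * riesz_kernel (3 - \<beta>) (x - y)"
  have k: "riesz_potential \<beta> (x - y) = ?k y" for y
    by (simp add: riesz_potential_def riesz_constant_def riesz_kernel_def)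
  have [measurable]: "?k \<in> borel_measurable lebesgue" by (rule borel_imp_lebesgue) measurable
  have "hartree_potential \<beta> p u x = (LI y. ?k y * cmod (v y) powr p)"
    unfolding hartree_potential_def convolution_def k
  proof (rule integral_lebesgue_eq)
    show "AE y in lborel. ?k y * cmod (u y) powr p = ?k y * cmod (v y) powr p"
      using uv by eventually_elim simp
  qed measurable
  also have "\<dots> = riesz_constant \<beta> * (LI y. riesz_kernel (3 - \<beta>) (x - y) * cmod (v y) powr p)"
    by (simp add: mult.assoc)
  also have "(LI y. riesz_kernel (3 - \<beta>) (x - y) * cmod (v y) powr p) = enn2real (nn_potential (3 - \<beta>) p v x)"
    unfolding nn_potential_def by (subst integral_eq_nn_integral) (auto simp: ennreal_mult)
  finally show ?thesis .
qed

theorem proposition1p2: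
  fixes \<alpha> \<beta> p \<omega> lam :: real
    and q :: complex
    and u \<phi> :: "space \<Rightarrow> complex"
  assumes "0 < \<beta>" and "\<beta> < 3"
    and "(3 + \<beta>) / 3 \<le> p" and "p < (5 + 2 * \<beta>) / 4"
    and "(\<phi>, q, lam) \<in> admissible \<alpha>"
    and "decomposes u \<phi> q lam"
    and "bound_state \<alpha> \<beta> p \<omega> u"
  shows "1 / 2 * energy_form \<alpha> u + 1 / 2 * \<alpha> * (cmod q)\<^sup>2 + 3 / 2 * \<omega> * (L2_norm u)\<^sup>2
           = (3 + \<beta>) / (2 * p) * interaction \<beta> p u"
proof -
  define s where "s = 3 - \<beta>"
  \<comment> \<open>The lower bound on p exceeds 1 because \<beta> > 0; the upper one is below 11/4
    because \<beta> < 3.\<close>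
  have s: "0 < s" "s < 3" and p: "1 < p" "p < 3" using assms(1-4) by (auto simp: s_def)
  have dom: "u \<in> hamiltonian_dom \<alpha>" and F: "hartree_term \<beta> p u \<in> L2"
    and eq: "AE x in lborel. hamiltonian \<alpha> u x + of_real \<omega> * u x - hartree_term \<beta> p u x = 0"
    using assms(7) by (auto simp: bound_state_def AE_lebesgue_iff)
  have u: "u \<in> L2" using dom by (simp add: hamiltonian_dom_def)
  then have um: "u \<in> borel_measurable lebesgue" by (simp add: L2_def)
  have "\<exists>v. \<exists>(\<phi>, q, lam) \<in> admissible \<alpha>. decomposes u \<phi> q lam \<and>
        v = (\<lambda>x. - weak_laplacian \<phi> x - q * of_real lam * green lam x)"
    using dom unfolding hamiltonian_dom_def by blast
  \<comment> \<open>The Hamiltonian is evaluated through a chosen decomposition, whose parameter may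
    differ from the given \<open>lam\<close>. The computation is made in the chosen one; the claim
    involves the given decomposition only through its charge, which is shown to be the same.\<close>
  from someI_ex[OF this] obtain \<phi>1 q1 lam1 where dec1: "(\<phi>1, q1, lam1) \<in> admissible \<alpha>" "decomposes u \<phi>1 q1 lam1"
    and ham: "hamiltonian \<alpha> u = (\<lambda>x. - weak_laplacian \<phi>1 x - q1 * of_real lam1 * green lam1 x)"
    unfolding hamiltonian_def[symmetric] by blast
  obtain \<psi> g G where R: "regular_representative \<alpha> u \<phi>1 q1 lam1 \<psi> g G"
    using admissible_representative[OF dec1] by blast
  then have \<psi>: "continuous_on UNIV \<psi>" "AE x in lborel. \<phi>1 x = \<psi> x" "\<psi> 0 = (\<alpha> + sqrt lam1 / (4 * pi)) *\<^sub>R q1"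
    and g: "\<And>i. L2_partial i \<psi> (g i)" and G: "\<And>i j. L2_partial j (g i) (G i j)"
    and lap: "AE x in lborel. weak_laplacian \<phi>1 x = (\<Sum>i\<in>UNIV. G i i x)"
    and dec: "AE x in lborel. u x = \<psi> x + yukawa (sqrt lam1) x *\<^sub>R q1"
    unfolding regular_representative_def by simp_all
  obtain \<psi>2 g2 G2 where "regular_representative \<alpha> u \<phi> q lam \<psi>2 g2 G2"
    using admissible_representative[OF assms(5,6)] by blast
  then have g2: "\<And>i. L2_partial i \<psi>2 (g2 i)" and dec2: "AE x in lborel. u x = \<psi>2 x + yukawa (sqrt lam) x *\<^sub>R q"
    unfolding regular_representative_def by simp_all
  have lam: "0 < lam" "0 < lam1" "\<phi>1 \<in> sobolev 2" using assms(5) dec1(1) by (simp_all add: admissible_def)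
  define a where "a = sqrt lam1"
  have a: "0 < a" "a\<^sup>2 = lam1" using lam(2) by (auto simp: a_def)
  have "q1 = q"
  proof (rule charge_unique[OF g g2 a(1)])
    show "0 < sqrt lam" using lam by simp
    show "AE x in lborel. \<psi> x + yukawa a x *\<^sub>R q1 = \<psi>2 x + yukawa (sqrt lam) x *\<^sub>R q"
      using dec dec2 unfolding a_def by eventually_elim simp
  qed
  define v where "v x = \<psi> x + yukawa a x *\<^sub>R q" for x
  have uv: "AE x in lborel. u x = v x" using dec by (simp add: v_def a_def \<open>q1 = q\<close>)
  have sv: "sq_integrable v"
    unfolding v_def by (rule sq_integrable_add[OF L2_partial_sq(1)[OF g] yukawa_sq_integrable[OF a(1)]])
  note vm[measurable] = sq_integrable_measurable[OF sv]
  define c where "c = riesz_constant \<beta>"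
  have c: "0 < c"
    using Gamma_real_pos[of "(3 - \<beta>) / 2"] Gamma_real_pos[of "\<beta> / 2"] assms(1,2) by (simp add: c_def riesz_constant_def)
  have pot: "hartree_potential \<beta> p u x = c * enn2real (nn_potential s p v x)" for x
    unfolding c_def s_def by (rule hartree_potential_eq[OF um vm uv])
  note [measurable] = potential_measurable[OF vm]
  have force: "AE x in lborel. hartree_term \<beta> p u x = c *\<^sub>R riesz_force s p v x"
    using uv by eventually_elim (simp add: hartree_term_def pot riesz_force_def scaleR_conv_of_real)
  have scF: "sq_integrable (\<lambda>x. c *\<^sub>R riesz_force s p v x)"
    by (rule L2_representative[OF F _ force]) measurable
  have sF: "sq_integrable (riesz_force s p v)"
    using sq_integrable_scaleR[OF scF, of "1 / c"] c by simp
  define N where "N = (LI x. enn2real (nn_potential s p v x) * cmod (v x) powr p)"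
  have N: "interaction \<beta> p u = c * N"
  proof -
    have "interaction \<beta> p u = (LI x. c * enn2real (nn_potential s p v x) * cmod (v x) powr p)"
      unfolding interaction_def pot
    proof (rule integral_lebesgue_eq)
      have [measurable]: "(\<lambda>x. c * enn2real (nn_potential s p v x)) \<in> borel_measurable lebesgue"
        by (rule borel_imp_lebesgue) measurable
      note [measurable] = um
      show "(\<lambda>x. c * enn2real (nn_potential s p v x) * cmod (u x) powr p) \<in> borel_measurable lebesgue" by measurable
      show "AE x in lborel. c * enn2real (nn_potential s p v x) * cmod (u x) powr p = c * enn2real (nn_potential s p v x) * cmod (v x) powr p"
        using uv by eventually_elim simp
    qed measurable
    then show ?thesis by (simp add: N_def mult.assoc)
  qed
  have Q: "energy_form \<alpha> u = form_value \<alpha> a q \<psi> g"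
    unfolding a_def using dec1(2) \<open>q1 = q\<close>
    by (intro energy_form_eq[OF sobolev_2_subset_1[OF lam(3)] u lam(2) _ borel_measurable_continuous_onI[OF \<psi>(1)] \<psi>(2) g]) simp
  have mass: "(L2_norm u)\<^sup>2 = (LI x. (cmod (v x))\<^sup>2)" by (rule L2_norm_eq[OF um vm uv])

  define \<epsilon> where "\<epsilon> n = 1 / real (Suc n)" for n
  have e: "0 < \<epsilon> n" for n by (simp add: \<epsilon>_def)
  have e0: "\<epsilon> \<longlonglongrightarrow> 0" unfolding \<epsilon>_def by (rule LIMSEQ_Suc[OF lim_1_over_n])
  define X where "X n i x = soft (\<epsilon> n) (x $ i) *\<^sub>R (g i x + yukawa_partial a i x *\<^sub>R q)" for n i x
  have \<psi>0: "\<psi> 0 = (\<alpha> + a / (4 * pi)) *\<^sub>R q" using \<psi>(3) by (simp add: a_def \<open>q1 = q\<close>)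
  define h where "h x = - (\<Sum>j\<in>UNIV. G j j x) - a\<^sup>2 *\<^sub>R (yukawa a x *\<^sub>R q)" for x
  have sh: "sq_integrable h"
    unfolding h_def using sq_integrable_scaleR[OF sq_integrable_sum[of UNIV "\<lambda>j. G j j"], of "-1"]
    by (intro sq_integrable_diff sq_integrable_scaleR yukawa_sq_integrable a) (simp add: L2_partial_sq(2)[OF G])
  have eq0: "AE x in lborel. h x + \<omega> *\<^sub>R v x - c *\<^sub>R riesz_force s p v x = 0"
    using eq uv force lap
    by eventually_elim (simp add: ham h_def green_eq_yukawa scaleR_conv_of_real \<open>q1 = q\<close> a(1) abs_of_pos a(2)[symmetric] mult_ac)
  \<comment> \<open>Boundedness of the truncation takes care of the regular part of the gradient,
    its vanishing at 0 of the singular part.\<close>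
  have sX: "sq_integrable (X n i)" for n i
  proof -
    note sf = shear_field_soft[OF e, of n]
    then have "sq_integrable (\<lambda>x. soft (\<epsilon> n) (x $ i) *\<^sub>R g i x + (soft (\<epsilon> n) (x $ i) * yukawa_partial a i x) *\<^sub>R q)"
      by (intro sq_integrable_add sq_integrable_weight(1) L2_partial_sq(1)[OF G] sq_integrable_weighted_yukawa_partial a)
         (auto simp: shear_field_def)
    then show ?thesis by (simp add: X_def[abs_def] scaleR_add_right)
  qed
  \<comment> \<open>The equation is paired with the truncated field, for which all three pairings
    are finite; the truncation is removed only afterwards, in each of them separately.\<close>
  have zero: "(\<Sum>i\<in>UNIV. LI x. h x \<bullet> X n i x) + \<omega> * (\<Sum>i\<in>UNIV. LI x. v x \<bullet> X n i x)
      - c * (\<Sum>i\<in>UNIV. LI x. riesz_force s p v x \<bullet> X n i x) = 0" for n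
  proof -
    have "(LI x. h x \<bullet> X n i x) + \<omega> * (LI x. v x \<bullet> X n i x) - c * (LI x. riesz_force s p v x \<bullet> X n i x) = 0" for i
    proof -
      have "(LI x. h x \<bullet> X n i x) + \<omega> * (LI x. v x \<bullet> X n i x) - c * (LI x. riesz_force s p v x \<bullet> X n i x)
         = (LI x. h x \<bullet> X n i x + \<omega> * (v x \<bullet> X n i x) - c * (riesz_force s p v x \<bullet> X n i x))"
        using integrable_inner_sq[OF sh sX] integrable_inner_sq[OF sv sX] integrable_inner_sq[OF sF sX] by simp
      also have "\<dots> = (LI x. (h x + \<omega> *\<^sub>R v x - c *\<^sub>R riesz_force s p v x) \<bullet> X n i x)"
        by (simp only: inner_diff_left inner_add_left inner_scaleR_left)
      also have "\<dots> = 0" by (rule integral_eq_zero_AE) (use eq0 in eventually_elim, simp)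
      finally show ?thesis .
    qed
    then have "(\<Sum>i\<in>UNIV. (LI x. h x \<bullet> X n i x) + \<omega> * (LI x. v x \<bullet> X n i x) - c * (LI x. riesz_force s p v x \<bullet> X n i x)) = 0" by simp
    then show ?thesis by (simp only: sum.distrib sum_subtractf sum_distrib_left)
  qed
  have "(\<lambda>n. (\<Sum>i\<in>UNIV. LI x. h x \<bullet> X n i x) + \<omega> * (\<Sum>i\<in>UNIV. LI x. v x \<bullet> X n i x)
      - c * (\<Sum>i\<in>UNIV. LI x. riesz_force s p v x \<bullet> X n i x))
    \<longlonglongrightarrow> (- (1 / 2) * form_value \<alpha> a q \<psi> g - 1 / 2 * \<alpha> * (cmod q)\<^sup>2) + \<omega> * (- (3 / 2) * (LI x. (cmod (v x))\<^sup>2))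
      - c * ((s - 6) / (2 * p) * N)"
    unfolding X_def h_def N_def
    by (intro tendsto_add tendsto_diff tendsto_mult tendsto_const hamiltonian_virial[OF \<psi>(1) g G a(1) \<psi>0 e e0]
        mass_virial[OF \<psi>(1) g G a(1) v_def e e0] riesz_force_virial[OF \<psi>(1) g G a(1) v_def s p sF e e0])
  then have "(- (1 / 2) * form_value \<alpha> a q \<psi> g - 1 / 2 * \<alpha> * (cmod q)\<^sup>2) + \<omega> * (- (3 / 2) * (LI x. (cmod (v x))\<^sup>2))
      - c * ((s - 6) / (2 * p) * N) = 0"
    unfolding zero by (simp add: LIMSEQ_const_iff)
  \<comment> \<open>With s = 3 - \<beta> the rate s - 6 is -(3 + \<beta>), and c N is the
    interaction with its normalising constant restored.\<close>
  moreover have "c * ((s - 6) / (2 * p) * N) = - ((3 + \<beta>) / (2 * p) * (c * N))"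
    using p by (simp add: s_def field_simps)
  ultimately show ?thesis unfolding Q mass N by (simp add: algebra_simps)
qed

end
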